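(* Let $V$ be a graded vector space and $M$ the formal graded manifold associated to $V$. A collection of tensors $\{\mu_{m,n}:\odot^nV\to\wedge^mV[2-m]\}_{m\ge1,n\ge1}$ defines a structure of $\mathsf{Lie^1Bi}_\infty$-algebra on $V$ if and only if the associated smooth polyvector field $$\Gamma:=\sum_{m\ge1}\Gamma_m\in\wedge^\bullet T_M$$ satisfies the equation $[\Gamma,\Gamma]=0$, where $[\ ,\ ]$ stands for the Schouten bracket of polyvector fields.
   Context: $k$ is a field of characteristic $0$; $V[p]^i=V^{i+p}$; $\odot^n$, $\wedge^m$ are graded symmetric and exterior powers. Associated polyvector field. Let $\{e_\alpha,\ \alpha=1,2,\ldots\}$ be a homogeneous basis of $V$; the dual basis $t^\alpha$, $|t^\alpha|=-|e_\alpha|$, defines a coordinate system on $M$ (isomorphic to the formal neighbourhood of $0$ in $V$), whose tangent bundle is $T_M$. Define numbers $\mu_{\alpha_1\ldots\alpha_n}^{\ \beta_1\ldots\beta_m}$ by $\mu_{m,n}(e_{\alpha_1},\dots,e_{\alpha_n})=\sum\mu_{\alpha_1\ldots\alpha_n}^{\ \beta_1\ldots\beta_m}\,e_{\beta_1}\wedge\cdots\wedge e_{\beta_m}$. Then, with summation over repeated indices, $$\Gamma_m:=\sum_{n=1}^\infty\frac1{m!\,n!}(-1)^{\epsilon}\,t^{\alpha_1}\cdots t^{\alpha_n}\,\mu_{\alpha_1\ldots\alpha_n}^{\ \beta_1\ldots\beta_m}\,\frac{\partial}{\partial t^{\beta_1}}\wedge\cdots\wedge\frac{\partial}{\partial t^{\beta_m}}\in\wedge^mT_M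 ,$$ $$\epsilon=\sum_{k=1}^n|e_{\alpha_k}|\Big(2-m+\sum_{i=1}^k|e_{\alpha_i}|\Big)+\sum_{k=1}^m(|e_{\beta_k}|+1)\sum_{i=k+1}^m|e_{\beta_i}| .$$ Each $\Gamma_m$ is a germ of a smooth formal polyvector field vanishing at $0\in M$. $\mathsf{Lie^1Bi}_\infty$-algebras. A dioperad (W. L. Gan) is a collection of dg $(\Sigma_m,\Sigma_n)$-bimodules $\mathcal P(m,n)$ ($m$ outputs, $n$ inputs, $m,n\ge1$) with one-edge grafting compositions and a unit, satisfying associativity and equivariance conditions modelled on the endomorphism dioperad $\mathcal End_V(m,n)=Hom(V^{\otimes n},V^{\otimes m})$; free dioperads are spanned by decorated directed trees. An algebra over a dioperad $\mathcal P$ is a dg vector space $V$ with a morphism of dioperads $\mathcal P\to\mathcal End_V$. A Lie 1-bialgebra is a graded vector space $V$ with linear maps $\delta:V\to\wedge^2V$, $\delta a=\sum a_1\wedge a_2$, and $\odot^2V\to V[1]$, $a\otimes b\mapsto(-1)^{|a|}[a\bullet b]$, satisfying: co-Jacobi $(\delta\otimes\mathrm{Id})\delta a+\tau(\delta\otimes\mathrm{Id})\delta a+\tau^2(\delta\otimes\mathrm{Id})\delta a=0$, $\tau$ being the cyclic permutation $(123)$ acting on $V^{\otimes3}$; Jacobi $[[a\bullet b]\bullet c]=[a\bullet[b\bullet c]]+(-1)^{|b||a|+|b|+|a|}[b\bullet[a\bullet c]]$; and the Leibniz type identity $\delta[a\bullet b]=\sum a_1\wedge[a_2\bullet b]-(-1)^{|a_1||a_2|}a_2\wedge[a_1\bullet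 b]+[a\bullet b_1]\wedge b_2-(-1)^{|b_1||b_2|}[a\bullet b_2]\wedge b_1$. $\mathsf{Lie^1Bi}$ is the dioperad whose algebras are Lie 1-bialgebras, and $\mathsf{Lie^1Bi}_\infty$ is its minimal resolution. Explicitly, $\mathsf{Lie^1Bi}_\infty$ is the free dioperad on the one-dimensional bimodules $E(m,n)=sgn_m\otimes1_n[m-2]$ for $m+n\ge3$, $E(1,1)=0$ ($sgn_m$ the sign and $1_n$ the trivial representation). Representing a basis element of $E(m,n)$ by the planar $(m,n)$-corolla $C_{m,n}$ with skew-symmetric outgoing and symmetric ingoing legs, the differential is $$dC_{m,n}=\sum_{\substack{I_1\sqcup I_2=(1,\dots,m),\ J_1\sqcup J_2=(1,\dots,n)\\ |I_1|\ge0,\,|I_2|\ge1,\ |J_1|\ge1,\,|J_2|\ge0}}(-1)^{\sigma(I_1\sqcup I_2)+|I_1||I_2|}\,T(I_1,I_2;J_1,J_2),$$ where $\sigma(I_1\sqcup I_2)$ is the sign of the shuffle and $T(I_1,I_2;J_1,J_2)$ is the planar two-vertex tree with lower vertex the corolla with inputs $J_1$ and outputs $I_1$ followed by the internal edge, and upper vertex the corolla with outputs $I_2$ and inputs the internal edge followed by $J_2$ (there are no $(1,1)$-corollas). In the data $\{\mu_{m,n}\}$, $\mu_{1,1}$ is the differential of the dg space $V$, and $\mu_{m,n}$, $m+n\ge3$, is the image of $C_{m,n}$. *)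

theory Defs
  imports Complex_Main
    "HOL-Library.Function_Algebras"
    "HOL-Library.Groups_Big_Fun"
    "HOL-Library.Multiset"
    "HOL-Combinatorics.Permutations"
begin

section \<open>Koszul signs\<close>

text \<open>
  Permutations act on the legs of an operation by relabelling: after acting with \<open>\<sigma>\<close>, the leg number
  \<open>i\<close> carries the number \<open>\<sigma> i\<close>.  All legs, list positions and labels are counted from \<open>0\<close>.
  With this convention inputs and outputs both carry left actions; the right action of the symmetric
  group on inputs is the action of the inverse.

  Koszul signs for operators follow the rule for operators (compositions, tensor products of maps,
  and the differential) that act from the right on their arguments: an operator of degree \<open>d\<close>
  meant for one tensor factor picks up the sign of passing all the factors to the right of that factor.
\<close>

definition parity_sign :: "int \<Rightarrow> 'a::ring_1" where
  "parity_sign d = (if even d then 1 else - 1)"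

definition koszul :: "(nat \<Rightarrow> nat) \<Rightarrow> bool list \<Rightarrow> 'a::comm_ring_1" where
  "koszul \<sigma> bs = (\<Prod>(i, j) \<in> {(i, j). i < j \<and> j < length bs \<and> \<sigma> j < \<sigma> i}.
      if bs ! \<sigma> i \<and> bs ! \<sigma> j then - 1 else 1)"

definition block_swap :: "nat \<Rightarrow> nat \<Rightarrow> nat \<Rightarrow> nat \<Rightarrow> nat" where
  "block_swap a b c i =
    (if i < a then i else if i < a + b then i + c else if i < a + b + c then i - b else i)"

definition shift_perm :: "nat \<Rightarrow> (nat \<Rightarrow> nat) \<Rightarrow> nat \<Rightarrow> nat" where
  "shift_perm k \<sigma> i = (if i < k then i else \<sigma> (i - k) + k)"

definition list_perm :: "nat list \<Rightarrow> nat \<Rightarrow> nat" where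
  "list_perm l i = (if i < length l then l ! i else i)"


section \<open>The dioperad \<open>Lie\<^sup>1Bi\<^sub>\<infinity>\<close>\<close>

text \<open>
  Dioperadic terms over the corollas.  \<open>DComp t s\<close> grafts the \<^emph>\<open>first\<close> input of the upper element \<open>t\<close>
  onto the \<^emph>\<open>last\<close> output of the lower element \<open>s\<close>; its outputs are the remaining outputs of \<open>s\<close>
  followed by those of \<open>t\<close>, its inputs are those of \<open>s\<close> followed by the remaining inputs of \<open>t\<close>.  All
  other one-edge graftings arise from this one by relabelling legs.
\<close>

datatype 'k dterm =
    DCor nat nat
  | DUnit
  | DZero nat nat int
  | DAdd "'k dterm" "'k dterm"
  | DScale 'k "'k dterm"
  | DComp "'k dterm" "'k dterm"
  | DOut "nat \<Rightarrow> nat" "'k dterm"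
  | DIn "nat \<Rightarrow> nat" "'k dterm"

primrec outs :: "'k dterm \<Rightarrow> nat" where
  "outs (DCor m n) = m"
| "outs DUnit = 1"
| "outs (DZero m n d) = m"
| "outs (DAdd t s) = outs t"
| "outs (DScale c t) = outs t"
| "outs (DComp t s) = outs s - 1 + outs t"
| "outs (DOut \<sigma> t) = outs t"
| "outs (DIn \<tau> t) = outs t"

primrec ins :: "'k dterm \<Rightarrow> nat" where
  "ins (DCor m n) = n"
| "ins DUnit = 1"
| "ins (DZero m n d) = n"
| "ins (DAdd t s) = ins t"
| "ins (DScale c t) = ins t"
| "ins (DComp t s) = ins s + (ins t - 1)"
| "ins (DOut \<sigma> t) = ins t"
| "ins (DIn \<tau> t) = ins t"

text \<open>
  \<open>E(m,n) = sgn\<^sub>m \<otimes> 1\<^sub>n[m - 2]\<close> is concentrated in degree \<open>2 - m\<close>, since \<open>V[p]\<^sup>i = V\<^sup>i\<^sup>+\<^sup>p\<close>.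
\<close>

primrec ddeg :: "'k dterm \<Rightarrow> int" where
  "ddeg (DCor m n) = 2 - int m"
| "ddeg DUnit = 0"
| "ddeg (DZero m n d) = d"
| "ddeg (DAdd t s) = ddeg t"
| "ddeg (DScale c t) = ddeg t"
| "ddeg (DComp t s) = ddeg t + ddeg s"
| "ddeg (DOut \<sigma> t) = ddeg t"
| "ddeg (DIn \<tau> t) = ddeg t"

primrec dwf :: "'k dterm \<Rightarrow> bool" where
  "dwf (DCor m n) \<longleftrightarrow> m \<ge> 1 \<and> n \<ge> 1 \<and> m + n \<ge> 3"
| "dwf DUnit \<longleftrightarrow> True"
| "dwf (DZero m n d) \<longleftrightarrow> m \<ge> 1 \<and> n \<ge> 1"
| "dwf (DAdd t s) \<longleftrightarrow> dwf t \<and> dwf s \<and> outs t = outs s \<and> ins t = ins s \<and> ddeg t = ddeg s"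
| "dwf (DScale c t) \<longleftrightarrow> dwf t"
| "dwf (DComp t s) \<longleftrightarrow> dwf t \<and> dwf s"
| "dwf (DOut \<sigma> t) \<longleftrightarrow> dwf t \<and> \<sigma> permutes {..<outs t}"
| "dwf (DIn \<tau> t) \<longleftrightarrow> dwf t \<and> \<tau> permutes {..<ins t}"

text \<open>
  The free dioperad on \<open>E\<close> is the set of well-formed terms modulo the following congruence: linear
  structure, actions of the symmetric groups, unit, sequential and parallel associativity,
  equivariance, and finally the relations of the bimodules \<open>E(m,n)\<close> themselves.
\<close>

inductive deq :: "'k::field dterm \<Rightarrow> 'k dterm \<Rightarrow> bool" (infix "\<approx>\<^sub>D" 50) where
  refl: "dwf t \<Longrightarrow> t \<approx>\<^sub>D t"
| sym: "t \<approx>\<^sub>D s \<Longrightarrow> s \<approx>\<^sub>D t"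
| trans: "t \<approx>\<^sub>D s \<Longrightarrow> s \<approx>\<^sub>D r \<Longrightarrow> t \<approx>\<^sub>D r"
| cong_add: "t \<approx>\<^sub>D t' \<Longrightarrow> s \<approx>\<^sub>D s' \<Longrightarrow> dwf (DAdd t s) \<Longrightarrow> DAdd t s \<approx>\<^sub>D DAdd t' s'"
| cong_scale: "t \<approx>\<^sub>D t' \<Longrightarrow> DScale c t \<approx>\<^sub>D DScale c t'"
| cong_comp: "t \<approx>\<^sub>D t' \<Longrightarrow> s \<approx>\<^sub>D s' \<Longrightarrow> DComp t s \<approx>\<^sub>D DComp t' s'"
| cong_out: "t \<approx>\<^sub>D t' \<Longrightarrow> dwf (DOut \<sigma> t) \<Longrightarrow> DOut \<sigma> t \<approx>\<^sub>D DOut \<sigma> t'"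
| cong_in: "t \<approx>\<^sub>D t' \<Longrightarrow> dwf (DIn \<tau> t) \<Longrightarrow> DIn \<tau> t \<approx>\<^sub>D DIn \<tau> t'"

| add_assoc: "dwf (DAdd (DAdd t s) r) \<Longrightarrow> DAdd (DAdd t s) r \<approx>\<^sub>D DAdd t (DAdd s r)"
| add_comm: "dwf (DAdd t s) \<Longrightarrow> DAdd t s \<approx>\<^sub>D DAdd s t"
| add_zero: "dwf t \<Longrightarrow> DAdd t (DZero (outs t) (ins t) (ddeg t)) \<approx>\<^sub>D t"
| add_minus: "dwf t \<Longrightarrow> DAdd t (DScale (- 1) t) \<approx>\<^sub>D DZero (outs t) (ins t) (ddeg t)"
| scale_one: "dwf t \<Longrightarrow> DScale 1 t \<approx>\<^sub>D t"
| scale_scale: "dwf t \<Longrightarrow> DScale a (DScale b t) \<approx>\<^sub>D DScale (a * b) t"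
| scale_left: "dwf t \<Longrightarrow> DScale (a + b) t \<approx>\<^sub>D DAdd (DScale a t) (DScale b t)"
| scale_right: "dwf (DAdd t s) \<Longrightarrow> DScale a (DAdd t s) \<approx>\<^sub>D DAdd (DScale a t) (DScale a s)"

| comp_add_left: "dwf (DAdd t t') \<Longrightarrow> dwf s \<Longrightarrow>
    DComp (DAdd t t') s \<approx>\<^sub>D DAdd (DComp t s) (DComp t' s)"
| comp_add_right: "dwf t \<Longrightarrow> dwf (DAdd s s') \<Longrightarrow>
    DComp t (DAdd s s') \<approx>\<^sub>D DAdd (DComp t s) (DComp t s')"
| comp_scale_left: "dwf t \<Longrightarrow> dwf s \<Longrightarrow> DComp (DScale c t) s \<approx>\<^sub>D DScale c (DComp t s)"
| comp_scale_right: "dwf t \<Longrightarrow> dwf s \<Longrightarrow> DComp t (DScale c s) \<approx>\<^sub>D DScale c (DComp t s)"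

| out_add: "dwf (DAdd t s) \<Longrightarrow> \<sigma> permutes {..<outs t} \<Longrightarrow>
    DOut \<sigma> (DAdd t s) \<approx>\<^sub>D DAdd (DOut \<sigma> t) (DOut \<sigma> s)"
| out_scale: "dwf (DOut \<sigma> t) \<Longrightarrow> DOut \<sigma> (DScale c t) \<approx>\<^sub>D DScale c (DOut \<sigma> t)"
| out_id: "dwf t \<Longrightarrow> DOut id t \<approx>\<^sub>D t"
| out_out: "dwf (DOut \<sigma> (DOut \<sigma>' t)) \<Longrightarrow> DOut \<sigma> (DOut \<sigma>' t) \<approx>\<^sub>D DOut (\<sigma> \<circ> \<sigma>') t"
| in_add: "dwf (DAdd t s) \<Longrightarrow> \<tau> permutes {..<ins t} \<Longrightarrow>
    DIn \<tau> (DAdd t s) \<approx>\<^sub>D DAdd (DIn \<tau> t) (DIn \<tau> s)"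
| in_scale: "dwf (DIn \<tau> t) \<Longrightarrow> DIn \<tau> (DScale c t) \<approx>\<^sub>D DScale c (DIn \<tau> t)"
| in_id: "dwf t \<Longrightarrow> DIn id t \<approx>\<^sub>D t"
| in_in: "dwf (DIn \<tau> (DIn \<tau>' t)) \<Longrightarrow> DIn \<tau> (DIn \<tau>' t) \<approx>\<^sub>D DIn (\<tau> \<circ> \<tau>') t"
| out_in: "dwf (DOut \<sigma> (DIn \<tau> t)) \<Longrightarrow> DOut \<sigma> (DIn \<tau> t) \<approx>\<^sub>D DIn \<tau> (DOut \<sigma> t)"

| unit_upper: "dwf t \<Longrightarrow> DComp DUnit t \<approx>\<^sub>D t"
| unit_lower: "dwf t \<Longrightarrow> DComp t DUnit \<approx>\<^sub>D t"
| assoc: "dwf r \<Longrightarrow> dwf s \<Longrightarrow> dwf t \<Longrightarrow> DComp r (DComp s t) \<approx>\<^sub>D DComp (DComp r s) t"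
  \<comment> \<open>\<open>r\<close> and \<open>s\<close> grafted onto the last two outputs of \<open>t\<close>, in either order\<close>
| parallel_upper: "dwf r \<Longrightarrow> dwf s \<Longrightarrow> dwf t \<Longrightarrow> outs t = a + 2 \<Longrightarrow>
    DComp r (DOut (block_swap a 1 (outs s)) (DComp s t)) \<approx>\<^sub>D
    DScale (parity_sign (ddeg r * ddeg s))
      (DOut (block_swap a (outs r) (outs s)) (DIn (block_swap (ins t) (ins r - 1) (ins s - 1))
        (DComp s (DOut (block_swap a 1 (outs r)) (DComp r (DOut (block_swap a 1 1) t))))))"
  \<comment> \<open>the first two inputs of \<open>t\<close> grafted onto \<open>s\<close> and \<open>r\<close>, in either order\<close>
| parallel_lower: "dwf r \<Longrightarrow> dwf s \<Longrightarrow> dwf t \<Longrightarrow> ins t \<ge> 2 \<Longrightarrow>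
    DComp (DIn (block_swap 0 (ins s) 1) (DComp t s)) r \<approx>\<^sub>D
    DScale (parity_sign (ddeg r * ddeg s))
      (DOut (block_swap 0 (outs s - 1) (outs r - 1)) (DIn (block_swap 0 (ins s) (ins r))
        (DComp (DIn (block_swap 0 (ins r) 1) (DComp (DIn (block_swap 0 1 1) t) r)) s)))"
| equiv_lower_out: "dwf t \<Longrightarrow> dwf s \<Longrightarrow> \<sigma> permutes {..<outs s - 1} \<Longrightarrow>
    DComp t (DOut \<sigma> s) \<approx>\<^sub>D DOut \<sigma> (DComp t s)"
| equiv_lower_in: "dwf t \<Longrightarrow> dwf s \<Longrightarrow> \<tau> permutes {..<ins s} \<Longrightarrow>
    DComp t (DIn \<tau> s) \<approx>\<^sub>D DIn \<tau> (DComp t s)"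
| equiv_upper_out: "dwf t \<Longrightarrow> dwf s \<Longrightarrow> \<sigma> permutes {..<outs t} \<Longrightarrow>
    DComp (DOut \<sigma> t) s \<approx>\<^sub>D DOut (shift_perm (outs s - 1) \<sigma>) (DComp t s)"
| equiv_upper_in: "dwf t \<Longrightarrow> dwf s \<Longrightarrow> \<tau> permutes {1..<ins t} \<Longrightarrow>
    DComp (DIn \<tau> t) s \<approx>\<^sub>D DIn (shift_perm (ins s - 1) \<tau>) (DComp t s)"

| corolla_out: "m \<ge> 1 \<Longrightarrow> n \<ge> 1 \<Longrightarrow> m + n \<ge> 3 \<Longrightarrow> \<sigma> permutes {..<m} \<Longrightarrow>
    DOut \<sigma> (DCor m n) \<approx>\<^sub>D DScale (of_int (sign \<sigma>)) (DCor m n)"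
| corolla_in: "m \<ge> 1 \<Longrightarrow> n \<ge> 1 \<Longrightarrow> m + n \<ge> 3 \<Longrightarrow> \<tau> permutes {..<n} \<Longrightarrow>
    DIn \<tau> (DCor m n) \<approx>\<^sub>D DCor m n"

text \<open>
  The differential on corollas.  \<open>I\<^sub>1\<close> and \<open>J\<^sub>1\<close> are increasing sublists of the labels and
  \<open>I\<^sub>2\<close>, \<open>J\<^sub>2\<close> their increasing complements; the tree \<open>T(I\<^sub>1,I\<^sub>2;J\<^sub>1,J\<^sub>2)\<close> has its outputs labelled
  by \<open>I\<^sub>1 @ I\<^sub>2\<close> and its inputs by \<open>J\<^sub>1 @ J\<^sub>2\<close>.
\<close>

definition complement_list :: "nat \<Rightarrow> nat list \<Rightarrow> nat list" where
  "complement_list n l = filter (\<lambda>i. i \<notin> set l) [0..<n]"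

definition splittings :: "nat \<Rightarrow> (nat list \<times> nat list) list" where
  "splittings n = map (\<lambda>l. (l, complement_list n l)) (subseqs [0..<n])"

definition two_vertex_tree :: "nat list \<Rightarrow> nat list \<Rightarrow> nat list \<Rightarrow> nat list \<Rightarrow> 'k dterm" where
  "two_vertex_tree I1 I2 J1 J2 =
    DOut (list_perm (I1 @ I2)) (DIn (list_perm (J1 @ J2))
      (DComp (DCor (length I2) (Suc (length J2))) (DCor (Suc (length I1)) (length J1))))"

definition corolla_differential :: "nat \<Rightarrow> nat \<Rightarrow> 'k::field dterm" where
  "corolla_differential m n = foldr DAdd
    [DScale (of_int (sign (list_perm (I1 @ I2))) * (- 1) ^ (length I1 * length I2))
       (two_vertex_tree I1 I2 J1 J2).
      (I1, I2) \<leftarrow> splittings m, (J1, J2) \<leftarrow> splittings n,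
      I2 \<noteq> [] \<and> J1 \<noteq> [] \<and>
      (Suc (length I1), length J1) \<noteq> (1, 1) \<and> (length I2, Suc (length J2)) \<noteq> (1, 1)]
    (DZero m n (3 - int m))"

text \<open>
  The differential of the free dioperad: the extension of the above to a derivation of degree \<open>1\<close>
  acting from the right.
\<close>

primrec ddiff :: "'k::field dterm \<Rightarrow> 'k dterm" where
  "ddiff (DCor m n) = corolla_differential m n"
| "ddiff DUnit = DZero 1 1 1"
| "ddiff (DZero m n d) = DZero m n (d + 1)"
| "ddiff (DAdd t s) = DAdd (ddiff t) (ddiff s)"
| "ddiff (DScale c t) = DScale c (ddiff t)"
| "ddiff (DComp t s) =
    DAdd (DComp t (ddiff s)) (DScale (parity_sign (ddeg s)) (DComp (ddiff t) s))"
| "ddiff (DOut \<sigma> t) = DOut \<sigma> (ddiff t)"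
| "ddiff (DIn \<tau> t) = DIn \<tau> (ddiff t)"


section \<open>Graded vector spaces, tensor powers and the endomorphism dioperad\<close>

text \<open>
  \<open>V\<^sup>\<otimes>\<^sup>m\<close> is realised inside the functions on \<open>m\<close>-tuples of linear functionals: \<open>v\<^sub>1 \<otimes> \<dots> \<otimes> v\<^sub>m\<close> is the
  function \<open>(\<xi>\<^sub>1, \<dots>, \<xi>\<^sub>m) \<mapsto> \<xi>\<^sub>1(v\<^sub>1) \<cdots> \<xi>\<^sub>m(v\<^sub>m)\<close> (no Koszul sign is put into this embedding),
  extended by \<open>0\<close> to all other lists of functions.
  Linear maps out of \<open>V\<^sup>\<otimes>\<^sup>n\<close> are multilinear maps on lists of length \<open>n\<close>, extended by \<open>0\<close> to other lists.
\<close>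

type_synonym ('v, 'k) tensor = "('v \<Rightarrow> 'k) list \<Rightarrow> 'k"
type_synonym ('v, 'k) operation = "'v list \<Rightarrow> ('v, 'k) tensor"

locale graded_vector_space = vector_space scale
  for scale :: "'k::field_char_0 \<Rightarrow> 'v::ab_group_add \<Rightarrow> 'v" +
  fixes V :: "int \<Rightarrow> 'v set"
  assumes subspace_V: "subspace (V i)"
    and direct_sum: "\<exists>!c. (\<forall>i. c i \<in> V i) \<and> finite {i. c i \<noteq> 0} \<and> v = (\<Sum>i | c i \<noteq> 0. c i)"
begin

definition component :: "'v \<Rightarrow> int \<Rightarrow> 'v" where
  "component v = (THE c. (\<forall>i. c i \<in> V i) \<and> finite {i. c i \<noteq> 0} \<and> v = (\<Sum>i | c i \<noteq> 0. c i))"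

definition parity_part :: "bool \<Rightarrow> 'v \<Rightarrow> 'v" where
  "parity_part b v = (\<Sum>i | component v i \<noteq> 0 \<and> odd i = b. component v i)"

definition twist :: "int \<Rightarrow> 'v \<Rightarrow> 'v" where
  \<comment> \<open>\<open>v \<mapsto> (-1)\<^bsup>d|v|\<^esup> v\<close>\<close>
  "twist d v = parity_part False v + scale (parity_sign d) (parity_part True v)"

definition functionals :: "('v \<Rightarrow> 'k) set" where
  "functionals = {\<xi>. Vector_Spaces.linear scale (*) \<xi>}"

definition pure_tensor :: "'v list \<Rightarrow> ('v, 'k) tensor" where
  "pure_tensor vs \<xi>s =
    (if length \<xi>s = length vs \<and> set \<xi>s \<subseteq> functionals then \<Prod>i<length vs. (\<xi>s ! i) (vs ! i) else 0)"

definition homogeneous :: "'v list \<Rightarrow> int list \<Rightarrow> bool" where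
  "homogeneous vs ds \<longleftrightarrow> length ds = length vs \<and> (\<forall>i<length vs. vs ! i \<in> V (ds ! i))"

definition tensor_power :: "nat \<Rightarrow> int \<Rightarrow> ('v, 'k) tensor set" where
  \<comment> \<open>the degree \<open>k\<close> part of \<open>V\<^sup>\<otimes>\<^sup>m\<close>\<close>
  "tensor_power m k = module.span (\<lambda>c (t :: ('v, 'k) tensor) \<xi>s. c * t \<xi>s)
    {pure_tensor vs |vs. length vs = m \<and> (\<exists>ds. homogeneous vs ds \<and> sum_list ds = k)}"

definition multilinear :: "('v, 'k) operation \<Rightarrow> bool" where
  "multilinear f \<longleftrightarrow> (\<forall>xs i u w c \<xi>s. i < length xs \<longrightarrow>
    f (xs[i := u + scale c w]) \<xi>s = f (xs[i := u]) \<xi>s + c * f (xs[i := w]) \<xi>s)"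

definition End :: "nat \<Rightarrow> nat \<Rightarrow> int \<Rightarrow> ('v, 'k) operation set" where
  \<comment> \<open>the degree \<open>d\<close> part of \<open>Hom(V\<^sup>\<otimes>\<^sup>n, V\<^sup>\<otimes>\<^sup>m)\<close>\<close>
  "End m n d = {f. (\<forall>xs. length xs \<noteq> n \<longrightarrow> f xs = 0) \<and> multilinear f \<and>
    (\<forall>xs ds. length xs = n \<and> homogeneous xs ds \<longrightarrow> f xs \<in> tensor_power m (sum_list ds + d))}"

definition end_in :: "(nat \<Rightarrow> nat) \<Rightarrow> ('v, 'k) operation \<Rightarrow> ('v, 'k) operation" where
  "end_in \<tau> f xs \<xi>s = (\<Sum>bs | length bs = length xs.
    koszul \<tau> bs * f (permute_list \<tau> (map2 parity_part bs xs)) \<xi>s)"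

definition end_out :: "(nat \<Rightarrow> nat) \<Rightarrow> ('v, 'k) operation \<Rightarrow> ('v, 'k) operation" where
  "end_out \<sigma> f xs \<xi>s = (if set \<xi>s \<subseteq> functionals then \<Sum>bs | length bs = length \<xi>s.
      koszul \<sigma> bs * f xs (permute_list \<sigma> (map2 (\<lambda>b \<xi>. \<xi> \<circ> parity_part b) bs \<xi>s))
    else 0)"

definition end_unit :: "('v, 'k) operation" where
  "end_unit xs = (if length xs = 1 then pure_tensor xs else 0)"

text \<open>
  Composition of \<open>g\<close> (upper, degree \<open>dg\<close>) and \<open>f\<close> (lower, degree \<open>df\<close>, with \<open>Suc m1\<close> outputs and \<open>n1\<close>
  inputs), in this order: if \<open>f x = b \<otimes> c\<close> with \<open>c\<close> in the last factor, then \<open>x \<otimes> y\<close> is sent to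
  \<open>(-1)\<^bsup>|f|(|g| + |y|)\<^esup> b \<otimes> g (c \<otimes> y)\<close>, the sign being that of moving \<open>f\<close> in \<open>x \<otimes> y \<otimes> g \<otimes> f\<close> next to \<open>x\<close>.
  Feeding the last factor of the tensor \<open>f x\<close> into \<open>g\<close> amounts to evaluating it on the functional
  \<open>v \<mapsto> g (v \<otimes> y) \<eta>\<close>.
\<close>

definition end_comp ::
  "nat \<Rightarrow> nat \<Rightarrow> int \<Rightarrow> int \<Rightarrow> ('v, 'k) operation \<Rightarrow> ('v, 'k) operation \<Rightarrow> ('v, 'k) operation" where
  "end_comp m1 n1 dg df g f zs \<xi>s = parity_sign (df * dg) *
    f (take n1 zs) (take m1 \<xi>s @ [\<lambda>v. g (v # map (twist df) (drop n1 zs)) (drop m1 \<xi>s)])"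

definition dg_vector_space :: "('v \<Rightarrow> 'v) \<Rightarrow> bool" where
  "dg_vector_space \<delta> \<longleftrightarrow> Vector_Spaces.linear scale scale \<delta> \<and> (\<forall>i. \<delta> ` V i \<subseteq> V (i + 1)) \<and> (\<forall>v. \<delta> (\<delta> v) = 0)"

definition end_diff :: "('v \<Rightarrow> 'v) \<Rightarrow> int \<Rightarrow> ('v, 'k) operation \<Rightarrow> ('v, 'k) operation" where
  \<comment> \<open>\<open>\<delta> \<circ> f - (-1)\<^bsup>|f|\<^esup> f \<circ> \<delta>\<close>, with \<open>\<delta>\<close> extended to tensor powers as a derivation acting from the right\<close>
  "end_diff \<delta> d f xs \<xi>s = (if set \<xi>s \<subseteq> functionals then
      (\<Sum>j<length \<xi>s. f xs (take j \<xi>s @ (\<xi>s ! j \<circ> \<delta>) # map (\<lambda>\<xi>. \<xi> \<circ> twist 1) (drop (Suc j) \<xi>s)))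
      - parity_sign d *
        (\<Sum>i<length xs. f (take i xs @ \<delta> (xs ! i) # map (twist 1) (drop (Suc i) xs)) \<xi>s)
    else 0)"

text \<open>Morphisms of dg dioperads from \<open>Lie\<^sup>1Bi\<^sub>\<infinity>\<close> to the endomorphism dioperad of \<open>(V, \<delta>)\<close>.\<close>

definition dioperad_morphism :: "('v \<Rightarrow> 'v) \<Rightarrow> ('k dterm \<Rightarrow> ('v, 'k) operation) \<Rightarrow> bool" where
  "dioperad_morphism \<delta> \<phi> \<longleftrightarrow>
    (\<forall>t s. t \<approx>\<^sub>D s \<longrightarrow> \<phi> t = \<phi> s) \<and>
    (\<forall>t. dwf t \<longrightarrow> \<phi> t \<in> End (outs t) (ins t) (ddeg t)) \<and>
    (\<forall>t s. dwf (DAdd t s) \<longrightarrow> \<phi> (DAdd t s) = \<phi> t + \<phi> s) \<and>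
    (\<forall>c t. dwf t \<longrightarrow> \<phi> (DScale c t) = (\<lambda>xs \<xi>s. c * \<phi> t xs \<xi>s)) \<and>
    (\<forall>\<sigma> t. dwf (DOut \<sigma> t) \<longrightarrow> \<phi> (DOut \<sigma> t) = end_out \<sigma> (\<phi> t)) \<and>
    (\<forall>\<tau> t. dwf (DIn \<tau> t) \<longrightarrow> \<phi> (DIn \<tau> t) = end_in \<tau> (\<phi> t)) \<and>
    \<phi> DUnit = end_unit \<and>
    (\<forall>t s. dwf t \<and> dwf s \<longrightarrow>
      \<phi> (DComp t s) = end_comp (outs s - 1) (ins s) (ddeg t) (ddeg s) (\<phi> t) (\<phi> s)) \<and>
    (\<forall>t. dwf t \<longrightarrow> \<phi> (ddiff t) = end_diff \<delta> (ddeg t) (\<phi> t))"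

text \<open>
  Linear maps \<open>\<odot>\<^sup>nV \<rightarrow> \<Lambda>\<^sup>mV[2 - m]\<close>: operations of degree \<open>2 - m\<close> that are graded symmetric in the inputs and
  whose values are graded skew-symmetric tensors; \<open>v\<^sub>1 \<and> \<dots> \<and> v\<^sub>m\<close> is identified with the
  skew-symmetrisation (with factor \<open>1/m!\<close>) of \<open>v\<^sub>1 \<otimes> \<dots> \<otimes> v\<^sub>m\<close>.
\<close>

definition sym_to_ext :: "nat \<Rightarrow> nat \<Rightarrow> ('v, 'k) operation set" where
  "sym_to_ext m n = {f \<in> End m n (2 - int m).
    (\<forall>\<tau>. \<tau> permutes {..<n} \<longrightarrow> end_in \<tau> f = f) \<and>
    (\<forall>\<sigma>. \<sigma> permutes {..<m} \<longrightarrow> end_out \<sigma> f = (\<lambda>xs \<xi>s. of_int (sign \<sigma>) * f xs \<xi>s))}"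

definition Lie1Bi_infinity_structure :: "(nat \<Rightarrow> nat \<Rightarrow> ('v, 'k) operation) \<Rightarrow> bool" where
  "Lie1Bi_infinity_structure \<mu> \<longleftrightarrow> (\<exists>\<delta> \<phi>.
    dg_vector_space \<delta> \<and>
    \<mu> 1 1 = (\<lambda>xs. if length xs = 1 then pure_tensor (map \<delta> xs) else 0) \<and>
    dioperad_morphism \<delta> \<phi> \<and>
    (\<forall>m n. m \<ge> 1 \<and> n \<ge> 1 \<and> m + n \<ge> 3 \<longrightarrow> \<phi> (DCor m n) = \<mu> m n))"

definition homogeneous_basis :: "'i set \<Rightarrow> ('i \<Rightarrow> 'v) \<Rightarrow> ('i \<Rightarrow> int) \<Rightarrow> bool" where
  "homogeneous_basis A e dg \<longleftrightarrow>
    inj_on e A \<and> independent (e ` A) \<and> span (e ` A) = UNIV \<and> (\<forall>\<alpha>\<in>A. e \<alpha> \<in> V (dg \<alpha>))"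

definition dual_basis :: "'i set \<Rightarrow> ('i \<Rightarrow> 'v) \<Rightarrow> 'i \<Rightarrow> 'v \<Rightarrow> 'k" where
  "dual_basis A e \<alpha> v = representation (e ` A) v (e \<alpha>)"

text \<open>
  The numbers \<open>\<mu>\<close> with lower indices \<open>\<alpha>s\<close> and upper indices \<open>\<beta>s\<close>.  As the values of \<open>\<mu>\<close> are
  skew-symmetric, the coefficients with respect to \<open>e\<^sub>\<beta>\<^sub>1 \<and> \<dots> \<and> e\<^sub>\<beta>\<^sub>m\<close>, normalised to be skew-symmetric in the
  upper indices, are those with respect to \<open>e\<^sub>\<beta>\<^sub>1 \<otimes> \<dots> \<otimes> e\<^sub>\<beta>\<^sub>m\<close>.
\<close>

definition coefficient ::
  "'i set \<Rightarrow> ('i \<Rightarrow> 'v) \<Rightarrow> (nat \<Rightarrow> nat \<Rightarrow> ('v, 'k) operation) \<Rightarrow> 'i list \<Rightarrow> 'i list \<Rightarrow> 'k" where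
  "coefficient A e \<mu> \<alpha>s \<beta>s =
    \<mu> (length \<beta>s) (length \<alpha>s) (map e \<alpha>s) (map (dual_basis A e) \<beta>s)"

end


section \<open>Formal power series in graded commuting variables\<close>

text \<open>
  A series is given by its coefficients at the normally ordered monomials, i.e. sorted words in
  the variables without repeated odd variables.  All \<open>Sum_any\<close> below are locally finite: in the
  products and derivatives only finitely many words contribute to a given coefficient.
\<close>

type_synonym ('x, 'k) series = "'x list \<Rightarrow> 'k"

definition normal_word :: "('x::linorder \<Rightarrow> int) \<Rightarrow> 'x list \<Rightarrow> bool" where
  "normal_word dg w \<longleftrightarrow> sorted w \<and> (\<forall>x. odd (dg x) \<longrightarrow> count_list w x \<le> 1)"

definition sorting_sign :: "('x::linorder \<Rightarrow> int) \<Rightarrow> 'x list \<Rightarrow> 'k::field" where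
  "sorting_sign dg w = (\<Prod>(i, j) \<in> {(i, j). i < j \<and> j < length w \<and> w ! j < w ! i}.
    parity_sign (dg (w ! i) * dg (w ! j)))"

definition word_series :: "('x::linorder \<Rightarrow> int) \<Rightarrow> 'x list \<Rightarrow> ('x, 'k::field) series" where
  \<comment> \<open>the product of the variables in the word \<open>w\<close>\<close>
  "word_series dg w u = (if u = sort w \<and> normal_word dg u then sorting_sign dg w else 0)"

definition series_mult ::
  "('x::linorder \<Rightarrow> int) \<Rightarrow> ('x, 'k::field) series \<Rightarrow> ('x, 'k) series \<Rightarrow> ('x, 'k) series" where
  "series_mult dg F G u = Sum_any (\<lambda>(v, w). F v * G w * word_series dg (v @ w) u)"

definition left_deriv ::
  "('x::linorder \<Rightarrow> int) \<Rightarrow> 'x \<Rightarrow> ('x, 'k::field) series \<Rightarrow> ('x, 'k) series" where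
  "left_deriv dg x F u = Sum_any (\<lambda>w. F w * (\<Sum>i | i < length w \<and> w ! i = x.
    parity_sign (dg x * sum_list (map dg (take i w))) * word_series dg (take i w @ drop (Suc i) w) u))"

definition right_deriv ::
  "('x::linorder \<Rightarrow> int) \<Rightarrow> 'x \<Rightarrow> ('x, 'k::field) series \<Rightarrow> ('x, 'k) series" where
  "right_deriv dg x F u = Sum_any (\<lambda>w. F w * (\<Sum>i | i < length w \<and> w ! i = x.
    parity_sign (dg x * sum_list (map dg (drop (Suc i) w))) * word_series dg (take i w @ drop (Suc i) w) u))"


section \<open>Polyvector fields on the formal graded manifold\<close>

text \<open>
  \<open>\<Lambda>\<^sup>\<bullet>T\<^sub>M\<close> is the algebra of formal series in the coordinates \<open>t\<^sup>\<alpha>\<close> of degree \<open>- |e\<^sub>\<alpha>|\<close> and the symbols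
  \<open>\<psi>\<^sub>\<alpha>\<close> of degree \<open>|e\<^sub>\<alpha>| + 1\<close> of the vector fields \<open>\<partial>/\<partial>t\<^sup>\<alpha>\<close>; its part \<open>\<Lambda>\<^sup>mT\<^sub>M\<close> consists of the series of degree
  \<open>m\<close> in the \<open>\<psi>\<close>.
\<close>

datatype 'i pvar = Coord 'i | Field 'i

instantiation pvar :: (linorder) linorder
begin

fun less_eq_pvar :: "'a pvar \<Rightarrow> 'a pvar \<Rightarrow> bool" where
  "Coord a \<le> Coord b \<longleftrightarrow> a \<le> b"
| "Coord a \<le> Field b \<longleftrightarrow> True"
| "Field a \<le> Coord b \<longleftrightarrow> False"
| "Field a \<le> Field b \<longleftrightarrow> a \<le> b"

definition less_pvar :: "'a pvar \<Rightarrow> 'a pvar \<Rightarrow> bool" where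
  "x < y \<longleftrightarrow> x \<le> y \<and> \<not> y \<le> (x :: 'a pvar)"

instance
proof
  fix x y z :: "'a pvar"
  show "x < y \<longleftrightarrow> x \<le> y \<and> \<not> y \<le> x" by (fact less_pvar_def)
  show "x \<le> x" by (cases x) auto
  show "x \<le> z" if "x \<le> y" "y \<le> z" using that by (cases x; cases y; cases z) auto
  show "x = y" if "x \<le> y" "y \<le> x" using that by (cases x; cases y) auto
  show "x \<le> y \<or> y \<le> x" by (cases x; cases y) auto
qed

end

primrec pvar_degree :: "('i \<Rightarrow> int) \<Rightarrow> 'i pvar \<Rightarrow> int" where
  "pvar_degree dg (Coord \<alpha>) = - dg \<alpha>"
| "pvar_degree dg (Field \<alpha>) = dg \<alpha> + 1"

text \<open>
  The polyvector field \<open>t\<^sup>\<alpha>\<^sup>1 \<cdots> t\<^sup>\<alpha>\<^sup>n \<partial>/\<partial>t\<^sup>\<beta>\<^sup>1 \<and> \<dots> \<and> \<partial>/\<partial>t\<^sup>\<beta>\<^sup>m\<close>.  As operators act from the right, further vector fields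
  are multiplied on the left: \<open>\<partial>/\<partial>t\<^sup>\<beta>\<^sup>1 \<and> \<dots> \<and> \<partial>/\<partial>t\<^sup>\<beta>\<^sup>m\<close> stands for \<open>\<psi>\<^sub>\<beta>\<^sub>m \<cdots> \<psi>\<^sub>\<beta>\<^sub>1\<close>, which differs from
  \<open>\<psi>\<^sub>\<beta>\<^sub>1 \<cdots> \<psi>\<^sub>\<beta>\<^sub>m\<close> by a sign only.
\<close>

definition polyvector_monomial ::
  "('i::linorder \<Rightarrow> int) \<Rightarrow> 'i list \<Rightarrow> 'i list \<Rightarrow> ('i pvar, 'k::field) series" where
  "polyvector_monomial dg \<alpha>s \<beta>s =
    word_series (pvar_degree dg) (map Coord \<alpha>s @ map Field (rev \<beta>s))"

text \<open>
  The Schouten bracket is the graded biderivation of degree \<open>-1\<close> with \<open>[\<psi>\<^sub>\<alpha>, F] = \<partial>F/\<partial>t\<^sup>\<alpha>\<close>; it restricts to the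
  action of vector fields on functions and to the Lie bracket of vector fields.  If the basis is
  infinite, the sum over \<open>\<alpha>\<close> is locally finite as soon as every monomial in the \<open>t\<close> has only finitely
  many coefficients in each \<open>\<Lambda>\<^sup>mT\<^sub>M\<close>, which holds for \<open>\<Gamma>\<close> below.
\<close>

definition schouten ::
  "('i::linorder \<Rightarrow> int) \<Rightarrow> ('i pvar, 'k::field) series \<Rightarrow> ('i pvar, 'k) series \<Rightarrow> ('i pvar, 'k) series" where
  "schouten dg F G u = (let p = pvar_degree dg in Sum_any (\<lambda>\<alpha>.
     series_mult p (right_deriv p (Field \<alpha>) F) (left_deriv p (Coord \<alpha>) G) u
   - series_mult p (right_deriv p (Coord \<alpha>) F) (left_deriv p (Field \<alpha>) G) u))"

definition gamma_exponent :: "('i \<Rightarrow> int) \<Rightarrow> 'i list \<Rightarrow> 'i list \<Rightarrow> int" where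
  "gamma_exponent dg \<alpha>s \<beta>s =
    (\<Sum>k<length \<alpha>s. dg (\<alpha>s ! k) * (2 - int (length \<beta>s) + (\<Sum>i\<le>k. dg (\<alpha>s ! i))))
    + (\<Sum>k<length \<beta>s. (dg (\<beta>s ! k) + 1) * (\<Sum>i\<in>{k<..<length \<beta>s}. dg (\<beta>s ! i)))"

context graded_vector_space
begin

definition Gamma_part :: "'i::linorder set \<Rightarrow> ('i \<Rightarrow> 'v) \<Rightarrow> ('i \<Rightarrow> int) \<Rightarrow>
    (nat \<Rightarrow> nat \<Rightarrow> ('v, 'k) operation) \<Rightarrow> nat \<Rightarrow> ('i pvar, 'k) series" where
  \<comment> \<open>\<open>\<Gamma>\<^sub>m\<close>; the sum runs over all \<open>n \<ge> 1\<close>, \<open>\<alpha>\<^sub>1, \<dots>, \<alpha>\<^sub>n\<close> and \<open>\<beta>\<^sub>1, \<dots>, \<beta>\<^sub>m\<close>\<close>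
  "Gamma_part A e dg \<mu> m u = Sum_any (\<lambda>(\<alpha>s, \<beta>s).
    if set \<alpha>s \<subseteq> A \<and> set \<beta>s \<subseteq> A \<and> \<alpha>s \<noteq> [] \<and> length \<beta>s = m
    then 1 / (fact m * fact (length \<alpha>s)) * parity_sign (gamma_exponent dg \<alpha>s \<beta>s)
      * coefficient A e \<mu> \<alpha>s \<beta>s * polyvector_monomial dg \<alpha>s \<beta>s u
    else 0)"

definition Gamma :: "'i::linorder set \<Rightarrow> ('i \<Rightarrow> 'v) \<Rightarrow> ('i \<Rightarrow> int) \<Rightarrow>
    (nat \<Rightarrow> nat \<Rightarrow> ('v, 'k) operation) \<Rightarrow> ('i pvar, 'k) series" where
  "Gamma A e dg \<mu> u = Sum_any (\<lambda>m. if m \<ge> 1 then Gamma_part A e dg \<mu> m u else 0)"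

end

end

theory Submission
  imports Defs "HOL-Combinatorics.Multiset_Permutations"
begin

text \<open>
  Both sides are equivalent to the same quadratic relations between the coefficients of the \<open>\<mu>\<^sub>m\<^sub>,\<^sub>n\<close>:
  for all words \<open>\<alpha>\<close>, \<open>\<beta>\<close>, the sum over all unshuffles of \<open>\<alpha>\<close> and \<open>\<beta>\<close> of the two-vertex composites of
  the \<open>\<mu>\<close>, including those with a vertex \<open>\<mu>\<^sub>1\<^sub>,\<^sub>1\<close>, vanishes.  On the dioperad side a morphism is
  determined by its values on corollas, and since both differentials are derivations it commutes with
  them as soon as it does so on corollas; the terms with \<open>\<mu>\<^sub>1\<^sub>,\<^sub>1\<close> make up the differential of the
  endomorphism dioperad, and the relation for words of length one is \<open>\<delta> \<circ> \<delta> = 0\<close>.  On the geometric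
  side the Taylor coefficients of a series form an alternating function on words; products become
  unshuffle sums and derivatives become insertions of a letter.  The Taylor coefficients of \<open>\<Gamma>\<close> are
  the coefficients of the \<open>\<mu>\<close> up to sign, hence those of \<open>[\<Gamma>, \<Gamma>]\<close> are, up to sign, twice the relations.
\<close>

section \<open>Alternating functionals on words\<close>

text \<open>Signs are the main obstacle: outputs are skew in degree |e| on the algebraic side, while
  the symbols of the vector fields commute in degree |e| + 1. Most identities between permutation
  signs are therefore not obtained by counting inversions but by evaluating one alternating
  functional in two ways. The exponent \<epsilon> of \<Gamma> contains a sum of degrees weighted by
  position; its behaviour under swaps turns one symmetry type into the other. The remaining parities
  are compared only on nonzero terms, where the degree 2 - m of the operations ties the degrees of
  the indices together. \<open>V\<close> may be infinite-dimensional, and then the dual basis does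
  not span the functionals. But every value of an operation is a finite combination of basis
  tensors, so matrix coefficients determine the operation and sums over an internal edge are finite.
  The free dioperad enters only through an interpretation of terms that respects its congruence. The
  factor 2 in [\<Gamma>,\<Gamma>] comes from the even total degree of \<Gamma>; inverting it, like
  dividing by factorials, uses characteristic 0.\<close>

lemma parity_sign_add: "parity_sign (a + b) = parity_sign a * parity_sign b"
  by (simp add: parity_sign_def)

lemma parity_sign_mult_self [simp]: "parity_sign a * parity_sign a = 1"
  by (simp add: parity_sign_def)

lemma parity_sign_mult_self_left [simp]: "parity_sign a * (parity_sign a * x) = x"
  by (simp add: parity_sign_def)

lemma parity_sign_0 [simp]: "parity_sign 0 = 1"
  by (simp add: parity_sign_def)

lemma parity_sign_cong: "even a = even b \<Longrightarrow> parity_sign a = parity_sign b"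
  by (simp add: parity_sign_def)

lemma power_minus_one_eq_parity_sign: "(- 1) ^ n = parity_sign (int n)"
  by (simp add: parity_sign_def minus_one_power_iff)

lemma parity_sign_nonzero [simp]: "parity_sign a \<noteq> (0 :: 'a :: ring_1_no_zero_divisors)"
  by (simp add: parity_sign_def)

text \<open>Adjacent swaps generate all permutations, so this is full symmetry with weight
  \<open>\<chi>\<close>. The letters \<open>a\<close> and \<open>b\<close> may coincide; if
  \<open>\<chi> a a = - 1\<close>, words with two neighbouring letters \<open>a\<close> are then
  killed outside characteristic 2.\<close>

definition alternating :: "('x \<Rightarrow> 'x \<Rightarrow> 'k::comm_ring_1) \<Rightarrow> ('x list \<Rightarrow> 'k) \<Rightarrow> bool" where
  "alternating \<chi> \<Phi> \<longleftrightarrow> (\<forall>x a b y. \<Phi> (x @ a # b # y) = \<chi> a b * \<Phi> (x @ b # a # y))"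

text \<open>Only strict inversions count, so equal letters contribute no factor. With
  \<open>graded_swap\<close> this is the sorting sign of a word of graded variables; with the
  constant weight -1, on words of positions, it is the usual sign of a permutation.\<close>

definition inversion_sign :: "('x::linorder \<Rightarrow> 'x \<Rightarrow> 'k::comm_ring_1) \<Rightarrow> 'x list \<Rightarrow> 'k" where
  "inversion_sign \<chi> w =
    (\<Prod>(i, j) \<in> {(i, j). i < j \<and> j < length w \<and> w ! j < w ! i}. \<chi> (w ! i) (w ! j))"

text \<open>Two symmetry types: \<open>graded_swap\<close> governs the inputs and the variables of
  series, \<open>skew_swap\<close> the outputs, where the sign representation is combined with the
  Koszul sign.\<close>

definition graded_swap :: "('x \<Rightarrow> int) \<Rightarrow> 'x \<Rightarrow> 'x \<Rightarrow> 'k::comm_ring_1" where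
  "graded_swap d a b = parity_sign (d a * d b)"

definition skew_swap :: "('x \<Rightarrow> int) \<Rightarrow> 'x \<Rightarrow> 'x \<Rightarrow> 'k::comm_ring_1" where
  "skew_swap d a b = - parity_sign (d a * d b)"

lemma sorting_sign_eq: "sorting_sign d = inversion_sign (graded_swap d)"
  by (simp add: sorting_sign_def inversion_sign_def graded_swap_def fun_eq_iff)

lemma alternatingD: "alternating \<chi> \<Phi> \<Longrightarrow> \<Phi> (x @ a # b # y) = \<chi> a b * \<Phi> (x @ b # a # y)"
  unfolding alternating_def by blast

lemma alternating_append_left: "alternating \<chi> \<Phi> \<Longrightarrow> alternating \<chi> (\<lambda>w. \<Phi> (u @ w))"
  unfolding alternating_def by (metis append_assoc)

lemma alternating_append_right: "alternating \<chi> \<Phi> \<Longrightarrow> alternating \<chi> (\<lambda>w. \<Phi> (w @ u))"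
  unfolding alternating_def by (metis append_assoc append_Cons)

lemma alternating_Cons: "alternating \<chi> \<Phi> \<Longrightarrow> alternating \<chi> (\<lambda>w. \<Phi> (a # w))"
  using alternating_append_left[of \<chi> \<Phi> "[a]"] by simp

lemma alternating_map: "alternating \<chi> \<Phi> \<Longrightarrow> alternating (\<lambda>i j. \<chi> (f i) (f j)) (\<lambda>w. \<Phi> (map f w))"
  unfolding alternating_def map_append list.map by blast

lemma alternating_move:
  assumes "alternating \<chi> \<Phi>"
  shows "\<Phi> (x @ a # y @ z) = (\<Prod>b\<leftarrow>y. \<chi> a b) * \<Phi> (x @ y @ a # z)"
proof (induction y arbitrary: x)
  case (Cons b y)
  have "\<Phi> (x @ a # b # y @ z) = \<chi> a b * \<Phi> ((x @ [b]) @ a # y @ z)"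
    using alternatingD[OF assms, of x a b "y @ z"] by simp
  also have "\<dots> = \<chi> a b * ((\<Prod>b\<leftarrow>y. \<chi> a b) * \<Phi> ((x @ [b]) @ y @ a # z))"
    by (simp only: Cons.IH)
  finally show ?case by (simp add: mult.assoc)
qed simp

text \<open>The block \<open>y\<close> is moved past \<open>z\<close> one letter at a time, its last
  letter first; hence the induction from the right end.\<close>

lemma alternating_block:
  assumes "alternating \<chi> \<Phi>"
  shows "\<Phi> (x @ y @ z @ w) = (\<Prod>a\<leftarrow>y. \<Prod>b\<leftarrow>z. \<chi> a b) * \<Phi> (x @ z @ y @ w)"
proof (induction y arbitrary: w rule: rev_induct)
  case (snoc a y)
  have "\<Phi> (x @ (y @ [a]) @ z @ w) = (\<Prod>b\<leftarrow>z. \<chi> a b) * \<Phi> (x @ y @ z @ a # w)"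
    using alternating_move[OF assms, of "x @ y" a z w] by simp
  also have "\<dots> = (\<Prod>b\<leftarrow>z. \<chi> a b) * ((\<Prod>a\<leftarrow>y. \<Prod>b\<leftarrow>z. \<chi> a b) * \<Phi> (x @ z @ y @ a # w))"
    by (simp only: snoc.IH)
  finally show ?case by (simp add: mult_ac)
qed simp

lemma prod_graded_swap:
  "(\<Prod>b\<leftarrow>z. graded_swap d a b) = parity_sign (d a * sum_list (map d z))"
  by (induction z) (simp_all add: graded_swap_def parity_sign_add distrib_left)

lemma prod_prod_graded_swap:
  "(\<Prod>a\<leftarrow>y. \<Prod>b\<leftarrow>z. graded_swap d a b) = parity_sign (sum_list (map d y) * sum_list (map d z))"
  by (induction y) (simp_all add: prod_graded_swap parity_sign_add distrib_right)

lemma skew_swap_eq: "skew_swap d a b = parity_sign (1 + d a * d b)"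
  by (simp add: skew_swap_def parity_sign_def)

lemma prod_skew_swap:
  "(\<Prod>b\<leftarrow>z. skew_swap d a b) = parity_sign (int (length z) + d a * sum_list (map d z))"
  by (induction z) (simp_all add: skew_swap_eq parity_sign_add distrib_left)

lemma inversion_sign_Nil [simp]: "inversion_sign \<chi> [] = 1"
  by (simp add: inversion_sign_def)

text \<open>An inversion of \<open>a # w\<close> either has first index 0 and pairs \<open>a\<close>
  with a smaller later letter, or is an inversion of \<open>w\<close> with both indices shifted. The
  resulting recursion makes the product over pairs accessible to induction on words.\<close>

lemma inversion_sign_Cons:
  "inversion_sign \<chi> (a # w) = (\<Prod>b\<leftarrow>w. if b < a then \<chi> a b else 1) * inversion_sign \<chi> w"
proof -
  let ?I = "\<lambda>w. {(i, j). i < j \<and> j < length w \<and> w ! j < w ! i}"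
  have fin: "finite (?I w)"
    by (rule finite_subset[of _ "{..<length w} \<times> {..<length w}"]) auto
  let ?A = "{(0::nat, Suc j) | j. j < length w \<and> w ! j < a}"
  let ?B = "(\<lambda>(i, j). (Suc i, Suc j)) ` ?I w"
  have eq: "?I (a # w) = ?A \<union> ?B"
  proof (intro set_eqI iffI)
    fix p assume "p \<in> ?I (a # w)"
    then obtain i j where p: "p = (i, j)" "i < j" "j < length (a # w)" "(a # w) ! j < (a # w) ! i"
      by auto
    then obtain j' where j: "j = Suc j'" by (cases j) auto
    show "p \<in> ?A \<union> ?B"
    proof (cases i)
      case 0 then show ?thesis using p j by auto
    next
      case (Suc i')
      then have "(i', j') \<in> ?I w" using p j by auto
      then have "(Suc i', Suc j') \<in> ?B" by (metis (no_types, lifting) case_prod_conv imageI)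
      then show ?thesis using p j Suc by simp
    qed
  qed auto
  have A: "?A = (\<lambda>j. (0, Suc j)) ` {j. j < length w \<and> w ! j < a}" by auto
  have "inversion_sign \<chi> (a # w) =
      (\<Prod>(i, j)\<in>?A. \<chi> ((a # w) ! i) ((a # w) ! j)) * (\<Prod>(i, j)\<in>?B. \<chi> ((a # w) ! i) ((a # w) ! j))"
    unfolding inversion_sign_def eq
    by (rule prod.union_disjoint) (use fin in \<open>auto simp: A\<close>)
  also have "(\<Prod>(i, j)\<in>?B. \<chi> ((a # w) ! i) ((a # w) ! j)) = inversion_sign \<chi> w"
    unfolding inversion_sign_def
    by (subst prod.reindex) (auto simp: inj_on_def case_prod_unfold)
  also have "(\<Prod>(i, j)\<in>?A. \<chi> ((a # w) ! i) ((a # w) ! j)) =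
      (\<Prod>j\<in>{j. j < length w \<and> w ! j < a}. \<chi> a (w ! j))"
    unfolding A by (subst prod.reindex) (auto simp: inj_on_def)
  also have "\<dots> = (\<Prod>j<length w. if w ! j < a then \<chi> a (w ! j) else 1)"
    by (rule prod.mono_neutral_cong_left) auto
  also have "\<dots> = (\<Prod>b\<leftarrow>w. if b < a then \<chi> a b else 1)"
    by (auto simp: prod.list_conv_set_nth atLeast0LessThan intro!: prod.cong)
  finally show ?thesis .
qed

lemma prod_list_map_mset_cong:
  "mset x = mset y \<Longrightarrow> (\<Prod>b\<leftarrow>x. f b :: 'k::comm_monoid_mult) = (\<Prod>b\<leftarrow>y. f b)"
  by (metis mset_map prod_mset_prod_list)

lemma prod_list_map_eq_1:
  "(\<And>b. b \<in> set w \<Longrightarrow> f b = 1) \<Longrightarrow> (\<Prod>b\<leftarrow>w. f b :: 'k::monoid_mult) = 1"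
  by (induction w) simp_all

lemma sum_list_map_mset_cong:
  "mset x = mset y \<Longrightarrow> (\<Sum>b\<leftarrow>x. f b :: 'k::comm_monoid_add) = (\<Sum>b\<leftarrow>y. f b)"
  by (metis mset_map sum_mset_sum_list)

lemma alternating_insort:
  assumes "alternating \<chi> \<Phi>" "sorted s"
  shows "\<Phi> (a # s) = (\<Prod>b\<leftarrow>s. if b < a then \<chi> a b else 1) * \<Phi> (insort a s)"
  using assms
proof (induction s arbitrary: \<Phi>)
  case (Cons b s)
  show ?case
  proof (cases "a \<le> b")
    case True
    then have "(\<Prod>c\<leftarrow>b # s. if c < a then \<chi> a c else 1) = 1"
      using Cons.prems(2) by (intro prod_list_map_eq_1) auto
    then show ?thesis using True by simp
  next
    case False
    have "\<Phi> (a # b # s) = \<chi> a b * \<Phi> (b # a # s)"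
      using alternatingD[OF Cons.prems(1), of "[]" a b s] by simp
    also have "\<Phi> (b # a # s) = (\<Prod>b\<leftarrow>s. if b < a then \<chi> a b else 1) * \<Phi> (b # insort a s)"
      using Cons.IH[OF alternating_Cons[OF Cons.prems(1), of b]] Cons.prems(2) by simp
    finally show ?thesis using False by (auto simp: mult.assoc not_le)
  qed
qed simp

text \<open>Insertion sort: each swap of a larger letter with a smaller one behind it contributes
  its \<open>\<chi>\<close>, and together these are the inversions. An alternating functional is
  thus determined by its values on sorted words, both for words of positions (permutation signs) and
  for words of variables (series).\<close>

theorem alternating_sort:
  assumes "alternating \<chi> \<Phi>"
  shows "\<Phi> w = inversion_sign \<chi> w * \<Phi> (sort w)"
  using assms
proof (induction w arbitrary: \<Phi>)
  case (Cons a w)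
  have "\<Phi> (a # w) = inversion_sign \<chi> w * \<Phi> (a # sort w)"
    using Cons.IH[OF alternating_Cons[OF Cons.prems, of a]] .
  also have "\<Phi> (a # sort w) = (\<Prod>b\<leftarrow>w. if b < a then \<chi> a b else 1) * \<Phi> (insort a (sort w))"
    using alternating_insort[OF Cons.prems, of "sort w" a]
      prod_list_map_mset_cong[of "sort w" w "\<lambda>b. if b < a then \<chi> a b else 1"] by simp
  finally show ?case by (simp add: inversion_sign_Cons mult_ac)
qed simp

text \<open>For \<open>a = b\<close> the two words coincide and no factor appears, so in general
  \<open>inversion_sign\<close> alternates only where the swapped letters differ. This is why
  \<open>position_sign\<close> is cut off on words with repetitions.\<close>

lemma inversion_sign_swap:
  assumes "a \<noteq> b" "\<And>a b. \<chi> a b * \<chi> b a = 1"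
  shows "inversion_sign \<chi> (x @ a # b # y) = \<chi> a b * inversion_sign \<chi> (x @ b # a # y)"
proof (induction x)
  case Nil
  have *: "\<chi> a b * (\<chi> b a * c) = c" for c
    using assms(2)[of a b] by (metis mult.assoc mult_1)
  show ?case using assms(1) by (cases "a < b") (auto simp: inversion_sign_Cons mult_ac *)
next
  case (Cons c x)
  show ?case by (simp add: inversion_sign_Cons Cons.IH mult_ac)
qed

lemma inversion_sign_sorted: "sorted w \<Longrightarrow> inversion_sign \<chi> w = 1"
proof -
  assume "sorted w"
  then have "{(i, j). i < j \<and> j < length w \<and> w ! j < w ! i} = {}"
    unfolding sorted_iff_nth_mono_less using not_le by blast
  then show ?thesis unfolding inversion_sign_def by (simp only: prod.empty)
qed

section \<open>Signs of permutations\<close>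

text \<open>The sign of rearranging \<open>w\<close> into \<open>permute_list \<sigma> w\<close>.
  Inversions are those of the word of positions, weighted by the letters of \<open>w\<close> found
  there, so equal letters at different positions are still exchanged with their sign.\<close>

definition perm_sign :: "('x \<Rightarrow> 'x \<Rightarrow> 'k::comm_ring_1) \<Rightarrow> (nat \<Rightarrow> nat) \<Rightarrow> 'x list \<Rightarrow> 'k" where
  "perm_sign \<chi> \<sigma> w = inversion_sign (\<lambda>i j. \<chi> (w ! i) (w ! j)) (map \<sigma> [0..<length w])"

text \<open>\<open>koszul\<close> sees only parities, listed as booleans. For the parity pattern of
  \<open>w\<close> the two signs agree, since a swap of graded letters is negative exactly if both
  are odd.\<close>

lemma koszul_eq_perm_sign:
  assumes "\<sigma> permutes {..<length w}"
  shows "koszul \<sigma> (map (\<lambda>a. odd (d a)) w) = perm_sign (graded_swap d) \<sigma> w"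
  unfolding koszul_def perm_sign_def inversion_sign_def
proof (rule prod.cong)
  fix p assume "p \<in> {(i, j). i < j \<and> j < length (map \<sigma> [0..<length w]) \<and>
    map \<sigma> [0..<length w] ! j < map \<sigma> [0..<length w] ! i}"
  then obtain i j where p: "p = (i, j)" and ij: "i < length w" "j < length w" by auto
  then have "\<sigma> i < length w" "\<sigma> j < length w"
    using permutes_in_image[OF assms] by auto
  then show "(case p of (i, j) \<Rightarrow> if map (\<lambda>a. odd (d a)) w ! \<sigma> i \<and> map (\<lambda>a. odd (d a)) w ! \<sigma> j then - 1 else 1) =
    (case p of (i, j) \<Rightarrow> graded_swap d (w ! (map \<sigma> [0..<length w] ! i)) (w ! (map \<sigma> [0..<length w] ! j)))"
    using p ij by (auto simp: graded_swap_def parity_sign_def)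
qed auto

lemma map_permutes_upt:
  assumes "\<sigma> permutes {..<n}"
  shows "map \<sigma> [0..<n] = permute_list \<sigma> [0..<n]"
  using permutes_in_image[OF assms] by (simp add: permute_list_def)

lemma sort_map_permutes:
  assumes "\<sigma> permutes {..<n}"
  shows "sort (map \<sigma> [0..<n]) = [0..<n]"
proof (rule properties_for_sort)
  show "mset [0..<n] = mset (map \<sigma> [0..<n])"
    using assms by (simp add: map_permutes_upt del: mset_upt mset_map)
qed simp

text \<open>The functional \<open>l \<mapsto> \<Phi> (map (nth w) l)\<close> on words of positions
  is alternating, and sorting the positions \<open>map \<sigma> [0..<length w]\<close> leads to the
  identity word. The claim is \<open>alternating_sort\<close> for this functional.\<close>

theorem alternating_permute:
  assumes "alternating \<chi> \<Phi>" "\<sigma> permutes {..<length w}"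
  shows "\<Phi> (permute_list \<sigma> w) = perm_sign \<chi> \<sigma> w * \<Phi> w"
proof -
  have "permute_list \<sigma> w = map (nth w) (map \<sigma> [0..<length w])"
    by (simp add: permute_list_def)
  then have "\<Phi> (permute_list \<sigma> w) = perm_sign \<chi> \<sigma> w * \<Phi> (map (nth w) [0..<length w])"
    using alternating_sort[OF alternating_map[OF assms(1), of "nth w"], of "map \<sigma> [0..<length w]"]
    by (simp add: perm_sign_def sort_map_permutes[OF assms(2)])
  then show ?thesis by (simp add: map_nth)
qed

text \<open>The universal alternating functional: it turns identities between signs into identities
  between values of alternating functionals.\<close>

definition position_sign :: "('x \<Rightarrow> 'x \<Rightarrow> 'k::comm_ring_1) \<Rightarrow> 'x list \<Rightarrow> nat list \<Rightarrow> 'k" where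
  "position_sign \<chi> w l = (if distinct l then inversion_sign (\<lambda>i j. \<chi> (w ! i) (w ! j)) l else 0)"

lemma alternating_position_sign:
  assumes "\<And>a b. \<chi> a b * \<chi> b a = 1"
  shows "alternating (\<lambda>i j. \<chi> (w ! i) (w ! j)) (position_sign \<chi> w)"
  unfolding alternating_def
proof (intro allI)
  fix x y :: "nat list" and a b
  show "position_sign \<chi> w (x @ a # b # y) = \<chi> (w ! a) (w ! b) * position_sign \<chi> w (x @ b # a # y)"
    using inversion_sign_swap[of a b "\<lambda>i j. \<chi> (w ! i) (w ! j)" x y] assms
    by (cases "a = b") (auto simp: position_sign_def)
qed

lemma position_sign_upt [simp]: "position_sign \<chi> w [0..<n] = 1"
  by (simp add: position_sign_def inversion_sign_sorted)

lemma perm_sign_eq_position_sign: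
  assumes "\<sigma> permutes {..<length w}"
  shows "perm_sign \<chi> \<sigma> w = position_sign \<chi> w (map \<sigma> [0..<length w])"
  using permutes_inj_on[OF assms] by (simp add: perm_sign_def position_sign_def distinct_map)

text \<open>The cocycle rule. The position word of \<open>\<sigma> \<circ> \<tau>\<close> is the
  \<open>\<tau>\<close>-rearrangement of that of \<open>\<sigma>\<close>; since
  \<open>position_sign\<close> is alternating, \<open>\<tau>\<close> splits off with the sign that
  it has on the already permuted word.\<close>

lemma perm_sign_compose:
  assumes \<sigma>: "\<sigma> permutes {..<length w}" and \<tau>: "\<tau> permutes {..<length w}"
    and \<chi>: "\<And>a b. \<chi> a b * \<chi> b a = 1"
  shows "perm_sign \<chi> (\<sigma> \<circ> \<tau>) w = perm_sign \<chi> \<sigma> w * perm_sign \<chi> \<tau> (permute_list \<sigma> w)"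
proof -
  let ?\<chi> = "\<lambda>i j. \<chi> (w ! i) (w ! j)"
  have inlen: "\<tau> i < length w" if "i < length w" for i
    using permutes_in_image[OF \<tau>] that by auto
  have \<tau>': "\<tau> permutes {..<length (map \<sigma> [0..<length w])}" using \<tau> by simp
  have "perm_sign \<chi> (\<sigma> \<circ> \<tau>) w = position_sign \<chi> w (map (\<sigma> \<circ> \<tau>) [0..<length w])"
    using perm_sign_eq_position_sign[OF permutes_compose[OF \<tau> \<sigma>]] .
  also have "map (\<sigma> \<circ> \<tau>) [0..<length w] = permute_list \<tau> (map \<sigma> [0..<length w])"
    using inlen by (simp add: permute_list_def)
  also have "position_sign \<chi> w \<dots> =
      perm_sign ?\<chi> \<tau> (map \<sigma> [0..<length w]) * position_sign \<chi> w (map \<sigma> [0..<length w])"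
    by (rule alternating_permute[OF alternating_position_sign \<tau>']) (rule \<chi>)
  also have "perm_sign ?\<chi> \<tau> (map \<sigma> [0..<length w]) = perm_sign \<chi> \<tau> (permute_list \<sigma> w)"
    unfolding perm_sign_def inversion_sign_def
    by (rule prod.cong) (auto simp: permute_list_def inlen)
  finally show ?thesis
    unfolding perm_sign_eq_position_sign[OF \<sigma>, of \<chi>] by (simp only: mult.commute)
qed

lemma perm_sign_id [simp]: "perm_sign \<chi> id w = 1"
  by (simp add: perm_sign_def inversion_sign_sorted)

section \<open>Blockwise permutations: extension, shift and exchange of blocks\<close>

lemma inversion_sign_append:
  assumes "\<forall>a\<in>set u. \<forall>b\<in>set v. a < b"
  shows "inversion_sign \<chi> (u @ v) = inversion_sign \<chi> u * inversion_sign \<chi> v"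
  using assms
proof (induction u)
  case (Cons a u)
  have "(\<Prod>b\<leftarrow>v. if b < a then \<chi> a b else 1) = 1"
    using Cons.prems by (intro prod_list_map_eq_1) auto
  then show ?case using Cons by (simp add: inversion_sign_Cons mult.assoc)
qed simp

lemma inversion_sign_map_strict_mono:
  assumes "\<And>i j. i \<in> set w \<Longrightarrow> j \<in> set w \<Longrightarrow> f i < f j \<longleftrightarrow> i < j"
  shows "inversion_sign \<chi> (map f w) = inversion_sign (\<lambda>i j. \<chi> (f i) (f j)) w"
  unfolding inversion_sign_def
  by (rule prod.cong) (auto simp: assms)

lemma inversion_sign_cong:
  assumes "\<And>i j. i \<in> set w \<Longrightarrow> j \<in> set w \<Longrightarrow> \<chi> i j = \<chi>' i j"
  shows "inversion_sign \<chi> w = inversion_sign \<chi>' w"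
  unfolding inversion_sign_def
  by (rule prod.cong) (auto simp: assms)

lemma perm_sign_append_left:
  assumes "\<sigma> permutes {..<length u}"
  shows "perm_sign \<chi> \<sigma> (u @ v) = perm_sign \<chi> \<sigma> u"
    and "permute_list \<sigma> (u @ v) = permute_list \<sigma> u @ v"
proof -
  let ?u = "length u" and ?v = "length v"
  have lt: "\<sigma> i < ?u" if "i < ?u" for i using permutes_in_image[OF assms] that by auto
  have ge: "\<sigma> i = i" if "?u \<le> i" for i using permutes_not_in[OF assms] that by auto
  have 1: "map \<sigma> [?u..<?u + ?v] = [?u..<?u + ?v]"
    by (rule map_idI) (auto intro: ge)
  have eq: "map \<sigma> [0..<?u + ?v] = map \<sigma> [0..<?u] @ [?u..<?u + ?v]"
    by (simp only: upt_add_eq_append[OF le0] map_append 1)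
  have "perm_sign \<chi> \<sigma> (u @ v) =
      inversion_sign (\<lambda>i j. \<chi> ((u @ v) ! i) ((u @ v) ! j)) (map \<sigma> [0..<?u])"
    unfolding perm_sign_def length_append eq
    by (subst inversion_sign_append) (auto simp: inversion_sign_sorted intro: less_le_trans[OF lt])
  also have "\<dots> = perm_sign \<chi> \<sigma> u"
    unfolding perm_sign_def by (rule inversion_sign_cong) (auto simp: nth_append lt)
  finally show "perm_sign \<chi> \<sigma> (u @ v) = perm_sign \<chi> \<sigma> u" .
  show "permute_list \<sigma> (u @ v) = permute_list \<sigma> u @ v"
    by (rule nth_equalityI) (auto simp: permute_list_def nth_append lt ge)
qed

text \<open>The positions of \<open>u\<close> come first and are fixed, and the shift of the
  remaining ones preserves their order, so only the inversions of \<sigma> on \<open>v\<close> are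
  left.\<close>

lemma perm_sign_shift_perm:
  assumes "\<sigma> permutes {..<length v}"
  shows "perm_sign \<chi> (shift_perm (length u) \<sigma>) (u @ v) = perm_sign \<chi> \<sigma> v"
    and "permute_list (shift_perm (length u) \<sigma>) (u @ v) = u @ permute_list \<sigma> v"
proof -
  let ?u = "length u" and ?v = "length v"
  have lt: "\<sigma> i < ?v" if "i < ?v" for i using permutes_in_image[OF assms] that by auto
  have 1: "map (shift_perm ?u \<sigma>) [0..<?u] = [0..<?u]"
    by (intro map_idI) (simp add: shift_perm_def)
  have 2: "map (shift_perm ?u \<sigma>) [?u..<?u + ?v] = map (\<lambda>i. i + ?u) (map \<sigma> [0..<?v])"
    by (rule nth_equalityI) (auto simp: shift_perm_def)
  have eq: "map (shift_perm ?u \<sigma>) [0..<?u + ?v] = [0..<?u] @ map (\<lambda>i. i + ?u) (map \<sigma> [0..<?v])"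
    by (simp only: upt_add_eq_append[OF le0] map_append 1 2)
  have "perm_sign \<chi> (shift_perm (length u) \<sigma>) (u @ v) =
      inversion_sign (\<lambda>i j. \<chi> ((u @ v) ! i) ((u @ v) ! j)) (map (\<lambda>i. i + ?u) (map \<sigma> [0..<?v]))"
    unfolding perm_sign_def length_append eq
    by (subst inversion_sign_append) (auto simp: inversion_sign_sorted)
  also have "\<dots> = inversion_sign (\<lambda>i j. \<chi> ((u @ v) ! (i + ?u)) ((u @ v) ! (j + ?u))) (map \<sigma> [0..<?v])"
    by (rule inversion_sign_map_strict_mono) simp
  also have "\<dots> = perm_sign \<chi> \<sigma> v"
    unfolding perm_sign_def by (rule inversion_sign_cong) (auto simp: nth_append)
  finally show "perm_sign \<chi> (shift_perm (length u) \<sigma>) (u @ v) = perm_sign \<chi> \<sigma> v" .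
  show "permute_list (shift_perm (length u) \<sigma>) (u @ v) = u @ permute_list \<sigma> v"
    by (rule nth_equalityI) (auto simp: permute_list_def nth_append shift_perm_def lt)
qed

lemma permutes_shift_perm:
  assumes "\<sigma> permutes {..<n}"
  shows "shift_perm k \<sigma> permutes {..<k + n}"
proof (rule bij_imp_permutes)
  have lt: "\<sigma> i < n" if "i < n" for i using permutes_in_image[OF assms] that by auto
  have inj: "inj_on (shift_perm k \<sigma>) {..<k + n}"
    by (auto simp: inj_on_def shift_perm_def inj_eq[OF permutes_inj[OF assms]] split: if_splits)
  have "shift_perm k \<sigma> ` {..<k + n} \<subseteq> {..<k + n}"
  proof safe
    fix i assume "i < k + n"
    then show "shift_perm k \<sigma> i < k + n" using lt[of "i - k"] by (auto simp: shift_perm_def)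
  qed
  then show "bij_betw (shift_perm k \<sigma>) {..<k + n} {..<k + n}"
    using inj by (simp add: bij_betw_def endo_inj_surj)
  show "shift_perm k \<sigma> x = x" if "x \<notin> {..<k + n}" for x
    using that permutes_not_in[OF assms] by (auto simp: shift_perm_def)
qed

lemma permutes_block_swap:
  assumes "a + b + c \<le> n"
  shows "block_swap a b c permutes {..<n}"
proof (rule bij_imp_permutes)
  have inj: "inj_on (block_swap a b c) {..<n}"
    by (auto simp: inj_on_def block_swap_def split: if_splits)
  have "block_swap a b c ` {..<n} \<subseteq> {..<n}"
    using assms by (auto simp: block_swap_def)
  then show "bij_betw (block_swap a b c) {..<n} {..<n}"
    using inj by (simp add: bij_betw_def endo_inj_surj)
  show "block_swap a b c x = x" if "x \<notin> {..<n}" for x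
    using that assms by (auto simp: block_swap_def)
qed

text \<open>The numbers \<open>b\<close> and \<open>c\<close> are the lengths of the two blocks in
  their order after the swap, because place \<open>i\<close> of the new list reads entry
  \<open>block_swap a b c i\<close> of the old one.\<close>

lemma permute_list_block_swap:
  assumes "length x = a" "length y = b" "length z = c"
  shows "permute_list (block_swap a b c) (x @ z @ y @ w) = x @ y @ z @ w"
proof (rule nth_equalityI)
  fix i assume "i < length (permute_list (block_swap a b c) (x @ z @ y @ w))"
  then have i: "i < a + c + b + length w" using assms by simp
  have "(x @ z @ y @ w) ! block_swap (length x) (length y) (length z) i = (x @ y @ z @ w) ! i"
  proof -
    consider "i < length x" | j where "i = length x + j" "j < length y"
      | j where "i = length x + (length y + j)" "j < length z"
      | j where "i = length x + (length y + (length z + j))"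
      by (metis le_Suc_ex linorder_not_less nat_add_left_cancel_less)
    then show ?thesis
    proof cases
      case 2
      then have "block_swap (length x) (length y) (length z) i = length x + (length z + j)"
        by (simp add: block_swap_def)
      then show ?thesis using 2 by (simp only: nth_append_length_plus) (simp add: nth_append)
    next
      case 3
      then have "block_swap (length x) (length y) (length z) i = length x + j"
        by (simp add: block_swap_def)
      then show ?thesis using 3 by (simp only: nth_append_length_plus) (simp add: nth_append)
    next
      case 4
      then have "block_swap (length x) (length y) (length z) i = length x + (length z + (length y + j))"
        by (simp add: block_swap_def)
      then show ?thesis using 4 by (simp only: nth_append_length_plus)
    qed (simp add: block_swap_def nth_append)
  qed
  then have "(x @ z @ y @ w) ! block_swap a b c i = (x @ y @ z @ w) ! i"
    by (simp only: assms)
  then show "permute_list (block_swap a b c) (x @ z @ y @ w) ! i = (x @ y @ z @ w) ! i"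
    using i assms by (simp add: permute_list_def add.assoc)
qed simp

lemma map_nth_middle: "map (nth (x @ y @ z)) [length x..<length x + length y] = y"
  by (rule nth_equalityI) (simp_all add: nth_append)

text \<open>Evaluating \<open>position_sign\<close> at the swapped word of positions and moving the
  block back with \<open>alternating_block\<close> yields the sign without enumerating
  inversions.\<close>

lemma perm_sign_block_swap:
  assumes len: "length x = a" "length y = b" "length z = c"
    and \<chi>: "\<And>a b. \<chi> a b * \<chi> b a = 1"
  shows "perm_sign \<chi> (block_swap a b c) (x @ z @ y @ w) = (\<Prod>p\<leftarrow>y. \<Prod>q\<leftarrow>z. \<chi> p q)"
proof -
  let ?l = "x @ z @ y @ w"
  let ?X = "[0..<a]" and ?Z = "[a..<a + c]" and ?Y = "[a + c..<a + c + b]"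
    and ?W = "[a + c + b..<a + c + b + length w]"
  have perm: "block_swap a b c permutes {..<length ?l}"
    by (rule permutes_block_swap) (simp add: len)
  have upt: "[0..<length ?l] = ?X @ ?Z @ ?Y @ ?W"
    using len upt_add_eq_append[of 0 "a + c + b" "length w"] upt_add_eq_append[of 0 "a + c" b]
      upt_add_eq_append[of 0 a c] by (simp add: add.assoc[symmetric])
  have Z: "map (nth ?l) ?Z = z" and Y: "map (nth ?l) ?Y = y"
    using map_nth_middle[of x z "y @ w"] map_nth_middle[of "x @ z" y w] by (simp_all add: len)
  have "map (block_swap a b c) [0..<length ?l] = permute_list (block_swap a b c) [0..<length ?l]"
    using perm by (rule map_permutes_upt)
  also have "\<dots> = ?X @ ?Y @ ?Z @ ?W"
    unfolding upt by (rule permute_list_block_swap) auto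
  finally have eq: "map (block_swap a b c) [0..<length ?l] = ?X @ ?Y @ ?Z @ ?W" .
  have "perm_sign \<chi> (block_swap a b c) ?l = position_sign \<chi> ?l (?X @ ?Y @ ?Z @ ?W)"
    using perm_sign_eq_position_sign[OF perm] eq by simp
  also have "\<dots> = (\<Prod>i\<leftarrow>?Y. \<Prod>j\<leftarrow>?Z. \<chi> (?l ! i) (?l ! j)) * position_sign \<chi> ?l (?X @ ?Z @ ?Y @ ?W)"
    by (rule alternating_block[OF alternating_position_sign]) (rule \<chi>)
  also have "?X @ ?Z @ ?Y @ ?W = [0..<length ?l]" by (rule upt[symmetric])
  also have "(\<Prod>i\<leftarrow>?Y. \<Prod>j\<leftarrow>?Z. \<chi> (?l ! i) (?l ! j)) =
      (\<Prod>p\<leftarrow>map (nth ?l) ?Y. \<Prod>q\<leftarrow>map (nth ?l) ?Z. \<chi> p q)"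
    by (simp only: map_map o_def)
  finally show ?thesis unfolding Y Z by simp
qed

text \<open>Converse of \<open>alternating_permute\<close>: the adjacent swap is the special case
  \<open>block_swap (length x) 1 1\<close>. This converts the invariance conditions of
  \<open>sym_to_ext\<close> into alternation of the matrix coefficients.\<close>

lemma alternatingI_permute:
  assumes "\<And>w \<sigma>. \<sigma> permutes {..<length w} \<Longrightarrow> \<Phi> w = perm_sign \<chi> \<sigma> w * \<Phi> (permute_list \<sigma> w)"
    and "\<And>a b. \<chi> a b * \<chi> b a = 1" "\<And>a b. \<chi> a b = \<chi> b a"
  shows "alternating \<chi> \<Phi>"
  unfolding alternating_def
proof (intro allI)
  fix x y :: "'a list" and a b :: 'a
  let ?w = "x @ [a] @ [b] @ y"
  have "block_swap (length x) 1 1 permutes {..<length ?w}"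
    by (rule permutes_block_swap) simp
  then have "\<Phi> ?w = perm_sign \<chi> (block_swap (length x) 1 1) ?w * \<Phi> (permute_list (block_swap (length x) 1 1) ?w)"
    by (rule assms(1))
  also have "permute_list (block_swap (length x) 1 1) ?w = x @ [b] @ [a] @ y"
    by (rule permute_list_block_swap) auto
  also have "perm_sign \<chi> (block_swap (length x) 1 1) ?w = \<chi> b a"
    using perm_sign_block_swap[where x = x and y = "[b]" and z = "[a]" and w = y and \<chi> = \<chi>] assms(2) by simp
  finally show "\<Phi> (x @ a # b # y) = \<chi> a b * \<Phi> (x @ b # a # y)"
    using assms(3)[of a b] by simp
qed

text \<open>The ordinary sign, viewed as a functional on words of positions and set to 0 on words
  that do not enumerate \<open>{..<n}\<close>. In this form it is alternating for the constant
  weight -1, and \<open>alternating_sort\<close> identifies it with an inversion sign.\<close>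

definition perm_list_sign :: "nat \<Rightarrow> nat list \<Rightarrow> int" where
  "perm_list_sign n l = (if distinct l \<and> set l = {..<n} \<and> length l = n then sign (list_perm l) else 0)"

lemma list_perm_permutes:
  assumes "distinct l" "set l = {..<length l}"
  shows "list_perm l permutes {..<length l}"
proof (rule bij_imp_permutes)
  have "bij_betw (nth l) {..<length l} {..<length l}"
    by (rule bij_betw_nth) (use assms in auto)
  moreover have "list_perm l i = l ! i" if "i \<in> {..<length l}" for i
    using that by (simp add: list_perm_def)
  ultimately show "bij_betw (list_perm l) {..<length l} {..<length l}"
    using bij_betw_cong[of "{..<length l}" "list_perm l" "nth l"] by blast
qed (simp add: list_perm_def)

lemma permute_list_list_perm:
  assumes "length l = length w"
  shows "permute_list (list_perm l) w = map (nth w) l"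
  using assms by (intro nth_equalityI) (auto simp: permute_list_def list_perm_def)

lemma alternating_perm_list_sign: "alternating (\<lambda>i j. - 1) (perm_list_sign n)"
  unfolding alternating_def
proof (intro allI)
  fix x y :: "nat list" and a b
  let ?l = "x @ a # b # y" and ?l' = "x @ b # a # y"
  let ?t = "transpose (length x) (Suc (length x))"
  show "perm_list_sign n ?l = - 1 * perm_list_sign n ?l'"
  proof (cases "distinct ?l \<and> set ?l = {..<n} \<and> length ?l = n")
    case True
    then have T': "distinct ?l' \<and> set ?l' = {..<n} \<and> length ?l' = n" by auto
    have p: "list_perm ?l permutes {..<n}" "list_perm ?l' permutes {..<n}"
      using list_perm_permutes[of ?l] list_perm_permutes[of ?l'] True T' by auto
    have "list_perm ?l = list_perm ?l' \<circ> ?t"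
    proof
      fix i
      consider "i < length x" | "i = length x" | "i = Suc (length x)" | j where "i = length x + Suc (Suc j)"
        by (metis Suc_lessI add_Suc_right less_iff_Suc_add linorder_less_linear)
      then show "list_perm ?l i = (list_perm ?l' \<circ> ?t) i"
        by cases (simp_all add: list_perm_def transpose_def nth_append)
    qed
    moreover have "permutation (list_perm ?l')" using p(2) by (auto simp: permutation_permutes)
    ultimately have "sign (list_perm ?l) = sign (list_perm ?l') * sign ?t"
      by (simp add: sign_compose permutation_swap_id)
    then have "sign (list_perm ?l) = - sign (list_perm ?l')"
      by (simp add: sign_swap_id)
    then show ?thesis unfolding perm_list_sign_def using True T' by simp
  next
    case False
    then have "\<not> (distinct ?l' \<and> set ?l' = {..<n} \<and> length ?l' = n)" by auto
    then show ?thesis using False by (simp only: perm_list_sign_def if_False)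
  qed
qed

lemma sign_eq_inversion_sign:
  assumes "\<sigma> permutes {..<n}"
  shows "sign \<sigma> = inversion_sign (\<lambda>i j. - 1) (map \<sigma> [0..<n])"
proof -
  have lp: "list_perm (map \<sigma> [0..<n]) = \<sigma>"
    using permutes_not_in[OF assms] by (auto simp: list_perm_def fun_eq_iff)
  have lid: "list_perm [0..<n] = id"
    by (auto simp: list_perm_def fun_eq_iff)
  have "perm_list_sign n (map \<sigma> [0..<n]) =
      inversion_sign (\<lambda>i j. - 1) (map \<sigma> [0..<n]) * perm_list_sign n [0..<n]"
    using alternating_sort[OF alternating_perm_list_sign, of n "map \<sigma> [0..<n]"]
    by (simp add: sort_map_permutes[OF assms])
  moreover have "perm_list_sign n (map \<sigma> [0..<n]) = sign \<sigma>"
    using permutes_inj_on[OF assms] permutes_image[OF assms]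
    by (simp add: perm_list_sign_def lp distinct_map atLeast0LessThan)
  moreover have "perm_list_sign n [0..<n] = 1"
    by (simp add: perm_list_sign_def lid atLeast0LessThan)
  ultimately show ?thesis by simp
qed

lemma inversion_sign_minus:
  "inversion_sign (\<lambda>i j. - \<chi> i j) w = of_int (inversion_sign (\<lambda>i j. - 1) w) * inversion_sign \<chi> w"
  unfolding inversion_sign_def of_int_prod prod.distrib[symmetric] by (rule prod.cong) auto

text \<open>Each inversion carries one additional factor -1, and these factors multiply to the
  ordinary sign.\<close>

lemma perm_sign_skew:
  assumes "\<sigma> permutes {..<length w}"
  shows "perm_sign (skew_swap d) \<sigma> w = of_int (sign \<sigma>) * perm_sign (graded_swap d) \<sigma> w"
  unfolding perm_sign_def sign_eq_inversion_sign[OF assms] skew_swap_def graded_swap_def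
  by (rule inversion_sign_minus)

lemma graded_swap_involutive: "graded_swap d a b * graded_swap d b a = 1"
  by (simp add: graded_swap_def mult.commute[of "d b"])

lemma skew_swap_involutive: "skew_swap d a b * skew_swap d b a = 1"
  by (simp add: skew_swap_def mult.commute[of "d b"])

lemma graded_swap_commute: "graded_swap d a b = graded_swap d b a"
  by (simp add: graded_swap_def mult.commute)

lemma skew_swap_commute: "skew_swap d a b = skew_swap d b a"
  by (simp add: skew_swap_def mult.commute)

section \<open>Coordinates\<close>

lemma vector_space_field: "vector_space ((*) :: 'a::field \<Rightarrow> 'a \<Rightarrow> 'a)"
  by unfold_locales (auto simp: algebra_simps)

lemma sum_fun_apply: "(\<Sum>x\<in>S. f x) y = (\<Sum>x\<in>S. f x y :: 'b :: comm_monoid_add)"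
  by (induction S rule: infinite_finite_induct) simp_all

text \<open>The notion of structure does not mention a basis, the polyvector field does. All
  comparisons are made in the coordinates of one fixed homogeneous basis, of arbitrary
  cardinality.\<close>

locale based_graded_space = graded_vector_space scale V
  for scale :: "'k::field_char_0 \<Rightarrow> 'v::ab_group_add \<Rightarrow> 'v" and V :: "int \<Rightarrow> 'v set" +
  fixes A :: "'i::linorder set" and e :: "'i \<Rightarrow> 'v" and dg :: "'i \<Rightarrow> int"
  assumes basis: "homogeneous_basis A e dg"
begin

abbreviation dual :: "'i \<Rightarrow> 'v \<Rightarrow> 'k" where "dual \<equiv> dual_basis A e"

definition supp :: "'v \<Rightarrow> 'i set" where "supp v = {\<alpha> \<in> A. dual \<alpha> v \<noteq> 0}"

definition words :: "nat \<Rightarrow> 'i list set" where "words n = {w. length w = n \<and> set w \<subseteq> A}"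

definition deg :: "'i list \<Rightarrow> int" where "deg w = (\<Sum>a\<leftarrow>w. dg a)"

lemma deg_simps [simp]: "deg [] = 0" "deg (a # w) = dg a + deg w" "deg (u @ w) = deg u + deg w"
  by (simp_all add: deg_def)

lemma words_0 [simp]: "w \<in> words 0 \<longleftrightarrow> w = []"
  by (auto simp: words_def)

lemma words_Cons [simp]: "a # w \<in> words n \<longleftrightarrow> a \<in> A \<and> n > 0 \<and> w \<in> words (n - 1)"
  by (auto simp: words_def)

lemma inj_on_e: "inj_on e A" and indep: "independent (e ` A)" and span_e: "span (e ` A) = UNIV"
  and e_in_V: "\<alpha> \<in> A \<Longrightarrow> e \<alpha> \<in> V (dg \<alpha>)"
  using basis by (auto simp: homogeneous_basis_def)

lemma dual_add: "dual \<alpha> (v + w) = dual \<alpha> v + dual \<alpha> w"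
  by (simp add: dual_basis_def representation_add[OF indep] span_e)

lemma dual_scale: "dual \<alpha> (scale c v) = c * dual \<alpha> v"
  by (simp add: dual_basis_def representation_scale[OF indep] span_e)

lemma dual_zero [simp]: "dual \<alpha> 0 = 0"
  by (simp add: dual_basis_def representation_zero)

lemma dual_sum: "dual \<alpha> (\<Sum>x\<in>S. f x) = (\<Sum>x\<in>S. dual \<alpha> (f x))"
  by (induction S rule: infinite_finite_induct) (simp_all add: dual_add)

lemma dual_e: "\<alpha> \<in> A \<Longrightarrow> \<beta> \<in> A \<Longrightarrow> dual \<alpha> (e \<beta>) = (if \<alpha> = \<beta> then 1 else 0)"
  using inj_on_e by (auto simp: dual_basis_def representation_basis[OF indep] inj_on_def)

lemma functionals_iff: "\<xi> \<in> functionals \<longleftrightarrow> (\<forall>v w. \<xi> (v + w) = \<xi> v + \<xi> w) \<and> (\<forall>c v. \<xi> (scale c v) = c * \<xi> v)"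
  by (simp add: functionals_def Vector_Spaces.linear_iff vector_space_field vector_space_axioms)

lemma dual_functional [simp]: "dual \<alpha> \<in> functionals"
  by (simp add: functionals_iff dual_add dual_scale)

lemma set_map_dual [simp]: "set (map dual \<beta>) \<subseteq> functionals"
  by auto

lemma dual_image_functionals [simp]: "dual ` X \<subseteq> functionals"
  by auto

lemma zero_functional [simp]: "(\<lambda>_. 0) \<in> functionals"
  by (simp add: functionals_iff)

lemma functional_add: "\<xi> \<in> functionals \<Longrightarrow> \<xi> (v + w) = \<xi> v + \<xi> w"
  and functional_scale: "\<xi> \<in> functionals \<Longrightarrow> \<xi> (scale c v) = c * \<xi> v"
  by (simp_all add: functionals_iff)

lemma functional_zero: "\<xi> \<in> functionals \<Longrightarrow> \<xi> 0 = 0"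
  using functional_scale[of \<xi> 0 0] by simp

lemma functional_sum: "\<xi> \<in> functionals \<Longrightarrow> \<xi> (\<Sum>x\<in>S. f x) = (\<Sum>x\<in>S. \<xi> (f x))"
  by (induction S rule: infinite_finite_induct) (simp_all add: functional_add functional_zero)

lemma finite_supp [simp]: "finite (supp v)"
proof -
  have "e ` supp v \<subseteq> {b. representation (e ` A) v b \<noteq> 0}"
    by (auto simp: supp_def dual_basis_def)
  then have "finite (e ` supp v)"
    using finite_representation finite_subset by blast
  moreover have "inj_on e (supp v)"
    using inj_on_e by (rule inj_on_subset) (auto simp: supp_def)
  ultimately show ?thesis by (rule finite_imageD)
qed

lemma expand: "v = (\<Sum>\<alpha>\<in>supp v. scale (dual \<alpha> v) (e \<alpha>))"
proof -
  have "v = (\<Sum>b | representation (e ` A) v b \<noteq> 0. scale (representation (e ` A) v b) b)"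
    using sum_nonzero_representation_eq[OF indep, of v] span_e by simp
  also have "{b. representation (e ` A) v b \<noteq> 0} = e ` supp v"
    using representation_ne_zero[of "e ` A" v] by (auto simp: supp_def dual_basis_def)
  also have "(\<Sum>b\<in>e ` supp v. scale (representation (e ` A) v b) b) = (\<Sum>\<alpha>\<in>supp v. scale (dual \<alpha> v) (e \<alpha>))"
    by (subst sum.reindex) (auto simp: dual_basis_def supp_def intro: inj_on_subset[OF inj_on_e])
  finally show ?thesis .
qed

lemma vector_eqI: "(\<And>\<alpha>. \<alpha> \<in> A \<Longrightarrow> dual \<alpha> v = dual \<alpha> w) \<Longrightarrow> v = w"
proof -
  assume eq: "\<And>\<alpha>. \<alpha> \<in> A \<Longrightarrow> dual \<alpha> v = dual \<alpha> w"
  then have "supp v = supp w" by (auto simp: supp_def)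
  moreover have "scale (dual \<alpha> v) (e \<alpha>) = scale (dual \<alpha> w) (e \<alpha>)" if "\<alpha> \<in> supp w" for \<alpha>
    using that eq by (simp add: supp_def)
  ultimately show "v = w" using expand[of v] expand[of w] by (metis (no_types, lifting) sum.cong)
qed

lemma component_unique:
  assumes "\<And>i. c i \<in> V i" "finite {i. c i \<noteq> 0}" "v = (\<Sum>i | c i \<noteq> 0. c i)"
  shows "component v = c"
  unfolding component_def by (rule the1_equality[OF direct_sum]) (use assms in blast)

text \<open>Grouping the basis expansion of \<open>v\<close> by degree gives a decomposition into
  homogeneous parts, and uniqueness of such a decomposition identifies it with
  \<open>component v\<close>.\<close>

lemma component_eq: "component v = (\<lambda>i. \<Sum>\<alpha>\<in>{\<alpha> \<in> supp v. dg \<alpha> = i}. scale (dual \<alpha> v) (e \<alpha>))"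
proof (rule component_unique)
  let ?c = "\<lambda>i. \<Sum>\<alpha>\<in>{\<alpha> \<in> supp v. dg \<alpha> = i}. scale (dual \<alpha> v) (e \<alpha>)"
  show "?c i \<in> V i" for i
    by (rule subspace_sum[OF subspace_V]) (auto simp: supp_def intro!: subspace_scale[OF subspace_V] e_in_V)
  have sub: "{i. ?c i \<noteq> 0} \<subseteq> dg ` supp v"
  proof
    fix i assume "i \<in> {i. ?c i \<noteq> 0}"
    then have "{\<alpha> \<in> supp v. dg \<alpha> = i} \<noteq> {}" by (metis (mono_tags, lifting) mem_Collect_eq sum.empty)
    then show "i \<in> dg ` supp v" by auto
  qed
  then show "finite {i. ?c i \<noteq> 0}" by (rule finite_subset) simp
  have "v = (\<Sum>i\<in>dg ` supp v. ?c i)"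
    using expand[of v] sum.image_gen[of "supp v" "\<lambda>\<alpha>. scale (dual \<alpha> v) (e \<alpha>)" dg] by simp
  also have "\<dots> = (\<Sum>i | ?c i \<noteq> 0. ?c i)"
    by (rule sum.mono_neutral_right) (use sub in auto)
  finally show "v = (\<Sum>i | ?c i \<noteq> 0. ?c i)" .
qed

lemma dual_component: "\<beta> \<in> A \<Longrightarrow> dual \<beta> (component v i) = (if dg \<beta> = i then dual \<beta> v else 0)"
proof -
  assume \<beta>: "\<beta> \<in> A"
  have "dual \<beta> (component v i) = (\<Sum>\<alpha>\<in>{\<alpha> \<in> supp v. dg \<alpha> = i}. dual \<alpha> v * dual \<beta> (e \<alpha>))"
    by (simp add: component_eq dual_sum dual_scale)
  also have "\<dots> = (\<Sum>\<alpha>\<in>{\<alpha> \<in> supp v. dg \<alpha> = i}. if \<alpha> = \<beta> then dual \<beta> v else 0)"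
    using \<beta> by (intro sum.cong) (auto simp: supp_def dual_e)
  also have "\<dots> = (if dg \<beta> = i then dual \<beta> v else 0)"
    using \<beta> by (subst sum.delta) (auto simp: supp_def[of v, symmetric], simp add: supp_def)
  finally show ?thesis .
qed

lemma finite_component: "finite {i. component v i \<noteq> 0}"
proof (rule finite_subset)
  show "{i. component v i \<noteq> 0} \<subseteq> dg ` supp v"
  proof
    fix i assume "i \<in> {i. component v i \<noteq> 0}"
    then have "{\<alpha> \<in> supp v. dg \<alpha> = i} \<noteq> {}"
      unfolding component_eq by (metis (mono_tags, lifting) mem_Collect_eq sum.empty)
    then show "i \<in> dg ` supp v" by auto
  qed
qed simp

lemma component_V: "v \<in> V i \<Longrightarrow> component v = (\<lambda>j. if j = i then v else 0)"
proof (rule component_unique)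
  assume v: "v \<in> V i"
  show "(if j = i then v else 0) \<in> V j" for j using v subspace_0[OF subspace_V] by simp
  have "{j. (if j = i then v else 0) \<noteq> 0} = (if v = 0 then {} else {i})" by auto
  then show "finite {j. (if j = i then v else 0) \<noteq> 0}"
    "v = (\<Sum>j | (if j = i then v else 0) \<noteq> 0. if j = i then v else 0)" by simp_all
qed

lemma V_degree: "v \<in> V i \<Longrightarrow> \<beta> \<in> supp v \<Longrightarrow> dg \<beta> = i"
  using dual_component[of \<beta> v "dg \<beta>"] by (auto simp: component_V supp_def split: if_splits)

lemma dual_parity_part: "\<beta> \<in> A \<Longrightarrow> dual \<beta> (parity_part b v) = (if odd (dg \<beta>) = b then dual \<beta> v else 0)"
proof -
  assume \<beta>: "\<beta> \<in> A"
  let ?S = "{i. component v i \<noteq> 0 \<and> odd i = b}"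
  have fin: "finite ?S" using finite_component by (rule rev_finite_subset) auto
  have "dual \<beta> (parity_part b v) = (\<Sum>i\<in>?S. if i = dg \<beta> then dual \<beta> v else 0)"
    unfolding parity_part_def dual_sum by (rule sum.cong) (auto simp: dual_component[OF \<beta>])
  also have "\<dots> = (if dg \<beta> \<in> ?S then dual \<beta> v else 0)"
    using fin by simp
  also have "\<dots> = (if odd (dg \<beta>) = b then dual \<beta> v else 0)"
    using dual_component[OF \<beta>, of v "dg \<beta>"] by auto
  finally show ?thesis .
qed

lemma parity_part_add: "parity_part b (v + w) = parity_part b v + parity_part b w"
  by (rule vector_eqI) (simp add: dual_parity_part dual_add)

lemma parity_part_scale: "parity_part b (scale c v) = scale c (parity_part b v)"
  by (rule vector_eqI) (simp add: dual_parity_part dual_scale)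

lemma twist_add: "twist d (v + w) = twist d v + twist d w"
  by (simp add: twist_def parity_part_add scale_right_distrib algebra_simps)

lemma twist_scale: "twist d (scale c v) = scale c (twist d v)"
  by (simp add: twist_def parity_part_scale scale_right_distrib mult.commute)

lemma dual_twist: "\<beta> \<in> A \<Longrightarrow> dual \<beta> (twist d v) = parity_sign (d * dg \<beta>) * dual \<beta> v"
  by (simp add: twist_def dual_add dual_scale dual_parity_part parity_sign_def)

lemma twist_e: "\<alpha> \<in> A \<Longrightarrow> twist d (e \<alpha>) = scale (parity_sign (d * dg \<alpha>)) (e \<alpha>)"
  by (rule vector_eqI) (simp add: dual_twist dual_scale dual_e)

lemma parity_part_e: "\<alpha> \<in> A \<Longrightarrow> parity_part b (e \<alpha>) = (if odd (dg \<alpha>) = b then e \<alpha> else 0)"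
  by (rule vector_eqI) (auto simp: dual_parity_part dual_e)

lemma dual_parity_part_fun: "\<beta> \<in> A \<Longrightarrow> dual \<beta> \<circ> parity_part b = (if odd (dg \<beta>) = b then dual \<beta> else (\<lambda>_. 0))"
  by (auto simp: fun_eq_iff dual_parity_part)

lemma dual_twist_fun: "\<beta> \<in> A \<Longrightarrow> dual \<beta> \<circ> twist d = (\<lambda>v. parity_sign (d * dg \<beta>) * dual \<beta> v)"
  by (auto simp: fun_eq_iff dual_twist)

lemma functional_twist [simp]: "\<xi> \<in> functionals \<Longrightarrow> \<xi> \<circ> twist d \<in> functionals"
  by (simp add: functionals_iff twist_add twist_scale)


section \<open>Tensors and operations in coordinates\<close>

text \<open>Scalars act on tensors pointwise, through an anonymous function. Naming span and
  subspace for this action keeps the module theorems below in a folded, usable form.\<close>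

definition tensor_span :: "('v, 'k) tensor set \<Rightarrow> ('v, 'k) tensor set" where
  "tensor_span = module.span (\<lambda>c t \<xi>s. c * t \<xi>s)"

definition tensor_subspace :: "('v, 'k) tensor set \<Rightarrow> bool" where
  "tensor_subspace = module.subspace (\<lambda>c t \<xi>s. c * t \<xi>s)"

lemma tensor_module: "module (\<lambda>c (t :: ('v, 'k) tensor) \<xi>s. c * t \<xi>s)"
  by unfold_locales (auto simp: fun_eq_iff algebra_simps)

lemmas tensor_span_base = module.span_base[OF tensor_module, folded tensor_span_def]
lemmas tensor_span_minimal =
  module.span_minimal[OF tensor_module, folded tensor_span_def tensor_subspace_def]
lemmas tensor_subspace_span =
  module.subspace_span[OF tensor_module, folded tensor_span_def tensor_subspace_def]
lemmas tensor_subspace_sum = module.subspace_sum[OF tensor_module, folded tensor_subspace_def]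
lemmas tensor_subspace_0 = module.subspace_0[OF tensor_module, folded tensor_subspace_def]
lemmas tensor_subspace_add = module.subspace_add[OF tensor_module, folded tensor_subspace_def]
lemmas tensor_subspace_scale = module.subspace_scale[OF tensor_module, folded tensor_subspace_def]
lemmas tensor_span_mono = module.span_mono[OF tensor_module, folded tensor_span_def]
lemmas tensor_span_induct =
  module.span_induct_alt[OF tensor_module, folded tensor_span_def, consumes 1, case_names base step]
lemmas tensor_subspaceI = module.subspaceI[OF tensor_module, folded tensor_subspace_def]

text \<open>A singleton \<open>D\<close> gives a homogeneous part of the tensor power;
  \<open>UNIV\<close> gives all of it, which is where the values at inhomogeneous arguments
  live.\<close>

definition tensors :: "nat \<Rightarrow> int set \<Rightarrow> ('v, 'k) tensor set" where
  "tensors m D = tensor_span {pure_tensor (map e \<beta>) | \<beta>. \<beta> \<in> words m \<and> deg \<beta> \<in> D}"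

lemma tensors_subspace: "tensor_subspace (tensors m D)"
  unfolding tensors_def by (rule tensor_subspace_span)

lemmas tensors_0 = tensor_subspace_0[OF tensors_subspace]
  and tensors_add = tensor_subspace_add[OF tensors_subspace]
  and tensors_scale = tensor_subspace_scale[OF tensors_subspace]
  and tensors_sum = tensor_subspace_sum[OF tensors_subspace]

lemma tensors_pure: "\<beta> \<in> words m \<Longrightarrow> deg \<beta> \<in> D \<Longrightarrow> pure_tensor (map e \<beta>) \<in> tensors m D"
  unfolding tensors_def by (rule tensor_span_base) auto

lemma tensors_mono: "D \<subseteq> D' \<Longrightarrow> tensors m D \<subseteq> tensors m D'"
  unfolding tensors_def by (rule tensor_span_mono) auto

lemma pure_tensor_Nil: "pure_tensor [] \<xi>s = (if \<xi>s = [] then 1 else 0)"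
  by (auto simp: pure_tensor_def)

lemma pure_tensor_Cons:
  "pure_tensor (v # vs) \<xi>s = (case \<xi>s of [] \<Rightarrow> 0 | \<xi> # \<eta>s \<Rightarrow> if \<xi> \<in> functionals then \<xi> v * pure_tensor vs \<eta>s else 0)"
  by (auto simp: pure_tensor_def prod.lessThan_Suc_shift simp del: prod.lessThan_Suc split: list.split)

lemma pure_tensor_dual:
  assumes "\<beta> \<in> words m" "\<gamma> \<in> words m"
  shows "pure_tensor (map e \<beta>) (map dual \<gamma>) = (if \<beta> = \<gamma> then 1 else 0)"
  using assms
proof (induction \<beta> arbitrary: m \<gamma>)
  case Nil
  then show ?case by (auto simp: words_def pure_tensor_Nil)
next
  case (Cons b \<beta>)
  then obtain c \<gamma>' where \<gamma>: "\<gamma> = c # \<gamma>'" by (cases \<gamma>) (auto simp: words_def)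
  have "pure_tensor (map e \<beta>) (map dual \<gamma>') = (if \<beta> = \<gamma>' then 1 else 0)"
    using Cons.prems by (intro Cons.IH[of "m - 1"]) (simp_all add: \<gamma>)
  then show ?case using Cons.prems by (simp add: \<gamma> pure_tensor_Cons dual_e)
qed

text \<open>Elements of a span are finite combinations, and pairing with dual words reads off the
  coefficients. The expansion is valid on all lists of functionals, also on those outside the span
  of the dual basis, which matters when \<open>V\<close> is infinite-dimensional.\<close>

lemma tensors_expand:
  assumes "t \<in> tensors m D"
  obtains S where "finite S" "S \<subseteq> words m" "\<And>\<beta>. \<beta> \<in> S \<Longrightarrow> deg \<beta> \<in> D"
    "\<And>\<beta>. \<beta> \<in> words m \<Longrightarrow> \<beta> \<notin> S \<Longrightarrow> t (map dual \<beta>) = 0"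
    "\<And>\<xi>s. t \<xi>s = (\<Sum>\<beta>\<in>S. t (map dual \<beta>) * pure_tensor (map e \<beta>) \<xi>s)"
proof -
  let ?P = "\<lambda>t. \<exists>S. finite S \<and> S \<subseteq> words m \<and> (\<forall>\<beta>\<in>S. deg \<beta> \<in> D) \<and>
    (\<forall>\<beta>\<in>words m - S. t (map dual \<beta>) = 0) \<and>
    (\<forall>\<xi>s. t \<xi>s = (\<Sum>\<beta>\<in>S. t (map dual \<beta>) * pure_tensor (map e \<beta>) \<xi>s))"
  have "?P t"
    using assms unfolding tensors_def
  proof (induction rule: tensor_span_induct)
    case base
    show ?case by (rule exI[of _ "{}"]) simp
  next
    case (step c x y)
    then obtain \<gamma> where \<gamma>: "x = pure_tensor (map e \<gamma>)" "\<gamma> \<in> words m" "deg \<gamma> \<in> D" by auto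
    from step obtain S where S: "finite S" "S \<subseteq> words m" "\<forall>\<beta>\<in>S. deg \<beta> \<in> D"
      "\<forall>\<beta>\<in>words m - S. y (map dual \<beta>) = 0"
      "\<And>\<xi>s. y \<xi>s = (\<Sum>\<beta>\<in>S. y (map dual \<beta>) * pure_tensor (map e \<beta>) \<xi>s)" by blast
    let ?S = "insert \<gamma> S"
    have dx: "x (map dual \<beta>) = (if \<beta> = \<gamma> then 1 else 0)" if "\<beta> \<in> words m" for \<beta>
      using pure_tensor_dual[OF \<gamma>(2) that] by (auto simp: \<gamma>(1))
    have "((\<lambda>\<xi>s. c * x \<xi>s) + y) \<xi>s =
        (\<Sum>\<beta>\<in>?S. ((\<lambda>\<xi>s. c * x \<xi>s) + y) (map dual \<beta>) * pure_tensor (map e \<beta>) \<xi>s)" for \<xi>s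
    proof -
      have "y \<xi>s = (\<Sum>\<beta>\<in>?S. y (map dual \<beta>) * pure_tensor (map e \<beta>) \<xi>s)"
        unfolding S(5)[of \<xi>s] by (rule sum.mono_neutral_left) (use S(1-4) \<gamma>(2) in auto)
      moreover have "c * x \<xi>s = (\<Sum>\<beta>\<in>?S. c * x (map dual \<beta>) * pure_tensor (map e \<beta>) \<xi>s)"
      proof -
        have "(\<Sum>\<beta>\<in>?S. c * x (map dual \<beta>) * pure_tensor (map e \<beta>) \<xi>s) =
            (\<Sum>\<beta>\<in>?S. if \<beta> = \<gamma> then c * pure_tensor (map e \<beta>) \<xi>s else 0)"
          by (rule sum.cong) (use S(2) \<gamma>(2) dx in auto)
        then show ?thesis using S(1) by (simp add: \<gamma>(1))
      qed
      ultimately show ?thesis by (simp add: distrib_right sum.distrib)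
    qed
    moreover have "finite ?S" "?S \<subseteq> words m" "\<forall>\<beta>\<in>?S. deg \<beta> \<in> D"
      "\<forall>\<beta>\<in>words m - ?S. ((\<lambda>\<xi>s. c * x \<xi>s) + y) (map dual \<beta>) = 0"
      using S(1-4) \<gamma>(2,3) dx by auto
    ultimately show ?case by blast
  qed
  then show ?thesis using that by blast
qed

text \<open>Both tensors expand over one common finite set of words, so agreement on words of the
  dual basis forces agreement on every list.\<close>

lemma tensors_eqI:
  assumes "t \<in> tensors m D" "t' \<in> tensors m D" "\<And>\<beta>. \<beta> \<in> words m \<Longrightarrow> t (map dual \<beta>) = t' (map dual \<beta>)"
  shows "t = t'"
proof
  fix \<xi>s
  from assms(1) obtain S where S: "finite S" "S \<subseteq> words m" 
    "\<And>\<beta>. \<beta> \<in> words m \<Longrightarrow> \<beta> \<notin> S \<Longrightarrow> t (map dual \<beta>) = 0"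
    "\<And>\<xi>s. t \<xi>s = (\<Sum>\<beta>\<in>S. t (map dual \<beta>) * pure_tensor (map e \<beta>) \<xi>s)"
    by (rule tensors_expand) blast
  from assms(2) obtain S' where S': "finite S'" "S' \<subseteq> words m" 
    "\<And>\<beta>. \<beta> \<in> words m \<Longrightarrow> \<beta> \<notin> S' \<Longrightarrow> t' (map dual \<beta>) = 0"
    "\<And>\<xi>s. t' \<xi>s = (\<Sum>\<beta>\<in>S'. t' (map dual \<beta>) * pure_tensor (map e \<beta>) \<xi>s)"
    by (rule tensors_expand) blast
  have "t \<xi>s = (\<Sum>\<beta>\<in>S \<union> S'. t (map dual \<beta>) * pure_tensor (map e \<beta>) \<xi>s)"
    unfolding S(4)[of \<xi>s] by (rule sum.mono_neutral_left) (use S(1-3) S'(1-3) in auto)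
  also have "\<dots> = (\<Sum>\<beta>\<in>S \<union> S'. t' (map dual \<beta>) * pure_tensor (map e \<beta>) \<xi>s)"
    by (rule sum.cong) (use S(2) S'(2) assms(3) in auto)
  also have "\<dots> = t' \<xi>s"
    unfolding S'(4)[of \<xi>s] by (rule sum.mono_neutral_right) (use S(1-3) S'(1-3) in auto)
  finally show "t \<xi>s = t' \<xi>s" .
qed

text \<open>Each homogeneous vector expands into basis vectors of its own degree, so the expansion
  of the product stays in a single total degree.\<close>

lemma pure_tensor_in_tensors:
  assumes "homogeneous vs ds"
  shows "pure_tensor vs \<in> tensors (length vs) {sum_list ds}"
  using assms
proof (induction vs arbitrary: ds)
  case Nil
  then show ?case using tensors_pure[of "[]" 0 "{0}"] by (simp add: homogeneous_def)
next
  case (Cons v vs)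
  then obtain d ds' where ds: "ds = d # ds'" "v \<in> V d" "homogeneous vs ds'"
    by (cases ds) (force simp: homogeneous_def)+
  obtain S where S: "finite S" "S \<subseteq> words (length vs)" "\<And>\<beta>. \<beta> \<in> S \<Longrightarrow> deg \<beta> \<in> {sum_list ds'}"
    "\<And>\<xi>s. pure_tensor vs \<xi>s = (\<Sum>\<beta>\<in>S. pure_tensor vs (map dual \<beta>) * pure_tensor (map e \<beta>) \<xi>s)"
    by (rule tensors_expand[OF Cons.IH[OF ds(3)]]) blast
  have "pure_tensor (v # vs) =
      (\<Sum>\<alpha>\<in>supp v. \<Sum>\<beta>\<in>S. (\<lambda>\<xi>s. (dual \<alpha> v * pure_tensor vs (map dual \<beta>)) * pure_tensor (map e (\<alpha> # \<beta>)) \<xi>s))"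
  proof
    fix \<xi>s
    have ev: "\<xi> v = (\<Sum>\<alpha>\<in>supp v. dual \<alpha> v * \<xi> (e \<alpha>))" if "\<xi> \<in> functionals" for \<xi>
      by (subst expand[of v]) (simp add: functional_sum[OF that] functional_scale[OF that])
    show "pure_tensor (v # vs) \<xi>s = (\<Sum>\<alpha>\<in>supp v. \<Sum>\<beta>\<in>S. (\<lambda>\<xi>s. (dual \<alpha> v * pure_tensor vs (map dual \<beta>)) * pure_tensor (map e (\<alpha> # \<beta>)) \<xi>s)) \<xi>s"
    proof (cases \<xi>s)
      case Nil
      then show ?thesis by (simp add: pure_tensor_Cons sum_fun_apply)
    next
      case (Cons \<xi> \<eta>s)
      show ?thesis
      proof (cases "\<xi> \<in> functionals")
        case True
        have "pure_tensor (v # vs) \<xi>s = (\<Sum>\<alpha>\<in>supp v. dual \<alpha> v * \<xi> (e \<alpha>)) *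
            (\<Sum>\<beta>\<in>S. pure_tensor vs (map dual \<beta>) * pure_tensor (map e \<beta>) \<eta>s)"
          using True Cons S(4)[of \<eta>s] ev[OF True] by (simp add: pure_tensor_Cons)
        then show ?thesis using True Cons
          by (simp add: pure_tensor_Cons sum_fun_apply sum_product mult_ac)
      next
        case False
        then show ?thesis using Cons by (simp add: pure_tensor_Cons sum_fun_apply)
      qed
    qed
  qed
  also have "\<dots> \<in> tensors (length (v # vs)) {sum_list ds}"
  proof (intro tensors_sum tensors_scale tensors_pure)
    fix \<alpha> \<beta> assume "\<alpha> \<in> supp v" "\<beta> \<in> S"
    then show "\<alpha> # \<beta> \<in> words (length (v # vs))" "deg (\<alpha> # \<beta>) \<in> {sum_list ds}"
      using S(2,3) V_degree[OF ds(2)] ds(1) by (auto simp: supp_def)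
  qed
  finally show ?case .
qed

lemma tensor_power_eq: "tensor_power m k = tensors m {k}"
proof
  show "tensor_power m k \<subseteq> tensors m {k}"
    unfolding tensor_power_def tensor_span_def[symmetric]
    by (rule tensor_span_minimal[OF _ tensors_subspace]) (use pure_tensor_in_tensors in auto)
  show "tensors m {k} \<subseteq> tensor_power m k"
    unfolding tensor_power_def tensor_span_def[symmetric] tensors_def
  proof (rule tensor_span_mono, rule subsetI)
    fix t assume "t \<in> {pure_tensor (map e \<beta>) |\<beta>. \<beta> \<in> words m \<and> deg \<beta> \<in> {k}}"
    then obtain \<beta> where t: "t = pure_tensor (map e \<beta>)" and \<beta>: "\<beta> \<in> words m" "deg \<beta> = k" by auto
    have "homogeneous (map e \<beta>) (map dg \<beta>)"
      using \<beta> by (auto simp: homogeneous_def words_def intro!: e_in_V)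
    then have "t = pure_tensor (map e \<beta>) \<and> length (map e \<beta>) = m \<and>
        (\<exists>ds. homogeneous (map e \<beta>) ds \<and> sum_list ds = k)"
      using \<beta> t by (auto simp: words_def deg_def)
    then show "t \<in> {pure_tensor vs |vs. length vs = m \<and> (\<exists>ds. homogeneous vs ds \<and> sum_list ds = k)}"
      by blast
  qed
qed

section \<open>Operations as matrices in the basis\<close>

lemma multilinearD:
  "multilinear f \<Longrightarrow> i < length xs \<Longrightarrow>
    f (xs[i := u + scale c w]) \<xi>s = f (xs[i := u]) \<xi>s + c * f (xs[i := w]) \<xi>s"
  by (simp add: multilinear_def)

lemma multilinear_zero: "multilinear f \<Longrightarrow> i < length xs \<Longrightarrow> xs ! i = 0 \<Longrightarrow> f xs \<xi>s = 0"
  using multilinearD[of f i xs 0 1 0 \<xi>s] by (metis add_cancel_right_right add_0 list_update_id mult_1 scale_one)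

lemma multilinear_scale: "multilinear f \<Longrightarrow> i < length xs \<Longrightarrow> f (xs[i := scale c w]) \<xi>s = c * f (xs[i := w]) \<xi>s"
  using multilinearD[of f i xs 0 c w \<xi>s] multilinear_zero[of f i "xs[i := 0]" \<xi>s] by simp

text \<open>Slots are replaced one at a time by generators; \<open>k\<close> counts the slots that
  may still contain a general element of the span. The sets \<open>B i\<close> depend on the slot so
  that a prescribed degree in each slot can be kept.\<close>

lemma multilinear_span:
  assumes f: "multilinear f" and H: "tensor_subspace H" and n: "length xs = n"
    and xs: "\<And>i. i < n \<Longrightarrow> xs ! i \<in> span (B i)"
    and base: "\<And>ys. length ys = n \<Longrightarrow> (\<And>i. i < n \<Longrightarrow> ys ! i \<in> B i) \<Longrightarrow> f ys \<in> H"
  shows "f xs \<in> H"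
proof -
  have "f ys \<in> H" if "k \<le> n" "length ys = n" "\<And>i. i < k \<Longrightarrow> ys ! i \<in> span (B i)"
    "\<And>i. k \<le> i \<Longrightarrow> i < n \<Longrightarrow> ys ! i \<in> B i" for k ys
    using that
  proof (induction k arbitrary: ys)
    case 0
    then show ?case using base by simp
  next
    case (Suc k)
    have "f (ys[k := x]) \<in> H" if "x \<in> span (B k)" for x
      using that
    proof (induction rule: span_induct_alt)
      case base
      have "f (ys[k := 0]) = 0"
        using multilinear_zero[OF f, of k "ys[k := 0]"] Suc.prems by (auto simp: fun_eq_iff)
      then show ?case using tensor_subspace_0[OF H] by (simp only:)
    next
      case (step c x y)
      have "f (ys[k := scale c x + y]) = f (ys[k := y]) + (\<lambda>\<xi>s. c * f (ys[k := x]) \<xi>s)"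
        using multilinearD[OF f, of k ys y c x] Suc.prems by (auto simp: fun_eq_iff add.commute)
      moreover have "f (ys[k := x]) \<in> H"
      proof (rule Suc.IH)
        show "ys[k := x] ! i \<in> span (B i)" if "i < k" for i
          using Suc.prems(3)[of i] that by simp
        show "ys[k := x] ! i \<in> B i" if "k \<le> i" "i < n" for i
          using Suc.prems(1,2) Suc.prems(4)[of i] step that by (cases "i = k") auto
      qed (use Suc.prems in auto)
      ultimately show ?case
        using step(2) by (metis tensor_subspace_add[OF H] tensor_subspace_scale[OF H])
    qed
    from this[of "ys ! k"] show ?case using Suc.prems by simp
  qed
  from this[of n xs] show ?thesis using n xs by simp
qed

lemma map_e_exhaust:
  assumes "\<And>i. i < length ys \<Longrightarrow> ys ! i \<in> e ` B i"
  obtains \<alpha> where "ys = map e \<alpha>" "length \<alpha> = length ys" "\<And>i. i < length ys \<Longrightarrow> \<alpha> ! i \<in> B i"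
proof -
  have "\<forall>i. \<exists>a. i < length ys \<longrightarrow> ys ! i = e a \<and> a \<in> B i" using assms by blast
  then obtain g where g: "\<And>i. i < length ys \<Longrightarrow> ys ! i = e (g i) \<and> g i \<in> B i" by metis
  show ?thesis
    by (rule that[of "map g [0..<length ys]"]) (auto intro!: nth_equalityI simp: g)
qed

lemma multilinear_eqI:
  assumes "multilinear f" "multilinear g" "\<And>\<alpha>. \<alpha> \<in> words n \<Longrightarrow> f (map e \<alpha>) = g (map e \<alpha>)"
    "\<And>xs. length xs \<noteq> n \<Longrightarrow> f xs = g xs"
  shows "f = g"
proof
  fix xs
  show "f xs = g xs"
  proof (cases "length xs = n")
    case True
    let ?h = "\<lambda>xs \<xi>s. f xs \<xi>s - g xs \<xi>s"
    have "multilinear ?h"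
      using assms(1,2) by (simp add: multilinear_def algebra_simps)
    then have "?h xs \<in> {0}"
    proof (rule multilinear_span[where n = n and B = "\<lambda>_. e ` A"])
      show "tensor_subspace {0}"
        by (rule tensor_subspaceI) (auto simp: fun_eq_iff)
      fix ys assume ys: "length ys = n" "\<And>i. i < n \<Longrightarrow> ys ! i \<in> e ` A"
      then obtain \<alpha> where "ys = map e \<alpha>" "length \<alpha> = n" "\<And>i. i < n \<Longrightarrow> \<alpha> ! i \<in> A"
        using map_e_exhaust[of ys "\<lambda>_. A"] by metis
      then have "\<alpha> \<in> words n" "ys = map e \<alpha>" by (auto simp: words_def in_set_conv_nth)
      then show "?h ys \<in> {0}" using assms(3)[of \<alpha>] by (auto simp: fun_eq_iff)
    qed (use True span_e in auto)
    then show ?thesis by (auto simp: fun_eq_iff)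
  qed (use assms(4) in auto)
qed

lemma V_span: "v \<in> V i \<Longrightarrow> v \<in> span (e ` {\<alpha> \<in> A. dg \<alpha> = i})"
proof -
  assume v: "v \<in> V i"
  have "(\<Sum>\<alpha>\<in>supp v. scale (dual \<alpha> v) (e \<alpha>)) \<in> span (e ` {\<alpha> \<in> A. dg \<alpha> = i})"
    by (intro span_sum span_scale span_base) (use V_degree[OF v] in \<open>auto simp: supp_def\<close>)
  then show ?thesis using expand[of v] by simp
qed

text \<open>Homogeneous vectors lie in the span of the basis vectors of their degree, so the degree
  of a multilinear operation can be tested on basis words alone.\<close>

lemma End_iff: "f \<in> End m n d \<longleftrightarrow> (\<forall>xs. length xs \<noteq> n \<longrightarrow> f xs = 0) \<and> multilinear f \<and>
  (\<forall>\<alpha>\<in>words n. f (map e \<alpha>) \<in> tensors m {deg \<alpha> + d})"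
proof (intro iffI conjI ballI)
  fix \<alpha> assume f: "f \<in> End m n d" and \<alpha>: "\<alpha> \<in> words n"
  have "homogeneous (map e \<alpha>) (map dg \<alpha>)" "length (map e \<alpha>) = n"
    using \<alpha> by (auto simp: homogeneous_def words_def intro!: e_in_V)
  then show "f (map e \<alpha>) \<in> tensors m {deg \<alpha> + d}"
    using f unfolding End_def tensor_power_eq deg_def by blast
next
  assume f: "(\<forall>xs. length xs \<noteq> n \<longrightarrow> f xs = 0) \<and> multilinear f \<and>
    (\<forall>\<alpha>\<in>words n. f (map e \<alpha>) \<in> tensors m {deg \<alpha> + d})"
  have "f xs \<in> tensors m {sum_list ds + d}" if xs: "length xs = n" "homogeneous xs ds" for xs ds
  proof (rule multilinear_span[where n = n and B = "\<lambda>i. e ` {\<alpha> \<in> A. dg \<alpha> = ds ! i}"])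
    show "xs ! i \<in> span (e ` {\<alpha> \<in> A. dg \<alpha> = ds ! i})" if "i < n" for i
      using xs that by (intro V_span) (auto simp: homogeneous_def)
    fix ys assume ys: "length ys = n" "\<And>i. i < n \<Longrightarrow> ys ! i \<in> e ` {\<alpha> \<in> A. dg \<alpha> = ds ! i}"
    then obtain \<alpha> where \<alpha>: "ys = map e \<alpha>" "length \<alpha> = n" "\<And>i. i < n \<Longrightarrow> \<alpha> ! i \<in> A \<and> dg (\<alpha> ! i) = ds ! i"
      using map_e_exhaust[of ys "\<lambda>i. {\<alpha> \<in> A. dg \<alpha> = ds ! i}"] by (smt (verit) mem_Collect_eq)
    then have "\<alpha> \<in> words n" by (auto simp: words_def in_set_conv_nth)
    moreover have "map dg \<alpha> = ds"
      using \<alpha> xs by (intro nth_equalityI) (auto simp: homogeneous_def)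
    ultimately show "f ys \<in> tensors m {sum_list ds + d}"
      using f \<alpha>(1) by (auto simp: deg_def)
  qed (use f xs tensors_subspace in auto)
  then show "f \<in> End m n d" using f unfolding End_def tensor_power_eq by blast
qed (auto simp: End_def)

lemma End_zero: "f \<in> End m n d \<Longrightarrow> length xs \<noteq> n \<Longrightarrow> f xs = 0"
  and End_multilinear: "f \<in> End m n d \<Longrightarrow> multilinear f"
  and End_basis: "f \<in> End m n d \<Longrightarrow> \<alpha> \<in> words n \<Longrightarrow> f (map e \<alpha>) \<in> tensors m {deg \<alpha> + d}"
  by (simp_all add: End_iff)

text \<open>At inhomogeneous arguments a value mixes degrees, hence \<open>UNIV\<close>. What
  survives is that the value is a tensor of length \<open>m\<close>, with its finite expansion and
  its linearity in each functional.\<close>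

lemma End_tensors:
  assumes "f \<in> End m n d"
  shows "f xs \<in> tensors m UNIV"
proof (cases "length xs = n")
  case True
  show ?thesis
  proof (rule multilinear_span[OF End_multilinear[OF assms] tensors_subspace True, where B = "\<lambda>_. e ` A"])
    fix ys assume ys: "length ys = n" "\<And>i. i < n \<Longrightarrow> ys ! i \<in> e ` A"
    then obtain \<alpha> where "ys = map e \<alpha>" "length \<alpha> = n" "\<And>i. i < n \<Longrightarrow> \<alpha> ! i \<in> A"
      using map_e_exhaust[of ys "\<lambda>_. A"] by metis
    then have "\<alpha> \<in> words n" "ys = map e \<alpha>" by (auto simp: words_def in_set_conv_nth)
    then show "f ys \<in> tensors m UNIV"
      using End_basis[OF assms] tensors_mono by blast
  qed (simp add: span_e)
qed (use End_zero[OF assms] tensors_0 in auto)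

text \<open>The value 0 outside \<open>A\<close> allows sums over an internal index to run over the
  whole index type.\<close>

definition mat :: "('v, 'k) operation \<Rightarrow> 'i list \<Rightarrow> 'i list \<Rightarrow> 'k" where
  "mat f \<alpha> \<beta> = (if set \<alpha> \<subseteq> A \<and> set \<beta> \<subseteq> A then f (map e \<alpha>) (map dual \<beta>) else 0)"

lemma tensors_not_functionals:
  assumes "t \<in> tensors m D" "length \<xi>s \<noteq> m \<or> \<not> set \<xi>s \<subseteq> functionals"
  shows "t \<xi>s = 0"
proof -
  obtain S where S: "S \<subseteq> words m"
    "\<And>\<xi>s. t \<xi>s = (\<Sum>\<beta>\<in>S. t (map dual \<beta>) * pure_tensor (map e \<beta>) \<xi>s)"
    by (rule tensors_expand[OF assms(1)]) blast
  show ?thesis unfolding S(2)[of \<xi>s]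
    by (rule sum.neutral) (use S(1) assms(2) in \<open>auto simp: pure_tensor_def words_def\<close>)
qed

text \<open>Besides the lengths, a nonzero coefficient yields the degree equation between inputs and
  outputs. It is the source of most parity relations in the sign comparisons below.\<close>

lemma mat_nonzero:
  assumes "f \<in> End m n d" "mat f \<alpha> \<beta> \<noteq> 0"
  shows "\<alpha> \<in> words n" "\<beta> \<in> words m" "deg \<beta> = deg \<alpha> + d"
proof -
  have sub: "set \<alpha> \<subseteq> A" "set \<beta> \<subseteq> A" and nz: "f (map e \<alpha>) (map dual \<beta>) \<noteq> 0"
    using assms(2) by (auto simp: mat_def split: if_splits)
  show \<alpha>: "\<alpha> \<in> words n"
  proof (rule ccontr)
    assume "\<alpha> \<notin> words n"
    then have "f (map e \<alpha>) = 0" using sub by (intro End_zero[OF assms(1)]) (simp add: words_def)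
    then show False using nz by simp
  qed
  obtain S where S: "S \<subseteq> words m" "\<And>\<beta>. \<beta> \<in> S \<Longrightarrow> deg \<beta> \<in> {deg \<alpha> + d}"
    "\<And>\<beta>. \<beta> \<in> words m \<Longrightarrow> \<beta> \<notin> S \<Longrightarrow> f (map e \<alpha>) (map dual \<beta>) = 0"
    by (rule tensors_expand[OF End_basis[OF assms(1) \<alpha>]]) blast
  show \<beta>: "\<beta> \<in> words m"
    using tensors_not_functionals[OF End_basis[OF assms(1) \<alpha>], of "map dual \<beta>"] nz sub by (auto simp: words_def)
  show "deg \<beta> = deg \<alpha> + d" using S \<beta> nz by auto
qed

text \<open>Rows are finite: fixed inputs admit finitely many output words, while an output word may
  arise from infinitely many input words. Later sums over internal edges are therefore controlled
  from a vertex whose inputs are already fixed.\<close>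

lemma finite_mat:
  assumes "f \<in> End m n d"
  shows "finite {\<beta>. mat f \<alpha> \<beta> \<noteq> 0}"
proof (cases "\<alpha> \<in> words n")
  case True
  obtain S where S: "finite S" "\<And>\<beta>. \<beta> \<in> words m \<Longrightarrow> \<beta> \<notin> S \<Longrightarrow> f (map e \<alpha>) (map dual \<beta>) = 0"
    by (rule tensors_expand[OF End_basis[OF assms True]]) blast
  have "{\<beta>. mat f \<alpha> \<beta> \<noteq> 0} \<subseteq> S"
    using S(2) mat_nonzero(2)[OF assms] by (force simp: mat_def split: if_splits)
  then show ?thesis using S(1) by (rule finite_subset)
next
  case False
  then have "{\<beta>. mat f \<alpha> \<beta> \<noteq> 0} = {}" using mat_nonzero(1)[OF assms] by blast
  then show ?thesis by simp
qed

lemma End_expand: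
  assumes "f \<in> End m n d" "\<alpha> \<in> words n"
  shows "f (map e \<alpha>) \<xi>s = (\<Sum>\<beta> | mat f \<alpha> \<beta> \<noteq> 0. mat f \<alpha> \<beta> * pure_tensor (map e \<beta>) \<xi>s)"
proof -
  obtain S where S: "finite S" "S \<subseteq> words m" "\<And>\<beta>. \<beta> \<in> words m \<Longrightarrow> \<beta> \<notin> S \<Longrightarrow> f (map e \<alpha>) (map dual \<beta>) = 0"
    "\<And>\<xi>s. f (map e \<alpha>) \<xi>s = (\<Sum>\<beta>\<in>S. f (map e \<alpha>) (map dual \<beta>) * pure_tensor (map e \<beta>) \<xi>s)"
    by (rule tensors_expand[OF End_basis[OF assms]]) blast
  have m: "mat f \<alpha> \<beta> = f (map e \<alpha>) (map dual \<beta>)" if "\<beta> \<in> words m" for \<beta>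
    using assms(2) that by (auto simp: mat_def words_def)
  have "f (map e \<alpha>) \<xi>s = (\<Sum>\<beta>\<in>S. mat f \<alpha> \<beta> * pure_tensor (map e \<beta>) \<xi>s)"
    unfolding S(4)[of \<xi>s] by (rule sum.cong) (use S(2) m in auto)
  also have "\<dots> = (\<Sum>\<beta> | mat f \<alpha> \<beta> \<noteq> 0. mat f \<alpha> \<beta> * pure_tensor (map e \<beta>) \<xi>s)"
    by (rule sum.mono_neutral_right) (use S(1-3) m mat_nonzero(2)[OF assms(1)] in force)+
  finally show ?thesis .
qed

lemma End_eqI:
  assumes "f \<in> End m n d" "g \<in> End m n d" "\<And>\<alpha> \<beta>. \<alpha> \<in> words n \<Longrightarrow> \<beta> \<in> words m \<Longrightarrow> mat f \<alpha> \<beta> = mat g \<alpha> \<beta>"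
  shows "f = g"
proof (rule multilinear_eqI)
  show "multilinear f" "multilinear g" using assms(1,2) End_multilinear by auto
  show "f xs = g xs" if "length xs \<noteq> n" for xs using that assms(1,2) End_zero by metis
  fix \<alpha> assume \<alpha>: "\<alpha> \<in> words n"
  show "f (map e \<alpha>) = g (map e \<alpha>)"
    by (rule tensors_eqI[OF End_basis[OF assms(1) \<alpha>] End_basis[OF assms(2) \<alpha>]])
      (use assms(3)[OF \<alpha>] \<alpha> in \<open>auto simp: mat_def words_def\<close>)
qed

text \<open>The embedding of tensors is multilinear on functionals and 0 by convention on lists
  containing other functions; hence the two membership assumptions.\<close>

lemma tensors_slot:
  assumes "t \<in> tensors m D" "j < length \<xi>s" "\<xi> \<in> functionals" "\<eta> \<in> functionals"
  shows "t (\<xi>s[j := \<lambda>v. \<xi> v + c * \<eta> v]) = t (\<xi>s[j := \<xi>]) + c * t (\<xi>s[j := \<eta>])"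
proof -
  have f: "(\<lambda>v. \<xi> v + c * \<eta> v) \<in> functionals"
    using assms(3,4) by (simp add: functionals_iff algebra_simps)
  have pure: "pure_tensor vs (\<xi>s[j := \<lambda>v. \<xi> v + c * \<eta> v]) =
      pure_tensor vs (\<xi>s[j := \<xi>]) + c * pure_tensor vs (\<xi>s[j := \<eta>])" for vs
    using assms(2) 
  proof (induction vs arbitrary: \<xi>s j)
    case (Cons v vs)
    then show ?case using f assms(3,4)
      by (cases \<xi>s; cases j) (auto simp: pure_tensor_Cons algebra_simps)
  qed (auto simp: pure_tensor_Nil)
  obtain S where S: "\<And>\<xi>s. t \<xi>s = (\<Sum>\<beta>\<in>S. t (map dual \<beta>) * pure_tensor (map e \<beta>) \<xi>s)"
    by (rule tensors_expand[OF assms(1)]) blast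
  show ?thesis
    unfolding S[of "\<xi>s[j := \<lambda>v. \<xi> v + c * \<eta> v]"] S[of "\<xi>s[j := \<xi>]"] S[of "\<xi>s[j := \<eta>]"] pure
    by (simp add: distrib_left sum.distrib sum_distrib_left mult_ac)
qed

lemma tensors_slot_zero: "t \<in> tensors m D \<Longrightarrow> j < length \<xi>s \<Longrightarrow> \<xi>s ! j = (\<lambda>_. 0) \<Longrightarrow> t \<xi>s = 0"
proof -
  assume t: "t \<in> tensors m D" "j < length \<xi>s" "\<xi>s ! j = (\<lambda>_. 0)"
  have "\<xi>s[j := \<lambda>_. 0] = \<xi>s" using t(3) by (metis list_update_id)
  then show "t \<xi>s = 0" using tensors_slot[OF t(1,2) zero_functional zero_functional, of 1] by simp
qed

end

context based_graded_space begin

section \<open>The operations of the endomorphism dioperad in coordinates\<close>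

definition lin :: "('v \<Rightarrow> 'v) \<Rightarrow> bool" where
  "lin L \<longleftrightarrow> (\<forall>u c w. L (u + scale c w) = L u + scale c (L w))"

text \<open>A different linear map in each slot: parity projections, twists and the summands of a
  differential all have this shape, so multilinearity and degrees are checked once for all of
  them.\<close>

definition map_at :: "(nat \<Rightarrow> 'v \<Rightarrow> 'v) \<Rightarrow> 'v list \<Rightarrow> 'v list" where
  "map_at L xs = map (\<lambda>k. L k (xs ! k)) [0..<length xs]"

definition comap_at :: "(nat \<Rightarrow> 'v \<Rightarrow> 'v) \<Rightarrow> ('v \<Rightarrow> 'k) list \<Rightarrow> ('v \<Rightarrow> 'k) list" where
  "comap_at L \<xi>s = map (\<lambda>k. (\<xi>s ! k) \<circ> L k) [0..<length \<xi>s]"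

lemma length_map_at [simp]: "length (map_at L xs) = length xs"
  and length_comap_at [simp]: "length (comap_at L \<xi>s) = length \<xi>s"
  by (simp_all add: map_at_def comap_at_def)

lemma lin_parity_part [simp]: "lin (parity_part b)" and lin_twist [simp]: "lin (twist d)" and lin_id [simp]: "lin id"
  by (simp_all add: lin_def parity_part_add parity_part_scale twist_add twist_scale)

lemma lin_dg: "dg_vector_space \<delta> \<Longrightarrow> lin \<delta>"
  by (simp add: lin_def dg_vector_space_def Vector_Spaces.linear_iff)

lemma functional_comp: "lin L \<Longrightarrow> \<xi> \<in> functionals \<Longrightarrow> \<xi> \<circ> L \<in> functionals"
proof -
  assume L: "lin L" and \<xi>: "\<xi> \<in> functionals"
  have add: "L (u + w) = L u + L w" for u w
    using L[unfolded lin_def, rule_format, of u 1 w] by simp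
  have "L 0 = 0" using add[of 0 0] by simp
  then have sc: "L (scale c w) = scale c (L w)" for c w
    using L[unfolded lin_def, rule_format, of 0 c w] by simp
  show ?thesis using \<xi> by (simp add: functionals_iff add sc)
qed

lemma map_at_update: "i < length xs \<Longrightarrow> map_at L (xs[i := z]) = (map_at L xs)[i := L i z]"
  by (rule nth_equalityI) (auto simp: map_at_def nth_list_update)

lemma multilinear_map_at: "multilinear f \<Longrightarrow> (\<And>k. lin (L k)) \<Longrightarrow> multilinear (\<lambda>xs. f (map_at L xs))"
  by (simp add: multilinear_def map_at_update lin_def)

lemma permute_list_update:
  assumes "\<tau> permutes {..<length xs}" "i < length xs"
  shows "permute_list \<tau> (xs[i := z]) = (permute_list \<tau> xs)[inv \<tau> i := z]"
proof (rule nth_equalityI)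
  fix k assume "k < length (permute_list \<tau> (xs[i := z]))"
  then have k: "k < length xs" by simp
  have \<tau>k: "\<tau> k < length xs" using permutes_in_image[OF assms(1)] k by auto
  have "inv \<tau> i = k \<longleftrightarrow> \<tau> k = i" using permutes_inv_eq[OF assms(1)] .
  then show "permute_list \<tau> (xs[i := z]) ! k = (permute_list \<tau> xs)[inv \<tau> i := z] ! k"
    using k \<tau>k by (auto simp: permute_list_def nth_list_update)
qed simp

lemma multilinear_permute:
  assumes "multilinear f" "\<tau> permutes {..<n}"
  shows "multilinear (\<lambda>xs. if length xs = n then f (permute_list \<tau> xs) else 0)"
  unfolding multilinear_def
proof (intro allI impI)
  fix xs i u w c \<xi>s assume i: "i < length (xs :: 'v list)"
  show "(if length (xs[i := u + scale c w]) = n then f (permute_list \<tau> (xs[i := u + scale c w])) else 0) \<xi>s =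
    (if length (xs[i := u]) = n then f (permute_list \<tau> (xs[i := u])) else 0) \<xi>s +
    c * (if length (xs[i := w]) = n then f (permute_list \<tau> (xs[i := w])) else 0) \<xi>s"
  proof (cases "length xs = n")
    case True
    have "inv \<tau> i < n" using permutes_in_image[OF permutes_inv[OF assms(2)], of i] i True by auto
    then show ?thesis
      using True i assms by (simp add: permute_list_update multilinearD)
  qed simp
qed

lemma multilinear_sum: "(\<And>x. x \<in> S \<Longrightarrow> multilinear (f x)) \<Longrightarrow> multilinear (\<lambda>xs \<xi>s. \<Sum>x\<in>S. c x * f x xs \<xi>s)"
  unfolding multilinear_def by (simp add: sum.distrib[symmetric] sum_distrib_left algebra_simps)

lemma homogeneous_map_at:
  assumes "\<alpha> \<in> words n" "\<And>k \<gamma>. \<gamma> \<in> A \<Longrightarrow> L k (e \<gamma>) \<in> V (dg \<gamma> + s k)"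
  shows "homogeneous (map_at L (map e \<alpha>)) (map (\<lambda>k. dg (\<alpha> ! k) + s k) [0..<n])"
  using assms by (auto simp: homogeneous_def map_at_def words_def subset_iff)

lemma sum_list_degrees:
  assumes "length \<alpha> = n"
  shows "sum_list (map (\<lambda>k. dg (\<alpha> ! k) + s k) [0..<n]) = deg \<alpha> + (\<Sum>k<n. s k)"
proof -
  have "sum_list (map (\<lambda>k. dg (\<alpha> ! k) + s k) [0..<n]) = (\<Sum>k<n. dg (\<alpha> ! k)) + (\<Sum>k<n. s k)"
    by (simp add: interv_sum_list_conv_sum_set_nat sum.distrib atLeast0LessThan)
  also have "(\<Sum>k<n. dg (\<alpha> ! k)) = deg \<alpha>"
    using assms by (simp add: deg_def sum_list_sum_nth atLeast0LessThan)
  finally show ?thesis .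
qed

lemma pure_tensor_comap_at:
  assumes "set \<xi>s \<subseteq> functionals" "\<And>k. lin (L k)"
  shows "pure_tensor vs (comap_at L \<xi>s) = pure_tensor (map_at L vs) \<xi>s"
proof -
  have "set (comap_at L \<xi>s) \<subseteq> functionals"
    using assms(1) by (auto simp: comap_at_def intro!: functional_comp assms(2))
  then show ?thesis
    using assms(1) by (auto simp: pure_tensor_def map_at_def comap_at_def intro!: prod.cong)
qed

text \<open>Induction over the span: an additive and homogeneous transformation of tensors only has
  to be followed on basis tensors.\<close>

lemma tensors_linear_image:
  assumes "t \<in> tensors m D" "\<And>x y. T (x + y) = T x + T y" "\<And>c x. T (\<lambda>\<xi>s. c * x \<xi>s) = (\<lambda>\<xi>s. c * T x \<xi>s)"
    "\<And>\<beta>. \<beta> \<in> words m \<Longrightarrow> deg \<beta> \<in> D \<Longrightarrow> T (pure_tensor (map e \<beta>)) \<in> tensors m' D'"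
  shows "T t \<in> tensors m' D'"
  using assms(1) unfolding tensors_def[of m D]
proof (induction rule: tensor_span_induct)
  case base
  have "T (0 + 0) = T 0 + T 0" by (rule assms(2))
  then have "T 0 = 0" by (simp only: add_0) (metis add_cancel_right_right)
  then show ?case by (simp only: tensors_0)
next
  case (step c x y)
  then have "T x \<in> tensors m' D'" using assms(4) by blast
  then show ?case using step(2) unfolding assms(2,3) by (intro tensors_add tensors_scale)
qed

lemma tensors_comap_at:
  assumes "t \<in> tensors m D" "\<And>k. lin (L k)" "\<And>k \<gamma>. \<gamma> \<in> A \<Longrightarrow> L k (e \<gamma>) \<in> V (dg \<gamma> + s k)"
    "\<And>k. k \<in> D \<Longrightarrow> k + (\<Sum>k<m. s k) \<in> D'"
  shows "(\<lambda>\<xi>s. if set \<xi>s \<subseteq> functionals then t (comap_at L \<xi>s) else 0) \<in> tensors m D'"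
proof (rule tensors_linear_image[OF assms(1)])
  let ?T = "\<lambda>(t :: ('v, 'k) tensor) \<xi>s. if set \<xi>s \<subseteq> functionals then t (comap_at L \<xi>s) else 0"
  fix \<beta> assume \<beta>: "\<beta> \<in> words m" "deg \<beta> \<in> D"
  have "?T (pure_tensor (map e \<beta>)) = pure_tensor (map_at L (map e \<beta>))"
  proof
    fix \<xi>s
    show "?T (pure_tensor (map e \<beta>)) \<xi>s = pure_tensor (map_at L (map e \<beta>)) \<xi>s"
      using pure_tensor_comap_at[of \<xi>s L, OF _ assms(2)] by (cases "set \<xi>s \<subseteq> functionals") (simp_all add: pure_tensor_def[of _ \<xi>s])
  qed
  moreover have "pure_tensor (map_at L (map e \<beta>)) \<in> tensors m {deg \<beta> + (\<Sum>k<m. s k)}"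
    using pure_tensor_in_tensors[OF homogeneous_map_at[OF \<beta>(1), of L s]] \<beta>(1) assms(3)
    by (simp add: sum_list_degrees words_def)
  moreover have "{deg \<beta> + (\<Sum>k<m. s k)} \<subseteq> D'" using assms(4)[OF \<beta>(2)] by simp
  ultimately show "?T (pure_tensor (map e \<beta>)) \<in> tensors m D'"
    using tensors_mono by (metis (no_types, lifting) subsetD)
qed (auto simp: fun_eq_iff)

text \<open>Reindexing the product by the inverse permutation moves the action from the functionals
  to the vectors.\<close>

lemma pure_tensor_permute:
  assumes "\<sigma> permutes {..<m}" "length vs = m" "length \<xi>s = m"
  shows "pure_tensor vs (permute_list \<sigma> \<xi>s) = pure_tensor (permute_list (inv \<sigma>) vs) \<xi>s"
proof -
  have \<sigma>': "inv \<sigma> permutes {..<m}" by (rule permutes_inv[OF assms(1)])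
  have lt: "inv \<sigma> i < m" if "i < m" for i using permutes_in_image[OF \<sigma>'] that by auto
  have "(\<Prod>i<m. (permute_list \<sigma> \<xi>s ! i) (vs ! i)) = (\<Prod>i<m. (permute_list \<sigma> \<xi>s ! inv \<sigma> i) (vs ! inv \<sigma> i))"
    using prod.permute[OF \<sigma>', of "\<lambda>i. (permute_list \<sigma> \<xi>s ! i) (vs ! i)"] by simp
  also have "\<dots> = (\<Prod>i<m. (\<xi>s ! i) (permute_list (inv \<sigma>) vs ! i))"
    using assms lt by (intro prod.cong) (auto simp: permute_list_def permutes_inverses)
  finally show ?thesis using assms by (simp add: pure_tensor_def)
qed

lemma tensors_permute:
  assumes "t \<in> tensors m D" "\<sigma> permutes {..<m}"
  shows "(\<lambda>\<xi>s. if length \<xi>s = m then t (permute_list \<sigma> \<xi>s) else 0) \<in> tensors m D"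
proof (rule tensors_linear_image[OF assms(1)])
  let ?T = "\<lambda>(t :: ('v, 'k) tensor) \<xi>s. if length \<xi>s = m then t (permute_list \<sigma> \<xi>s) else 0"
  have \<sigma>': "inv \<sigma> permutes {..<m}" by (rule permutes_inv[OF assms(2)])
  fix \<beta> assume \<beta>: "\<beta> \<in> words m" "deg \<beta> \<in> D"
  then have len: "length \<beta> = m" by (simp add: words_def)
  have "?T (pure_tensor (map e \<beta>)) = pure_tensor (map e (permute_list (inv \<sigma>) \<beta>))"
  proof
    fix \<xi>s
    show "?T (pure_tensor (map e \<beta>)) \<xi>s = pure_tensor (map e (permute_list (inv \<sigma>) \<beta>)) \<xi>s"
      using pure_tensor_permute[OF assms(2), of "map e \<beta>" \<xi>s] permute_list_map[of "inv \<sigma>" \<beta> e] \<sigma>' len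
      by (auto simp: pure_tensor_def)
  qed
  moreover have "permute_list (inv \<sigma>) \<beta> \<in> words m" "deg (permute_list (inv \<sigma>) \<beta>) = deg \<beta>"
    using \<beta> \<sigma>' len by (auto simp: words_def deg_def intro!: sum_list_map_mset_cong)
  ultimately show "?T (pure_tensor (map e \<beta>)) \<in> tensors m D"
    using \<beta>(2) tensors_pure by metis
qed (auto simp: fun_eq_iff)

lemma End_homogeneous:
  "f \<in> End m n d \<Longrightarrow> length xs = n \<Longrightarrow> homogeneous xs ds \<Longrightarrow> f xs \<in> tensors m {sum_list ds + d}"
  by (simp add: End_def tensor_power_eq)

lemma End_I:
  assumes "\<And>xs. length xs \<noteq> n \<Longrightarrow> f xs = 0" "multilinear f"
    "\<And>\<alpha>. \<alpha> \<in> words n \<Longrightarrow> f (map e \<alpha>) \<in> tensors m {deg \<alpha> + d}"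
  shows "f \<in> End m n d"
  using assms by (simp add: End_iff)

lemma End_0: "0 \<in> End m n d"
  by (rule End_I) (auto simp: multilinear_def tensors_0)

lemma End_add: "f \<in> End m n d \<Longrightarrow> g \<in> End m n d \<Longrightarrow> f + g \<in> End m n d"
  by (rule End_I) (auto simp: multilinear_def algebra_simps End_iff tensors_add)

lemma End_scale: "f \<in> End m n d \<Longrightarrow> (\<lambda>xs \<xi>s. c * f xs \<xi>s) \<in> End m n d"
  by (rule End_I) (auto simp: multilinear_def algebra_simps End_iff tensors_scale fun_eq_iff)

lemma mat_0 [simp]: "mat 0 \<alpha> \<beta> = 0"
  by (simp add: mat_def)

lemma mat_add: "mat (f + g) \<alpha> \<beta> = mat f \<alpha> \<beta> + mat g \<alpha> \<beta>"
  by (simp add: mat_def)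

lemma mat_scale: "mat (\<lambda>xs \<xi>s. c * f xs \<xi>s) \<alpha> \<beta> = c * mat f \<alpha> \<beta>"
  by (simp add: mat_def)

lemma parity_part_homogeneous: "\<gamma> \<in> A \<Longrightarrow> parity_part b (e \<gamma>) \<in> V (dg \<gamma>)"
  using subspace_0[OF subspace_V] by (simp add: parity_part_e e_in_V)

lemma twist_homogeneous: "\<gamma> \<in> A \<Longrightarrow> twist d (e \<gamma>) \<in> V (dg \<gamma>)"
  using subspace_scale[OF subspace_V] by (simp add: twist_e e_in_V)

lemma map2_parity_part: "length bs = length xs \<Longrightarrow> map2 parity_part bs xs = map_at (\<lambda>k. parity_part (bs ! k)) xs"
  by (rule nth_equalityI) (auto simp: map_at_def)

lemma map2_co_parity_part:
  "length bs = length \<xi>s \<Longrightarrow> map2 (\<lambda>b \<xi>. \<xi> \<circ> parity_part b) bs \<xi>s = comap_at (\<lambda>k. parity_part (bs ! k)) \<xi>s"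
  by (rule nth_equalityI) (auto simp: comap_at_def)

lemma finite_bool_lists [simp]: "finite {bs :: bool list. length bs = n}"
  using finite_lists_length_eq[of "UNIV :: bool set" n] by simp

text \<open>The index set of parity patterns is made independent of the argument by fixing their
  length \<open>n\<close>; lists of another length contribute 0 on both sides. In this form
  \<open>end_in\<close> is visibly a finite sum of multilinear maps.\<close>

lemma end_in_eq:
  assumes "f \<in> End m n d"
  shows "end_in \<tau> f = (\<lambda>xs \<xi>s. \<Sum>bs | length bs = n. koszul \<tau> bs *
    (\<lambda>xs. (if length xs = n then f (permute_list \<tau> xs) else 0)) (map_at (\<lambda>k. parity_part (bs ! k)) xs) \<xi>s)"
proof (intro ext)
  fix xs \<xi>s
  show "end_in \<tau> f xs \<xi>s = (\<Sum>bs | length bs = n. koszul \<tau> bs *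
    (\<lambda>xs. (if length xs = n then f (permute_list \<tau> xs) else 0)) (map_at (\<lambda>k. parity_part (bs ! k)) xs) \<xi>s)"
  proof (cases "length xs = n")
    case True
    then show ?thesis unfolding end_in_def by (intro sum.cong) (auto simp: map2_parity_part)
  next
    case False
    then have "f (permute_list \<tau> (map2 parity_part bs xs)) \<xi>s = 0" if "length bs = length xs" for bs
      using End_zero[OF assms, of "permute_list \<tau> (map2 parity_part bs xs)"] that by simp
    then show ?thesis using False by (simp add: end_in_def)
  qed
qed

lemma End_end_in:
  assumes f: "f \<in> End m n d" and \<tau>: "\<tau> permutes {..<n}"
  shows "end_in \<tau> f \<in> End m n d"
proof (rule End_I)
  show "end_in \<tau> f xs = 0" if "length xs \<noteq> n" for xs
    using that by (simp add: end_in_eq[OF f] fun_eq_iff)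
  show "multilinear (end_in \<tau> f)"
    unfolding end_in_eq[OF f]
    by (intro multilinear_sum multilinear_map_at multilinear_permute[OF End_multilinear[OF f] \<tau>] lin_parity_part)
  fix \<alpha> assume \<alpha>: "\<alpha> \<in> words n"
  then have len: "length \<alpha> = n" by (simp add: words_def)
  have "f (permute_list \<tau> (map_at (\<lambda>k. parity_part (bs ! k)) (map e \<alpha>))) \<in> tensors m {deg \<alpha> + d}" for bs
  proof -
    have "homogeneous (map_at (\<lambda>k. parity_part (bs ! k)) (map e \<alpha>)) (map (\<lambda>k. dg (\<alpha> ! k) + 0) [0..<n])"
      using \<alpha> parity_part_homogeneous by (intro homogeneous_map_at) auto
    then have "homogeneous (permute_list \<tau> (map_at (\<lambda>k. parity_part (bs ! k)) (map e \<alpha>)))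
        (permute_list \<tau> (map (\<lambda>k. dg (\<alpha> ! k) + 0) [0..<n]))"
      using permutes_in_image[OF \<tau>] len by (auto simp: homogeneous_def permute_list_def)
    moreover have "sum_list (permute_list \<tau> (map (\<lambda>k. dg (\<alpha> ! k) + 0) [0..<n])) = deg \<alpha>"
      using \<tau> sum_list_map_mset_cong[of "permute_list \<tau> (map (\<lambda>k. dg (\<alpha> ! k) + 0) [0..<n])" "map (\<lambda>k. dg (\<alpha> ! k) + 0) [0..<n]" id]
        sum_list_degrees[OF len, of "\<lambda>_. 0"] by (simp del: add_0_right)
    ultimately show ?thesis
      using End_homogeneous[OF f, of "permute_list \<tau> (map_at (\<lambda>k. parity_part (bs ! k)) (map e \<alpha>))"
          "permute_list \<tau> (map (\<lambda>k. dg (\<alpha> ! k) + 0) [0..<n])"] len by simp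
  qed
  then have "(\<Sum>bs | length bs = n. (\<lambda>\<xi>s. koszul \<tau> bs * f (permute_list \<tau> (map_at (\<lambda>k. parity_part (bs ! k)) (map e \<alpha>))) \<xi>s)) \<in> tensors m {deg \<alpha> + d}"
    by (intro tensors_sum tensors_scale)
  also have "(\<Sum>bs | length bs = n. (\<lambda>\<xi>s. koszul \<tau> bs * f (permute_list \<tau> (map_at (\<lambda>k. parity_part (bs ! k)) (map e \<alpha>))) \<xi>s)) = end_in \<tau> f (map e \<alpha>)"
    using len by (simp add: end_in_eq[OF f] fun_eq_iff sum_fun_apply)
  finally show "end_in \<tau> f (map e \<alpha>) \<in> tensors m {deg \<alpha> + d}" .
qed

lemma permute_list_zero:
  assumes "\<tau> permutes {..<length xs}" "i < length xs" "xs ! i = z"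
  shows "inv \<tau> i < length (permute_list \<tau> xs)" "permute_list \<tau> xs ! inv \<tau> i = z"
proof -
  show "inv \<tau> i < length (permute_list \<tau> xs)"
    using permutes_in_image[OF permutes_inv[OF assms(1)], of i] assms(2) by auto
  then show "permute_list \<tau> xs ! inv \<tau> i = z"
    using assms by (simp add: permute_list_def permutes_inverses)
qed

lemma map_at_parities: "set \<alpha> \<subseteq> A \<Longrightarrow> map_at (\<lambda>k. parity_part (map (\<lambda>a. odd (dg a)) \<alpha> ! k)) (map e \<alpha>) = map e \<alpha>"
  by (rule nth_equalityI) (auto simp: map_at_def parity_part_e subset_iff)

lemma comap_at_parities: "set \<beta> \<subseteq> A \<Longrightarrow> comap_at (\<lambda>k. parity_part (map (\<lambda>a. odd (dg a)) \<beta> ! k)) (map dual \<beta>) = map dual \<beta>"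
proof (rule nth_equalityI)
  fix i assume "set \<beta> \<subseteq> A" "i < length (comap_at (\<lambda>k. parity_part (map (\<lambda>a. odd (dg a)) \<beta> ! k)) (map dual \<beta>))"
  then have "i < length \<beta>" "\<beta> ! i \<in> A" by auto
  then show "comap_at (\<lambda>k. parity_part (map (\<lambda>a. odd (dg a)) \<beta> ! k)) (map dual \<beta>) ! i = map dual \<beta> ! i"
    using dual_parity_part_fun[of "\<beta> ! i" "odd (dg (\<beta> ! i))"] by (simp add: comap_at_def)
qed simp

text \<open>On a word of basis vectors every parity pattern other than that of the word projects
  some slot to 0, so exactly one Koszul sign survives.\<close>

lemma mat_end_in:
  assumes f: "f \<in> End m n d" and \<tau>: "\<tau> permutes {..<n}"
  shows "mat (end_in \<tau> f) \<alpha> \<beta> = perm_sign (graded_swap dg) \<tau> \<alpha> * mat f (permute_list \<tau> \<alpha>) \<beta>"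
proof (cases "\<alpha> \<in> words n \<and> set \<beta> \<subseteq> A")
  case True
  then have len: "length \<alpha> = n" and sub: "set \<alpha> \<subseteq> A" "set \<beta> \<subseteq> A" by (auto simp: words_def)
  let ?b = "map (\<lambda>a. odd (dg a)) \<alpha>"
  let ?F = "\<lambda>bs. koszul \<tau> bs * f (permute_list \<tau> (map_at (\<lambda>k. parity_part (bs ! k)) (map e \<alpha>))) (map dual \<beta>)"
  have "?F bs = 0" if bs: "length bs = n" "bs \<noteq> ?b" for bs
  proof -
    obtain i where i: "i < n" "bs ! i \<noteq> ?b ! i" using bs len nth_equalityI[of bs ?b] by auto
    then have "map_at (\<lambda>k. parity_part (bs ! k)) (map e \<alpha>) ! i = 0"
      using len sub by (auto simp: map_at_def parity_part_e subset_iff)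
    then show ?thesis
      using permute_list_zero[of \<tau> "map_at (\<lambda>k. parity_part (bs ! k)) (map e \<alpha>)" i 0] \<tau> len i
        multilinear_zero[OF End_multilinear[OF f]] by simp
  qed
  then have "(\<Sum>bs | length bs = n. ?F bs) = (\<Sum>bs | length bs = n. if bs = ?b then ?F ?b else 0)"
    by (intro sum.cong) auto
  also have "\<dots> = ?F ?b" using len by simp
  also have "\<dots> = perm_sign (graded_swap dg) \<tau> \<alpha> * f (map e (permute_list \<tau> \<alpha>)) (map dual \<beta>)"
    using \<tau> len sub by (simp add: map_at_parities permute_list_map koszul_eq_perm_sign)
  finally show ?thesis
    using True \<tau> len sub by (simp add: mat_def end_in_eq[OF f])
next
  case False
  have "mat f (permute_list \<tau> \<alpha>) \<beta> = 0"
  proof (rule ccontr)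
    assume nz: "mat f (permute_list \<tau> \<alpha>) \<beta> \<noteq> 0"
    then have "permute_list \<tau> \<alpha> \<in> words n" "set \<beta> \<subseteq> A"
      using mat_nonzero[OF f nz] by (auto simp: words_def)
    then show False using False \<tau> by (auto simp: words_def)
  qed
  moreover have "mat (end_in \<tau> f) \<alpha> \<beta> = 0"
    using mat_nonzero[OF End_end_in[OF f \<tau>], of \<alpha> \<beta>] False by (auto simp: words_def)
  ultimately show ?thesis by simp
qed

lemma end_out_eq:
  assumes "f \<in> End m n d" "\<sigma> permutes {..<m}"
  shows "end_out \<sigma> f xs = (\<Sum>bs | length bs = m. (\<lambda>\<xi>s. koszul \<sigma> bs *
    (if set \<xi>s \<subseteq> functionals
     then (\<lambda>\<xi>s. if length \<xi>s = m then f xs (permute_list \<sigma> \<xi>s) else 0) (comap_at (\<lambda>k. parity_part (bs ! k)) \<xi>s) else 0)))"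
proof
  fix \<xi>s
  show "end_out \<sigma> f xs \<xi>s = (\<Sum>bs | length bs = m. (\<lambda>\<xi>s. koszul \<sigma> bs *
    (if set \<xi>s \<subseteq> functionals
     then (\<lambda>\<xi>s. if length \<xi>s = m then f xs (permute_list \<sigma> \<xi>s) else 0) (comap_at (\<lambda>k. parity_part (bs ! k)) \<xi>s) else 0))) \<xi>s"
  proof (cases "set \<xi>s \<subseteq> functionals \<and> length \<xi>s = m")
    case True
    then show ?thesis
      unfolding end_out_def sum_fun_apply by (auto simp: map2_co_parity_part intro!: sum.cong)
  next
    case False
    have "f xs (permute_list \<sigma> (map2 (\<lambda>b \<xi>. \<xi> \<circ> parity_part b) bs \<xi>s)) = 0"
      if "length bs = length \<xi>s" "length \<xi>s \<noteq> m" for bs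
      using tensors_not_functionals[OF End_tensors[OF assms(1)]] that by simp
    then show ?thesis using False unfolding end_out_def sum_fun_apply by auto
  qed
qed

lemma End_end_out:
  assumes f: "f \<in> End m n d" and \<sigma>: "\<sigma> permutes {..<m}"
  shows "end_out \<sigma> f \<in> End m n d"
proof (rule End_I)
  show "end_out \<sigma> f xs = 0" if "length xs \<noteq> n" for xs
    using End_zero[OF f that] by (simp add: end_out_def fun_eq_iff)
  show "multilinear (end_out \<sigma> f)"
    unfolding multilinear_def end_out_def
    by (auto simp: multilinearD[OF End_multilinear[OF f]] sum.distrib[symmetric] sum_distrib_left algebra_simps)
  fix \<alpha> assume \<alpha>: "\<alpha> \<in> words n"
  show "end_out \<sigma> f (map e \<alpha>) \<in> tensors m {deg \<alpha> + d}"
    unfolding end_out_eq[OF f \<sigma>]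
    by (intro tensors_sum tensors_scale tensors_comap_at[where s = "\<lambda>_. 0" and D = "{deg \<alpha> + d}"] tensors_permute[OF End_basis[OF f \<alpha>] \<sigma>])
      (auto simp: parity_part_homogeneous)
qed

text \<open>Dual to the case of inputs: here the projections act on functionals, and a dual basis
  vector composed with the wrong projection is the zero functional.\<close>

lemma mat_end_out:
  assumes f: "f \<in> End m n d" and \<sigma>: "\<sigma> permutes {..<m}"
  shows "mat (end_out \<sigma> f) \<alpha> \<beta> = perm_sign (graded_swap dg) \<sigma> \<beta> * mat f \<alpha> (permute_list \<sigma> \<beta>)"
proof (cases "\<beta> \<in> words m \<and> set \<alpha> \<subseteq> A")
  case True
  then have len: "length \<beta> = m" and sub: "set \<alpha> \<subseteq> A" "set \<beta> \<subseteq> A" by (auto simp: words_def)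
  let ?b = "map (\<lambda>a. odd (dg a)) \<beta>"
  let ?F = "\<lambda>bs. koszul \<sigma> bs * f (map e \<alpha>) (permute_list \<sigma> (comap_at (\<lambda>k. parity_part (bs ! k)) (map dual \<beta>)))"
  have "?F bs = 0" if bs: "length bs = m" "bs \<noteq> ?b" for bs
  proof -
    obtain i where i: "i < m" "bs ! i \<noteq> ?b ! i" using bs len nth_equalityI[of bs ?b] by auto
    then have "comap_at (\<lambda>k. parity_part (bs ! k)) (map dual \<beta>) ! i = (\<lambda>_. 0)"
      using len sub by (auto simp: comap_at_def dual_parity_part_fun subset_iff)
    then show ?thesis
      using permute_list_zero[of \<sigma> "comap_at (\<lambda>k. parity_part (bs ! k)) (map dual \<beta>)" i "\<lambda>_. 0"] \<sigma> len i
        tensors_slot_zero[OF End_tensors[OF f]] by simp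
  qed
  then have "(\<Sum>bs | length bs = m. ?F bs) = (\<Sum>bs | length bs = m. if bs = ?b then ?F ?b else 0)"
    by (intro sum.cong) auto
  also have "\<dots> = ?F ?b" using len by simp
  also have "\<dots> = perm_sign (graded_swap dg) \<sigma> \<beta> * f (map e \<alpha>) (map dual (permute_list \<sigma> \<beta>))"
    using \<sigma> len sub by (simp add: comap_at_parities permute_list_map koszul_eq_perm_sign)
  finally show ?thesis
    using True \<sigma> len sub by (simp add: mat_def end_out_eq[OF f \<sigma>] sum_fun_apply)
next
  case False
  have "mat f \<alpha> (permute_list \<sigma> \<beta>) = 0"
  proof (rule ccontr)
    assume nz: "mat f \<alpha> (permute_list \<sigma> \<beta>) \<noteq> 0"
    then have "permute_list \<sigma> \<beta> \<in> words m" "set \<alpha> \<subseteq> A"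
      using mat_nonzero[OF f nz] by (auto simp: words_def)
    then show False using False \<sigma> by (auto simp: words_def)
  qed
  moreover have "mat (end_out \<sigma> f) \<alpha> \<beta> = 0"
    using mat_nonzero[OF End_end_out[OF f \<sigma>], of \<alpha> \<beta>] False by (auto simp: words_def)
  ultimately show ?thesis by simp
qed

lemma End_end_unit: "end_unit \<in> End 1 1 0"
proof (rule End_I)
  show "multilinear end_unit"
    unfolding multilinear_def
  proof (intro allI impI)
    fix xs i u w c \<xi>s assume "i < length (xs :: 'v list)"
    then show "end_unit (xs[i := u + scale c w]) \<xi>s = end_unit (xs[i := u]) \<xi>s + c * end_unit (xs[i := w]) \<xi>s"
      by (cases "length xs = 1"; cases \<xi>s) (auto simp: length_Suc_conv end_unit_def pure_tensor_Cons
          pure_tensor_Nil functional_add functional_scale algebra_simps)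
  qed
qed (auto simp: end_unit_def words_def intro!: tensors_pure)

lemma mat_end_unit: "mat end_unit \<alpha> \<beta> = (if \<alpha> = \<beta> \<and> \<alpha> \<in> words 1 then 1 else 0)"
proof (cases "\<alpha> \<in> words 1 \<and> \<beta> \<in> words 1")
  case True
  then show ?thesis using pure_tensor_dual[of \<alpha> 1 \<beta>] by (auto simp: mat_def end_unit_def words_def)
next
  case False
  then have "mat end_unit \<alpha> \<beta> = 0" using mat_nonzero(1,2)[OF End_end_unit, of \<alpha> \<beta>] by blast
  then show ?thesis using False by auto
qed

section \<open>Slots, twists and composition in coordinates\<close>

lemma pure_tensor_append:
  "pure_tensor (vs @ ws) \<xi>s = pure_tensor vs (take (length vs) \<xi>s) * pure_tensor ws (drop (length vs) \<xi>s)"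
proof (induction vs arbitrary: \<xi>s)
  case (Cons v vs)
  then show ?case by (cases \<xi>s) (auto simp: pure_tensor_Cons)
qed (simp add: pure_tensor_Nil)

text \<open>One output is evaluated on an arbitrary functional \<open>h\<close>; of the basis
  tensors in the value only those agreeing with \<open>b1\<close> and \<open>b2\<close> in the other
  slots survive. For compositions \<open>h\<close> feeds a vector into the upper operation, for the
  differential it is a dual vector composed with \<delta>.\<close>

lemma output_slot:
  assumes f: "f \<in> End m n d" and \<alpha>: "\<alpha> \<in> words n" and h: "h \<in> functionals"
    and b: "set b1 \<subseteq> A" "set b2 \<subseteq> A"
  shows "finite {\<gamma>. mat f \<alpha> (b1 @ \<gamma> # b2) \<noteq> 0}"
    and "f (map e \<alpha>) (map dual b1 @ h # map dual b2) = (\<Sum>\<gamma> | mat f \<alpha> (b1 @ \<gamma> # b2) \<noteq> 0. h (e \<gamma>) * mat f \<alpha> (b1 @ \<gamma> # b2))"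
proof -
  let ?T = "{\<beta>. mat f \<alpha> \<beta> \<noteq> 0}" and ?S = "{\<gamma>. mat f \<alpha> (b1 @ \<gamma> # b2) \<noteq> 0}"
  let ?g = "\<lambda>\<gamma>. b1 @ \<gamma> # b2"
  let ?\<xi>s = "map dual b1 @ h # map dual b2"
  have inj: "inj_on ?g ?S" by (auto simp: inj_on_def)
  have sub: "?g ` ?S \<subseteq> ?T" by auto
  show fin: "finite ?S" using finite_mat[OF f] sub inj finite_imageD finite_subset by blast
  have "pure_tensor (map e \<beta>) ?\<xi>s = 0" if \<beta>: "\<beta> \<in> ?T" "\<beta> \<notin> ?g ` ?S" for \<beta>
  proof (cases "length \<beta> = length b1 + Suc (length b2)")
    case False
    then show ?thesis by (simp add: pure_tensor_def)
  next
    case True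
    define b1' \<gamma> b2' where s: "b1' = take (length b1) \<beta>" "\<gamma> = \<beta> ! length b1" "b2' = drop (Suc (length b1)) \<beta>"
    have eq: "\<beta> = b1' @ \<gamma> # b2'" and len: "length b1' = length b1" "length b2' = length b2"
      using True id_take_nth_drop[of "length b1" \<beta>] by (auto simp: s)
    have "set \<beta> \<subseteq> A" using mat_nonzero(2)[OF f, of \<alpha> \<beta>] \<beta> by (auto simp: words_def)
    then have w: "b1' \<in> words (length b1)" "b2' \<in> words (length b2)" "b1 \<in> words (length b1)" "b2 \<in> words (length b2)"
      using eq len b by (auto simp: words_def)
    have "b1' \<noteq> b1 \<or> b2' \<noteq> b2" using \<beta> eq by auto
    then show ?thesis
      using pure_tensor_dual[OF w(1,3)] pure_tensor_dual[OF w(2,4)] len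
      by (auto simp: eq pure_tensor_append pure_tensor_Cons)
  qed
  then have "f (map e \<alpha>) ?\<xi>s = (\<Sum>\<beta>\<in>?g ` ?S. mat f \<alpha> \<beta> * pure_tensor (map e \<beta>) ?\<xi>s)"
    unfolding End_expand[OF f \<alpha>, of ?\<xi>s] using sub finite_mat[OF f] by (intro sum.mono_neutral_right) auto
  also have "\<dots> = (\<Sum>\<gamma>\<in>?S. mat f \<alpha> (?g \<gamma>) * pure_tensor (map e (?g \<gamma>)) ?\<xi>s)"
    by (subst sum.reindex[OF inj]) simp
  also have "\<dots> = (\<Sum>\<gamma>\<in>?S. h (e \<gamma>) * mat f \<alpha> (?g \<gamma>))"
  proof (rule sum.cong)
    have "pure_tensor (map e b1) (map dual b1) = 1" "pure_tensor (map e b2) (map dual b2) = 1"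
      using pure_tensor_dual[of b1 "length b1" b1] pure_tensor_dual[of b2 "length b2" b2] b by (auto simp: words_def)
    then show "mat f \<alpha> (?g \<gamma>) * pure_tensor (map e (?g \<gamma>)) ?\<xi>s = h (e \<gamma>) * mat f \<alpha> (?g \<gamma>)" for \<gamma>
      using h by (simp add: pure_tensor_append pure_tensor_Cons)
  qed simp
  finally show "f (map e \<alpha>) ?\<xi>s = (\<Sum>\<gamma>\<in>?S. h (e \<gamma>) * mat f \<alpha> (?g \<gamma>))" .
qed

lemma multilinear_slot:
  assumes "multilinear f"
  shows "f (us @ (\<Sum>x\<in>S. scale (c x) (v x)) # ws) \<xi>s = (\<Sum>x\<in>S. c x * f (us @ v x # ws) \<xi>s)"
proof (induction S rule: infinite_finite_induct)
  case (insert x S)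
  have "f ((us @ 0 # ws)[length us := (\<Sum>x\<in>S. scale (c x) (v x)) + scale (c x) (v x)]) \<xi>s =
      f ((us @ 0 # ws)[length us := (\<Sum>x\<in>S. scale (c x) (v x))]) \<xi>s +
      c x * f ((us @ 0 # ws)[length us := v x]) \<xi>s"
    by (rule multilinearD[OF assms]) simp
  then show ?case using insert by (simp add: add.commute)
qed (use multilinear_zero[OF assms, of "length us" "us @ 0 # ws" \<xi>s] in simp_all)

lemma input_slot:
  assumes "multilinear f" "set a1 \<subseteq> A" "set a2 \<subseteq> A" "set \<beta> \<subseteq> A"
  shows "f (map e a1 @ x # map e a2) (map dual \<beta>) = (\<Sum>\<gamma>\<in>supp x. dual \<gamma> x * mat f (a1 @ \<gamma> # a2) \<beta>)"
proof -
  have "f (map e a1 @ x # map e a2) (map dual \<beta>) =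
      (\<Sum>\<gamma>\<in>supp x. dual \<gamma> x * f (map e a1 @ e \<gamma> # map e a2) (map dual \<beta>))"
    using multilinear_slot[OF assms(1), of "map e a1" "\<lambda>\<gamma>. dual \<gamma> x" e "supp x"] expand[of x] by simp
  also have "\<dots> = (\<Sum>\<gamma>\<in>supp x. dual \<gamma> x * mat f (a1 @ \<gamma> # a2) \<beta>)"
    by (rule sum.cong) (use assms in \<open>auto simp: mat_def supp_def\<close>)
  finally show ?thesis .
qed

lemma multilinear_twist:
  assumes "multilinear f" "set w \<subseteq> A"
  shows "f (us @ map (twist d) (map e w)) \<xi>s = parity_sign (d * deg w) * f (us @ map e w) \<xi>s"
  using assms(2)
proof (induction w arbitrary: us)
  case (Cons a w)
  have "f (us @ map (twist d) (map e (a # w))) \<xi>s = f ((us @ [twist d (e a)]) @ map (twist d) (map e w)) \<xi>s"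
    by simp
  also have "\<dots> = parity_sign (d * deg w) * f ((us @ [twist d (e a)]) @ map e w) \<xi>s"
    using Cons by (intro Cons.IH) simp
  also have "f ((us @ [twist d (e a)]) @ map e w) \<xi>s = parity_sign (d * dg a) * f (us @ e a # map e w) \<xi>s"
    using multilinear_scale[OF assms(1), of "length us" "us @ 0 # map e w" "parity_sign (d * dg a)" "e a"] Cons.prems
    by (simp add: twist_e)
  finally show ?case by (simp add: parity_sign_add distrib_left mult_ac)
qed simp

end

context based_graded_space begin

lemma input_functional:
  assumes "multilinear g"
  shows "(\<lambda>v. g (v # ws) \<eta>s) \<in> functionals"
  using multilinearD[OF assms, of 0 "0 # ws" _ 1 _ \<eta>s] multilinear_scale[OF assms, of 0 "0 # ws" _ _ \<eta>s]
  by (simp add: functionals_iff)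

lemma tensors_last:
  assumes "t \<in> tensors m D" "\<xi> \<in> functionals" "\<eta> \<in> functionals"
  shows "t (\<zeta>s @ [\<lambda>v. \<xi> v + c * \<eta> v]) = t (\<zeta>s @ [\<xi>]) + c * t (\<zeta>s @ [\<eta>])"
  using tensors_slot[OF assms(1) _ assms(2,3), of "length \<zeta>s" "\<zeta>s @ [\<xi>]" c] by simp

lemma tensors_prod:
  assumes "b \<in> words m1" "t \<in> tensors m2 D" "\<And>k. k \<in> D \<Longrightarrow> deg b + k \<in> D'"
  shows "(\<lambda>\<xi>s. pure_tensor (map e b) (take m1 \<xi>s) * t (drop m1 \<xi>s)) \<in> tensors (m1 + m2) D'"
proof (rule tensors_linear_image[OF assms(2)])
  fix \<beta> assume \<beta>: "\<beta> \<in> words m2" "deg \<beta> \<in> D"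
  have "(\<lambda>\<xi>s. pure_tensor (map e b) (take m1 \<xi>s) * pure_tensor (map e \<beta>) (drop m1 \<xi>s)) = pure_tensor (map e (b @ \<beta>))"
    using assms(1) by (simp add: pure_tensor_append fun_eq_iff words_def)
  moreover have "b @ \<beta> \<in> words (m1 + m2)" using assms(1) \<beta> by (auto simp: words_def)
  ultimately show "(\<lambda>\<xi>s. pure_tensor (map e b) (take m1 \<xi>s) * pure_tensor (map e \<beta>) (drop m1 \<xi>s)) \<in> tensors (m1 + m2) D'"
    using tensors_pure[of "b @ \<beta>" "m1 + m2" D'] assms(3) \<beta>(2) by simp
qed (simp_all add: fun_eq_iff algebra_simps)

text \<open>After expansion of the lower operation into basis tensors, the last letter is fed into
  \<open>g\<close> and the others form a prefix of the output. The result is a finite sum of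
  products of the kind treated in \<open>tensors_prod\<close>.\<close>

lemma End_end_comp:
  assumes f: "f \<in> End (Suc m1) n1 df" and g: "g \<in> End m2 (Suc n2) d"
  shows "end_comp m1 n1 d df g f \<in> End (m1 + m2) (n1 + n2) (d + df)"
proof (rule End_I)
  have slot0: "f xs (\<xi>s @ [\<lambda>_. 0]) = 0" for xs \<xi>s
    using tensors_slot_zero[OF End_tensors[OF f], of "length \<xi>s" "\<xi>s @ [\<lambda>_. 0]"] by simp
  show "end_comp m1 n1 d df g f zs = 0" if "length zs \<noteq> n1 + n2" for zs
  proof (cases "length (take n1 zs) = n1")
    case False
    then show ?thesis using End_zero[OF f False] by (simp add: end_comp_def fun_eq_iff)
  next
    \<comment> \<open>If enough arguments are present for the lower operation, the upper one
      receives a wrong number of them, and the lower one is then evaluated on the zero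
      functional.\<close>
    case True
    then have "g (v # map (twist df) (drop n1 zs)) = 0" for v
      using that by (intro End_zero[OF g]) auto
    then show ?thesis by (simp add: end_comp_def fun_eq_iff slot0)
  qed
  show "multilinear (end_comp m1 n1 d df g f)"
    unfolding multilinear_def
  proof (intro allI impI)
    fix zs i u w c \<xi>s assume i: "i < length (zs :: 'v list)"
    let ?h = "\<lambda>ys v. g (v # map (twist df) ys) (drop m1 \<xi>s)"
    show "end_comp m1 n1 d df g f (zs[i := u + scale c w]) \<xi>s =
        end_comp m1 n1 d df g f (zs[i := u]) \<xi>s + c * end_comp m1 n1 d df g f (zs[i := w]) \<xi>s"
    proof (cases "i < n1")
      case True
      then show ?thesis using i
        by (simp add: end_comp_def take_update_swap drop_update_cancel multilinearD[OF End_multilinear[OF f]] algebra_simps)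
    next
      case False
      let ?y = "drop n1 zs"
      have h: "?h (?y[i - n1 := u + scale c w]) = (\<lambda>v. ?h (?y[i - n1 := u]) v + c * ?h (?y[i - n1 := w]) v)"
      proof
        fix v
        show "?h (?y[i - n1 := u + scale c w]) v = ?h (?y[i - n1 := u]) v + c * ?h (?y[i - n1 := w]) v"
          using multilinearD[OF End_multilinear[OF g], of "Suc (i - n1)" "v # map (twist df) ?y" "twist df u" c "twist df w" "drop m1 \<xi>s"]
            False i by (simp add: map_update twist_add twist_scale)
      qed
      have "f (take n1 zs) (take m1 \<xi>s @ [?h (?y[i - n1 := u + scale c w])]) =
          f (take n1 zs) (take m1 \<xi>s @ [?h (?y[i - n1 := u])]) + c * f (take n1 zs) (take m1 \<xi>s @ [?h (?y[i - n1 := w])])"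
        unfolding h
        by (intro tensors_last[OF End_tensors[OF f]] input_functional[OF End_multilinear[OF g]])
      then show ?thesis using False i
        by (simp add: end_comp_def drop_update_swap algebra_simps)
    qed
  qed
  fix \<alpha> assume \<alpha>: "\<alpha> \<in> words (n1 + n2)"
  define \<alpha>1 \<alpha>2 where s: "\<alpha>1 = take n1 \<alpha>" "\<alpha>2 = drop n1 \<alpha>"
  have \<alpha>1: "\<alpha>1 \<in> words n1" and \<alpha>2: "\<alpha>2 \<in> words n2" and deg: "deg \<alpha> = deg \<alpha>1 + deg \<alpha>2"
    using \<alpha> deg_simps(3)[of \<alpha>1 \<alpha>2] set_take_subset[of n1 \<alpha>] set_drop_subset[of n1 \<alpha>] by (auto simp: words_def s)
  let ?T = "{\<beta>. mat f \<alpha>1 \<beta> \<noteq> 0}"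
  have "end_comp m1 n1 d df g f (map e \<alpha>) = (\<Sum>\<beta>\<in>?T. (\<lambda>\<xi>s. (parity_sign (df * d) * mat f \<alpha>1 \<beta> * parity_sign (df * deg \<alpha>2)) *
      (pure_tensor (map e (butlast \<beta>)) (take m1 \<xi>s) * g (map e (last \<beta> # \<alpha>2)) (drop m1 \<xi>s))))"
  proof
    fix \<xi>s
    let ?h = "\<lambda>v. g (v # map (twist df) (map e \<alpha>2)) (drop m1 \<xi>s)"
    have "pure_tensor (map e \<beta>) (take m1 \<xi>s @ [?h]) =
        parity_sign (df * deg \<alpha>2) * (pure_tensor (map e (butlast \<beta>)) (take m1 \<xi>s) * g (map e (last \<beta> # \<alpha>2)) (drop m1 \<xi>s))"
      if "\<beta> \<in> ?T" for \<beta>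
    proof -
      have \<beta>: "\<beta> \<in> words (Suc m1)" using mat_nonzero(2)[OF f, of \<alpha>1 \<beta>] that by simp
      then have len: "length (butlast \<beta>) = m1" and eq: "\<beta> = butlast \<beta> @ [last \<beta>]"
        by (auto simp: words_def) (metis append_butlast_last_id length_0_conv nat.distinct(1))
      show ?thesis
      proof (cases "m1 \<le> length \<xi>s")
        case True
        have "pure_tensor (map e (butlast \<beta> @ [last \<beta>])) (take m1 \<xi>s @ [?h]) =
            pure_tensor (map e (butlast \<beta>)) (take m1 \<xi>s) * ?h (e (last \<beta>))"
          using True len input_functional[OF End_multilinear[OF g]]
          by (simp add: pure_tensor_append pure_tensor_Cons pure_tensor_Nil)
        also have "?h (e (last \<beta>)) = parity_sign (df * deg \<alpha>2) * g (map e (last \<beta> # \<alpha>2)) (drop m1 \<xi>s)"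
          using multilinear_twist[OF End_multilinear[OF g], of \<alpha>2 "[e (last \<beta>)]"] \<alpha>2 by (auto simp: words_def)
        finally show ?thesis using eq by (simp add: mult_ac)
      next
        case False
        then show ?thesis using \<beta> len by (simp add: pure_tensor_def words_def)
      qed
    qed
    then show "end_comp m1 n1 d df g f (map e \<alpha>) \<xi>s = (\<Sum>\<beta>\<in>?T. (\<lambda>\<xi>s. (parity_sign (df * d) * mat f \<alpha>1 \<beta> * parity_sign (df * deg \<alpha>2)) *
      (pure_tensor (map e (butlast \<beta>)) (take m1 \<xi>s) * g (map e (last \<beta> # \<alpha>2)) (drop m1 \<xi>s)))) \<xi>s"
      unfolding end_comp_def take_map drop_map s[symmetric] End_expand[OF f \<alpha>1] sum_fun_apply sum_distrib_left
      by (intro sum.cong) (auto simp: mult_ac)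
  qed
  also have "\<dots> \<in> tensors (m1 + m2) {deg \<alpha> + (d + df)}"
  proof (rule tensors_sum, rule tensors_scale)
    fix \<beta> assume "\<beta> \<in> ?T"
    then have \<beta>: "\<beta> \<in> words (Suc m1)" "deg \<beta> = deg \<alpha>1 + df" using mat_nonzero(2,3)[OF f, of \<alpha>1 \<beta>] by auto
    then have len: "length \<beta> = Suc m1" and eq: "\<beta> = butlast \<beta> @ [last \<beta>]"
      by (auto simp: words_def) (metis append_butlast_last_id length_0_conv nat.distinct(1))
    have A: "set (butlast \<beta>) \<subseteq> A" "last \<beta> \<in> A"
      using \<beta>(1) arg_cong[OF eq, of set] by (auto simp: words_def)
    then have w: "butlast \<beta> \<in> words m1" "last \<beta> # \<alpha>2 \<in> words (Suc n2)"
      using len \<alpha>2 by (auto simp: words_def)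
    have "deg (butlast \<beta>) + dg (last \<beta>) = deg \<alpha>1 + df"
      using \<beta>(2) arg_cong[OF eq, of deg] by simp
    then show "(\<lambda>\<xi>s. pure_tensor (map e (butlast \<beta>)) (take m1 \<xi>s) * g (map e (last \<beta> # \<alpha>2)) (drop m1 \<xi>s)) \<in> tensors (m1 + m2) {deg \<alpha> + (d + df)}"
      by (intro tensors_prod[OF w(1) End_basis[OF g w(2)]]) (auto simp: deg)
  qed
  finally show "end_comp m1 n1 d df g f (map e \<alpha>) \<in> tensors (m1 + m2) {deg \<alpha> + (d + df)}" .
qed

lemma finite_mat_slot: "f \<in> End m n d \<Longrightarrow> finite {\<gamma>. mat f \<alpha> (b1 @ \<gamma> # b2) \<noteq> 0}"
proof -
  assume f: "f \<in> End m n d"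
  have "inj_on (\<lambda>\<gamma>. b1 @ \<gamma> # b2) {\<gamma>. mat f \<alpha> (b1 @ \<gamma> # b2) \<noteq> 0}" by (auto simp: inj_on_def)
  moreover have "(\<lambda>\<gamma>. b1 @ \<gamma> # b2) ` {\<gamma>. mat f \<alpha> (b1 @ \<gamma> # b2) \<noteq> 0} \<subseteq> {\<beta>. mat f \<alpha> \<beta> \<noteq> 0}" by auto
  ultimately show ?thesis using finite_mat[OF f] finite_imageD finite_subset by blast
qed

text \<open>Composition is matrix multiplication along the internal edge \<gamma>. The sign collects
  \<open>df * d\<close> from the order of the two operators and \<open>df * deg a2\<close> from the
  twists of the remaining upper inputs.\<close>

lemma mat_end_comp:
  assumes f: "f \<in> End (Suc m1) n1 df" and g: "g \<in> End m2 (Suc n2) d"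
    and len: "length a1 = n1" "length b1 = m1"
  shows "mat (end_comp m1 n1 d df g f) (a1 @ a2) (b1 @ b2) =
    parity_sign (df * (d + deg a2)) * Sum_any (\<lambda>\<gamma>. mat f a1 (b1 @ [\<gamma>]) * mat g (\<gamma> # a2) b2)"
proof (cases "set a1 \<subseteq> A \<and> set a2 \<subseteq> A \<and> set b1 \<subseteq> A \<and> set b2 \<subseteq> A")
  case True
  let ?S = "{\<gamma>. mat f a1 (b1 @ [\<gamma>]) \<noteq> 0}"
  let ?h = "\<lambda>v. g (v # map (twist df) (map e a2)) (map dual b2)"
  have w: "a1 \<in> words n1" using True len by (simp add: words_def)
  have S: "\<gamma> \<in> A" if "\<gamma> \<in> ?S" for \<gamma> using mat_nonzero(2)[OF f, of a1 "b1 @ [\<gamma>]"] that by (auto simp: words_def)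
  have "mat (end_comp m1 n1 d df g f) (a1 @ a2) (b1 @ b2) =
      parity_sign (df * d) * f (map e a1) (map dual b1 @ [?h])"
    using True len by (simp add: mat_def end_comp_def)
  also have "f (map e a1) (map dual b1 @ [?h]) = (\<Sum>\<gamma>\<in>?S. ?h (e \<gamma>) * mat f a1 (b1 @ [\<gamma>]))"
    using output_slot(2)[OF f w input_functional[OF End_multilinear[OF g]], of b1 "[]"] True by simp
  also have "\<dots> = (\<Sum>\<gamma>\<in>?S. parity_sign (df * deg a2) * (mat f a1 (b1 @ [\<gamma>]) * mat g (\<gamma> # a2) b2))"
  proof (rule sum.cong)
    fix \<gamma> assume "\<gamma> \<in> ?S"
    then have "\<gamma> \<in> A" by (rule S)
    then have "?h (e \<gamma>) = parity_sign (df * deg a2) * mat g (\<gamma> # a2) b2"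
      using multilinear_twist[OF End_multilinear[OF g], of a2 "[e \<gamma>]"] True by (simp add: mat_def)
    then show "?h (e \<gamma>) * mat f a1 (b1 @ [\<gamma>]) = parity_sign (df * deg a2) * (mat f a1 (b1 @ [\<gamma>]) * mat g (\<gamma> # a2) b2)"
      by (simp add: mult_ac)
  qed simp
  also have "\<dots> = parity_sign (df * deg a2) * Sum_any (\<lambda>\<gamma>. mat f a1 (b1 @ [\<gamma>]) * mat g (\<gamma> # a2) b2)"
    unfolding sum_distrib_left[symmetric]
    using finite_mat_slot[OF f, of a1 b1 "[]"] by (subst Sum_any.expand_superset[of ?S]) auto
  finally show ?thesis by (simp add: parity_sign_add distrib_left mult_ac)
next
  case False
  then have "(\<lambda>\<gamma>. mat f a1 (b1 @ [\<gamma>]) * mat g (\<gamma> # a2) b2) = (\<lambda>_. 0)"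
    by (intro ext) (auto simp: mat_def)
  moreover have "mat (end_comp m1 n1 d df g f) (a1 @ a2) (b1 @ b2) = 0"
    using False by (auto simp: mat_def)
  ultimately show ?thesis by (simp only: Sum_any.neutral mult_zero_right)
qed


lemma tensors_co_twist:
  assumes "t \<in> tensors m D" "set b \<subseteq> A"
  shows "t (\<zeta>s @ map (\<lambda>\<xi>. \<xi> \<circ> twist d) (map dual b)) = parity_sign (d * deg b) * t (\<zeta>s @ map dual b)"
  using assms(2)
proof (induction b arbitrary: \<zeta>s)
  case (Cons a w)
  have "t (\<zeta>s @ map (\<lambda>\<xi>. \<xi> \<circ> twist d) (map dual (a # w))) = t ((\<zeta>s @ [dual a \<circ> twist d]) @ map (\<lambda>\<xi>. \<xi> \<circ> twist d) (map dual w))"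
    by simp
  also have "\<dots> = parity_sign (d * deg w) * t ((\<zeta>s @ [dual a \<circ> twist d]) @ map dual w)"
    using Cons by (intro Cons.IH) simp
  also have "t ((\<zeta>s @ [dual a \<circ> twist d]) @ map dual w) = parity_sign (d * dg a) * t (\<zeta>s @ dual a # map dual w)"
    using tensors_slot[OF assms(1), of "length \<zeta>s" "\<zeta>s @ (\<lambda>_. 0) # map dual w" "\<lambda>_. 0" "dual a" "parity_sign (d * dg a)"]
      tensors_slot_zero[OF assms(1), of "length \<zeta>s" "\<zeta>s @ (\<lambda>_. 0) # map dual w"] Cons.prems
    by (simp add: dual_twist_fun)
  finally show ?case by (simp add: parity_sign_add distrib_left mult_ac)
qed simp

section \<open>The differential of the endomorphism dioperad\<close>

context
  fixes \<delta> :: "'v \<Rightarrow> 'v"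
  assumes \<delta>: "dg_vector_space \<delta>"
begin

definition d_in :: "nat \<Rightarrow> 'v list \<Rightarrow> 'v list" where
  "d_in i xs = take i xs @ \<delta> (xs ! i) # map (twist 1) (drop (Suc i) xs)"

definition d_out :: "nat \<Rightarrow> ('v \<Rightarrow> 'k) list \<Rightarrow> ('v \<Rightarrow> 'k) list" where
  "d_out j \<xi>s = take j \<xi>s @ (\<xi>s ! j \<circ> \<delta>) # map (\<lambda>\<xi>. \<xi> \<circ> twist 1) (drop (Suc j) \<xi>s)"

text \<open>The summand of the derivation at place \<open>i\<close>. As \<delta> acts from the
  right, it passes the factors behind place \<open>i\<close>, which are twisted, while those before
  it are untouched.\<close>

definition d_step :: "nat \<Rightarrow> nat \<Rightarrow> 'v \<Rightarrow> 'v" where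
  "d_step i k = (if k < i then id else if k = i then \<delta> else twist 1)"

lemma lin_d_step: "lin (d_step i k)"
  using lin_dg[OF \<delta>] by (simp add: d_step_def)

lemma d_in_eq: "i < length xs \<Longrightarrow> d_in i xs = map_at (d_step i) xs"
  by (rule nth_equalityI) (auto simp: d_in_def map_at_def d_step_def nth_append nth_Cons' min_def)

lemma d_out_eq: "j < length \<xi>s \<Longrightarrow> d_out j \<xi>s = comap_at (d_step j) \<xi>s"
  by (rule nth_equalityI) (auto simp: d_out_def comap_at_def d_step_def nth_append nth_Cons' min_def)

lemma \<delta>_e: "\<gamma> \<in> A \<Longrightarrow> \<delta> (e \<gamma>) \<in> V (dg \<gamma> + 1)"
  using \<delta> e_in_V by (auto simp: dg_vector_space_def)

lemma \<delta>_scale: "\<delta> (scale c v) = scale c (\<delta> v)"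
  using \<delta> by (simp add: dg_vector_space_def Vector_Spaces.linear_iff)

lemma d_step_homogeneous: "\<gamma> \<in> A \<Longrightarrow> d_step i k (e \<gamma>) \<in> V (dg \<gamma> + (if k = i then 1 else 0))"
  using \<delta>_e by (simp add: d_step_def e_in_V twist_homogeneous)

lemma length_d_in [simp]: "i < length xs \<Longrightarrow> length (d_in i xs) = length xs"
  and length_d_out [simp]: "j < length \<xi>s \<Longrightarrow> length (d_out j \<xi>s) = length \<xi>s"
  by (simp_all add: d_in_eq d_out_eq)

text \<open>Both sums receive a fixed number of summands, \<open>m\<close> and \<open>n\<close>,
  because \<open>f\<close> vanishes on lists of any other length. This exhibits the differential as
  a finite combination of slotwise linear substitutions.\<close>

lemma end_diff_eq:
  assumes f: "f \<in> End m n d'"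
  shows "end_diff \<delta> d f xs \<xi>s =
    (\<Sum>j<m. (\<lambda>\<xi>s. if set \<xi>s \<subseteq> functionals then f xs (comap_at (d_step j) \<xi>s) else 0) \<xi>s) -
      parity_sign d * (\<Sum>i<n. f (map_at (d_step i) xs) \<xi>s)"
proof (cases "set \<xi>s \<subseteq> functionals")
  case True
  have "(\<Sum>j<length \<xi>s. f xs (d_out j \<xi>s)) = (\<Sum>j<m. f xs (comap_at (d_step j) \<xi>s))"
  proof (cases "length \<xi>s = m")
    case False
    then have "f xs \<eta>s = 0" if "length \<eta>s = length \<xi>s" for \<eta>s
      using tensors_not_functionals[OF End_tensors[OF f], of \<eta>s] that by simp
    then show ?thesis by simp
  qed (simp add: d_out_eq)
  moreover have "(\<Sum>i<length xs. f (d_in i xs) \<xi>s) = (\<Sum>i<n. f (map_at (d_step i) xs) \<xi>s)"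
  proof (cases "length xs = n")
    case False
    then have "f ys \<xi>s = 0" if "length ys = length xs" for ys
      using End_zero[OF f, of ys] that by simp
    then show ?thesis by simp
  qed (simp add: d_in_eq)
  ultimately show ?thesis using True by (simp add: end_diff_def d_in_def d_out_def)
next
  case False
  then have "f ys \<xi>s = 0" for ys using tensors_not_functionals[OF End_tensors[OF f]] by blast
  then show ?thesis using False by (auto simp: end_diff_def)
qed

lemma End_end_diff:
  assumes f: "f \<in> End m n d"
  shows "end_diff \<delta> d f \<in> End m n (d + 1)"
proof (rule End_I)
  show "end_diff \<delta> d f xs = 0" if "length xs \<noteq> n" for xs
    using that by (simp add: fun_eq_iff end_diff_eq[OF f] End_zero[OF f] cong: if_cong)
  have 1: "multilinear (\<lambda>xs. f (map_at (d_step i) xs))" for i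
    by (rule multilinear_map_at[OF End_multilinear[OF f] lin_d_step])
  show "multilinear (end_diff \<delta> d f)"
    unfolding multilinear_def
  proof (intro allI impI)
    fix xs i u w c \<xi>s assume i: "i < length (xs :: 'v list)"
    show "end_diff \<delta> d f (xs[i := u + scale c w]) \<xi>s =
        end_diff \<delta> d f (xs[i := u]) \<xi>s + c * end_diff \<delta> d f (xs[i := w]) \<xi>s"
      unfolding end_diff_eq[OF f] multilinearD[OF End_multilinear[OF f] i] multilinearD[OF 1 i]
      by (cases "set \<xi>s \<subseteq> functionals") (simp_all add: sum.distrib sum_distrib_left algebra_simps)
  qed
  fix \<alpha> assume \<alpha>: "\<alpha> \<in> words n"
  have 1: "(\<lambda>\<xi>s. if set \<xi>s \<subseteq> functionals then f (map e \<alpha>) (comap_at (d_step j) \<xi>s) else 0) \<in> tensors m {deg \<alpha> + (d + 1)}"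
    if "j < m" for j
    using that
    by (intro tensors_comap_at[OF End_basis[OF f \<alpha>] lin_d_step d_step_homogeneous]) auto
  have 2: "f (map_at (d_step i) (map e \<alpha>)) \<in> tensors m {deg \<alpha> + (d + 1)}" if "i < n" for i
  proof -
    have "homogeneous (map_at (d_step i) (map e \<alpha>)) (map (\<lambda>k. dg (\<alpha> ! k) + (if k = i then 1 else 0)) [0..<n])"
      by (rule homogeneous_map_at[OF \<alpha> d_step_homogeneous])
    from End_homogeneous[OF f _ this] show ?thesis
      using \<alpha> that by (auto simp: words_def sum_list_degrees add_ac)
  qed
  have "(\<Sum>j<m. (\<lambda>\<xi>s. if set \<xi>s \<subseteq> functionals then f (map e \<alpha>) (comap_at (d_step j) \<xi>s) else 0)) +
      (\<lambda>\<xi>s. - parity_sign d * (\<Sum>i<n. f (map_at (d_step i) (map e \<alpha>))) \<xi>s) \<in> tensors m {deg \<alpha> + (d + 1)}"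
    by (intro tensors_add tensors_scale tensors_sum 1 2) auto
  also have "(\<Sum>j<m. (\<lambda>\<xi>s. if set \<xi>s \<subseteq> functionals then f (map e \<alpha>) (comap_at (d_step j) \<xi>s) else 0)) +
      (\<lambda>\<xi>s. - parity_sign d * (\<Sum>i<n. f (map_at (d_step i) (map e \<alpha>))) \<xi>s) = end_diff \<delta> d f (map e \<alpha>)"
    by (rule ext) (simp add: end_diff_eq[OF f] sum_fun_apply)
  finally show "end_diff \<delta> d f (map e \<alpha>) \<in> tensors m {deg \<alpha> + (d + 1)}" .
qed

definition d_mat :: "'i \<Rightarrow> 'i \<Rightarrow> 'k" where
  "d_mat \<gamma> \<beta> = (if \<gamma> \<in> A \<and> \<beta> \<in> A then dual \<beta> (\<delta> (e \<gamma>)) else 0)"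

lemma d_mat_degree: "d_mat \<gamma> \<beta> \<noteq> 0 \<Longrightarrow> dg \<beta> = dg \<gamma> + 1"
  using V_degree[OF \<delta>_e] by (auto simp: d_mat_def supp_def split: if_splits)

lemma mat_d_out:
  assumes f: "f \<in> End m n d" and w: "\<alpha> \<in> words n" "\<beta> \<in> words m" "j < m"
  shows "f (map e \<alpha>) (d_out j (map dual \<beta>)) =
    parity_sign (deg (drop (Suc j) \<beta>)) * Sum_any (\<lambda>\<gamma>. d_mat \<gamma> (\<beta> ! j) * mat f \<alpha> (take j \<beta> @ \<gamma> # drop (Suc j) \<beta>))"
proof -
  have len: "length \<beta> = m" and A: "set \<beta> \<subseteq> A" "set (take j \<beta>) \<subseteq> A" "set (drop (Suc j) \<beta>) \<subseteq> A" "\<beta> ! j \<in> A"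
    using w set_take_subset[of j \<beta>] set_drop_subset[of "Suc j" \<beta>] by (auto simp: words_def)
  let ?S = "{\<gamma>. mat f \<alpha> (take j \<beta> @ \<gamma> # drop (Suc j) \<beta>) \<noteq> 0}"
  have fnl: "dual (\<beta> ! j) \<circ> \<delta> \<in> functionals" by (rule functional_comp[OF lin_dg[OF \<delta>]]) simp
  have S: "\<gamma> \<in> A" if "\<gamma> \<in> ?S" for \<gamma>
    using mat_nonzero(2)[OF f, of \<alpha> "take j \<beta> @ \<gamma> # drop (Suc j) \<beta>"] that by (auto simp: words_def)
  have "f (map e \<alpha>) (d_out j (map dual \<beta>)) = f (map e \<alpha>) ((map dual (take j \<beta>) @ [dual (\<beta> ! j) \<circ> \<delta>]) @ map (\<lambda>\<xi>. \<xi> \<circ> twist 1) (map dual (drop (Suc j) \<beta>)))"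
    using w(3) len by (simp add: d_out_def take_map drop_map)
  also have "\<dots> = parity_sign (deg (drop (Suc j) \<beta>)) * f (map e \<alpha>) (map dual (take j \<beta>) @ (dual (\<beta> ! j) \<circ> \<delta>) # map dual (drop (Suc j) \<beta>))"
    using tensors_co_twist[OF End_tensors[OF f] A(3), of "map e \<alpha>" "map dual (take j \<beta>) @ [dual (\<beta> ! j) \<circ> \<delta>]" 1] by simp
  also have "f (map e \<alpha>) (map dual (take j \<beta>) @ (dual (\<beta> ! j) \<circ> \<delta>) # map dual (drop (Suc j) \<beta>)) =
      (\<Sum>\<gamma>\<in>?S. (dual (\<beta> ! j) \<circ> \<delta>) (e \<gamma>) * mat f \<alpha> (take j \<beta> @ \<gamma> # drop (Suc j) \<beta>))"
    by (rule output_slot(2)[OF f w(1) fnl A(2,3)])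
  also have "\<dots> = (\<Sum>\<gamma>\<in>?S. d_mat \<gamma> (\<beta> ! j) * mat f \<alpha> (take j \<beta> @ \<gamma> # drop (Suc j) \<beta>))"
    by (rule sum.cong) (use S A(4) in \<open>auto simp: d_mat_def\<close>)
  also have "\<dots> = Sum_any (\<lambda>\<gamma>. d_mat \<gamma> (\<beta> ! j) * mat f \<alpha> (take j \<beta> @ \<gamma> # drop (Suc j) \<beta>))"
    using finite_mat_slot[OF f] by (subst Sum_any.expand_superset[of ?S]) auto
  finally show ?thesis .
qed

lemma mat_d_in:
  assumes f: "f \<in> End m n d" and w: "\<alpha> \<in> words n" "\<beta> \<in> words m" "i < n"
  shows "f (d_in i (map e \<alpha>)) (map dual \<beta>) =
    parity_sign (deg (drop (Suc i) \<alpha>)) * Sum_any (\<lambda>\<gamma>. d_mat (\<alpha> ! i) \<gamma> * mat f (take i \<alpha> @ \<gamma> # drop (Suc i) \<alpha>) \<beta>)"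
proof -
  have len: "length \<alpha> = n" and A: "set \<alpha> \<subseteq> A" "set (take i \<alpha>) \<subseteq> A" "set (drop (Suc i) \<alpha>) \<subseteq> A" "\<alpha> ! i \<in> A" "set \<beta> \<subseteq> A"
    using w set_take_subset[of i \<alpha>] set_drop_subset[of "Suc i" \<alpha>] by (auto simp: words_def)
  let ?S = "supp (\<delta> (e (\<alpha> ! i)))"
  have "f (d_in i (map e \<alpha>)) (map dual \<beta>) = f ((map e (take i \<alpha>) @ [\<delta> (e (\<alpha> ! i))]) @ map (twist 1) (map e (drop (Suc i) \<alpha>))) (map dual \<beta>)"
    using w(3) len by (simp add: d_in_def take_map drop_map)
  also have "\<dots> = parity_sign (deg (drop (Suc i) \<alpha>)) * f (map e (take i \<alpha>) @ \<delta> (e (\<alpha> ! i)) # map e (drop (Suc i) \<alpha>)) (map dual \<beta>)"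
    using multilinear_twist[OF End_multilinear[OF f] A(3), of "map e (take i \<alpha>) @ [\<delta> (e (\<alpha> ! i))]" 1] by simp
  also have "f (map e (take i \<alpha>) @ \<delta> (e (\<alpha> ! i)) # map e (drop (Suc i) \<alpha>)) (map dual \<beta>) =
      (\<Sum>\<gamma>\<in>?S. dual \<gamma> (\<delta> (e (\<alpha> ! i))) * mat f (take i \<alpha> @ \<gamma> # drop (Suc i) \<alpha>) \<beta>)"
    by (rule input_slot[OF End_multilinear[OF f] A(2,3,5)])
  also have "\<dots> = (\<Sum>\<gamma>\<in>?S. d_mat (\<alpha> ! i) \<gamma> * mat f (take i \<alpha> @ \<gamma> # drop (Suc i) \<alpha>) \<beta>)"
    by (rule sum.cong) (use A(4) in \<open>auto simp: d_mat_def supp_def\<close>)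
  also have "\<dots> = Sum_any (\<lambda>\<gamma>. d_mat (\<alpha> ! i) \<gamma> * mat f (take i \<alpha> @ \<gamma> # drop (Suc i) \<alpha>) \<beta>)"
    by (rule Sum_any.expand_superset[OF finite_supp, symmetric]) (auto simp: d_mat_def supp_def split: if_splits)
  finally show ?thesis .
qed

lemma mat_end_diff:
  assumes f: "f \<in> End m n d" and w: "\<alpha> \<in> words n" "\<beta> \<in> words m"
  shows "mat (end_diff \<delta> d f) \<alpha> \<beta> =
    (\<Sum>j<m. parity_sign (deg (drop (Suc j) \<beta>)) * Sum_any (\<lambda>\<gamma>. d_mat \<gamma> (\<beta> ! j) * mat f \<alpha> (take j \<beta> @ \<gamma> # drop (Suc j) \<beta>)))
    - parity_sign d * (\<Sum>i<n. parity_sign (deg (drop (Suc i) \<alpha>)) * Sum_any (\<lambda>\<gamma>. d_mat (\<alpha> ! i) \<gamma> * mat f (take i \<alpha> @ \<gamma> # drop (Suc i) \<alpha>) \<beta>))"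
proof -
  have "mat (end_diff \<delta> d f) \<alpha> \<beta> = (\<Sum>j<m. f (map e \<alpha>) (d_out j (map dual \<beta>))) - parity_sign d * (\<Sum>i<n. f (d_in i (map e \<alpha>)) (map dual \<beta>))"
    using w by (simp add: mat_def words_def end_diff_def d_in_def d_out_def)
  then show ?thesis using mat_d_out[OF f w] mat_d_in[OF f w] by simp
qed

end

end

section \<open>The differential as a derivation of composition\<close>

context based_graded_space begin

lemma V_twist: "v \<in> V k \<Longrightarrow> twist d v = scale (parity_sign (d * k)) v"
  by (rule vector_eqI) (use V_degree in \<open>auto simp: dual_twist dual_scale supp_def\<close>)

lemma twist_twist: "twist a (twist b v) = twist (a + b) v"
  by (rule vector_eqI) (simp add: dual_twist distrib_right parity_sign_add mult.assoc)

lemma tensors_sum_last: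
  assumes "t \<in> tensors m D" "\<And>x. x \<in> S \<Longrightarrow> \<xi> x \<in> functionals"
  shows "t (\<zeta>s @ [\<lambda>v. \<Sum>x\<in>S. \<xi> x v]) = (\<Sum>x\<in>S. t (\<zeta>s @ [\<xi> x]))"
  using assms(2)
proof (induction S rule: infinite_finite_induct)
  case (insert x S)
  have "(\<lambda>v. \<Sum>x\<in>S. \<xi> x v) \<in> functionals"
    using insert.prems by (auto simp: functionals_iff sum.distrib sum_distrib_left)
  then show ?case
    using insert tensors_last[OF assms(1), of "\<xi> x" "\<lambda>v. \<Sum>x\<in>S. \<xi> x v" \<zeta>s 1] by simp
qed (use tensors_slot_zero[OF assms(1), of "length \<zeta>s" "\<zeta>s @ [\<lambda>_. 0]"] in simp_all)

lemma functionals_combine: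
  "\<xi> \<in> functionals \<Longrightarrow> \<eta> \<in> functionals \<Longrightarrow> (\<lambda>v. \<xi> v + c * \<eta> v) \<in> functionals"
  by (simp add: functionals_iff algebra_simps)

lemma functionals_sum:
  "(\<And>x. x \<in> S \<Longrightarrow> \<xi> x \<in> functionals) \<Longrightarrow> (\<lambda>v. \<Sum>x\<in>S. \<xi> x v) \<in> functionals"
  by (auto simp: functionals_iff sum.distrib sum_distrib_left)

lemma multilinear_scale_slot:
  "multilinear f \<Longrightarrow> f (us @ scale c v # ws) \<xi>s = c * f (us @ v # ws) \<xi>s"
  using multilinear_scale[of f "length us" "us @ v # ws" c v \<xi>s] by simp

text \<open>An operation of degree \<open>d\<close> commutes with the twist up to the sign of
  \<open>d\<close>, since the output and input degrees of a nonzero coefficient differ by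
  \<open>d\<close>.\<close>

lemma End_twist:
  assumes g: "g \<in> End m n d" and b: "set b \<subseteq> A"
  shows "g xs (map (\<lambda>\<xi>. \<xi> \<circ> twist 1) (map dual b)) = parity_sign d * g (map (twist 1) xs) (map dual b)"
proof -
  \<comment> \<open>The outputs are frozen at \<open>b\<close>; the additional argument
    \<open>\<xi>s\<close> only gives both sides the type of an operation, so that their equality can
    be tested on basis words. It is instantiated with \<open>[]\<close> at the end.\<close>
  let ?F = "\<lambda>xs \<xi>s. if set \<xi>s \<subseteq> functionals then g xs (map (\<lambda>\<xi>. \<xi> \<circ> twist 1) (map dual b)) else 0"
  let ?G = "\<lambda>xs \<xi>s. if set \<xi>s \<subseteq> functionals then parity_sign d * g (map (twist 1) xs) (map dual b) else 0"
  have tw: "map (twist 1) xs = map_at (\<lambda>_. twist 1) xs" for xs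
    by (rule nth_equalityI) (auto simp: map_at_def)
  have "?F = ?G"
  proof (rule multilinear_eqI)
    show "multilinear ?F"
      using multilinearD[OF End_multilinear[OF g]] unfolding multilinear_def by simp
    show "multilinear ?G"
      using multilinearD[OF multilinear_map_at[OF End_multilinear[OF g] lin_twist]]
      unfolding multilinear_def tw by (simp add: algebra_simps)
    show "?F xs = ?G xs" if "length xs \<noteq> n" for xs
    proof -
      have "g xs = 0" "g (map (twist 1) xs) = 0" using that by (simp_all add: End_zero[OF g])
      then show ?thesis by auto
    qed
    fix \<alpha> assume \<alpha>: "\<alpha> \<in> words n"
    have "g (map e \<alpha>) (map (\<lambda>\<xi>. \<xi> \<circ> twist 1) (map dual b)) = parity_sign (deg b) * g (map e \<alpha>) (map dual b)"
      using tensors_co_twist[OF End_tensors[OF g] b, of _ "[]" 1] by simp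
    also have "\<dots> = parity_sign d * (parity_sign (deg \<alpha>) * g (map e \<alpha>) (map dual b))"
    proof (cases "g (map e \<alpha>) (map dual b) = 0")
      case False
      then have "deg b = deg \<alpha> + d" using mat_nonzero(3)[OF g, of \<alpha> b] \<alpha> b by (auto simp: mat_def words_def)
      then show ?thesis by (simp add: parity_sign_add mult_ac)
    qed simp
    also have "parity_sign (deg \<alpha>) * g (map e \<alpha>) (map dual b) = g (map (twist 1) (map e \<alpha>)) (map dual b)"
      using multilinear_twist[OF End_multilinear[OF g], of \<alpha> "[]" 1] \<alpha> by (simp add: words_def)
    finally have eq: "g (map e \<alpha>) (map (\<lambda>\<xi>. \<xi> \<circ> twist 1) (map dual b)) =
      parity_sign d * g (map (twist 1) (map e \<alpha>)) (map dual b)" .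
    show "?F (map e \<alpha>) = ?G (map e \<alpha>)" by (rule ext) (simp only: eq)
  qed
  from fun_cong[OF fun_cong[OF this, of xs], of "[]"] show ?thesis by simp
qed

context
  fixes \<delta> :: "'v \<Rightarrow> 'v"
  assumes \<delta>: "dg_vector_space \<delta>"
begin

abbreviation "din \<equiv> d_in \<delta>"
abbreviation "dout \<equiv> d_out \<delta>"

lemma end_diff_functionals:
  "set \<xi>s \<subseteq> functionals \<Longrightarrow> end_diff \<delta> d f xs \<xi>s =
    (\<Sum>j<length \<xi>s. f xs (dout j \<xi>s)) - parity_sign d * (\<Sum>i<length xs. f (din i xs) \<xi>s)"
  by (simp add: end_diff_def d_in_def[OF \<delta>] d_out_def[OF \<delta>])

lemma d_in_append1: "i < length xs \<Longrightarrow> din i (xs @ ys) = din i xs @ map (twist 1) ys"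
  by (simp add: d_in_def[OF \<delta>] nth_append)

lemma d_in_append2: "din (length xs + i) (xs @ ys) = xs @ din i ys"
  by (simp add: d_in_def[OF \<delta>] nth_append)

lemma d_out_append1: "i < length xs \<Longrightarrow> dout i (xs @ ys) = dout i xs @ map (\<lambda>\<xi>. \<xi> \<circ> twist 1) ys"
  by (simp add: d_out_def[OF \<delta>] nth_append)

lemma d_out_append2: "dout (length xs + i) (xs @ ys) = xs @ dout i ys"
  by (simp add: d_out_def[OF \<delta>] nth_append)

lemma sum_lessThan_add: "(\<Sum>i<a + b. F i) = (\<Sum>i<a. F i) + (\<Sum>i<b. F (a + i :: nat) :: 'k)"
  by (induction b) (simp_all add: add_ac)

text \<open>Twists commute with each other, so only place \<open>i\<close> matters: there the vector
  \<open>\<delta> (e (a ! i))\<close> has degree one higher than \<open>e (a ! i)\<close>, which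
  produces the sign of \<open>d\<close>.\<close>

lemma d_in_twist:
  assumes "multilinear g" "i < length a" "set a \<subseteq> A"
  shows "g (us @ map (twist d) (din i (map e a))) \<xi>s = parity_sign d * g (us @ din i (map (twist d) (map e a))) \<xi>s"
proof -
  let ?x = "\<delta> (e (a ! i))"
  have ai: "a ! i \<in> A" using assms(2,3) by auto
  have x: "?x \<in> V (dg (a ! i) + 1)" by (rule \<delta>_e[OF \<delta> ai])
  have 1: "twist d ?x = scale (parity_sign d) (scale (parity_sign (d * dg (a ! i))) ?x)"
    by (simp add: V_twist[OF x] distrib_left parity_sign_add mult.commute)
  have 2: "\<delta> (twist d (e (a ! i))) = scale (parity_sign (d * dg (a ! i))) ?x"
    by (simp add: V_twist[OF e_in_V[OF ai]] \<delta>_scale[OF \<delta>])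
  have 3: "map (twist d) (din i (map e a)) =
      map (twist d) (take i (map e a)) @ scale (parity_sign d) (\<delta> (twist d (e (a ! i)))) # map (twist 1) (map (twist d) (drop (Suc i) (map e a)))"
    using assms(2) by (simp add: d_in_def[OF \<delta>] 1 2 twist_twist add.commute)
  have 4: "din i (map (twist d) (map e a)) =
      map (twist d) (take i (map e a)) @ \<delta> (twist d (e (a ! i))) # map (twist 1) (map (twist d) (drop (Suc i) (map e a)))"
    using assms(2) by (simp add: d_in_def[OF \<delta>] take_map drop_map)
  show ?thesis
    unfolding 3 4
    using multilinear_scale_slot[OF assms(1), of "us @ map (twist d) (take i (map e a))"] by simp
qed

text \<open>Both sides are expanded over the legs of the composite. The right side contains in
  addition two terms with \<delta> on the internal edge, once as last output of \<open>f\<close> and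
  once as first input of \<open>g\<close>; they have opposite signs and cancel.\<close>

theorem end_diff_comp:
  assumes f: "f \<in> End (Suc m1) n1 df" and g: "g \<in> End m2 (Suc n2) d"
  shows "end_diff \<delta> (d + df) (end_comp m1 n1 d df g f) =
    end_comp m1 n1 d (df + 1) g (end_diff \<delta> df f) +
    (\<lambda>xs \<xi>s. parity_sign df * end_comp m1 n1 (d + 1) df (end_diff \<delta> d g) f xs \<xi>s)"
    (is "?L = ?R1 + ?R2")
proof (rule End_eqI)
  let ?s = "parity_sign :: int \<Rightarrow> 'k"
  have Df: "end_diff \<delta> df f \<in> End (Suc m1) n1 (df + 1)" by (rule End_end_diff[OF \<delta> f])
  have Dg: "end_diff \<delta> d g \<in> End m2 (Suc n2) (d + 1)" by (rule End_end_diff[OF \<delta> g])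
  show "?L \<in> End (m1 + m2) (n1 + n2) (d + df + 1)"
    by (rule End_end_diff[OF \<delta> End_end_comp[OF f g]])
  have "?R1 \<in> End (m1 + m2) (n1 + n2) (d + (df + 1))" by (rule End_end_comp[OF Df g])
  moreover have "?R2 \<in> End (m1 + m2) (n1 + n2) (d + 1 + df)" by (rule End_scale[OF End_end_comp[OF f Dg]])
  ultimately show "?R1 + ?R2 \<in> End (m1 + m2) (n1 + n2) (d + df + 1)"
    using End_add[of ?R1 "m1 + m2" "n1 + n2" "d + df + 1" ?R2] by (simp add: algebra_simps)
  fix \<alpha> \<beta> assume "\<alpha> \<in> words (n1 + n2)" "\<beta> \<in> words (m1 + m2)"
  then obtain a1 a2 b1 b2 where w: "\<alpha> = a1 @ a2" "\<beta> = b1 @ b2"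
    "length a1 = n1" "length a2 = n2" "length b1 = m1" "length b2 = m2"
    "set a1 \<subseteq> A" "set a2 \<subseteq> A" "set b1 \<subseteq> A" "set b2 \<subseteq> A"
    using that[of "take n1 \<alpha>" "drop n1 \<alpha>" "take m1 \<beta>" "drop m1 \<beta>"]
      set_take_subset[of n1 \<alpha>] set_drop_subset[of n1 \<alpha>] set_take_subset[of m1 \<beta>] set_drop_subset[of m1 \<beta>]
    by (auto simp: words_def)
  define x y \<zeta> \<eta> where xy: "x = map e a1" "y = map e a2" "\<zeta> = map dual b1" "\<eta> = map dual b2"
  have len: "length x = n1" "length y = n2" "length \<zeta> = m1" "length \<eta> = m2"
    and fn: "set \<zeta> \<subseteq> functionals" "set \<eta> \<subseteq> functionals" using w by (auto simp: xy)
  \<comment> \<open>The functional plugged into the last output of \<open>f\<close>: its argument is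
    fed into \<open>g\<close> together with the \<open>d'\<close>-twisted remaining inputs.
    Differentiating \<open>f\<close> raises its degree, so \<open>d'\<close> is \<open>df\<close> in
    some terms and \<open>df + 1\<close> in others.\<close>
  define h where "h = (\<lambda>d' y \<eta> v. g (v # map (twist d') y) \<eta>)"
  have hf: "h d' y \<eta> \<in> functionals" for d' y \<eta>
    unfolding h_def by (rule input_functional[OF End_multilinear[OF g]])
  note tl = tensors_last[OF End_tensors[OF f]] and tsl = tensors_sum_last[OF End_tensors[OF f]]
  have comp: "end_comp m1 n1 d df g f (x' @ y') (\<zeta>' @ \<eta>') = ?s (df * d) * f x' (\<zeta>' @ [h df y' \<eta>'])"
    if "length x' = n1" "length \<zeta>' = m1" for x' y' \<zeta>' \<eta>'
    using that by (simp add: end_comp_def h_def)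
  have L: "?L (x @ y) (\<zeta> @ \<eta>) = ?s (df * d) *
     ((\<Sum>j<m1. f x (dout j \<zeta> @ [h df y (map (\<lambda>\<xi>. \<xi> \<circ> twist 1) \<eta>)])) + (\<Sum>j<m2. f x (\<zeta> @ [h df y (dout j \<eta>)]))
     - ?s (d + df) * ((\<Sum>i<n1. f (din i x) (\<zeta> @ [h df (map (twist 1) y) \<eta>])) + (\<Sum>i<n2. f x (\<zeta> @ [h df (din i y) \<eta>]))))"
  proof -
    have "(\<Sum>j<length (\<zeta> @ \<eta>). end_comp m1 n1 d df g f (x @ y) (dout j (\<zeta> @ \<eta>))) =
        (\<Sum>j<m1. end_comp m1 n1 d df g f (x @ y) (dout j \<zeta> @ map (\<lambda>\<xi>. \<xi> \<circ> twist 1) \<eta>)) +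
        (\<Sum>j<m2. end_comp m1 n1 d df g f (x @ y) (\<zeta> @ dout j \<eta>))"
      using d_out_append2[of \<zeta> _ \<eta>] by (simp add: sum_lessThan_add len d_out_append1)
    also have "\<dots> = ?s (df * d) * ((\<Sum>j<m1. f x (dout j \<zeta> @ [h df y (map (\<lambda>\<xi>. \<xi> \<circ> twist 1) \<eta>)])) + (\<Sum>j<m2. f x (\<zeta> @ [h df y (dout j \<eta>)])))"
      by (simp add: comp len \<delta> sum_distrib_left distrib_left)
    finally have 1: "(\<Sum>j<length (\<zeta> @ \<eta>). end_comp m1 n1 d df g f (x @ y) (dout j (\<zeta> @ \<eta>))) = \<dots>" .
    have "(\<Sum>i<length (x @ y). end_comp m1 n1 d df g f (din i (x @ y)) (\<zeta> @ \<eta>)) =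
        (\<Sum>i<n1. end_comp m1 n1 d df g f (din i x @ map (twist 1) y) (\<zeta> @ \<eta>)) +
        (\<Sum>i<n2. end_comp m1 n1 d df g f (x @ din i y) (\<zeta> @ \<eta>))"
      using d_in_append2[of x _ y] by (simp add: sum_lessThan_add len d_in_append1)
    also have "\<dots> = ?s (df * d) * ((\<Sum>i<n1. f (din i x) (\<zeta> @ [h df (map (twist 1) y) \<eta>])) + (\<Sum>i<n2. f x (\<zeta> @ [h df (din i y) \<eta>])))"
      by (simp add: comp len \<delta> sum_distrib_left distrib_left)
    finally have 2: "(\<Sum>i<length (x @ y). end_comp m1 n1 d df g f (din i (x @ y)) (\<zeta> @ \<eta>)) = \<dots>" .
    have "set (\<zeta> @ \<eta>) \<subseteq> functionals" using fn by simp
    from end_diff_functionals[OF this, of "d + df" "end_comp m1 n1 d df g f" "x @ y", unfolded 1 2]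
    show ?thesis by (simp add: algebra_simps)
  qed
  have R1: "?R1 (x @ y) (\<zeta> @ \<eta>) = ?s ((df + 1) * d) *
      ((\<Sum>j<m1. f x (dout j \<zeta> @ [h (df + 1) y \<eta> \<circ> twist 1])) + f x (\<zeta> @ [h (df + 1) y \<eta> \<circ> \<delta>])
       - ?s df * (\<Sum>i<n1. f (din i x) (\<zeta> @ [h (df + 1) y \<eta>])))"
  proof -
    let ?l = "\<zeta> @ [h (df + 1) y \<eta>]"
    have "set ?l \<subseteq> functionals" using fn hf by simp
    from end_diff_functionals[OF this, of df f x]
    have "end_diff \<delta> df f x ?l = (\<Sum>j<Suc m1. f x (dout j ?l)) - ?s df * (\<Sum>i<n1. f (din i x) ?l)"
      by (simp add: len)
    also have "(\<Sum>j<Suc m1. f x (dout j ?l)) = (\<Sum>j<m1. f x (dout j \<zeta> @ [h (df + 1) y \<eta> \<circ> twist 1])) + f x (\<zeta> @ [h (df + 1) y \<eta> \<circ> \<delta>])"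
      using d_out_append2[of \<zeta> 0 "[h (df + 1) y \<eta>]"] by (simp add: len d_out_append1) (simp add: d_out_def[OF \<delta>])
    finally show ?thesis
      using len by (simp add: end_comp_def h_def)
  qed
  have R2: "?R2 (x @ y) (\<zeta> @ \<eta>) = ?s df * ?s (df * (d + 1)) *
      ((\<Sum>j<m2. f x (\<zeta> @ [h df y (dout j \<eta>)])) - ?s d * (f x (\<zeta> @ [h (df + 1) y \<eta> \<circ> \<delta>]) +
        (\<Sum>i<n2. ?s df * f x (\<zeta> @ [h df (din i y) \<eta>]))))"
  proof -
    have "(\<lambda>v. end_diff \<delta> d g (v # map (twist df) y) \<eta>) =
      (\<lambda>v. (\<Sum>j<m2. h df y (dout j \<eta>) v) + (- ?s d) * ((h (df + 1) y \<eta> \<circ> \<delta>) v + ?s df * (\<Sum>i<n2. h df (din i y) \<eta> v)))"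
    proof
      fix v
      have "(\<Sum>i<Suc n2. g (din i (v # map (twist df) y)) \<eta>) =
          g (din 0 (v # map (twist df) y)) \<eta> + (\<Sum>i<n2. g (din (Suc i) (v # map (twist df) y)) \<eta>)"
        by (rule sum.lessThan_Suc_shift)
      also have "g (din 0 (v # map (twist df) y)) \<eta> = (h (df + 1) y \<eta> \<circ> \<delta>) v"
        by (simp add: d_in_def[OF \<delta>] h_def twist_twist add.commute o_def)
      also have "(\<Sum>i<n2. g (din (Suc i) (v # map (twist df) y)) \<eta>) = (\<Sum>i<n2. ?s df * h df (din i y) \<eta> v)"
      proof (rule sum.cong)
        fix i assume "i \<in> {..<n2}"
        then have "g ([v] @ map (twist df) (din i (map e a2))) \<eta> = ?s df * g ([v] @ din i (map (twist df) (map e a2))) \<eta>"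
          by (intro d_in_twist[OF End_multilinear[OF g]]) (use w in auto)
        then have "?s df * h df (din i y) \<eta> v = g ([v] @ din i (map (twist df) y)) \<eta>"
          by (simp add: h_def xy)
        moreover have "din (Suc i) (v # map (twist df) y) = [v] @ din i (map (twist df) y)"
          using d_in_append2[of "[v]" i "map (twist df) y"] by simp
        ultimately show "g (din (Suc i) (v # map (twist df) y)) \<eta> = ?s df * h df (din i y) \<eta> v" by simp
      qed simp
      finally show "end_diff \<delta> d g (v # map (twist df) y) \<eta> =
        (\<Sum>j<m2. h df y (dout j \<eta>) v) + (- ?s d) * ((h (df + 1) y \<eta> \<circ> \<delta>) v + ?s df * (\<Sum>i<n2. h df (din i y) \<eta> v))"
        using end_diff_functionals[OF fn(2), of d g "v # map (twist df) y"] len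
        by (simp add: h_def sum_distrib_left)
    qed
    moreover have "f x (\<zeta> @ [\<lambda>v. (\<Sum>j<m2. h df y (dout j \<eta>) v) + (- ?s d) * ((h (df + 1) y \<eta> \<circ> \<delta>) v + ?s df * (\<Sum>i<n2. h df (din i y) \<eta> v))]) =
       (\<Sum>j<m2. f x (\<zeta> @ [h df y (dout j \<eta>)])) + (- ?s d) * (f x (\<zeta> @ [h (df + 1) y \<eta> \<circ> \<delta>]) + ?s df * (\<Sum>i<n2. f x (\<zeta> @ [h df (din i y) \<eta>])))"
      by (subst tl, (rule functionals_sum functionals_combine hf functional_comp[OF lin_dg[OF \<delta>]])+,
          subst tl, (rule functionals_sum functionals_combine hf functional_comp[OF lin_dg[OF \<delta>]])+,
          simp add: tsl hf)
    ultimately show ?thesis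
      using len by (simp add: end_comp_def sum_distrib_left)
  qed
  \<comment> \<open>When \<delta> acts on an output of \<open>f\<close>, the outputs \<eta> of
    \<open>g\<close> are twisted. This twist is moved through \<open>g\<close> onto its inputs at
    the cost of the sign of \<open>d\<close>, where it merges with the twist by
    \<open>df\<close>.\<close>
  have 1: "h df y (map (\<lambda>\<xi>. \<xi> \<circ> twist 1) \<eta>) = (\<lambda>v. 0 + ?s d * (h (df + 1) y \<eta> \<circ> twist 1) v)"
    unfolding xy(4) h_def End_twist[OF g w(10)] by (simp add: twist_twist o_def add.commute xy fun_eq_iff)
  have 1: "f x' (\<zeta>' @ [h df y (map (\<lambda>\<xi>. \<xi> \<circ> twist 1) \<eta>)]) = ?s d * f x' (\<zeta>' @ [h (df + 1) y \<eta> \<circ> twist 1])" for x' \<zeta>'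
    unfolding 1 using tl[OF zero_functional functional_comp[OF lin_twist hf], of x' \<zeta>' "?s d"]
      tensors_slot_zero[OF End_tensors[OF f], of "length \<zeta>'" "\<zeta>' @ [\<lambda>_. 0]"] by simp
  have 2: "h df (map (twist 1) y) \<eta> = h (df + 1) y \<eta>"
    by (simp add: h_def fun_eq_iff twist_twist o_def)
  have "?L (x @ y) (\<zeta> @ \<eta>) = ?R1 (x @ y) (\<zeta> @ \<eta>) + ?R2 (x @ y) (\<zeta> @ \<eta>)"
    unfolding L R1 R2 1 2 sum_distrib_left[symmetric]
    by (simp add: parity_sign_add algebra_simps)
  then show "mat ?L \<alpha> \<beta> = mat (?R1 + ?R2) \<alpha> \<beta>"
    by (simp add: mat_def w(1,2) xy)
qed

end

end

section \<open>Sums over indices; the differential and the symmetric groups\<close>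

lemma Sum_any_cmult: "c * Sum_any g = Sum_any (\<lambda>x. c * g x :: 'a :: semiring_no_zero_divisors)"
\<comment> \<open>A nonzero constant leaves the support unchanged, so either both sums are finite or
  both take the default value 0. For \<open>c = 0\<close> both sides are 0 in any case.\<close>
proof (cases "c = 0")
  case True
  then show ?thesis by (simp only: mult_zero_left Sum_any.neutral)
next
  case False
  then have "{a. c * g a \<noteq> 0} = {a. g a \<noteq> 0}" by simp
  then show ?thesis by (simp add: Sum_any.expand_set sum_distrib_left)
qed

lemma Sum_any_multc: "Sum_any g * c = Sum_any (\<lambda>x. g x * c :: 'a :: semiring_no_zero_divisors)"
proof (cases "c = 0")
  case True
  then show ?thesis by (simp only: mult_zero_right Sum_any.neutral)
next
  case False
  then have "{a. g a * c \<noteq> 0} = {a. g a \<noteq> 0}" by simp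
  then show ?thesis by (simp add: Sum_any.expand_set sum_distrib_right)
qed

text \<open>The support must be finite jointly in both variables: an infinite family has
  \<open>Sum_any\<close> equal to 0 by default, and iterated sums could then disagree.\<close>

lemma Sum_any_swap:
  assumes "finite {(a, b). g a b \<noteq> 0}"
  shows "Sum_any (\<lambda>a. Sum_any (\<lambda>b. g a b)) = Sum_any (\<lambda>b. Sum_any (\<lambda>a. g a b))"
proof (rule Sum_any.swap)
  show "finite (fst ` {(a, b). g a b \<noteq> 0} \<times> snd ` {(a, b). g a b \<noteq> 0})" using assms by simp
  show "{a. \<exists>b. g a b \<noteq> 0} \<times> {b. \<exists>a. g a b \<noteq> 0} \<subseteq> fst ` {(a, b). g a b \<noteq> 0} \<times> snd ` {(a, b). g a b \<noteq> 0}"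
    by (force simp: image_iff)
qed

text \<open>The part of a position word behind the first occurrence of \<open>j\<close>: the factors
  that an operator sitting at \<open>j\<close> has to pass.\<close>

primrec after :: "nat \<Rightarrow> nat list \<Rightarrow> nat list" where
  "after j [] = []"
| "after j (a # l) = (if a = j then l else after j l)"

lemma after_append: "after j (x @ l) = (if j \<in> set x then after j x @ l else after j l)"
  by (induction x) auto

text \<open>An odd operator changes the parity of the letter at \<open>\<sigma> k\<close>. The
  Koszul sign then changes by the sign of carrying the operator from its place in \<open>w\<close>
  to its place in the permuted word, which is the quotient of the two tail signs. This is what makes
  the differential equivariant.\<close>

lemma perm_sign_odd_letter:
  assumes \<sigma>: "\<sigma> permutes {..<length w}" and k: "k < length w" and \<gamma>: "odd (d \<gamma> + d (w ! \<sigma> k))"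
  shows "perm_sign (graded_swap d) \<sigma> (w[\<sigma> k := \<gamma>]) * parity_sign (\<Sum>a\<leftarrow>drop (Suc (\<sigma> k)) w. d a) =
    perm_sign (graded_swap d) \<sigma> w * (parity_sign (\<Sum>a\<leftarrow>drop (Suc k) (permute_list \<sigma> w). d a) :: 'k :: comm_ring_1)"
proof -
  let ?n = "length w" and ?j = "\<sigma> k" and ?l = "map \<sigma> [0..<length w]"
  let ?s = "parity_sign :: int \<Rightarrow> 'k"
  \<comment> \<open>\<open>\<rho>\<close> is the quotient of the swap weights after and before the
    change of letter, \<open>\<Phi>\<close> the sign of the tail behind position \<open>?j\<close>.
    Since \<open>\<Phi>\<close> is alternating for \<open>\<rho>\<close>, its values at the sorted
    and at the permuted positions differ by the inversion sign of \<open>\<rho>\<close>.\<close>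
  define \<rho> where "\<rho> p q = (if p = ?j then ?s (d (w ! q)) else if q = ?j then ?s (d (w ! p)) else 1)" for p q
  define \<Phi> where "\<Phi> l = (if distinct l \<and> ?j \<in> set l then ?s (\<Sum>p\<leftarrow>after ?j l. d (w ! p)) else 0)" for l
  have "alternating \<rho> \<Phi>"
    unfolding alternating_def
  proof (intro allI)
    fix x y :: "nat list" and a b
    show "\<Phi> (x @ a # b # y) = \<rho> a b * \<Phi> (x @ b # a # y)"
    proof (cases "distinct (x @ a # b # y) \<and> ?j \<in> set (x @ a # b # y)")
      case True
      then consider "?j \<in> set x" "a \<noteq> ?j" "b \<noteq> ?j" | "?j \<notin> set x" "a = ?j" "b \<noteq> ?j" | "?j \<notin> set x" "b = ?j" "a \<noteq> ?j"
        | "?j \<notin> set x" "b \<noteq> ?j" "a \<noteq> ?j" "?j \<in> set y" by auto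
      then show ?thesis
        using True by cases (auto simp: \<Phi>_def \<rho>_def after_append parity_sign_add add_ac mult_ac)
    next
      case False
      then have "\<not> (distinct (x @ b # a # y) \<and> ?j \<in> set (x @ b # a # y))" by auto
      then have "\<Phi> (x @ b # a # y) = 0" unfolding \<Phi>_def by (rule if_not_P)
      moreover have "\<Phi> (x @ a # b # y) = 0" using False unfolding \<Phi>_def by (rule if_not_P)
      ultimately show ?thesis by simp
    qed
  qed
  from alternating_sort[OF this, of ?l]
  have *: "\<Phi> ?l = inversion_sign \<rho> ?l * \<Phi> [0..<?n]"
    by (simp add: sort_map_permutes[OF \<sigma>])
  have j: "?j < ?n" using permutes_in_image[OF \<sigma>] k by auto
  have split: "[0..<?n] = [0..<i] @ i # [Suc i..<?n]" if "i < ?n" for i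
    using that by (metis upt_add_eq_append upt_conv_Cons le0 le_add_diff_inverse less_imp_le)
  have 1: "after ?j [0..<?n] = [Suc ?j..<?n]"
    by (subst split[OF j]) (simp add: after_append)
  have "?j \<notin> set (map \<sigma> [0..<k])"
    using inj_eq[OF permutes_inj[OF \<sigma>]] by auto
  then have 2: "after ?j ?l = map \<sigma> [Suc k..<?n]"
    by (subst split[OF k]) (simp add: after_append)
  have drop: "drop i v = map (nth v) [i..<length v]" for i and v :: "'a list"
    by (rule nth_equalityI) auto
  have "\<Phi> [0..<?n] = ?s (\<Sum>a\<leftarrow>drop (Suc ?j) w. d a)"
    using j by (simp add: \<Phi>_def 1 drop o_def)
  moreover have "\<Phi> ?l = ?s (\<Sum>a\<leftarrow>drop (Suc k) (permute_list \<sigma> w). d a)"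
    using k permutes_inj_on[OF \<sigma>] unfolding \<Phi>_def 2
    by (simp add: distinct_map drop_map permute_list_def o_def)
  moreover have "perm_sign (graded_swap d) \<sigma> (w[?j := \<gamma>]) = perm_sign (graded_swap d) \<sigma> w * inversion_sign \<rho> ?l"
  proof -
    have g: "graded_swap d (w[?j := \<gamma>] ! p) (w[?j := \<gamma>] ! q) = graded_swap d (w ! p) (w ! q) * \<rho> p q"
      if "p < ?n" "q < ?n" "p \<noteq> q" for p q
      using that \<gamma> j by (auto simp: graded_swap_def \<rho>_def nth_list_update parity_sign_def)
    have lt: "\<sigma> i < ?n" if "i < ?n" for i using permutes_in_image[OF \<sigma>] that by auto
    have "perm_sign (graded_swap d) \<sigma> (w[?j := \<gamma>]) =
        inversion_sign (\<lambda>p q. graded_swap d (w ! p) (w ! q) * \<rho> p q) ?l"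
      unfolding perm_sign_def inversion_sign_def length_list_update
    proof (rule prod.cong)
      fix z assume z: "z \<in> {(i, j). i < j \<and> j < length ?l \<and> ?l ! j < ?l ! i}"
      obtain i i' where zz: "z = (i, i')" by (cases z)
      then have i: "i < ?n" "i' < ?n" "?l ! i' < ?l ! i" using z by auto
      then have "?l ! i < ?n" "?l ! i' < ?n" "?l ! i \<noteq> ?l ! i'" using lt by auto
      from g[OF this] show "(case z of (i, j) \<Rightarrow> graded_swap d (w[?j := \<gamma>] ! (?l ! i)) (w[?j := \<gamma>] ! (?l ! j))) =
          (case z of (i, j) \<Rightarrow> graded_swap d (w ! (?l ! i)) (w ! (?l ! j)) * \<rho> (?l ! i) (?l ! j))"
        by (simp only: zz prod.case)
    qed simp
    also have "\<dots> = perm_sign (graded_swap d) \<sigma> w * inversion_sign \<rho> ?l"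
      unfolding perm_sign_def inversion_sign_def prod.distrib[symmetric] by (rule prod.cong) auto
    finally show ?thesis .
  qed
  ultimately show ?thesis using * by (simp add: mult_ac)
qed

context based_graded_space begin

lemma permute_words: "\<sigma> permutes {..<n} \<Longrightarrow> w \<in> words n \<Longrightarrow> permute_list \<sigma> w \<in> words n"
  by (simp add: words_def)

lemma deg_permute: "\<sigma> permutes {..<length w} \<Longrightarrow> deg (permute_list \<sigma> w) = deg w"
  unfolding deg_def by (rule sum_list_map_mset_cong) simp

context
  fixes \<delta> :: "'v \<Rightarrow> 'v"
  assumes \<delta>: "dg_vector_space \<delta>"
begin

text \<open>The sum over outputs is reindexed by \<sigma> and compared term by term through
  \<open>perm_sign_odd_letter\<close>; a nonzero entry of the matrix of \<delta> supplies the change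
  of parity. In the sum over inputs the Koszul sign is a common factor.\<close>

lemma end_diff_out:
  assumes f: "f \<in> End m n d" and \<sigma>: "\<sigma> permutes {..<m}"
  shows "end_diff \<delta> d (end_out \<sigma> f) = end_out \<sigma> (end_diff \<delta> d f)"
proof (rule End_eqI)
  let ?s = "parity_sign :: int \<Rightarrow> 'k" and ?kz = "perm_sign (graded_swap dg) \<sigma>"
  note Of = End_end_out[OF f \<sigma>]
  show "end_diff \<delta> d (end_out \<sigma> f) \<in> End m n (d + 1)" by (rule End_end_diff[OF \<delta> Of])
  show "end_out \<sigma> (end_diff \<delta> d f) \<in> End m n (d + 1)" by (rule End_end_out[OF End_end_diff[OF \<delta> f] \<sigma>])
  fix \<alpha> \<beta> assume w: "\<alpha> \<in> words n" "\<beta> \<in> words m"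
  then have len: "length \<beta> = m" by (simp add: words_def)
  let ?p = "permute_list \<sigma> \<beta>"
  let ?F = "\<lambda>j. ?s (deg (drop (Suc j) \<beta>)) * Sum_any (\<lambda>\<gamma>. d_mat \<delta> \<gamma> (\<beta> ! j) * (?kz (\<beta>[j := \<gamma>]) * mat f \<alpha> (permute_list \<sigma> (\<beta>[j := \<gamma>]))))"
  let ?G = "\<lambda>j. ?s (deg (drop (Suc j) ?p)) * Sum_any (\<lambda>\<gamma>. d_mat \<delta> \<gamma> (?p ! j) * mat f \<alpha> (?p[j := \<gamma>]))"
  have FG: "?F (\<sigma> k) = ?kz \<beta> * ?G k" if k: "k < m" for k
  proof -
    have \<sigma>k: "\<sigma> k < m" using permutes_in_image[OF \<sigma>] k by auto
    have pk: "?p ! k = \<beta> ! \<sigma> k" using k len by (simp add: permute_list_def)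
    have pu: "permute_list \<sigma> (\<beta>[\<sigma> k := \<gamma>]) = ?p[k := \<gamma>]" for \<gamma>
      using permute_list_update[of \<sigma> \<beta> "\<sigma> k" \<gamma>] \<sigma> \<sigma>k len by (simp add: permutes_inverses)
    show ?thesis
      unfolding Sum_any_cmult
    proof (rule arg_cong[where f = Sum_any], rule ext)
      fix \<gamma>
      show "?s (deg (drop (Suc (\<sigma> k)) \<beta>)) * (d_mat \<delta> \<gamma> (\<beta> ! \<sigma> k) * (?kz (\<beta>[\<sigma> k := \<gamma>]) * mat f \<alpha> (permute_list \<sigma> (\<beta>[\<sigma> k := \<gamma>])))) =
          ?kz \<beta> * (?s (deg (drop (Suc k) ?p)) * (d_mat \<delta> \<gamma> (?p ! k) * mat f \<alpha> (?p[k := \<gamma>])))"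
      proof (cases "d_mat \<delta> \<gamma> (\<beta> ! \<sigma> k) = 0")
        case False
        then have "odd (dg \<gamma> + dg (\<beta> ! \<sigma> k))" using d_mat_degree[OF \<delta>] by fastforce
        then have "?kz (\<beta>[\<sigma> k := \<gamma>]) * ?s (deg (drop (Suc (\<sigma> k)) \<beta>)) = ?kz \<beta> * ?s (deg (drop (Suc k) ?p))"
          using perm_sign_odd_letter[of \<sigma> \<beta> k dg \<gamma>] \<sigma> k len by (simp add: deg_def)
        then show ?thesis by (simp add: pk pu mult_ac)
      qed (simp add: pk)
    qed
  qed
  have "mat (end_diff \<delta> d (end_out \<sigma> f)) \<alpha> \<beta> = (\<Sum>j<m. ?F j) -
      ?s d * (\<Sum>i<n. ?s (deg (drop (Suc i) \<alpha>)) * Sum_any (\<lambda>\<gamma>. d_mat \<delta> (\<alpha> ! i) \<gamma> * (?kz \<beta> * mat f (take i \<alpha> @ \<gamma> # drop (Suc i) \<alpha>) ?p)))"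
    unfolding mat_end_diff[OF \<delta> Of w] mat_end_out[OF f \<sigma>] using len
    by (intro arg_cong2[where f = minus] sum.cong) (simp_all add: upd_conv_take_nth_drop)
  also have "(\<Sum>j<m. ?F j) = (\<Sum>k<m. ?F (\<sigma> k))"
    using sum.permute[OF \<sigma>, of ?F] by (simp add: o_def)
  also have "\<dots> = ?kz \<beta> * (\<Sum>k<m. ?G k)"
    unfolding sum_distrib_left by (rule sum.cong) (use FG in auto)
  also have "(\<Sum>i<n. ?s (deg (drop (Suc i) \<alpha>)) * Sum_any (\<lambda>\<gamma>. d_mat \<delta> (\<alpha> ! i) \<gamma> * (?kz \<beta> * mat f (take i \<alpha> @ \<gamma> # drop (Suc i) \<alpha>) ?p))) =
      ?kz \<beta> * (\<Sum>i<n. ?s (deg (drop (Suc i) \<alpha>)) * Sum_any (\<lambda>\<gamma>. d_mat \<delta> (\<alpha> ! i) \<gamma> * mat f (take i \<alpha> @ \<gamma> # drop (Suc i) \<alpha>) ?p))"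
    by (simp add: sum_distrib_left Sum_any_cmult mult_ac)
  also have "?kz \<beta> * (\<Sum>k<m. ?G k) - ?s d * (?kz \<beta> * (\<Sum>i<n. ?s (deg (drop (Suc i) \<alpha>)) * Sum_any (\<lambda>\<gamma>. d_mat \<delta> (\<alpha> ! i) \<gamma> * mat f (take i \<alpha> @ \<gamma> # drop (Suc i) \<alpha>) ?p))) =
      ?kz \<beta> * mat (end_diff \<delta> d f) \<alpha> ?p"
    unfolding mat_end_diff[OF \<delta> f w(1) permute_words[OF \<sigma> w(2)]] using len
    by (simp add: algebra_simps upd_conv_take_nth_drop)
  also have "\<dots> = mat (end_out \<sigma> (end_diff \<delta> d f)) \<alpha> \<beta>"
    by (simp add: mat_end_out[OF End_end_diff[OF \<delta> f] \<sigma>])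
  finally show "mat (end_diff \<delta> d (end_out \<sigma> f)) \<alpha> \<beta> = mat (end_out \<sigma> (end_diff \<delta> d f)) \<alpha> \<beta>" .
qed

lemma end_diff_in:
  assumes f: "f \<in> End m n d" and \<sigma>: "\<sigma> permutes {..<n}"
  shows "end_diff \<delta> d (end_in \<sigma> f) = end_in \<sigma> (end_diff \<delta> d f)"
proof (rule End_eqI)
  let ?s = "parity_sign :: int \<Rightarrow> 'k" and ?kz = "perm_sign (graded_swap dg) \<sigma>"
  note Of = End_end_in[OF f \<sigma>]
  show "end_diff \<delta> d (end_in \<sigma> f) \<in> End m n (d + 1)" by (rule End_end_diff[OF \<delta> Of])
  show "end_in \<sigma> (end_diff \<delta> d f) \<in> End m n (d + 1)" by (rule End_end_in[OF End_end_diff[OF \<delta> f] \<sigma>])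
  fix \<alpha> \<beta> assume w: "\<alpha> \<in> words n" "\<beta> \<in> words m"
  then have len: "length \<alpha> = n" by (simp add: words_def)
  let ?p = "permute_list \<sigma> \<alpha>"
  let ?F = "\<lambda>j. ?s (deg (drop (Suc j) \<alpha>)) * Sum_any (\<lambda>\<gamma>. d_mat \<delta> (\<alpha> ! j) \<gamma> * (?kz (\<alpha>[j := \<gamma>]) * mat f (permute_list \<sigma> (\<alpha>[j := \<gamma>])) \<beta>))"
  let ?G = "\<lambda>j. ?s (deg (drop (Suc j) ?p)) * Sum_any (\<lambda>\<gamma>. d_mat \<delta> (?p ! j) \<gamma> * mat f (?p[j := \<gamma>]) \<beta>)"
  have FG: "?F (\<sigma> k) = ?kz \<alpha> * ?G k" if k: "k < n" for k
  proof -
    have \<sigma>k: "\<sigma> k < n" using permutes_in_image[OF \<sigma>] k by auto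
    have pk: "?p ! k = \<alpha> ! \<sigma> k" using k len by (simp add: permute_list_def)
    have pu: "permute_list \<sigma> (\<alpha>[\<sigma> k := \<gamma>]) = ?p[k := \<gamma>]" for \<gamma>
      using permute_list_update[of \<sigma> \<alpha> "\<sigma> k" \<gamma>] \<sigma> \<sigma>k len by (simp add: permutes_inverses)
    show ?thesis
      unfolding Sum_any_cmult
    proof (rule arg_cong[where f = Sum_any], rule ext)
      fix \<gamma>
      show "?s (deg (drop (Suc (\<sigma> k)) \<alpha>)) * (d_mat \<delta> (\<alpha> ! \<sigma> k) \<gamma> * (?kz (\<alpha>[\<sigma> k := \<gamma>]) * mat f (permute_list \<sigma> (\<alpha>[\<sigma> k := \<gamma>])) \<beta>)) =
          ?kz \<alpha> * (?s (deg (drop (Suc k) ?p)) * (d_mat \<delta> (?p ! k) \<gamma> * mat f (?p[k := \<gamma>]) \<beta>))"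
      proof (cases "d_mat \<delta> (\<alpha> ! \<sigma> k) \<gamma> = 0")
        case False
        then have "odd (dg \<gamma> + dg (\<alpha> ! \<sigma> k))" using d_mat_degree[OF \<delta>] by fastforce
        then have "?kz (\<alpha>[\<sigma> k := \<gamma>]) * ?s (deg (drop (Suc (\<sigma> k)) \<alpha>)) = ?kz \<alpha> * ?s (deg (drop (Suc k) ?p))"
          using perm_sign_odd_letter[of \<sigma> \<alpha> k dg \<gamma>] \<sigma> k len by (simp add: deg_def)
        then show ?thesis by (simp add: pk pu mult_ac)
      qed (simp add: pk)
    qed
  qed
  have "mat (end_diff \<delta> d (end_in \<sigma> f)) \<alpha> \<beta> =
      (\<Sum>j<m. ?s (deg (drop (Suc j) \<beta>)) * Sum_any (\<lambda>\<gamma>. d_mat \<delta> \<gamma> (\<beta> ! j) * (?kz \<alpha> * mat f ?p (take j \<beta> @ \<gamma> # drop (Suc j) \<beta>)))) -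
      ?s d * (\<Sum>i<n. ?F i)"
    unfolding mat_end_diff[OF \<delta> Of w] mat_end_in[OF f \<sigma>] using len
    by (intro arg_cong2[where f = minus] arg_cong2[where f = times] sum.cong) (simp_all add: upd_conv_take_nth_drop)
  also have "(\<Sum>j<n. ?F j) = (\<Sum>k<n. ?F (\<sigma> k))"
    using sum.permute[OF \<sigma>, of ?F] by (simp add: o_def)
  also have "\<dots> = ?kz \<alpha> * (\<Sum>k<n. ?G k)"
    unfolding sum_distrib_left by (rule sum.cong) (use FG in auto)
  also have "(\<Sum>j<m. ?s (deg (drop (Suc j) \<beta>)) * Sum_any (\<lambda>\<gamma>. d_mat \<delta> \<gamma> (\<beta> ! j) * (?kz \<alpha> * mat f ?p (take j \<beta> @ \<gamma> # drop (Suc j) \<beta>)))) =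
      ?kz \<alpha> * (\<Sum>j<m. ?s (deg (drop (Suc j) \<beta>)) * Sum_any (\<lambda>\<gamma>. d_mat \<delta> \<gamma> (\<beta> ! j) * mat f ?p (take j \<beta> @ \<gamma> # drop (Suc j) \<beta>)))"
    by (simp add: sum_distrib_left Sum_any_cmult mult_ac)
  also have "?kz \<alpha> * (\<Sum>j<m. ?s (deg (drop (Suc j) \<beta>)) * Sum_any (\<lambda>\<gamma>. d_mat \<delta> \<gamma> (\<beta> ! j) * mat f ?p (take j \<beta> @ \<gamma> # drop (Suc j) \<beta>))) -
        ?s d * (?kz \<alpha> * (\<Sum>k<n. ?G k)) =
      ?kz \<alpha> * mat (end_diff \<delta> d f) ?p \<beta>"
    unfolding mat_end_diff[OF \<delta> f permute_words[OF \<sigma> w(1)] w(2)] using len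
    by (simp add: algebra_simps upd_conv_take_nth_drop)
  also have "\<dots> = mat (end_in \<sigma> (end_diff \<delta> d f)) \<alpha> \<beta>"
    by (simp add: mat_end_in[OF End_end_diff[OF \<delta> f] \<sigma>])
  finally show "mat (end_diff \<delta> d (end_in \<sigma> f)) \<alpha> \<beta> = mat (end_in \<sigma> (end_diff \<delta> d f)) \<alpha> \<beta>" .
qed

end

end

context based_graded_space begin

section \<open>The axioms of a dioperad for the endomorphism dioperad\<close>

lemma words_split: "w \<in> words (a + b) \<Longrightarrow> \<exists>u v. w = u @ v \<and> u \<in> words a \<and> v \<in> words b"
  using set_take_subset[of a w] set_drop_subset[of a w]
  by (intro exI[of _ "take a w"] exI[of _ "drop a w"]) (auto simp: words_def)

lemma words_split3: "w \<in> words (a + b + c) \<Longrightarrow> \<exists>u v x. w = u @ v @ x \<and> u \<in> words a \<and> v \<in> words b \<and> x \<in> words c"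
  using words_split[of w "a + b" c] words_split[of _ a b] by (metis append.assoc)

lemma length_words: "w \<in> words n \<Longrightarrow> length w = n"
  by (simp add: words_def)

lemma mat_degree: "f \<in> End m n d \<Longrightarrow> mat f \<alpha> \<beta> \<noteq> 0 \<Longrightarrow> deg \<beta> = deg \<alpha> + d"
  by (rule mat_nonzero(3))

lemma end_in_id: "f \<in> End m n d \<Longrightarrow> end_in id f = f"
  by (rule End_eqI[OF End_end_in]) (auto simp: mat_end_in)

lemma end_out_id: "f \<in> End m n d \<Longrightarrow> end_out id f = f"
  by (rule End_eqI[OF End_end_out]) (auto simp: mat_end_out)

lemma end_in_in:
  assumes f: "f \<in> End m n d" and \<sigma>: "\<sigma> permutes {..<n}" and \<tau>: "\<tau> permutes {..<n}"
  shows "end_in \<sigma> (end_in \<tau> f) = end_in (\<sigma> \<circ> \<tau>) f"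
proof (rule End_eqI)
  show "end_in \<sigma> (end_in \<tau> f) \<in> End m n d" by (intro End_end_in f \<sigma> \<tau>)
  have \<sigma>\<tau>: "\<sigma> \<circ> \<tau> permutes {..<n}" by (rule permutes_compose[OF \<tau> \<sigma>])
  then show "end_in (\<sigma> \<circ> \<tau>) f \<in> End m n d" by (intro End_end_in f)
  fix \<alpha> \<beta> assume "\<alpha> \<in> words n" "\<beta> \<in> words m"
  then show "mat (end_in \<sigma> (end_in \<tau> f)) \<alpha> \<beta> = mat (end_in (\<sigma> \<circ> \<tau>) f) \<alpha> \<beta>"
    using \<sigma> \<tau> perm_sign_compose[of \<sigma> \<alpha> \<tau> "graded_swap dg :: 'i \<Rightarrow> 'i \<Rightarrow> 'k"] permute_list_compose[of \<tau> \<alpha> \<sigma>]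
    by (simp add: mat_end_in[OF End_end_in[OF f \<tau>] \<sigma>] mat_end_in[OF f \<tau>] mat_end_in[OF f \<sigma>\<tau>]
        length_words graded_swap_involutive mult.assoc)
qed

lemma end_out_out:
  assumes f: "f \<in> End m n d" and \<sigma>: "\<sigma> permutes {..<m}" and \<tau>: "\<tau> permutes {..<m}"
  shows "end_out \<sigma> (end_out \<tau> f) = end_out (\<sigma> \<circ> \<tau>) f"
proof (rule End_eqI)
  show "end_out \<sigma> (end_out \<tau> f) \<in> End m n d" by (intro End_end_out f \<sigma> \<tau>)
  have \<sigma>\<tau>: "\<sigma> \<circ> \<tau> permutes {..<m}" by (rule permutes_compose[OF \<tau> \<sigma>])
  then show "end_out (\<sigma> \<circ> \<tau>) f \<in> End m n d" by (intro End_end_out f)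
  fix \<alpha> \<beta> assume "\<alpha> \<in> words n" "\<beta> \<in> words m"
  then show "mat (end_out \<sigma> (end_out \<tau> f)) \<alpha> \<beta> = mat (end_out (\<sigma> \<circ> \<tau>) f) \<alpha> \<beta>"
    using \<sigma> \<tau> perm_sign_compose[of \<sigma> \<beta> \<tau> "graded_swap dg :: 'i \<Rightarrow> 'i \<Rightarrow> 'k"] permute_list_compose[of \<tau> \<beta> \<sigma>]
    by (simp add: mat_end_out[OF End_end_out[OF f \<tau>] \<sigma>] mat_end_out[OF f \<tau>] mat_end_out[OF f \<sigma>\<tau>]
        length_words graded_swap_involutive mult.assoc)
qed

lemma end_out_in:
  assumes f: "f \<in> End m n d" and \<sigma>: "\<sigma> permutes {..<m}" and \<tau>: "\<tau> permutes {..<n}"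
  shows "end_out \<sigma> (end_in \<tau> f) = end_in \<tau> (end_out \<sigma> f)"
  by (rule End_eqI[OF End_end_out[OF End_end_in[OF f \<tau>] \<sigma>] End_end_in[OF End_end_out[OF f \<sigma>] \<tau>]])
    (simp add: mat_end_out[OF End_end_in[OF f \<tau>] \<sigma>] mat_end_in[OF f \<tau>] mat_end_in[OF End_end_out[OF f \<sigma>] \<tau>]
      mat_end_out[OF f \<sigma>] mult_ac)

lemma end_in_add: "f \<in> End m n d \<Longrightarrow> g \<in> End m n d \<Longrightarrow> \<tau> permutes {..<n} \<Longrightarrow> end_in \<tau> (f + g) = end_in \<tau> f + end_in \<tau> g"
  by (rule End_eqI[OF End_end_in[OF End_add] End_add[OF End_end_in End_end_in]])
    (auto simp: mat_end_in[OF End_add] mat_end_in mat_add algebra_simps)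

lemma end_out_add: "f \<in> End m n d \<Longrightarrow> g \<in> End m n d \<Longrightarrow> \<tau> permutes {..<m} \<Longrightarrow> end_out \<tau> (f + g) = end_out \<tau> f + end_out \<tau> g"
  by (rule End_eqI[OF End_end_out[OF End_add] End_add[OF End_end_out End_end_out]])
    (auto simp: mat_end_out[OF End_add] mat_end_out mat_add algebra_simps)

lemma end_in_scale: "end_in \<tau> (\<lambda>xs \<xi>s. c * f xs \<xi>s) = (\<lambda>xs \<xi>s. c * end_in \<tau> f xs \<xi>s)"
  by (auto simp: end_in_def fun_eq_iff sum_distrib_left mult_ac)

lemma end_out_scale: "end_out \<tau> (\<lambda>xs \<xi>s. c * f xs \<xi>s) = (\<lambda>xs \<xi>s. c * end_out \<tau> f xs \<xi>s)"
  by (auto simp: end_out_def fun_eq_iff sum_distrib_left mult_ac)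

lemma end_comp_add_lower: "end_comp m1 n1 d df g (f + f') = end_comp m1 n1 d df g f + end_comp m1 n1 d df g f'"
  by (simp add: end_comp_def fun_eq_iff distrib_left)

lemma end_comp_scale_lower: "end_comp m1 n1 d df g (\<lambda>xs \<xi>s. c * f xs \<xi>s) = (\<lambda>xs \<xi>s. c * end_comp m1 n1 d df g f xs \<xi>s)"
  by (simp add: end_comp_def fun_eq_iff mult_ac)

lemma tensors_last_zero: "t \<in> tensors m D \<Longrightarrow> t (\<zeta>s @ [\<lambda>_. 0]) = 0"
  using tensors_slot_zero[of t m D "length \<zeta>s" "\<zeta>s @ [\<lambda>_. 0]"] by simp

lemma words_1: "w \<in> words 1 \<longleftrightarrow> (\<exists>a\<in>A. w = [a])"
  by (auto simp: words_def length_Suc_conv)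

lemma end_comp_combine_upper:
  assumes "f \<in> End (Suc m1) n1 df" "g \<in> End m2 (Suc n2) d" "g' \<in> End m2 (Suc n2) d"
  shows "end_comp m1 n1 d df (\<lambda>xs \<xi>s. g xs \<xi>s + c * g' xs \<xi>s) f =
    (\<lambda>xs \<xi>s. end_comp m1 n1 d df g f xs \<xi>s + c * end_comp m1 n1 d df g' f xs \<xi>s)"
proof (intro ext)
  fix xs \<xi>s
  show "end_comp m1 n1 d df (\<lambda>xs \<xi>s. g xs \<xi>s + c * g' xs \<xi>s) f xs \<xi>s =
    end_comp m1 n1 d df g f xs \<xi>s + c * end_comp m1 n1 d df g' f xs \<xi>s"
    unfolding end_comp_def
    by (subst tensors_last[OF End_tensors[OF assms(1)]])
      (auto simp: algebra_simps intro!: input_functional End_multilinear[OF assms(2)] End_multilinear[OF assms(3)])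
qed

lemma end_comp_add_upper:
  "f \<in> End (Suc m1) n1 df \<Longrightarrow> g \<in> End m2 (Suc n2) d \<Longrightarrow> g' \<in> End m2 (Suc n2) d \<Longrightarrow>
    end_comp m1 n1 d df (g + g') f = end_comp m1 n1 d df g f + end_comp m1 n1 d df g' f"
  using end_comp_combine_upper[of f m1 n1 df g m2 n2 d g' 1] by (simp add: plus_fun_def)

lemma end_comp_scale_upper:
  assumes "f \<in> End (Suc m1) n1 df" "g \<in> End m2 (Suc n2) d"
  shows "end_comp m1 n1 d df (\<lambda>xs \<xi>s. c * g xs \<xi>s) f = (\<lambda>xs \<xi>s. c * end_comp m1 n1 d df g f xs \<xi>s)"
proof -
  have "end_comp m1 n1 d df 0 f = 0"
    by (simp add: end_comp_def fun_eq_iff tensors_last_zero[OF End_tensors[OF assms(1)]])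
  then show ?thesis
    using end_comp_combine_upper[OF assms(1) End_0 assms(2), of c] by (simp add: fun_eq_iff)
qed

lemma end_comp_unit_upper:
  assumes f: "f \<in> End (Suc m) n d"
  shows "end_comp m n 0 d end_unit f = f"
proof (rule End_eqI)
  have u: "end_unit \<in> End 1 (Suc 0) 0" using End_end_unit by simp
  show "end_comp m n 0 d end_unit f \<in> End (m + 1) (n + 0) (0 + d)" by (rule End_end_comp[OF f u])
  show "f \<in> End (m + 1) (n + 0) (0 + d)" using f by simp
  fix \<alpha> \<beta> assume w: "\<alpha> \<in> words (n + 0)" "\<beta> \<in> words (m + 1)"
  then obtain b c where \<beta>: "\<beta> = b @ [c]" "b \<in> words m" "c \<in> A"
    using words_split[OF w(2)] words_1 by metis
  have "mat (end_comp m n 0 d end_unit f) (\<alpha> @ []) (b @ [c]) = Sum_any (\<lambda>\<gamma>. mat f \<alpha> (b @ [\<gamma>]) * mat end_unit [\<gamma>] [c])"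
    using w \<beta> by (subst mat_end_comp[OF f u]) (auto simp: words_def)
  also have "(\<lambda>\<gamma>. mat f \<alpha> (b @ [\<gamma>]) * mat end_unit [\<gamma>] [c]) = (\<lambda>\<gamma>. if \<gamma> = c then mat f \<alpha> (b @ [c]) else 0)"
    using \<beta> by (auto simp: mat_end_unit)
  finally show "mat (end_comp m n 0 d end_unit f) \<alpha> \<beta> = mat f \<alpha> \<beta>" by (simp add: \<beta>)
qed

lemma end_comp_unit_lower:
  assumes f: "f \<in> End m (Suc n) d"
  shows "end_comp 0 1 d 0 f end_unit = f"
proof (rule End_eqI)
  have u: "end_unit \<in> End (Suc 0) 1 0" using End_end_unit by simp
  show "end_comp 0 1 d 0 f end_unit \<in> End (0 + m) (1 + n) (d + 0)" by (rule End_end_comp[OF u f])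
  show "f \<in> End (0 + m) (1 + n) (d + 0)" using f by simp
  fix \<alpha> \<beta> assume w: "\<alpha> \<in> words (1 + n)" "\<beta> \<in> words (0 + m)"
  then obtain a a' where \<alpha>: "\<alpha> = [a] @ a'" "a' \<in> words n" "a \<in> A"
    using words_split[OF w(1)] words_1 by metis
  have "mat (end_comp 0 1 d 0 f end_unit) ([a] @ a') ([] @ \<beta>) = Sum_any (\<lambda>\<gamma>. mat end_unit [a] ([] @ [\<gamma>]) * mat f (\<gamma> # a') \<beta>)"
    using w \<alpha> by (subst mat_end_comp[OF u f]) (auto simp: words_def)
  also have "(\<lambda>\<gamma>. mat end_unit [a] ([] @ [\<gamma>]) * mat f (\<gamma> # a') \<beta>) = (\<lambda>\<gamma>. if \<gamma> = a then mat f (a # a') \<beta> else 0)"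
    using \<alpha> by (auto simp: mat_end_unit)
  finally show "mat (end_comp 0 1 d 0 f end_unit) \<alpha> \<beta> = mat f \<alpha> \<beta>" by (simp add: \<alpha>)
qed

lemma finite_mat_slot2:
  assumes "f \<in> End m n d"
  shows "finite {(x, y). mat f \<alpha> (b1 @ x # y # b2) \<noteq> 0}"
proof -
  have "inj_on (\<lambda>(x, y). b1 @ x # y # b2) {(x, y). mat f \<alpha> (b1 @ x # y # b2) \<noteq> 0}" by (auto simp: inj_on_def)
  moreover have "(\<lambda>(x, y). b1 @ x # y # b2) ` {(x, y). mat f \<alpha> (b1 @ x # y # b2) \<noteq> 0} \<subseteq> {\<beta>. mat f \<alpha> \<beta> \<noteq> 0}" by auto
  ultimately show ?thesis using finite_mat[OF assms] finite_imageD finite_subset by blast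
qed

text \<open>Both sides sum the same products over the two internal edges \<open>x\<close> and
  \<open>y\<close>, and the two sign exponents are equal as polynomials in the degrees.\<close>

lemma end_comp_assoc:
  assumes t: "t \<in> End (Suc p) n1 dt" and s: "s \<in> End (Suc q) (Suc n2) ds" and r: "r \<in> End m3 (Suc n3) dr"
  shows "end_comp (p + q) (n1 + n2) dr (ds + dt) r (end_comp p n1 ds dt s t) =
    end_comp p n1 (dr + ds) dt (end_comp q (Suc n2) dr ds r s) t"
    (is "?L = ?R")
proof (rule End_eqI)
  have st: "end_comp p n1 ds dt s t \<in> End (Suc (p + q)) (n1 + n2) (ds + dt)"
    using End_end_comp[OF t s] by simp
  have rs: "end_comp q (Suc n2) dr ds r s \<in> End (q + m3) (Suc (n2 + n3)) (dr + ds)"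
    using End_end_comp[OF s r] by simp
  show "?L \<in> End (p + q + m3) (n1 + n2 + n3) (dr + (ds + dt))" by (rule End_end_comp[OF st r])
  show "?R \<in> End (p + q + m3) (n1 + n2 + n3) (dr + (ds + dt))"
    using End_end_comp[OF t rs] by (simp add: add_ac)
  fix \<alpha> \<beta> assume "\<alpha> \<in> words (n1 + n2 + n3)" "\<beta> \<in> words (p + q + m3)"
  then obtain a1 a2 a3 b1 b2 b3 where w: "\<alpha> = a1 @ a2 @ a3" "\<beta> = b1 @ b2 @ b3"
    "a1 \<in> words n1" "a2 \<in> words n2" "a3 \<in> words n3" "b1 \<in> words p" "b2 \<in> words q" "b3 \<in> words m3"
    using words_split3 by metis
  note len = w(3-8)[THEN length_words]
  let ?s = "parity_sign :: int \<Rightarrow> 'k"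
  have "mat ?L \<alpha> \<beta> = mat ?L ((a1 @ a2) @ a3) ((b1 @ b2) @ b3)" by (simp add: w)
  also have "\<dots> = ?s ((ds + dt) * (dr + deg a3)) * Sum_any (\<lambda>y. (?s (dt * (ds + deg a2)) *
      Sum_any (\<lambda>x. mat t a1 (b1 @ [x]) * mat s (x # a2) (b2 @ [y]))) * mat r (y # a3) b3)"
    by (subst mat_end_comp[OF st r], simp add: len, simp add: len)
      (simp only: append_assoc mat_end_comp[OF t s len(1) len(4)])
  also have "\<dots> = Sum_any (\<lambda>y. Sum_any (\<lambda>x. ?s ((ds + dt) * (dr + deg a3)) * (?s (dt * (ds + deg a2)) *
      (mat t a1 (b1 @ [x]) * mat s (x # a2) (b2 @ [y]) * mat r (y # a3) b3))))"
    by (simp add: Sum_any_cmult Sum_any_multc mult_ac)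
  also have "\<dots> = Sum_any (\<lambda>x. Sum_any (\<lambda>y. ?s ((ds + dt) * (dr + deg a3)) * (?s (dt * (ds + deg a2)) *
      (mat t a1 (b1 @ [x]) * mat s (x # a2) (b2 @ [y]) * mat r (y # a3) b3))))"
  proof (rule Sum_any_swap, rule finite_subset)
    \<comment> \<open>Row finiteness in two stages: finitely many \<open>x\<close> for the fixed
      inputs \<open>a1\<close>, and for each of them finitely many \<open>y\<close>.\<close>
    show "finite (\<Union>x\<in>{x. mat t a1 (b1 @ x # []) \<noteq> 0}. (\<lambda>y. (y, x)) ` {y. mat s (x # a2) (b2 @ y # []) \<noteq> 0})"
      by (intro finite_UN_I finite_imageI finite_mat_slot[OF t] finite_mat_slot[OF s])
  qed auto
  also have "\<dots> = ?s (dt * (dr + ds + deg (a2 @ a3))) * Sum_any (\<lambda>x. mat t a1 (b1 @ [x]) *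
     (?s (ds * (dr + deg a3)) * Sum_any (\<lambda>y. mat s (x # a2) (b2 @ [y]) * mat r (y # a3) b3)))"
    by (simp add: Sum_any_cmult mult_ac) (simp add: parity_sign_add distrib_left distrib_right mult_ac)
  also have "\<dots> = mat ?R \<alpha> \<beta>"
    unfolding w(1,2) mat_end_comp[OF t rs len(1) len(4)]
    using mat_end_comp[OF s r, of "_ # a2" b2 a3 b3] len by simp
  finally show "mat ?L \<alpha> \<beta> = mat ?R \<alpha> \<beta>" .
qed

lemma kz_block:
  "length x = a \<Longrightarrow> length y = b \<Longrightarrow> length z = c \<Longrightarrow>
    perm_sign (graded_swap dg) (block_swap a b c) (x @ z @ y @ w) = (parity_sign (deg y * deg z) :: 'k)"
  by (simp add: perm_sign_block_swap graded_swap_involutive prod_prod_graded_swap deg_def)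

lemma mat_out_block:
  assumes "f \<in> End (a + b + c) n d" "length x = a" "length y = b" "length z = c" 
  shows "mat (end_out (block_swap a b c) f) \<alpha> (x @ z @ y) = parity_sign (deg y * deg z) * mat f \<alpha> (x @ y @ z)"
  using mat_end_out[OF assms(1) permutes_block_swap[of a b c "a + b + c"], of \<alpha> "x @ z @ y"]
    kz_block[OF assms(2,3,4), of "[]"] permute_list_block_swap[OF assms(2,3,4), of "[]"] by simp

lemma mat_in_block:
  assumes "f \<in> End m (a + b + c + k) d" "length x = a" "length y = b" "length z = c"
  shows "mat (end_in (block_swap a b c) f) (x @ z @ y @ w) \<beta> = parity_sign (deg y * deg z) * mat f (x @ y @ z @ w) \<beta>"
  using mat_end_in[OF assms(1) permutes_block_swap[of a b c "a + b + c + k"], of "x @ z @ y @ w" \<beta>]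
    kz_block[OF assms(2,3,4), of w] permute_list_block_swap[OF assms(2,3,4), of w] by simp

lemma mat_out_block0:
  assumes "f \<in> End (b + c + k) n d" "length y = b" "length z = c"
  shows "mat (end_out (block_swap 0 b c) f) \<alpha> (z @ y @ w) = parity_sign (deg y * deg z) * mat f \<alpha> (y @ z @ w)"
  using mat_end_out[OF assms(1) permutes_block_swap[of 0 b c "b + c + k"], of \<alpha> "z @ y @ w"]
    kz_block[of "[]", OF _ assms(2,3), of 0 w] permute_list_block_swap[of "[]" 0, OF _ assms(2,3), of w] by simp

text \<open>Signs only have to agree where the coefficient is nonzero, and there the degree
  equations of the vertices are available.\<close>

lemma parity_product_eqI:
  assumes "x \<noteq> 0 \<Longrightarrow> (p :: 'k) = q"
  shows "p * x = q * (x :: 'k)"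
  using assms by (cases "x = 0") auto

text \<open>Both edges leave \<open>t\<close>, \<open>x\<close> towards \<open>r\<close> and
  \<open>y\<close> towards \<open>s\<close>. Exchanging these two outputs and the leg blocks of
  \<open>r\<close> and \<open>s\<close> produces crossing signs; substituting the degrees of
  \<open>bs\<close> and \<open>br\<close> shows that the two orders of grafting have the same total
  sign.\<close>

lemma end_comp_parallel_upper:
  assumes t: "t \<in> End (Suc (Suc a)) nt dt" and s: "s \<in> End ms (Suc ns) ds" and r: "r \<in> End mr (Suc nr) dr"
  shows "end_comp (a + ms) (nt + ns) dr (ds + dt) r (end_out (block_swap a 1 ms) (end_comp (Suc a) nt ds dt s t)) =
    (\<lambda>xs \<xi>s. parity_sign (dr * ds) * end_out (block_swap a mr ms) (end_in (block_swap nt nr ns)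
      (end_comp (a + mr) (nt + nr) ds (dr + dt) s (end_out (block_swap a 1 mr)
        (end_comp (Suc a) nt dr dt r (end_out (block_swap a 1 1) t))))) xs \<xi>s)"
    (is "?L = (\<lambda>xs \<xi>s. _ * ?R xs \<xi>s)")
proof (rule End_eqI)
  let ?s = "parity_sign :: int \<Rightarrow> 'k"
  have st: "end_comp (Suc a) nt ds dt s t \<in> End (a + 1 + ms) (nt + ns) (ds + dt)"
    using End_end_comp[OF t s] by simp
  have pst: "end_out (block_swap a 1 ms) (end_comp (Suc a) nt ds dt s t) \<in> End (Suc (a + ms)) (nt + ns) (ds + dt)"
    using End_end_out[OF st permutes_block_swap[of a 1 ms "a + 1 + ms"]] by simp
  show "?L \<in> End (a + ms + mr) (nt + ns + nr) (dr + (ds + dt))"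
    by (rule End_end_comp[OF pst r])
  have pt: "end_out (block_swap a 1 1) t \<in> End (Suc (Suc a)) nt dt"
    using End_end_out[OF t permutes_block_swap[of a 1 1 "Suc (Suc a)"]] by simp
  have rt: "end_comp (Suc a) nt dr dt r (end_out (block_swap a 1 1) t) \<in> End (a + 1 + mr) (nt + nr) (dr + dt)"
    using End_end_comp[OF pt r] by simp
  have prt: "end_out (block_swap a 1 mr) (end_comp (Suc a) nt dr dt r (end_out (block_swap a 1 1) t)) \<in> End (Suc (a + mr)) (nt + nr) (dr + dt)"
    using End_end_out[OF rt permutes_block_swap[of a 1 mr "a + 1 + mr"]] by simp
  let ?C = "end_comp (a + mr) (nt + nr) ds (dr + dt) s (end_out (block_swap a 1 mr)
        (end_comp (Suc a) nt dr dt r (end_out (block_swap a 1 1) t)))"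
  have C: "?C \<in> End (a + mr + ms) (nt + nr + ns + 0) (ds + (dr + dt))"
    using End_end_comp[OF prt s] by simp
  have iC: "end_in (block_swap nt nr ns) ?C \<in> End (a + mr + ms) (nt + nr + ns + 0) (ds + (dr + dt))"
    by (rule End_end_in[OF C permutes_block_swap]) simp
  have "?R \<in> End (a + mr + ms) (nt + nr + ns + 0) (ds + (dr + dt))"
    by (rule End_end_out[OF iC permutes_block_swap]) simp
  then show "(\<lambda>xs \<xi>s. ?s (dr * ds) * ?R xs \<xi>s) \<in> End (a + ms + mr) (nt + ns + nr) (dr + (ds + dt))"
    using End_scale by (simp add: add_ac)
  fix \<alpha> \<beta> assume "\<alpha> \<in> words (nt + ns + nr)" "\<beta> \<in> words (a + ms + mr)"
  then obtain ta sa ra b bs br where w: "\<alpha> = ta @ sa @ ra" "\<beta> = b @ bs @ br"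
    "ta \<in> words nt" "sa \<in> words ns" "ra \<in> words nr" "b \<in> words a" "bs \<in> words ms" "br \<in> words mr"
    using words_split3 by metis
  note len = w(3-8)[THEN length_words]
  define E where "E x y = mat t ta (b @ [x, y]) * (mat s (y # sa) bs * mat r (x # ra) br)" for x y
  have "mat ?L \<alpha> \<beta> = mat ?L ((ta @ sa) @ ra) ((b @ bs) @ br)" by (simp add: w)
  also have "\<dots> = ?s ((ds + dt) * (dr + deg ra)) * Sum_any (\<lambda>x. (?s (dg x * deg bs) * (?s (dt * (ds + deg sa)) *
      Sum_any (\<lambda>y. mat t ta (b @ [x, y]) * mat s (y # sa) bs))) * mat r (x # ra) br)"
  proof -
    have "mat (end_out (block_swap a 1 ms) (end_comp (Suc a) nt ds dt s t)) (ta @ sa) ((b @ bs) @ [x]) =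
      ?s (dg x * deg bs) * (?s (dt * (ds + deg sa)) * Sum_any (\<lambda>y. mat t ta (b @ [x, y]) * mat s (y # sa) bs))" for x
      using mat_out_block[OF st, of b "[x]" bs "ta @ sa"] mat_end_comp[OF t s, of ta "b @ [x]" sa bs] len by simp
    then show ?thesis
      using mat_end_comp[OF pst r, of "ta @ sa" "b @ bs" ra br] len by simp
  qed
  also have "\<dots> = Sum_any (\<lambda>x. Sum_any (\<lambda>y. (?s ((ds + dt) * (dr + deg ra)) * (?s (dg x * deg bs) * ?s (dt * (ds + deg sa)))) * E x y))"
    by (simp add: Sum_any_cmult Sum_any_multc E_def mult_ac)
  also have "\<dots> = Sum_any (\<lambda>y. Sum_any (\<lambda>x. (?s ((ds + dt) * (dr + deg ra)) * (?s (dg x * deg bs) * ?s (dt * (ds + deg sa)))) * E x y))"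
    by (rule Sum_any_swap, rule finite_subset[OF _ finite_mat_slot2[OF t, of ta b "[]"]]) (auto simp: E_def)
  also have "\<dots> = Sum_any (\<lambda>y. Sum_any (\<lambda>x. (?s (dr * ds) * ?s (deg br * deg bs) * ?s (deg ra * deg sa) * ?s ((dr + dt) * (ds + deg sa)) *
      ?s (dg y * deg br) * ?s (dt * (dr + deg ra)) * ?s (dg y * dg x)) * E x y))"
  proof (rule arg_cong[where f = Sum_any], rule ext, rule arg_cong[where f = Sum_any], rule ext, rule parity_product_eqI)
    fix x y assume "E x y \<noteq> 0"
    then have "mat s (y # sa) bs \<noteq> 0" "mat r (x # ra) br \<noteq> 0" by (auto simp: E_def)
    then have "deg bs = dg y + deg sa + ds" "deg br = dg x + deg ra + dr"
      using mat_degree[OF s] mat_degree[OF r] by fastforce+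
    then show "?s ((ds + dt) * (dr + deg ra)) * (?s (dg x * deg bs) * ?s (dt * (ds + deg sa))) =
      ?s (dr * ds) * ?s (deg br * deg bs) * ?s (deg ra * deg sa) * ?s ((dr + dt) * (ds + deg sa)) *
      ?s (dg y * deg br) * ?s (dt * (dr + deg ra)) * ?s (dg y * dg x)"
      by (simp add: parity_sign_add distrib_left distrib_right mult_ac)
  qed
  also have "\<dots> = ?s (dr * ds) * (?s (deg br * deg bs) * (?s (deg ra * deg sa) * (?s ((dr + dt) * (ds + deg sa)) *
      Sum_any (\<lambda>y. (?s (dg y * deg br) * (?s (dt * (dr + deg ra)) * Sum_any (\<lambda>x. (?s (dg y * dg x) * mat t ta (b @ [x, y])) * mat r (x # ra) br))) * mat s (y # sa) bs))))"
    by (simp add: Sum_any_cmult Sum_any_multc E_def mult_ac)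
  also have "\<dots> = mat (\<lambda>xs \<xi>s. ?s (dr * ds) * ?R xs \<xi>s) \<alpha> \<beta>"
  proof -
    have 1: "mat (end_out (block_swap a 1 1) t) ta ((b @ [y]) @ [x]) = ?s (dg x * dg y) * mat t ta (b @ [x, y])" for x y
      using mat_out_block[of t a 1 1 nt dt b "[x]" "[y]" ta] t len by simp
    have 2: "mat (end_out (block_swap a 1 mr) (end_comp (Suc a) nt dr dt r (end_out (block_swap a 1 1) t))) (ta @ ra) ((b @ br) @ [y]) =
      ?s (dg y * deg br) * (?s (dt * (dr + deg ra)) * Sum_any (\<lambda>x. (?s (dg y * dg x) * mat t ta (b @ [x, y])) * mat r (x # ra) br))" for y
      using mat_out_block[OF rt, of b "[y]" br "ta @ ra"] mat_end_comp[OF pt r, of ta "b @ [y]" ra br] len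
      by (simp add: 1[simplified] mult.commute[of "dg y"])
    have "mat ?R \<alpha> \<beta> = ?s (deg br * deg bs) * (?s (deg ra * deg sa) * mat ?C ((ta @ ra) @ sa) ((b @ br) @ bs))"
      using mat_out_block[OF iC, of b br bs \<alpha>] mat_in_block[OF C, of ta ra sa "[]"] len by (simp add: w)
    also have "mat ?C ((ta @ ra) @ sa) ((b @ br) @ bs) = ?s ((dr + dt) * (ds + deg sa)) *
      Sum_any (\<lambda>y. (?s (dg y * deg br) * (?s (dt * (dr + deg ra)) * Sum_any (\<lambda>x. (?s (dg y * dg x) * mat t ta (b @ [x, y])) * mat r (x # ra) br))) * mat s (y # sa) bs)"
      using mat_end_comp[OF prt s, of "ta @ ra" "b @ br" sa bs] 2 len by simp
    finally show ?thesis by (simp add: mat_scale)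
  qed
  finally show "mat ?L \<alpha> \<beta> = mat (\<lambda>xs \<xi>s. ?s (dr * ds) * ?R xs \<xi>s) \<alpha> \<beta>" .
qed

text \<open>Mirror image of the previous identity, with both edges ending in \<open>t\<close>. They
  start at different vertices with fixed inputs, so the pairs of indices lie in a product of two
  finite sets.\<close>

lemma end_comp_parallel_lower:
  assumes t: "t \<in> End mt (Suc (Suc nt)) dt" and s: "s \<in> End (Suc ms) ns ds" and r: "r \<in> End (Suc mr) nr dr"
  shows "end_comp mr nr (dt + ds) dr (end_in (block_swap 0 ns 1) (end_comp ms ns dt ds t s)) r =
    (\<lambda>xs \<xi>s. parity_sign (dr * ds) * end_out (block_swap 0 ms mr) (end_in (block_swap 0 ns nr)
      (end_comp ms ns (dt + dr) ds (end_in (block_swap 0 nr 1)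
        (end_comp mr nr dt dr (end_in (block_swap 0 1 1) t) r)) s)) xs \<xi>s)"
    (is "?L = (\<lambda>xs \<xi>s. _ * ?R xs \<xi>s)")
proof (rule End_eqI)
  let ?s = "parity_sign :: int \<Rightarrow> 'k"
  have st: "end_comp ms ns dt ds t s \<in> End (ms + mt) (0 + ns + 1 + nt) (dt + ds)"
    using End_end_comp[OF s t] by simp
  have pst: "end_in (block_swap 0 ns 1) (end_comp ms ns dt ds t s) \<in> End (ms + mt) (Suc (ns + nt)) (dt + ds)"
    using End_end_in[OF st permutes_block_swap[of 0 ns 1 "0 + ns + 1 + nt"]] by simp
  show "?L \<in> End (mr + (ms + mt)) (nr + (ns + nt)) (dt + ds + dr)"
    by (rule End_end_comp[OF r pst])
  have pt: "end_in (block_swap 0 1 1) t \<in> End mt (Suc (Suc nt)) dt"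
    using End_end_in[OF t permutes_block_swap[of 0 1 1 "Suc (Suc nt)"]] by simp
  have rt: "end_comp mr nr dt dr (end_in (block_swap 0 1 1) t) r \<in> End (mr + mt) (0 + nr + 1 + nt) (dt + dr)"
    using End_end_comp[OF r pt] by simp
  have prt: "end_in (block_swap 0 nr 1) (end_comp mr nr dt dr (end_in (block_swap 0 1 1) t) r) \<in> End (mr + mt) (Suc (nr + nt)) (dt + dr)"
    using End_end_in[OF rt permutes_block_swap[of 0 nr 1 "0 + nr + 1 + nt"]] by simp
  let ?C = "end_comp ms ns (dt + dr) ds (end_in (block_swap 0 nr 1)
        (end_comp mr nr dt dr (end_in (block_swap 0 1 1) t) r)) s"
  have C: "?C \<in> End (ms + mr + mt) (0 + ns + nr + nt) (dt + dr + ds)"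
    using End_end_comp[OF s prt] by (simp add: add_ac)
  have iC: "end_in (block_swap 0 ns nr) ?C \<in> End (ms + mr + mt) (0 + ns + nr + nt) (dt + dr + ds)"
    by (rule End_end_in[OF C permutes_block_swap]) simp
  have "?R \<in> End (ms + mr + mt) (0 + ns + nr + nt) (dt + dr + ds)"
    by (rule End_end_out[OF iC permutes_block_swap]) simp
  then show "(\<lambda>xs \<xi>s. ?s (dr * ds) * ?R xs \<xi>s) \<in> End (mr + (ms + mt)) (nr + (ns + nt)) (dt + ds + dr)"
    using End_scale by (simp add: add_ac)
  fix \<alpha> \<beta> assume "\<alpha> \<in> words (nr + (ns + nt))" "\<beta> \<in> words (mr + (ms + mt))"
  then obtain ta sa ra bt bs br where w: "\<alpha> = ra @ sa @ ta" "\<beta> = br @ bs @ bt"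
    "ra \<in> words nr" "sa \<in> words ns" "ta \<in> words nt" "br \<in> words mr" "bs \<in> words ms" "bt \<in> words mt"
    using words_split3[of \<alpha> nr ns nt] words_split3[of \<beta> mr ms mt] unfolding add.assoc by blast
  note len = w(3-8)[THEN length_words]
  define E where "E x y = mat r ra (br @ [y]) * mat s sa (bs @ [x]) * mat t (x # y # ta) bt" for x y
  have "mat ?L \<alpha> \<beta> = ?s (dr * (dt + ds + deg (sa @ ta))) * Sum_any (\<lambda>y. mat r ra (br @ [y]) * (?s (deg sa * dg y) * (?s (ds * (dt + deg (y # ta))) *
      Sum_any (\<lambda>x. mat s sa (bs @ [x]) * mat t (x # y # ta) bt))))"
  proof -
    have "mat (end_in (block_swap 0 ns 1) (end_comp ms ns dt ds t s)) (y # sa @ ta) (bs @ bt) =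
      ?s (deg sa * dg y) * (?s (ds * (dt + deg (y # ta))) * Sum_any (\<lambda>x. mat s sa (bs @ [x]) * mat t (x # y # ta) bt))" for y
      using mat_in_block[OF st, of "[]" sa "[y]" ta] mat_end_comp[OF s t, of sa bs "y # ta" bt] len by simp
    then show ?thesis
      using mat_end_comp[OF r pst, of ra br "sa @ ta" "bs @ bt"] len by (simp add: w)
  qed
  also have "\<dots> = Sum_any (\<lambda>y. Sum_any (\<lambda>x. (?s (dr * (dt + ds + deg (sa @ ta))) * (?s (deg sa * dg y) * ?s (ds * (dt + deg (y # ta))))) * E x y))"
    by (simp add: Sum_any_cmult Sum_any_multc E_def mult_ac)
  also have "\<dots> = Sum_any (\<lambda>x. Sum_any (\<lambda>y. (?s (dr * (dt + ds + deg (sa @ ta))) * (?s (deg sa * dg y) * ?s (ds * (dt + deg (y # ta))))) * E x y))"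
  proof (rule Sum_any_swap, rule finite_subset)
    show "finite ({y. mat r ra (br @ y # []) \<noteq> 0} \<times> {x. mat s sa (bs @ x # []) \<noteq> 0})"
      by (intro finite_cartesian_product finite_mat_slot[OF r] finite_mat_slot[OF s])
  qed (auto simp: E_def)
  also have "\<dots> = Sum_any (\<lambda>x. Sum_any (\<lambda>y. (?s (dr * ds) * ?s (deg bs * deg br) * ?s (deg sa * deg ra) * ?s (ds * (dt + dr + deg (ra @ ta))) *
      ?s (deg ra * dg x) * ?s (dr * (dt + deg (x # ta))) * ?s (dg x * dg y)) * E x y))"
  proof (rule arg_cong[where f = Sum_any], rule ext, rule arg_cong[where f = Sum_any], rule ext, rule parity_product_eqI)
    fix x y assume "E x y \<noteq> 0"
    then have "mat s sa (bs @ [x]) \<noteq> 0" "mat r ra (br @ [y]) \<noteq> 0" by (auto simp: E_def)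
    then have "deg (bs @ [x]) = deg sa + ds" "deg (br @ [y]) = deg ra + dr"
      using mat_degree[OF s] mat_degree[OF r] by blast+
    \<comment> \<open>The degrees of the two lower operators are eliminated, which leaves a parity
      identity in \<open>dt\<close> and the degrees of the legs and edges.\<close>
    then have d: "ds = deg bs + dg x - deg sa" "dr = deg br + dg y - deg ra" by simp_all
    show "?s (dr * (dt + ds + deg (sa @ ta))) * (?s (deg sa * dg y) * ?s (ds * (dt + deg (y # ta)))) =
      ?s (dr * ds) * ?s (deg bs * deg br) * ?s (deg sa * deg ra) * ?s (ds * (dt + dr + deg (ra @ ta))) *
      ?s (deg ra * dg x) * ?s (dr * (dt + deg (x # ta))) * ?s (dg x * dg y)"
      unfolding parity_sign_add[symmetric] d
      by (rule parity_sign_cong) (simp add: algebra_simps, argo)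
  qed
  also have "\<dots> = ?s (dr * ds) * (?s (deg bs * deg br) * (?s (deg sa * deg ra) * (?s (ds * (dt + dr + deg (ra @ ta))) *
      Sum_any (\<lambda>x. mat s sa (bs @ [x]) * (?s (deg ra * dg x) * (?s (dr * (dt + deg (x # ta))) * Sum_any (\<lambda>y. mat r ra (br @ [y]) * (?s (dg x * dg y) * mat t (x # y # ta) bt))))))))"
    by (simp add: Sum_any_cmult Sum_any_multc E_def mult_ac)
  also have "\<dots> = mat (\<lambda>xs \<xi>s. ?s (dr * ds) * ?R xs \<xi>s) \<alpha> \<beta>"
  proof -
    have 1: "mat (end_in (block_swap 0 1 1) t) (y # x # ta) bt = ?s (dg x * dg y) * mat t (x # y # ta) bt" for x y
      using mat_in_block[of t mt 0 1 1 nt dt "[]" "[x]" "[y]" ta bt] t by simp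
    have 2: "mat (end_in (block_swap 0 nr 1) (end_comp mr nr dt dr (end_in (block_swap 0 1 1) t) r)) (x # ra @ ta) (br @ bt) =
      ?s (deg ra * dg x) * (?s (dr * (dt + deg (x # ta))) * Sum_any (\<lambda>y. mat r ra (br @ [y]) * (?s (dg x * dg y) * mat t (x # y # ta) bt)))" for x
      using mat_in_block[OF rt, of "[]" ra "[x]" ta] mat_end_comp[OF r pt, of ra br "x # ta" bt] len by (simp add: 1[simplified])
    have "mat ?R \<alpha> \<beta> = ?s (deg bs * deg br) * (?s (deg sa * deg ra) * mat ?C (sa @ ra @ ta) (bs @ br @ bt))"
      using mat_out_block0[OF iC, of bs br \<alpha> bt] mat_in_block[OF C, of "[]" sa ra ta] len by (simp add: w)
    also have "mat ?C (sa @ ra @ ta) (bs @ br @ bt) = ?s (ds * (dt + dr + deg (ra @ ta))) *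
      Sum_any (\<lambda>x. mat s sa (bs @ [x]) * (?s (deg ra * dg x) * (?s (dr * (dt + deg (x # ta))) * Sum_any (\<lambda>y. mat r ra (br @ [y]) * (?s (dg x * dg y) * mat t (x # y # ta) bt)))))"
      using mat_end_comp[OF s prt, of sa bs "ra @ ta" "br @ bt"] 2 len by simp
    finally show ?thesis by (simp add: mat_scale)
  qed
  finally show "mat ?L \<alpha> \<beta> = mat (\<lambda>xs \<xi>s. ?s (dr * ds) * ?R xs \<xi>s) \<alpha> \<beta>" .
qed

end

lemma shift_perm_shift_perm: "shift_perm k (shift_perm l \<tau>) = shift_perm (k + l) \<tau>"
  by (auto simp: shift_perm_def fun_eq_iff)

text \<open>The grafted input of the upper operation has number 0 and is fixed, so such a
  permutation is a shifted permutation of the other inputs. In this form the action transfers to the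
  inputs of the composite.\<close>

lemma permutes_shift_perm_1:
  assumes "\<tau> permutes {1..<Suc n}"
  obtains \<tau>' where "\<tau>' permutes {..<n}" "\<tau> = shift_perm 1 \<tau>'"
proof -
  let ?t = "\<lambda>i. \<tau> (Suc i) - 1"
  have out: "\<tau> i = i" if "i \<notin> {1..<Suc n}" for i using permutes_not_in[OF assms that] .
  have pos: "1 \<le> \<tau> (Suc i)" for i
    using permutes_in_image[OF assms, of "Suc i"] out[of "Suc i"] by (cases "Suc i \<in> {1..<Suc n}") auto
  have lt: "\<tau> (Suc i) < Suc n" if "i < n" for i
    using permutes_in_image[OF assms, of "Suc i"] that by auto
  have inj: "inj_on ?t {..<n}"
  proof (rule inj_onI)
    fix i j assume "?t i = ?t j"
    then have "\<tau> (Suc i) = \<tau> (Suc j)" using pos[of i] pos[of j] by linarith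
    then show "i = j" using injD[OF permutes_inj[OF assms]] by blast
  qed
  have "?t ` {..<n} \<subseteq> {..<n}" using lt pos by (fastforce simp: less_diff_conv)
  then have "bij_betw ?t {..<n} {..<n}" using inj by (simp add: bij_betw_def endo_inj_surj)
  then have "?t permutes {..<n}"
    by (rule bij_imp_permutes) (use out in auto)
  moreover have "\<tau> = shift_perm 1 ?t"
  proof
    fix i
    show "\<tau> i = shift_perm 1 ?t i"
    proof (cases i)
      case (Suc k)
      then show ?thesis using pos[of k] by (simp add: shift_perm_def)
    qed (use out[of 0] in \<open>simp add: shift_perm_def\<close>)
  qed
  ultimately show ?thesis by (rule that)
qed

section \<open>Equivariance of composition and the interpretation of terms\<close>

context based_graded_space begin

lemma permutes_subset_lessThan: "\<sigma> permutes {..<m} \<Longrightarrow> m \<le> (n :: nat) \<Longrightarrow> \<sigma> permutes {..<n}"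
  by (erule permutes_subset) auto

lemma composite_words_split:
  assumes "\<alpha> \<in> words (n1 + n2)" "\<beta> \<in> words (m1 + m2)"
  shows "\<exists>a1 a2 b1 b2. \<alpha> = a1 @ a2 \<and> \<beta> = b1 @ b2 \<and> length a1 = n1 \<and> length a2 = n2 \<and> length b1 = m1 \<and> length b2 = m2"
  using words_split[OF assms(1)] words_split[OF assms(2)] length_words by blast

lemma end_comp_lower_out:
  assumes f: "f \<in> End (Suc m1) n1 df" and g: "g \<in> End m2 (Suc n2) d" and \<sigma>: "\<sigma> permutes {..<m1}"
  shows "end_comp m1 n1 d df g (end_out \<sigma> f) = end_out \<sigma> (end_comp m1 n1 d df g f)"
proof -
  let ?C = "end_comp m1 n1 d df g f"
  let ?kz = "perm_sign (graded_swap dg) :: _ \<Rightarrow> _ \<Rightarrow> 'k"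
  note C = End_end_comp[OF f g]
  have \<sigma>1: "\<sigma> permutes {..<Suc m1}" and \<sigma>2: "\<sigma> permutes {..<m1 + m2}"
    using \<sigma> by (simp_all add: permutes_subset_lessThan[where m = m1])
  show ?thesis
  proof (rule End_eqI[OF End_end_comp[OF End_end_out[OF f \<sigma>1] g] End_end_out[OF C \<sigma>2]])
    fix \<alpha> \<beta> assume "\<alpha> \<in> words (n1 + n2)" "\<beta> \<in> words (m1 + m2)"
    then obtain a1 a2 b1 b2 where w: "\<alpha> = a1 @ a2" "\<beta> = b1 @ b2" "length a1 = n1" "length b1 = m1"
      using composite_words_split[of \<alpha> n1 n2 \<beta> m1 m2] by metis
    have \<sigma>b: "\<sigma> permutes {..<length b1}" using \<sigma> w by simp
    show "mat (end_comp m1 n1 d df g (end_out \<sigma> f)) \<alpha> \<beta> = mat (end_out \<sigma> ?C) \<alpha> \<beta>"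
      using w unfolding w(1,2) mat_end_comp[OF End_end_out[OF f \<sigma>1] g w(3,4)] mat_end_out[OF f \<sigma>1] mat_end_out[OF C \<sigma>2]
        perm_sign_append_left[OF \<sigma>b]
      by (subst mat_end_comp[OF f g w(3)]) (simp_all add: Sum_any_cmult mult_ac)
  qed
qed

lemma end_comp_lower_in:
  assumes f: "f \<in> End (Suc m1) n1 df" and g: "g \<in> End m2 (Suc n2) d" and \<sigma>: "\<sigma> permutes {..<n1}"
  shows "end_comp m1 n1 d df g (end_in \<sigma> f) = end_in \<sigma> (end_comp m1 n1 d df g f)"
proof -
  let ?C = "end_comp m1 n1 d df g f"
  let ?kz = "perm_sign (graded_swap dg) :: _ \<Rightarrow> _ \<Rightarrow> 'k"
  note C = End_end_comp[OF f g]
  have \<sigma>2: "\<sigma> permutes {..<n1 + n2}" using permutes_subset_lessThan[OF \<sigma>] by simp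
  show ?thesis
  proof (rule End_eqI[OF End_end_comp[OF End_end_in[OF f \<sigma>] g] End_end_in[OF C \<sigma>2]])
    fix \<alpha> \<beta> assume "\<alpha> \<in> words (n1 + n2)" "\<beta> \<in> words (m1 + m2)"
    then obtain a1 a2 b1 b2 where w: "\<alpha> = a1 @ a2" "\<beta> = b1 @ b2" "length a1 = n1" "length b1 = m1"
      using composite_words_split[of \<alpha> n1 n2 \<beta> m1 m2] by metis
    have \<sigma>b: "\<sigma> permutes {..<length a1}" using \<sigma> w by simp
    show "mat (end_comp m1 n1 d df g (end_in \<sigma> f)) \<alpha> \<beta> = mat (end_in \<sigma> ?C) \<alpha> \<beta>"
      using w unfolding w(1,2) mat_end_comp[OF End_end_in[OF f \<sigma>] g w(3,4)] mat_end_in[OF f \<sigma>] mat_end_in[OF C \<sigma>2]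
        perm_sign_append_left[OF \<sigma>b]
      by (subst mat_end_comp[OF f g _ w(4)]) (simp_all add: Sum_any_cmult mult_ac)
  qed
qed

lemma end_comp_upper_out:
  assumes f: "f \<in> End (Suc m1) n1 df" and g: "g \<in> End m2 (Suc n2) d" and \<sigma>: "\<sigma> permutes {..<m2}"
  shows "end_comp m1 n1 d df (end_out \<sigma> g) f = end_out (shift_perm m1 \<sigma>) (end_comp m1 n1 d df g f)"
proof -
  let ?C = "end_comp m1 n1 d df g f"
  let ?kz = "perm_sign (graded_swap dg) :: _ \<Rightarrow> _ \<Rightarrow> 'k"
  note C = End_end_comp[OF f g]
  have \<sigma>2: "shift_perm m1 \<sigma> permutes {..<m1 + m2}" using \<sigma> by (rule permutes_shift_perm)
  show ?thesis
  proof (rule End_eqI[OF End_end_comp[OF f End_end_out[OF g \<sigma>]] End_end_out[OF C \<sigma>2]])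
    fix \<alpha> \<beta> assume "\<alpha> \<in> words (n1 + n2)" "\<beta> \<in> words (m1 + m2)"
    then obtain a1 a2 b1 b2 where w: "\<alpha> = a1 @ a2" "\<beta> = b1 @ b2" "length a1 = n1" "length b1 = m1" "length b2 = m2"
      using composite_words_split[of \<alpha> n1 n2 \<beta> m1 m2] by metis
    have \<sigma>b: "\<sigma> permutes {..<length b2}" using \<sigma> w by simp
    show "mat (end_comp m1 n1 d df (end_out \<sigma> g) f) \<alpha> \<beta> = mat (end_out (shift_perm m1 \<sigma>) ?C) \<alpha> \<beta>"
      using perm_sign_shift_perm(1)[OF \<sigma>b, of "graded_swap dg :: _ \<Rightarrow> _ \<Rightarrow> 'k" b1]
          perm_sign_shift_perm(2)[OF \<sigma>b, of b1]
      unfolding w mat_end_comp[OF f End_end_out[OF g \<sigma>] w(3,4)] mat_end_out[OF g \<sigma>] mat_end_out[OF C \<sigma>2]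
      by (simp add: w mat_end_comp[OF f g w(3,4)] Sum_any_cmult mult_ac)
  qed
qed

lemma end_comp_upper_in:
  assumes f: "f \<in> End (Suc m1) n1 df" and g: "g \<in> End m2 (Suc n2) d" and \<tau>: "\<sigma> permutes {1..<Suc n2}" and n1: "n1 \<ge> 1"
  shows "end_comp m1 n1 d df (end_in \<sigma> g) f = end_in (shift_perm (n1 - 1) \<sigma>) (end_comp m1 n1 d df g f)"
proof -
  let ?C = "end_comp m1 n1 d df g f"
  let ?kz = "perm_sign (graded_swap dg) :: _ \<Rightarrow> _ \<Rightarrow> 'k"
  note C = End_end_comp[OF f g]
  obtain \<sigma>' where \<sigma>': "\<sigma>' permutes {..<n2}" "\<sigma> = shift_perm 1 \<sigma>'"
    using permutes_shift_perm_1[OF \<tau>] .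
  have \<sigma>: "\<sigma> permutes {..<Suc n2}" using permutes_shift_perm[OF \<sigma>'(1), of 1] \<sigma>'(2) by simp
  have sh: "shift_perm (n1 - 1) \<sigma> = shift_perm n1 \<sigma>'" using n1 by (simp add: \<sigma>'(2) shift_perm_shift_perm)
  have \<sigma>2: "shift_perm n1 \<sigma>' permutes {..<n1 + n2}" using \<sigma>'(1) by (rule permutes_shift_perm)
  show ?thesis
    unfolding sh
  proof (rule End_eqI[OF End_end_comp[OF f End_end_in[OF g \<sigma>]] End_end_in[OF C \<sigma>2]])
    fix \<alpha> \<beta> assume "\<alpha> \<in> words (n1 + n2)" "\<beta> \<in> words (m1 + m2)"
    then obtain a1 a2 b1 b2 where w: "\<alpha> = a1 @ a2" "\<beta> = b1 @ b2" "length a1 = n1" "length b1 = m1" "length a2 = n2"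
      using composite_words_split[of \<alpha> n1 n2 \<beta> m1 m2] by metis
    have \<sigma>b: "\<sigma>' permutes {..<length a2}" using \<sigma>'(1) w by simp
    have g': "mat (end_in \<sigma> g) (\<gamma> # a2) b2 = ?kz \<sigma>' a2 * mat g (\<gamma> # permute_list \<sigma>' a2) b2" for \<gamma>
      using mat_end_in[OF g \<sigma>, of "\<gamma> # a2" b2]
        perm_sign_shift_perm(1)[OF \<sigma>b, of "graded_swap dg :: _ \<Rightarrow> _ \<Rightarrow> 'k" "[\<gamma>]"]
        perm_sign_shift_perm(2)[OF \<sigma>b, of "[\<gamma>]"] by (simp add: \<sigma>'(2))
    show "mat (end_comp m1 n1 d df (end_in \<sigma> g) f) \<alpha> \<beta> = mat (end_in (shift_perm n1 \<sigma>') ?C) \<alpha> \<beta>"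
      using perm_sign_shift_perm(1)[OF \<sigma>b, of "graded_swap dg :: _ \<Rightarrow> _ \<Rightarrow> 'k" a1]
          perm_sign_shift_perm(2)[OF \<sigma>b, of a1]
      unfolding w(1,2) mat_end_comp[OF f End_end_in[OF g \<sigma>] w(3,4)] mat_end_in[OF C \<sigma>2] g'
      by (simp add: w mat_end_comp[OF f g w(3,4)] deg_permute[OF \<sigma>b] Sum_any_cmult mult_ac)
  qed
qed

text \<open>The candidate for the morphism with the values \<open>\<mu>\<close> on corollas. It is
  defined on all terms; well-formedness enters through \<open>sem_End\<close>.\<close>

primrec sem :: "(nat \<Rightarrow> nat \<Rightarrow> ('v, 'k) operation) \<Rightarrow> 'k dterm \<Rightarrow> ('v, 'k) operation" where
  "sem \<mu> (DCor m n) = \<mu> m n"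
| "sem \<mu> DUnit = end_unit"
| "sem \<mu> (DZero m n d) = 0"
| "sem \<mu> (DAdd t s) = sem \<mu> t + sem \<mu> s"
| "sem \<mu> (DScale c t) = (\<lambda>xs \<xi>s. c * sem \<mu> t xs \<xi>s)"
| "sem \<mu> (DComp t s) = end_comp (outs s - 1) (ins s) (ddeg t) (ddeg s) (sem \<mu> t) (sem \<mu> s)"
| "sem \<mu> (DOut \<sigma> t) = end_out \<sigma> (sem \<mu> t)"
| "sem \<mu> (DIn \<tau> t) = end_in \<tau> (sem \<mu> t)"

lemma outs_ins_pos: "dwf t \<Longrightarrow> 1 \<le> outs t \<and> 1 \<le> ins t"
  by (induction t) auto

context
  fixes \<mu> :: "nat \<Rightarrow> nat \<Rightarrow> ('v, 'k) operation"
  assumes \<mu>: "\<And>m n. m \<ge> 1 \<Longrightarrow> n \<ge> 1 \<Longrightarrow> \<mu> m n \<in> sym_to_ext m n"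
begin

lemma mu_End: "m \<ge> 1 \<Longrightarrow> n \<ge> 1 \<Longrightarrow> \<mu> m n \<in> End m n (2 - int m)"
  using \<mu> by (simp add: sym_to_ext_def)

lemma sem_End: "dwf t \<Longrightarrow> sem \<mu> t \<in> End (outs t) (ins t) (ddeg t)"
proof (induction t)
  case (DComp t s)
  then obtain m1 n2 where "outs s = Suc m1" "ins t = Suc n2"
    using outs_ins_pos[of s] outs_ins_pos[of t] by (metis dwf.simps(6) Suc_le_D One_nat_def)
  then show ?case using DComp End_end_comp[of "sem \<mu> s" m1 "ins s" "ddeg s" "sem \<mu> t" "outs t" n2 "ddeg t"] by simp
next
  case (DAdd t s)
  then have "sem \<mu> t + sem \<mu> s \<in> End (outs t) (ins t) (ddeg t)" by (intro End_add) simp_all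
  then show ?case by (simp only: sem.simps outs.simps ins.simps ddeg.simps)
next
  case DUnit show ?case using End_end_unit by simp
qed (auto simp: mu_End End_0 End_scale End_end_out End_end_in)

lemma sem_comp_End:
  assumes "dwf t" "dwf s"
  obtains m1 n2 where "outs s = Suc m1" "ins t = Suc n2" "sem \<mu> s \<in> End (Suc m1) (ins s) (ddeg s)"
    "sem \<mu> t \<in> End (outs t) (Suc n2) (ddeg t)"
  using sem_End[OF assms(1)] sem_End[OF assms(2)] outs_ins_pos[OF assms(1)] outs_ins_pos[OF assms(2)]
  by (metis Suc_le_D One_nat_def)

text \<open>Carried along in the induction on the congruence: the interpretation of a composite
  depends on arities and degrees read off from the terms, so these must be known to agree for
  congruent terms.\<close>

definition same_type :: "'k dterm \<Rightarrow> 'k dterm \<Rightarrow> bool" where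
  "same_type t s \<longleftrightarrow> dwf t \<and> dwf s \<and> outs t = outs s \<and> ins t = ins s \<and> ddeg t = ddeg s"

text \<open>The structural rules hold in the endomorphism dioperad by the identities above, and the
  two rules for corollas are the symmetry conditions in \<open>sym_to_ext\<close>. The
  interpretation therefore descends to the free dioperad.\<close>

theorem deq_sound: "t \<approx>\<^sub>D s \<Longrightarrow> same_type t s \<and> sem \<mu> t = sem \<mu> s"
proof (induction rule: deq.induct)
  case (comp_add_left t t' s)
  then obtain m1 n2 where *: "outs s = Suc m1" "ins t = Suc n2" "sem \<mu> s \<in> End (Suc m1) (ins s) (ddeg s)"
    "sem \<mu> t \<in> End (outs t) (Suc n2) (ddeg t)" using sem_comp_End[of t s] by auto
  moreover have "sem \<mu> t' \<in> End (outs t) (Suc n2) (ddeg t)" using sem_End[of t'] comp_add_left *(2) by simp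
  ultimately have "end_comp m1 (ins s) (ddeg t) (ddeg s) (sem \<mu> t + sem \<mu> t') (sem \<mu> s) =
      end_comp m1 (ins s) (ddeg t) (ddeg s) (sem \<mu> t) (sem \<mu> s) + end_comp m1 (ins s) (ddeg t) (ddeg s) (sem \<mu> t') (sem \<mu> s)"
    by (intro end_comp_add_upper)
  then show ?case using comp_add_left * by (simp add: same_type_def)
next
  case (comp_scale_left t s c)
  then obtain m1 n2 where "outs s = Suc m1" "ins t = Suc n2" "sem \<mu> s \<in> End (Suc m1) (ins s) (ddeg s)"
    "sem \<mu> t \<in> End (outs t) (Suc n2) (ddeg t)" using sem_comp_End[of t s] by auto
  then show ?case using comp_scale_left end_comp_scale_upper[of "sem \<mu> s" m1 "ins s" "ddeg s" "sem \<mu> t" "outs t" n2 "ddeg t" c]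
    by (simp add: same_type_def)
next
  case (out_add t s \<sigma>)
  then show ?case using sem_End[of t] sem_End[of s] by (auto simp: same_type_def end_out_add)
next
  case (in_add t s \<sigma>)
  then show ?case using sem_End[of t] sem_End[of s] by (auto simp: same_type_def end_in_add)
next
  case (out_id t)
  then show ?case using sem_End[of t] by (auto simp: same_type_def end_out_id permutes_id)
next
  case (in_id t)
  then show ?case using sem_End[of t] by (auto simp: same_type_def end_in_id permutes_id)
next
  case (out_out \<sigma> \<sigma>' t)
  then show ?case using sem_End[of t] end_out_out[of "sem \<mu> t" "outs t" "ins t" "ddeg t" \<sigma> \<sigma>'] permutes_compose[of \<sigma>' "{..<outs t}" \<sigma>]
    by (simp add: same_type_def)
next
  case (in_in \<sigma> \<sigma>' t)
  then show ?case using sem_End[of t] end_in_in[of "sem \<mu> t" "outs t" "ins t" "ddeg t" \<sigma> \<sigma>'] permutes_compose[of \<sigma>' "{..<ins t}" \<sigma>]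
    by (simp add: same_type_def)
next
  case (out_in \<sigma> \<tau> t)
  then show ?case using sem_End[of t] end_out_in[of "sem \<mu> t" "outs t" "ins t" "ddeg t" \<sigma> \<tau>] by (simp add: same_type_def)
next
  case (unit_upper t)
  obtain m1 where m1: "outs t = Suc m1" using outs_ins_pos[OF unit_upper] by (cases "outs t") auto
  show ?case using unit_upper sem_End[OF unit_upper] end_comp_unit_upper[of "sem \<mu> t" m1] m1 by (simp add: same_type_def)
next
  case (unit_lower t)
  obtain n2 where n2: "ins t = Suc n2" using outs_ins_pos[OF unit_lower] by (cases "ins t") auto
  show ?case using unit_lower sem_End[OF unit_lower] end_comp_unit_lower[of "sem \<mu> t" "outs t" n2] n2 by (simp add: same_type_def)
next
  case (assoc r s t)
  obtain p n2 where 1: "outs t = Suc p" "ins s = Suc n2" "sem \<mu> t \<in> End (Suc p) (ins t) (ddeg t)"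
    "sem \<mu> s \<in> End (outs s) (Suc n2) (ddeg s)"
    by (rule sem_comp_End[OF assoc(2,3)])
  obtain q n3 where 2: "outs s = Suc q" "ins r = Suc n3" "sem \<mu> s \<in> End (Suc q) (ins s) (ddeg s)"
    "sem \<mu> r \<in> End (outs r) (Suc n3) (ddeg r)" by (rule sem_comp_End[OF assoc(1,2)])
  show ?case
    using assoc end_comp_assoc[of "sem \<mu> t" p "ins t" "ddeg t" "sem \<mu> s" q n2 "ddeg s" "sem \<mu> r" "outs r" n3 "ddeg r"] 1 2
    by (simp add: same_type_def)
next
  case (parallel_upper r s t a)
  obtain n2 where n2: "ins s = Suc n2" using outs_ins_pos[of s] parallel_upper by (cases "ins s") auto
  obtain n3 where n3: "ins r = Suc n3" using outs_ins_pos[of r] parallel_upper by (cases "ins r") auto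
  have 1: "outs t = Suc (Suc a)" "ins s = Suc n2" "sem \<mu> t \<in> End (Suc (Suc a)) (ins t) (ddeg t)"
    "sem \<mu> s \<in> End (outs s) (Suc n2) (ddeg s)" and 2: "ins r = Suc n3" "sem \<mu> r \<in> End (outs r) (Suc n3) (ddeg r)"
    using parallel_upper sem_End[of t] sem_End[of s] sem_End[of r] n2 n3 by simp_all
  have p: "block_swap a b c permutes {..<a + b + c}" for a b c by (rule permutes_block_swap) simp
  have p': "block_swap a (Suc 0) c permutes {..<Suc (a + c)}" for a c using p[of a 1 c] by simp
  show ?case
    using parallel_upper end_comp_parallel_upper[of "sem \<mu> t" a "ins t" "ddeg t" "sem \<mu> s" "outs s" n2 "ddeg s" "sem \<mu> r" "outs r" n3 "ddeg r"] 1 2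
      p'[of a "outs r"] p'[of a "outs s"] p'[of a 1] p[of a "outs r" "outs s"] p[of "ins t" n3 n2]
    by (simp add: same_type_def add_ac)
next
  case (parallel_lower r s t)
  obtain nt where nt: "ins t = Suc (Suc nt)" using parallel_lower(4) le_Suc_ex[of 2 "ins t"] by auto
  obtain ms where ms: "outs s = Suc ms" using outs_ins_pos[of s] parallel_lower by (cases "outs s") auto
  obtain mr where mr: "outs r = Suc mr" using outs_ins_pos[of r] parallel_lower by (cases "outs r") auto
  have 1: "outs s = Suc ms" "sem \<mu> s \<in> End (Suc ms) (ins s) (ddeg s)"
    and 2: "outs r = Suc mr" "sem \<mu> r \<in> End (Suc mr) (ins r) (ddeg r)"
    using parallel_lower sem_End[of s] sem_End[of r] ms mr by simp_all
  have t: "sem \<mu> t \<in> End (outs t) (Suc (Suc nt)) (ddeg t)" using sem_End[of t] parallel_lower nt by simp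
  have p: "block_swap 0 b c permutes {..<k}" if "b + c \<le> k" for b c k by (rule permutes_block_swap) (use that in simp)
  show ?case
    using parallel_lower end_comp_parallel_lower[OF t 1(2) 2(2)] nt 1 2
      p[of "ins s" 1 "Suc (ins s + nt)"] p[of "ins r" 1 "Suc (ins r + nt)"] p[of 1 1 "Suc (Suc nt)"]
      p[of ms mr "ms + (mr + outs t)"] p[of "ins s" "ins r" "ins s + (ins r + nt)"]
    by (simp add: same_type_def add_ac)
next
  case (equiv_lower_out t s \<sigma>)
  then obtain m1 n2 where *: "outs s = Suc m1" "ins t = Suc n2" "sem \<mu> s \<in> End (Suc m1) (ins s) (ddeg s)"
    "sem \<mu> t \<in> End (outs t) (Suc n2) (ddeg t)" using sem_comp_End[of t s] by auto
  moreover have "\<sigma> permutes {..<Suc m1}" "\<sigma> permutes {..<m1 + outs t}"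
    using equiv_lower_out * permutes_subset_lessThan[of \<sigma> m1] by simp_all
  ultimately show ?case using equiv_lower_out by (simp add: same_type_def end_comp_lower_out)
next
  case (equiv_lower_in t s \<sigma>)
  then obtain m1 n2 where *: "outs s = Suc m1" "ins t = Suc n2" "sem \<mu> s \<in> End (Suc m1) (ins s) (ddeg s)"
    "sem \<mu> t \<in> End (outs t) (Suc n2) (ddeg t)" using sem_comp_End[of t s] by auto
  moreover have "\<sigma> permutes {..<ins s + n2}"
    using equiv_lower_in * permutes_subset_lessThan[of \<sigma> "ins s"] by simp
  ultimately show ?case using equiv_lower_in by (simp add: same_type_def end_comp_lower_in)
next
  case (equiv_upper_out t s \<sigma>)
  then obtain m1 n2 where *: "outs s = Suc m1" "ins t = Suc n2" "sem \<mu> s \<in> End (Suc m1) (ins s) (ddeg s)"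
    "sem \<mu> t \<in> End (outs t) (Suc n2) (ddeg t)" using sem_comp_End[of t s] by auto
  then show ?case using equiv_upper_out permutes_shift_perm[of \<sigma> "outs t" m1]
    by (simp add: same_type_def end_comp_upper_out)
next
  case (equiv_upper_in t s \<sigma>)
  then obtain m1 n2 where *: "outs s = Suc m1" "ins t = Suc n2" "sem \<mu> s \<in> End (Suc m1) (ins s) (ddeg s)"
    "sem \<mu> t \<in> End (outs t) (Suc n2) (ddeg t)" using sem_comp_End[of t s] by auto
  have insp: "ins s \<ge> 1" using outs_ins_pos equiv_upper_in by blast
  obtain \<sigma>' where \<sigma>': "\<sigma>' permutes {..<n2}" "\<sigma> = shift_perm 1 \<sigma>'"
    using permutes_shift_perm_1[of \<sigma> n2] equiv_upper_in * by auto
  have "\<sigma> permutes {..<Suc n2}" using permutes_shift_perm[OF \<sigma>'(1), of 1] \<sigma>'(2) by simp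
  moreover have "shift_perm (ins s - 1) \<sigma> permutes {..<ins s + n2}"
    using permutes_shift_perm[OF \<sigma>'(1), of "ins s"] insp by (simp add: \<sigma>'(2) shift_perm_shift_perm)
  ultimately show ?case using equiv_upper_in * insp by (simp add: same_type_def end_comp_upper_in)
next
  case (corolla_out m n \<sigma>)
  then show ?case using \<mu>[of m n] by (auto simp: same_type_def sym_to_ext_def)
next
  case (corolla_in m n \<sigma>)
  then show ?case using \<mu>[of m n] by (auto simp: same_type_def sym_to_ext_def)
next
  case (cong_comp t t' s s')
  then show ?case by (simp add: same_type_def)
next
  case (cong_out t t' \<sigma>)
  then show ?case by (simp add: same_type_def)
next
  case (cong_in t t' \<sigma>)
  then show ?case by (simp add: same_type_def)
qed (auto simp: same_type_def add_ac outs_ins_pos[simplified] fun_eq_iff algebra_simps end_out_scale end_in_scale end_comp_add_lower end_comp_scale_lower)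

end

end

section \<open>Unshuffles of words\<close>

text \<open>The pairing of \<open>G\<close> with the unshuffle coproduct of a word. The first letter
  joins the left part for free; to join the right part it has to be moved past the letters of the
  left part, which costs the product of the \<open>\<chi> b a\<close>.\<close>

fun unshuffle_sum ::
  "('x \<Rightarrow> 'x \<Rightarrow> 'k::comm_ring_1) \<Rightarrow> ('x list \<Rightarrow> 'x list \<Rightarrow> 'k) \<Rightarrow> 'x list \<Rightarrow> 'k" where
  "unshuffle_sum \<chi> G [] = G [] []"
| "unshuffle_sum \<chi> G (a # w) =
    unshuffle_sum \<chi> (\<lambda>x y. G (a # x) y) w + unshuffle_sum \<chi> (\<lambda>x y. (\<Prod>b\<leftarrow>x. \<chi> b a) * G x (a # y)) w"

lemma unshuffle_sum_cmult: "unshuffle_sum \<chi> (\<lambda>x y. c * G x y) w = c * unshuffle_sum \<chi> G w"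
proof (induction w arbitrary: G)
  case (Cons a w)
  have "unshuffle_sum \<chi> (\<lambda>x y. (\<Prod>b\<leftarrow>x. \<chi> b a) * (c * G x (a # y))) w =
      unshuffle_sum \<chi> (\<lambda>x y. c * ((\<Prod>b\<leftarrow>x. \<chi> b a) * G x (a # y))) w"
    by (simp add: mult.left_commute)
  then show ?case using Cons.IH by (simp add: distrib_left)
qed simp

lemma unshuffle_sum_add:
  "unshuffle_sum \<chi> (\<lambda>x y. G x y + H x y) w = unshuffle_sum \<chi> G w + unshuffle_sum \<chi> H w"
  by (induction w arbitrary: G H) (simp_all add: distrib_left add_ac)

lemma unshuffle_sum_zero:
  "(\<And>x y. set x \<union> set y = set w \<Longrightarrow> G x y = 0) \<Longrightarrow> unshuffle_sum \<chi> G w = 0"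
proof (induction w arbitrary: G)
  case (Cons a w)
  have "unshuffle_sum \<chi> (\<lambda>x y. G (a # x) y) w = 0"
    by (rule Cons.IH) (use Cons.prems in auto)
  moreover have "unshuffle_sum \<chi> (\<lambda>x y. (\<Prod>b\<leftarrow>x. \<chi> b a) * G x (a # y)) w = 0"
    by (rule Cons.IH) (use Cons.prems in auto)
  ultimately show ?case by simp
qed simp

lemma unshuffle_sum_left_Nil:
  "(\<And>x y. x \<noteq> [] \<Longrightarrow> G x y = 0) \<Longrightarrow> unshuffle_sum \<chi> G w = G [] w"
proof (induction w arbitrary: G)
  case (Cons a w)
  have "unshuffle_sum \<chi> (\<lambda>x y. G (a # x) y) w = 0"
    by (rule unshuffle_sum_zero) (use Cons.prems in auto)
  moreover have "unshuffle_sum \<chi> (\<lambda>x y. (\<Prod>b\<leftarrow>x. \<chi> b a) * G x (a # y)) w = (\<Prod>b\<leftarrow>[]. \<chi> b a) * G [] (a # w)"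
    by (rule Cons.IH) (use Cons.prems in auto)
  ultimately show ?case by simp
qed simp

lemma unshuffle_sum_right_Nil:
  "(\<And>x y. y \<noteq> [] \<Longrightarrow> G x y = 0) \<Longrightarrow> unshuffle_sum \<chi> G w = G w []"
proof (induction w arbitrary: G)
  case (Cons a w)
  have "unshuffle_sum \<chi> (\<lambda>x y. (\<Prod>b\<leftarrow>x. \<chi> b a) * G x (a # y)) w = 0"
    by (rule unshuffle_sum_zero) (use Cons.prems in auto)
  moreover have "unshuffle_sum \<chi> (\<lambda>x y. G (a # x) y) w = G (a # w) []"
    by (rule Cons.IH) (use Cons.prems in auto)
  ultimately show ?case by simp
qed simp

text \<open>If the left part is a single letter, an unshuffle selects this letter and moves it to
  the front. This and its mirror image turn the trees with a (1,1) vertex into the sums over legs in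
  a differential.\<close>

lemma unshuffle_sum_left_single:
  "(\<And>x y. length x \<noteq> 1 \<Longrightarrow> G x y = 0) \<Longrightarrow> unshuffle_sum \<chi> G w =
    (\<Sum>i<length w. (\<Prod>b\<leftarrow>take i w. \<chi> (w ! i) b) * G [w ! i] (take i w @ drop (Suc i) w))"
proof (induction w arbitrary: G)
  case Nil
  then show ?case by simp
next
  case (Cons a w)
  have "unshuffle_sum \<chi> (\<lambda>x y. G (a # x) y) w = G [a] w"
    by (rule unshuffle_sum_left_Nil) (use Cons.prems in auto)
  moreover have "unshuffle_sum \<chi> (\<lambda>x y. (\<Prod>b\<leftarrow>x. \<chi> b a) * G x (a # y)) w =
      (\<Sum>i<length w. (\<Prod>b\<leftarrow>take i w. \<chi> (w ! i) b) * ((\<Prod>b\<leftarrow>[w ! i]. \<chi> b a) * G [w ! i] (a # take i w @ drop (Suc i) w)))"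
    by (rule Cons.IH) (use Cons.prems in auto)
  ultimately show ?case
    by (simp add: sum.lessThan_Suc_shift mult_ac del: sum.lessThan_Suc)
qed

lemma unshuffle_sum_right_single:
  "(\<And>x y. length y \<noteq> 1 \<Longrightarrow> G x y = 0) \<Longrightarrow> unshuffle_sum \<chi> G w =
    (\<Sum>i<length w. (\<Prod>b\<leftarrow>drop (Suc i) w. \<chi> b (w ! i)) * G (take i w @ drop (Suc i) w) [w ! i])"
proof (induction w arbitrary: G)
  case Nil
  then show ?case by simp
next
  case (Cons a w)
  have "unshuffle_sum \<chi> (\<lambda>x y. (\<Prod>b\<leftarrow>x. \<chi> b a) * G x (a # y)) w = (\<Prod>b\<leftarrow>w. \<chi> b a) * G w [a]"
    by (rule unshuffle_sum_right_Nil) (use Cons.prems in auto)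
  moreover have "unshuffle_sum \<chi> (\<lambda>x y. G (a # x) y) w =
      (\<Sum>i<length w. (\<Prod>b\<leftarrow>drop (Suc i) w. \<chi> b (w ! i)) * G (a # take i w @ drop (Suc i) w) [w ! i])"
    by (rule Cons.IH) (use Cons.prems in auto)
  ultimately show ?case
    by (simp add: sum.lessThan_Suc_shift mult_ac add_ac del: sum.lessThan_Suc)
qed

text \<open>When the first two letters are swapped, the unshuffles sending both to one side use the
  alternation of \<open>G\<close>, and the two mixed terms are exchanged. A common prefix is
  absorbed into \<open>G\<close>: the weight of a letter sent to the right is symmetric in
  \<open>x\<close>, so the modified \<open>G\<close> is again alternating.\<close>

theorem alternating_unshuffle_sum:
  assumes \<chi>: "\<And>a b. \<chi> a b * \<chi> b a = 1" "\<And>a b. \<chi> a b = \<chi> b a"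
    and G: "\<And>y. alternating \<chi> (\<lambda>x. G x y)" "\<And>x. alternating \<chi> (G x)"
  shows "alternating \<chi> (unshuffle_sum \<chi> G)"
  unfolding alternating_def
proof (intro allI)
  fix u w a b
  show "unshuffle_sum \<chi> G (u @ a # b # w) = \<chi> a b * unshuffle_sum \<chi> G (u @ b # a # w)"
    using G
  proof (induction u arbitrary: G)
    case Nil
    have 1: "G (a # b # x) y = \<chi> a b * G (b # a # x) y" and 2: "G x (a # b # y) = \<chi> a b * G x (b # a # y)" for x y
      using alternatingD[OF Nil(1), of "[]" a b x y] alternatingD[OF Nil(2), of x "[]" a b y] by simp_all
    have 4: "(\<lambda>x. G (a # b # x)) = (\<lambda>x y. \<chi> a b * G (b # a # x) y)" by (intro ext) (rule 1)
    have 3: "\<chi> a b * (\<chi> a b * c) = c" for c using \<chi>(1)[of a b] \<chi>(2)[of b a] by (metis mult.assoc mult_1)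
    have 5: "\<chi> b a = \<chi> a b" by (rule \<chi>(2))
    have "unshuffle_sum \<chi> G (a # b # w) =
        unshuffle_sum \<chi> (\<lambda>x y. \<chi> a b * G (b # a # x) y) w +
        unshuffle_sum \<chi> (\<lambda>x y. (\<Prod>c\<leftarrow>x. \<chi> c b) * G (a # x) (b # y)) w +
        (unshuffle_sum \<chi> (\<lambda>x y. \<chi> b a * ((\<Prod>c\<leftarrow>x. \<chi> c a) * G (b # x) (a # y))) w +
        unshuffle_sum \<chi> (\<lambda>x y. \<chi> a b * ((\<Prod>c\<leftarrow>x. \<chi> c b) * ((\<Prod>c\<leftarrow>x. \<chi> c a) * G x (b # a # y)))) w)"
      by (simp add: 4 2 mult_ac)
    moreover have "unshuffle_sum \<chi> G (b # a # w) =
        unshuffle_sum \<chi> (\<lambda>x y. G (b # a # x) y) w +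
        unshuffle_sum \<chi> (\<lambda>x y. (\<Prod>c\<leftarrow>x. \<chi> c a) * G (b # x) (a # y)) w +
        (unshuffle_sum \<chi> (\<lambda>x y. \<chi> a b * ((\<Prod>c\<leftarrow>x. \<chi> c b) * G (a # x) (b # y))) w +
        unshuffle_sum \<chi> (\<lambda>x y. (\<Prod>c\<leftarrow>x. \<chi> c b) * ((\<Prod>c\<leftarrow>x. \<chi> c a) * G x (b # a # y))) w)"
      by (simp add: mult_ac)
    ultimately show ?case
      by (simp only: append_Nil unshuffle_sum_cmult distrib_left 5 3 add_ac)
  next
    case (Cons c u)
    have "unshuffle_sum \<chi> (\<lambda>x y. G (c # x) y) (u @ a # b # w) =
        \<chi> a b * unshuffle_sum \<chi> (\<lambda>x y. G (c # x) y) (u @ b # a # w)"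
      by (rule Cons.IH) (use alternating_Cons[OF Cons.prems(1)] Cons.prems(2) in auto)
    moreover have "unshuffle_sum \<chi> (\<lambda>x y. (\<Prod>d\<leftarrow>x. \<chi> d c) * G x (c # y)) (u @ a # b # w) =
        \<chi> a b * unshuffle_sum \<chi> (\<lambda>x y. (\<Prod>d\<leftarrow>x. \<chi> d c) * G x (c # y)) (u @ b # a # w)"
    proof (rule Cons.IH)
      show "alternating \<chi> (\<lambda>x. (\<Prod>d\<leftarrow>x. \<chi> d c) * G x (c # y))" for y
        unfolding alternating_def
      proof (intro allI)
        fix x z and p q
        show "(\<Prod>d\<leftarrow>x @ p # q # z. \<chi> d c) * G (x @ p # q # z) (c # y) =
            \<chi> p q * ((\<Prod>d\<leftarrow>x @ q # p # z. \<chi> d c) * G (x @ q # p # z) (c # y))"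
          by (simp add: alternatingD[OF Cons.prems(1), of x p q z] mult_ac)
      qed
      show "alternating \<chi> (\<lambda>y. (\<Prod>d\<leftarrow>x. \<chi> d c) * G x (c # y))" for x
        unfolding alternating_def
      proof (intro allI)
        fix y z and p q
        show "(\<Prod>d\<leftarrow>x. \<chi> d c) * G x (c # y @ p # q # z) = \<chi> p q * ((\<Prod>d\<leftarrow>x. \<chi> d c) * G x (c # y @ q # p # z))"
          using alternatingD[OF Cons.prems(2), of x "c # y" p q z] by (simp add: mult_ac)
      qed
    qed
    ultimately show ?case by (simp add: distrib_left)
  qed
qed

lemma inversion_sign_insert_min:
  assumes "\<And>b. b \<in> set x \<union> set y \<Longrightarrow> a < b \<or> a = b \<and> \<chi> a a = 1"
  shows "inversion_sign \<chi> (x @ a # y) = (\<Prod>b\<leftarrow>x. \<chi> b a) * inversion_sign \<chi> (x @ y)"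
  using assms
proof (induction x)
  case Nil
  have "(\<Prod>b\<leftarrow>y. if b < a then \<chi> a b else 1) = 1"
    using Nil by (intro prod_list_map_eq_1) (auto dest: less_asym)
  then show ?case by (simp add: inversion_sign_Cons)
next
  case (Cons c x)
  have "(if a < c then \<chi> c a else 1) = \<chi> c a" using Cons.prems[of c] by auto
  moreover have "inversion_sign \<chi> (x @ a # y) = (\<Prod>b\<leftarrow>x. \<chi> b a) * inversion_sign \<chi> (x @ y)"
    using Cons.prems by (intro Cons.IH) auto
  ultimately show ?case by (simp add: inversion_sign_Cons mult_ac)
qed

text \<open>\<open>subseqs (a # l)\<close> consists of the subsequences with \<open>a\<close> and
  those without, which is the recursion of \<open>unshuffle_sum\<close>. As \<open>a\<close> is the
  smallest position, the sign changes as for the insertion of a minimal letter.\<close>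

lemma unshuffle_sum_subseqs:
  fixes w :: "'x list" and l :: "nat list"
  assumes "sorted l" "distinct l"
  shows "(\<Sum>I\<leftarrow>subseqs l. inversion_sign (\<lambda>i j. \<chi> (w ! i) (w ! j)) (I @ filter (\<lambda>i. i \<notin> set I) l) *
      G (map (nth w) I) (map (nth w) (filter (\<lambda>i. i \<notin> set I) l))) = unshuffle_sum \<chi> G (map (nth w) l)"
  using assms
proof (induction l arbitrary: G)
  case (Cons a l)
  let ?\<chi> = "\<lambda>i j. \<chi> (w ! i) (w ! j)"
  let ?f = "\<lambda>I l. filter (\<lambda>i. i \<notin> set I) l"
  let ?F = "\<lambda>I. inversion_sign ?\<chi> (I @ ?f I (a # l)) * G (map (nth w) I) (map (nth w) (?f I (a # l)))"
  have gt: "a < b" if "b \<in> set l" for b using Cons.prems that by (cases "a = b") auto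
  have sub: "set I \<subseteq> set l" if "I \<in> set (subseqs l)" for I
    using that subseqs_powset[of l] by blast
  have 1: "?F (a # I) = inversion_sign ?\<chi> (I @ ?f I l) * G (w ! a # map (nth w) I) (map (nth w) (?f I l))"
    if I: "I \<in> set (subseqs l)" for I
  proof -
    have f: "?f (a # I) (a # l) = ?f I l" using Cons.prems(2) by (auto intro: filter_cong)
    have "inversion_sign ?\<chi> ([] @ a # (I @ ?f I l)) = (\<Prod>b\<leftarrow>[]. ?\<chi> b a) * inversion_sign ?\<chi> ([] @ (I @ ?f I l))"
      by (rule inversion_sign_insert_min) (use gt sub[OF I] in auto)
    then show ?thesis by (simp only: f) simp
  qed
  have 2: "?F I = inversion_sign ?\<chi> (I @ ?f I l) * ((\<Prod>b\<leftarrow>map (nth w) I. \<chi> b (w ! a)) * G (map (nth w) I) (w ! a # map (nth w) (?f I l)))"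
    if I: "I \<in> set (subseqs l)" for I
  proof -
    have f: "?f I (a # l) = a # ?f I l" using Cons.prems(2) sub[OF I] by auto
    have "inversion_sign ?\<chi> (I @ a # ?f I l) = (\<Prod>b\<leftarrow>I. ?\<chi> b a) * inversion_sign ?\<chi> (I @ ?f I l)"
      by (rule inversion_sign_insert_min) (use gt sub[OF I] in auto)
    then show ?thesis by (simp only: f) (simp add: o_def mult_ac)
  qed
  have "(\<Sum>I\<leftarrow>subseqs (a # l). ?F I) = (\<Sum>I\<leftarrow>subseqs l. ?F (a # I)) + (\<Sum>I\<leftarrow>subseqs l. ?F I)"
    by (simp add: Let_def o_def)
  also have "(\<Sum>I\<leftarrow>subseqs l. ?F (a # I)) = unshuffle_sum \<chi> (\<lambda>x y. G (w ! a # x) y) (map (nth w) l)"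
    using Cons.IH[of "\<lambda>x y. G (w ! a # x) y"] Cons.prems 1 by (simp cong: map_cong)
  also have "(\<Sum>I\<leftarrow>subseqs l. ?F I) = unshuffle_sum \<chi> (\<lambda>x y. (\<Prod>b\<leftarrow>x. \<chi> b (w ! a)) * G x (w ! a # y)) (map (nth w) l)"
    using Cons.IH[of "\<lambda>x y. (\<Prod>b\<leftarrow>x. \<chi> b (w ! a)) * G x (w ! a # y)"] Cons.prems 2 by (simp cong: map_cong)
  finally show ?case by simp
qed simp

lemma splittings_properties:
  assumes "(I, K) \<in> set (splittings n)"
  shows "distinct (I @ K)" "set (I @ K) = {..<n}" "length (I @ K) = n"
proof -
  have I: "I \<in> set (subseqs [0..<n])" and K: "K = complement_list n I"
    using assms by (auto simp: splittings_def)
  have "set I \<subseteq> {..<n}" using I subseqs_powset[of "[0..<n]"] by (auto simp: atLeast0LessThan)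
  then show set: "set (I @ K) = {..<n}" by (auto simp: K complement_list_def)
  have "distinct I" using I subseqs_distinctD by fastforce
  then show dist: "distinct (I @ K)" by (auto simp: K complement_list_def)
  show "length (I @ K) = n" using distinct_card[OF dist] set by simp
qed

lemma list_perm_splitting_permutes:
  "(I, K) \<in> set (splittings n) \<Longrightarrow> list_perm (I @ K) permutes {..<n}"
  using list_perm_permutes[of "I @ K"] splittings_properties[of I K n] by simp

theorem unshuffle_sum_splittings:
  "(\<Sum>(I, K)\<leftarrow>splittings (length w). perm_sign \<chi> (list_perm (I @ K)) w * G (map (nth w) I) (map (nth w) K)) =
    unshuffle_sum \<chi> G w"
proof -
  have "perm_sign \<chi> (list_perm (I @ K)) w = inversion_sign (\<lambda>i j. \<chi> (w ! i) (w ! j)) (I @ K)"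
    if "(I, K) \<in> set (splittings (length w))" for I K
  proof -
    have "map (list_perm (I @ K)) [0..<length w] = I @ K"
      using splittings_properties(3)[OF that] by (intro nth_equalityI) (auto simp: list_perm_def)
    then show ?thesis by (simp add: perm_sign_def)
  qed
  then have "(\<Sum>(I, K)\<leftarrow>splittings (length w). perm_sign \<chi> (list_perm (I @ K)) w * G (map (nth w) I) (map (nth w) K)) =
      (\<Sum>(I, K)\<leftarrow>splittings (length w). inversion_sign (\<lambda>i j. \<chi> (w ! i) (w ! j)) (I @ K) * G (map (nth w) I) (map (nth w) K))"
    by (intro arg_cong[where f = sum_list] map_cong) auto
  also have "\<dots> = unshuffle_sum \<chi> G (map (nth w) [0..<length w])"
    unfolding unshuffle_sum_subseqs[OF sorted_upt distinct_upt, symmetric]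
    by (simp add: splittings_def complement_list_def o_def)
  finally show ?thesis by (simp only: map_nth)
qed

section \<open>The quadratic relations\<close>

lemma sum_list_concat: "sum_list (concat xss) = sum_list (map sum_list xss)"
  by (induction xss) simp_all

context based_graded_space begin

text \<open>All arities in one function, read off from the lengths of the words. The value 0 on
  empty words encodes \<open>m \<ge> 1\<close> and \<open>n \<ge> 1\<close>, and with it the
  conditions in the differential that \<open>I\<^sub>2\<close> and \<open>J\<^sub>1\<close> be
  nonempty.\<close>

definition coef :: "(nat \<Rightarrow> nat \<Rightarrow> ('v, 'k) operation) \<Rightarrow> 'i list \<Rightarrow> 'i list \<Rightarrow> 'k" where
  "coef \<mu> \<alpha> \<beta> = (if \<alpha> = [] \<or> \<beta> = [] then 0 else mat (\<mu> (length \<beta>) (length \<alpha>)) \<alpha> \<beta>)"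

text \<open>A two-vertex tree with lower inputs \<open>x\<close>, remaining upper inputs
  \<open>y\<close>, free lower outputs \<open>z\<close> and upper outputs \<open>w\<close>. The
  first sign is the factor (-1)^(|I1||I2|) of the corolla differential. The second is that of
  \<open>end_comp\<close>: the lower vertex has one output more than \<open>z\<close>, hence degree
  \<open>1 - length z\<close>, and the upper one has degree \<open>2 - length w\<close>.\<close>

definition composite :: "(nat \<Rightarrow> nat \<Rightarrow> ('v, 'k) operation) \<Rightarrow> 'i list \<Rightarrow> 'i list \<Rightarrow> 'i list \<Rightarrow> 'i list \<Rightarrow> 'k" where
  "composite \<mu> x y z w = parity_sign (int (length z * length w)) *
    (parity_sign ((1 - int (length z)) * (2 - int (length w) + deg y)) *
      Sum_any (\<lambda>\<gamma>. coef \<mu> x (z @ [\<gamma>]) * coef \<mu> (\<gamma> # y) w))"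

text \<open>Trees with a vertex \<open>\<mu> 1 1\<close> are included, so the differential of the dg
  space is part of the same quadratic expression.\<close>

definition relation :: "(nat \<Rightarrow> nat \<Rightarrow> ('v, 'k) operation) \<Rightarrow> 'i list \<Rightarrow> 'i list \<Rightarrow> 'k" where
  "relation \<mu> \<alpha> \<beta> = unshuffle_sum (graded_swap dg) (\<lambda>x y. unshuffle_sum (skew_swap dg) (composite \<mu> x y) \<beta>) \<alpha>"

lemma composite_Nil [simp]: "composite \<mu> [] y z w = 0" "composite \<mu> x y z [] = 0"
  by (simp_all add: composite_def coef_def)

lemma coef_support: "coef \<mu> \<alpha> \<beta> \<noteq> 0 \<Longrightarrow> set \<alpha> \<subseteq> A \<and> set \<beta> \<subseteq> A"
  by (auto simp: coef_def mat_def split: if_splits)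

lemma composite_support:
  assumes "composite \<mu> x y z w \<noteq> 0"
  shows "set x \<subseteq> A \<and> set y \<subseteq> A \<and> set z \<subseteq> A \<and> set w \<subseteq> A"
proof (rule ccontr)
  assume *: "\<not> (set x \<subseteq> A \<and> set y \<subseteq> A \<and> set z \<subseteq> A \<and> set w \<subseteq> A)"
  have "coef \<mu> x (z @ [\<gamma>]) * coef \<mu> (\<gamma> # y) w = 0" for \<gamma>
    using coef_support[of \<mu> x "z @ [\<gamma>]"] coef_support[of \<mu> "\<gamma> # y" w] * by auto
  then show False using assms by (simp add: composite_def del: mult_eq_0_iff)
qed

lemma relation_support: "\<not> (set \<alpha> \<subseteq> A \<and> set \<beta> \<subseteq> A \<and> \<alpha> \<noteq> [] \<and> \<beta> \<noteq> []) \<Longrightarrow> relation \<mu> \<alpha> \<beta> = 0"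
proof -
  assume *: "\<not> (set \<alpha> \<subseteq> A \<and> set \<beta> \<subseteq> A \<and> \<alpha> \<noteq> [] \<and> \<beta> \<noteq> [])"
  show ?thesis
  proof (cases "\<alpha> = [] \<or> \<beta> = []")
    case True
    moreover have "unshuffle_sum (skew_swap dg) (composite \<mu> [] []) \<beta> = 0"
      by (rule unshuffle_sum_zero) simp
    ultimately show ?thesis unfolding relation_def
      by (auto intro!: unshuffle_sum_zero)
  next
    case False
    show ?thesis
      unfolding relation_def
    proof (intro unshuffle_sum_zero)
      fix x y z w assume "set x \<union> set y = set \<alpha>" "set z \<union> set w = set \<beta>"
      then show "composite \<mu> x y z w = 0"
        using composite_support[of \<mu> x y z w] * False by (metis Un_subset_iff)
    qed
  qed
qed

context
  fixes \<mu> :: "nat \<Rightarrow> nat \<Rightarrow> ('v, 'k) operation"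
  assumes \<mu>: "\<And>m n. m \<ge> 1 \<Longrightarrow> n \<ge> 1 \<Longrightarrow> \<mu> m n \<in> sym_to_ext m n"
begin

lemma alternating_coef_in: "alternating (graded_swap dg) (\<lambda>\<alpha>. coef \<mu> \<alpha> \<beta>)"
proof (rule alternatingI_permute[OF _ graded_swap_involutive graded_swap_commute])
  fix w \<sigma> assume \<sigma>: "\<sigma> permutes {..<length (w :: 'i list)}"
  show "coef \<mu> w \<beta> = perm_sign (graded_swap dg) \<sigma> w * coef \<mu> (permute_list \<sigma> w) \<beta>"
  proof (cases "w = [] \<or> \<beta> = []")
    case True
    moreover have "permute_list \<sigma> w = []" if "w = []" using that by simp
    ultimately show ?thesis by (auto simp: coef_def)
  next
    case False
    then have mn: "length \<beta> \<ge> 1" "length w \<ge> 1" by (simp_all add: Suc_le_eq)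
    have "permute_list \<sigma> w \<noteq> []" using False by (metis length_0_conv length_permute_list)
    moreover have "end_in \<sigma> (\<mu> (length \<beta>) (length w)) = \<mu> (length \<beta>) (length w)"
      using \<mu>[OF mn] \<sigma> by (simp add: sym_to_ext_def)
    ultimately show ?thesis using False mat_end_in[OF mu_End[OF \<mu> mn] \<sigma>, of w \<beta>] by (simp add: coef_def)
  qed
qed

lemma alternating_coef_out: "alternating (skew_swap dg) (coef \<mu> \<alpha>)"
proof (rule alternatingI_permute[OF _ skew_swap_involutive skew_swap_commute])
  fix w \<sigma> assume \<sigma>: "\<sigma> permutes {..<length (w :: 'i list)}"
  show "coef \<mu> \<alpha> w = perm_sign (skew_swap dg) \<sigma> w * coef \<mu> \<alpha> (permute_list \<sigma> w)"
  proof (cases "w = [] \<or> \<alpha> = []")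
    case True
    moreover have "permute_list \<sigma> w = []" if "w = []" using that by simp
    ultimately show ?thesis by (auto simp: coef_def)
  next
    case False
    then have mn: "length w \<ge> 1" "length \<alpha> \<ge> 1" by (simp_all add: Suc_le_eq)
    have ne: "permute_list \<sigma> w \<noteq> []" using False by (metis length_0_conv length_permute_list)
    have "end_out \<sigma> (\<mu> (length w) (length \<alpha>)) = (\<lambda>xs \<xi>s. of_int (sign \<sigma>) * \<mu> (length w) (length \<alpha>) xs \<xi>s)"
      using \<mu>[OF mn] \<sigma> by (simp add: sym_to_ext_def)
    then have "of_int (sign \<sigma>) * mat (\<mu> (length w) (length \<alpha>)) \<alpha> w =
        perm_sign (graded_swap dg) \<sigma> w * mat (\<mu> (length w) (length \<alpha>)) \<alpha> (permute_list \<sigma> w)"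
      using mat_end_out[OF mu_End[OF \<mu> mn] \<sigma>, of \<alpha> w] by (simp add: mat_scale)
    then have "of_int (sign \<sigma>) * (of_int (sign \<sigma>) * mat (\<mu> (length w) (length \<alpha>)) \<alpha> w) =
        perm_sign (skew_swap dg) \<sigma> w * mat (\<mu> (length w) (length \<alpha>)) \<alpha> (permute_list \<sigma> w)"
      by (simp add: perm_sign_skew[OF \<sigma>] mult_ac)
    moreover have "of_int (sign \<sigma>) * (of_int (sign \<sigma>) * c) = (c :: 'k)" for c
      by (cases \<sigma> rule: sign_cases) simp_all
    ultimately show ?thesis using False ne by (simp add: coef_def)
  qed
qed

lemma finite_coef: "finite {\<gamma>. coef \<mu> \<alpha> (b1 @ \<gamma> # b2) \<noteq> 0}"
proof (cases "\<alpha> = []")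
  case False
  then show ?thesis
    using finite_mat_slot[OF mu_End[OF \<mu>, of "length (b1 @ undefined # b2)" "length \<alpha>"], of \<alpha> b1 b2]
    by (simp add: coef_def Suc_le_eq)
qed (simp add: coef_def)

text \<open>The shuffle sign of the differential and the Koszul sign of the output action combine to
  a skew sign, while the inputs keep their Koszul sign. A summand of the differential thus becomes a
  summand of a double unshuffle sum.\<close>

lemma mat_two_vertex_tree:
  assumes I: "(I1, I2) \<in> set (splittings (length \<beta>))" "I2 \<noteq> []" and J: "(J1, J2) \<in> set (splittings (length \<alpha>))" "J1 \<noteq> []"
  shows "mat (sem \<mu> (DScale (of_int (sign (list_perm (I1 @ I2))) * (- 1) ^ (length I1 * length I2)) (two_vertex_tree I1 I2 J1 J2))) \<alpha> \<beta> =
    perm_sign (skew_swap dg) (list_perm (I1 @ I2)) \<beta> * (perm_sign (graded_swap dg) (list_perm (J1 @ J2)) \<alpha> *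
      composite \<mu> (map (nth \<alpha>) J1) (map (nth \<alpha>) J2) (map (nth \<beta>) I1) (map (nth \<beta>) I2))"
proof -
  let ?s = "parity_sign :: int \<Rightarrow> 'k"
  let ?x = "map (nth \<alpha>) J1" and ?y = "map (nth \<alpha>) J2" and ?z = "map (nth \<beta>) I1" and ?w = "map (nth \<beta>) I2"
  have lI: "length I1 + length I2 = length \<beta>" and lJ: "length J1 + length J2 = length \<alpha>"
    using splittings_properties(3)[OF I(1)] splittings_properties(3)[OF J(1)] by simp_all
  have f: "\<mu> (Suc (length I1)) (length J1) \<in> End (Suc (length I1)) (length J1) (2 - int (Suc (length I1)))"
    using J(2) by (intro mu_End[OF \<mu>]) (simp_all add: Suc_le_eq)
  have g: "\<mu> (length I2) (Suc (length J2)) \<in> End (length I2) (Suc (length J2)) (2 - int (length I2))"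
    using I(2) by (intro mu_End[OF \<mu>]) (simp_all add: Suc_le_eq)
  let ?C = "end_comp (length I1) (length J1) (2 - int (length I2)) (2 - int (Suc (length I1)))
    (\<mu> (length I2) (Suc (length J2))) (\<mu> (Suc (length I1)) (length J1))"
  have C: "?C \<in> End (length \<beta>) (length \<alpha>) (2 - int (length I2) + (2 - int (Suc (length I1))))"
    using End_end_comp[OF f g] lI lJ by simp
  have pI: "list_perm (I1 @ I2) permutes {..<length \<beta>}" and pJ: "list_perm (J1 @ J2) permutes {..<length \<alpha>}"
    using list_perm_splitting_permutes[OF I(1)] list_perm_splitting_permutes[OF J(1)] by auto
  have pl: "permute_list (list_perm (I1 @ I2)) \<beta> = ?z @ ?w" "permute_list (list_perm (J1 @ J2)) \<alpha> = ?x @ ?y"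
    using permute_list_list_perm[of "I1 @ I2" \<beta>] permute_list_list_perm[of "J1 @ J2" \<alpha>] lI lJ by simp_all
  have "mat (sem \<mu> (two_vertex_tree I1 I2 J1 J2)) \<alpha> \<beta> =
      perm_sign (graded_swap dg) (list_perm (I1 @ I2)) \<beta> * (perm_sign (graded_swap dg) (list_perm (J1 @ J2)) \<alpha> * mat ?C (?x @ ?y) (?z @ ?w))"
    using mat_end_out[OF End_end_in[OF C pJ] pI, of \<alpha> \<beta>] mat_end_in[OF C pJ, of \<alpha> "?z @ ?w"]
    by (simp add: two_vertex_tree_def pl)
  also have "mat ?C (?x @ ?y) (?z @ ?w) = ?s ((1 - int (length I1)) * (2 - int (length I2) + deg ?y)) *
      Sum_any (\<lambda>\<gamma>. coef \<mu> ?x (?z @ [\<gamma>]) * coef \<mu> (\<gamma> # ?y) ?w)"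
    using mat_end_comp[OF f g, of ?x ?z ?y ?w] I(2) J(2) by (simp add: coef_def)
  finally show ?thesis
    by (simp add: mat_scale composite_def perm_sign_skew[OF pI] power_minus_one_eq_parity_sign mult_ac)
qed

lemma sem_foldr: "mat (sem \<mu> (foldr DAdd ts z)) \<alpha> \<beta> = (\<Sum>t\<leftarrow>ts. mat (sem \<mu> t) \<alpha> \<beta>) + mat (sem \<mu> z) \<alpha> \<beta>"
proof (induction ts)
  case (Cons a ts)
  have "mat (sem \<mu> a + sem \<mu> (foldr DAdd ts z)) \<alpha> \<beta> = mat (sem \<mu> a) \<alpha> \<beta> + mat (sem \<mu> (foldr DAdd ts z)) \<alpha> \<beta>"
    by (rule mat_add)
  then show ?case using Cons by (simp only: foldr_Cons o_apply sem.simps list.map sum_list.Cons add.assoc)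
qed simp

lemma sum_list_pair_cong:
  "(\<And>x y. (x, y) \<in> set zs \<Longrightarrow> F x y = G x y) \<Longrightarrow> (\<Sum>(x, y)\<leftarrow>zs. F x y) = (\<Sum>(x, y)\<leftarrow>zs. G x y)"
  by (intro arg_cong[where f = sum_list] map_cong) auto

text \<open>No vertex is a (1,1)-corolla: the lower vertex has \<open>length z + 1\<close> outputs
  and \<open>length x\<close> inputs, the upper one \<open>length w\<close> outputs and
  \<open>length y + 1\<close> inputs.\<close>

definition admissible :: "'i list \<Rightarrow> 'i list \<Rightarrow> 'i list \<Rightarrow> 'i list \<Rightarrow> bool" where
  "admissible x y z w \<longleftrightarrow> \<not> (length z = 0 \<and> length x = 1) \<and> \<not> (length w = 1 \<and> length y = 0)"

lemma mat_corolla_differential: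
  "mat (sem \<mu> (corolla_differential (length \<beta>) (length \<alpha>))) \<alpha> \<beta> =
    unshuffle_sum (graded_swap dg) (\<lambda>x y. unshuffle_sum (skew_swap dg)
      (\<lambda>z w. if admissible x y z w then composite \<mu> x y z w else 0) \<beta>) \<alpha>"
proof -
  let ?C = "\<lambda>x y z w. if admissible x y z w then composite \<mu> x y z w else 0"
  let ?sI = "\<lambda>I1 I2. perm_sign (skew_swap dg) (list_perm (I1 @ I2)) \<beta> :: 'k"
  let ?sJ = "\<lambda>J1 J2. perm_sign (graded_swap dg) (list_perm (J1 @ J2)) \<alpha> :: 'k"
  let ?T = "\<lambda>I1 I2 J1 J2. ?sI I1 I2 * (?sJ J1 J2 * ?C (map (nth \<alpha>) J1) (map (nth \<alpha>) J2) (map (nth \<beta>) I1) (map (nth \<beta>) I2))"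
  let ?D = "\<lambda>I1 I2 J1 J2. DScale (of_int (sign (list_perm (I1 @ I2))) * (- 1) ^ (length I1 * length I2)) (two_vertex_tree I1 I2 J1 J2) :: 'k dterm"
  let ?P = "\<lambda>I1 I2 J1 J2. I2 \<noteq> [] \<and> J1 \<noteq> [] \<and> (Suc (length I1), length J1) \<noteq> (1, 1) \<and> (length I2, Suc (length J2)) \<noteq> (1, 1)"
  have *: "(\<Sum>t\<leftarrow>(if ?P I1 I2 J1 J2 then [?D I1 I2 J1 J2] else []). mat (sem \<mu> t) \<alpha> \<beta>) = ?T I1 I2 J1 J2"
    if "(I1, I2) \<in> set (splittings (length \<beta>))" "(J1, J2) \<in> set (splittings (length \<alpha>))" for I1 I2 J1 J2
  proof (cases "?P I1 I2 J1 J2")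
    case True
    then have "admissible (map (nth \<alpha>) J1) (map (nth \<alpha>) J2) (map (nth \<beta>) I1) (map (nth \<beta>) I2)"
      by (auto simp: admissible_def)
    then show ?thesis using True mat_two_vertex_tree[OF that(1) _ that(2)] by simp
  next
    case False
    then have "?C (map (nth \<alpha>) J1) (map (nth \<alpha>) J2) (map (nth \<beta>) I1) (map (nth \<beta>) I2) = 0"
      by (auto simp: admissible_def)
    then show ?thesis by (simp only: if_not_P[OF False]) simp
  qed
  have "mat (sem \<mu> (corolla_differential (length \<beta>) (length \<alpha>))) \<alpha> \<beta> =
      (\<Sum>(I1, I2)\<leftarrow>splittings (length \<beta>). \<Sum>(J1, J2)\<leftarrow>splittings (length \<alpha>).
        \<Sum>t\<leftarrow>(if ?P I1 I2 J1 J2 then [?D I1 I2 J1 J2] else []). mat (sem \<mu> t) \<alpha> \<beta>)"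
    unfolding corolla_differential_def sem_foldr
    by (simp add: map_concat sum_list_concat o_def case_prod_unfold)
  also have "\<dots> = (\<Sum>(I1, I2)\<leftarrow>splittings (length \<beta>). \<Sum>(J1, J2)\<leftarrow>splittings (length \<alpha>). ?T I1 I2 J1 J2)"
    by (rule sum_list_pair_cong) (intro sum_list_pair_cong *)
  also have "\<dots> = (\<Sum>(I1, I2)\<leftarrow>splittings (length \<beta>). ?sI I1 I2 *
      (\<Sum>(J1, J2)\<leftarrow>splittings (length \<alpha>). ?sJ J1 J2 * ?C (map (nth \<alpha>) J1) (map (nth \<alpha>) J2) (map (nth \<beta>) I1) (map (nth \<beta>) I2)))"
    by (simp add: sum_list_const_mult[symmetric] case_prod_unfold)
  also have "\<dots> = unshuffle_sum (skew_swap dg) (\<lambda>z w. unshuffle_sum (graded_swap dg) (\<lambda>x y. ?C x y z w) \<alpha>) \<beta>"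
    unfolding unshuffle_sum_splittings[of "graded_swap dg" \<alpha> "\<lambda>x y. ?C x y _ _"]
    by (rule unshuffle_sum_splittings[where G = "\<lambda>z w. unshuffle_sum (graded_swap dg) (\<lambda>x y. ?C x y z w) \<alpha>"])
  \<comment> \<open>The unshuffles of inputs and of outputs are independent, so the two sums may be
    exchanged.\<close>
  also have "\<dots> = unshuffle_sum (graded_swap dg) (\<lambda>x y. unshuffle_sum (skew_swap dg) (\<lambda>z w. ?C x y z w) \<beta>) \<alpha>"
  proof -
    have "unshuffle_sum \<chi> (\<lambda>z w. unshuffle_sum \<chi>' (\<lambda>x y. H x y z w) \<alpha>) \<beta> =
        unshuffle_sum \<chi>' (\<lambda>x y. unshuffle_sum \<chi> (H x y) \<beta>) \<alpha>" for H and \<chi> \<chi>' :: "'i \<Rightarrow> 'i \<Rightarrow> 'k" and \<beta>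
      by (induction \<beta> arbitrary: H) (simp_all add: unshuffle_sum_add unshuffle_sum_cmult[symmetric])
    then show ?thesis .
  qed
  finally show ?thesis .
qed

context
  fixes \<delta> :: "'v \<Rightarrow> 'v"
  assumes \<delta>: "dg_vector_space \<delta>" and \<mu>11: "\<mu> 1 1 = (\<lambda>xs. if length xs = 1 then pure_tensor (map \<delta> xs) else 0)"
begin

lemma coef_11: "coef \<mu> [a] [b] = d_mat \<delta> a b"
proof (cases "a \<in> A \<and> b \<in> A")
  case True
  have "\<mu> 1 1 [e a] [dual b] = dual b (\<delta> (e a))"
    unfolding \<mu>11 by (simp add: pure_tensor_Cons pure_tensor_Nil)
  then show ?thesis using True by (simp add: coef_def mat_def d_mat_def[OF \<delta>])
qed (auto simp: coef_def mat_def d_mat_def[OF \<delta>])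

text \<open>The upper vertex is \<delta>: no further inputs and one output letter, moved from place
  \<open>j\<close> to the end. The two signs of \<open>composite\<close> leave a global minus. In
  moving the internal letter back to place \<open>j\<close>, the change of parity by \<delta> leaves
  exactly the sign of the tail.\<close>

lemma upper_differential:
  assumes "\<alpha> \<noteq> []" "\<beta> \<noteq> []"
  shows "unshuffle_sum (graded_swap dg) (\<lambda>x y. unshuffle_sum (skew_swap dg)
      (\<lambda>z w. if length w = 1 \<and> length y = 0 then composite \<mu> x y z w else 0) \<beta>) \<alpha> =
    - (\<Sum>j<length \<beta>. parity_sign (deg (drop (Suc j) \<beta>)) * Sum_any (\<lambda>\<gamma>. d_mat \<delta> \<gamma> (\<beta> ! j) * coef \<mu> \<alpha> (take j \<beta> @ \<gamma> # drop (Suc j) \<beta>)))"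
proof -
  let ?s = "parity_sign :: int \<Rightarrow> 'k"
  have "unshuffle_sum (graded_swap dg) (\<lambda>x y. unshuffle_sum (skew_swap dg)
      (\<lambda>z w. if length w = 1 \<and> length y = 0 then composite \<mu> x y z w else 0) \<beta>) \<alpha> =
    unshuffle_sum (skew_swap dg) (\<lambda>z w. if length w = 1 \<and> length ([] :: 'i list) = 0 then composite \<mu> \<alpha> [] z w else 0) \<beta>"
    by (rule unshuffle_sum_right_Nil) (simp add: unshuffle_sum_zero)
  also have "\<dots> = (\<Sum>j<length \<beta>. (\<Prod>b\<leftarrow>drop (Suc j) \<beta>. skew_swap dg b (\<beta> ! j)) * composite \<mu> \<alpha> [] (take j \<beta> @ drop (Suc j) \<beta>) [\<beta> ! j])"
    by (subst unshuffle_sum_right_single) auto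
  also have "\<dots> = (\<Sum>j<length \<beta>. - (?s (deg (drop (Suc j) \<beta>)) * Sum_any (\<lambda>\<gamma>. d_mat \<delta> \<gamma> (\<beta> ! j) * coef \<mu> \<alpha> (take j \<beta> @ \<gamma> # drop (Suc j) \<beta>))))"
  proof (rule sum.cong)
    fix j assume "j \<in> {..<length \<beta>}"
    let ?T = "take j \<beta>" and ?D = "drop (Suc j) \<beta>" and ?b = "\<beta> ! j"
    have 1: "(\<Prod>b\<leftarrow>?D. skew_swap dg b ?b) = ?s (int (length ?D) + dg ?b * deg ?D)"
      using prod_skew_swap[of dg ?b ?D] by (simp add: skew_swap_commute[of dg _ ?b] deg_def)
    have c: "composite \<mu> \<alpha> [] z [b] = - Sum_any (\<lambda>\<gamma>. coef \<mu> \<alpha> (z @ [\<gamma>]) * d_mat \<delta> \<gamma> b)" for z b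
    proof -
      have "composite \<mu> \<alpha> [] z [b] = ?s (int (length z) + (1 - int (length z))) * Sum_any (\<lambda>\<gamma>. coef \<mu> \<alpha> (z @ [\<gamma>]) * d_mat \<delta> \<gamma> b)"
        by (simp add: composite_def coef_11 parity_sign_add[symmetric] mult.assoc[symmetric] del: parity_sign_add)
      then show ?thesis by (simp add: parity_sign_def)
    qed
    have "(\<Prod>b\<leftarrow>?D. skew_swap dg b ?b) * composite \<mu> \<alpha> [] (?T @ ?D) [?b] =
        - Sum_any (\<lambda>\<gamma>. ?s (int (length ?D) + dg ?b * deg ?D) * (coef \<mu> \<alpha> (?T @ ?D @ [\<gamma>]) * d_mat \<delta> \<gamma> ?b))"
      unfolding 1 c by (simp add: Sum_any_cmult)
    also have "(\<lambda>\<gamma>. ?s (int (length ?D) + dg ?b * deg ?D) * (coef \<mu> \<alpha> (?T @ ?D @ [\<gamma>]) * d_mat \<delta> \<gamma> ?b)) =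
        (\<lambda>\<gamma>. ?s (deg ?D) * (d_mat \<delta> \<gamma> ?b * coef \<mu> \<alpha> (?T @ \<gamma> # ?D)))"
    proof
      fix \<gamma>
      show "?s (int (length ?D) + dg ?b * deg ?D) * (coef \<mu> \<alpha> (?T @ ?D @ [\<gamma>]) * d_mat \<delta> \<gamma> ?b) =
          ?s (deg ?D) * (d_mat \<delta> \<gamma> ?b * coef \<mu> \<alpha> (?T @ \<gamma> # ?D))"
      proof (cases "d_mat \<delta> \<gamma> ?b = 0")
        case False
        then have d: "dg ?b = dg \<gamma> + 1" by (rule d_mat_degree[OF \<delta>])
        have "coef \<mu> \<alpha> (?T @ \<gamma> # ?D) = ?s (int (length ?D) + dg \<gamma> * deg ?D) * coef \<mu> \<alpha> (?T @ ?D @ [\<gamma>])"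
          using alternating_move[OF alternating_coef_out, of \<alpha> ?T \<gamma> ?D "[]"] by (simp add: prod_skew_swap deg_def)
        then show ?thesis unfolding d by (simp add: parity_sign_add distrib_right mult_ac)
      qed simp
    qed
    also have "- Sum_any \<dots> = - (?s (deg ?D) * Sum_any (\<lambda>\<gamma>. d_mat \<delta> \<gamma> ?b * coef \<mu> \<alpha> (?T @ \<gamma> # ?D)))"
      by (simp add: Sum_any_cmult)
    finally show "(\<Prod>b\<leftarrow>?D. skew_swap dg b ?b) * composite \<mu> \<alpha> [] (?T @ ?D) [?b] = \<dots>" .
  qed simp
  finally show ?thesis by (simp add: sum_negf)
qed

text \<open>The lower vertex is \<delta>: one input letter, moved to the front, and no free output.
  Having degree 1, it contributes the degree of the upper vertex and those of the other inputs.
  Moving the internal letter back to its place cancels the part of the letters before it.\<close>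

lemma lower_differential:
  assumes "\<alpha> \<noteq> []" "\<beta> \<noteq> []"
  shows "unshuffle_sum (graded_swap dg) (\<lambda>x y. unshuffle_sum (skew_swap dg)
      (\<lambda>z w. if length z = 0 \<and> length x = 1 then composite \<mu> x y z w else 0) \<beta>) \<alpha> =
    parity_sign (2 - int (length \<beta>)) * (\<Sum>i<length \<alpha>. parity_sign (deg (drop (Suc i) \<alpha>)) * Sum_any (\<lambda>\<gamma>. d_mat \<delta> (\<alpha> ! i) \<gamma> * coef \<mu> (take i \<alpha> @ \<gamma> # drop (Suc i) \<alpha>) \<beta>))"
proof -
  let ?s = "parity_sign :: int \<Rightarrow> 'k"
  have "unshuffle_sum (skew_swap dg) (\<lambda>z w. if length z = 0 \<and> length x = 1 then composite \<mu> x y z w else 0) \<beta> =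
      (if length ([] :: 'i list) = 0 \<and> length x = 1 then composite \<mu> x y [] \<beta> else 0)" for x y
    by (rule unshuffle_sum_left_Nil) simp
  then have "unshuffle_sum (graded_swap dg) (\<lambda>x y. unshuffle_sum (skew_swap dg)
      (\<lambda>z w. if length z = 0 \<and> length x = 1 then composite \<mu> x y z w else 0) \<beta>) \<alpha> =
    unshuffle_sum (graded_swap dg) (\<lambda>x y. if length x = 1 then composite \<mu> x y [] \<beta> else 0) \<alpha>"
    by simp
  also have "\<dots> = (\<Sum>i<length \<alpha>. (\<Prod>b\<leftarrow>take i \<alpha>. graded_swap dg (\<alpha> ! i) b) * composite \<mu> [\<alpha> ! i] (take i \<alpha> @ drop (Suc i) \<alpha>) [] \<beta>)"
    by (subst unshuffle_sum_left_single) auto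
  also have "\<dots> = (\<Sum>i<length \<alpha>. ?s (2 - int (length \<beta>)) * (?s (deg (drop (Suc i) \<alpha>)) * Sum_any (\<lambda>\<gamma>. d_mat \<delta> (\<alpha> ! i) \<gamma> * coef \<mu> (take i \<alpha> @ \<gamma> # drop (Suc i) \<alpha>) \<beta>)))"
  proof (rule sum.cong)
    fix i assume "i \<in> {..<length \<alpha>}"
    let ?T = "take i \<alpha>" and ?D = "drop (Suc i) \<alpha>" and ?a = "\<alpha> ! i"
    have "(\<Prod>b\<leftarrow>?T. graded_swap dg ?a b) * composite \<mu> [?a] (?T @ ?D) [] \<beta> =
        Sum_any (\<lambda>\<gamma>. ?s (dg ?a * deg ?T) * (?s (2 - int (length \<beta>)) * (?s (deg ?T) * (?s (deg ?D) * (d_mat \<delta> ?a \<gamma> * coef \<mu> (\<gamma> # ?T @ ?D) \<beta>)))))"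
      by (simp add: composite_def coef_11 prod_graded_swap deg_def[symmetric] Sum_any_cmult parity_sign_add mult_ac)
    also have "(\<lambda>\<gamma>. ?s (dg ?a * deg ?T) * (?s (2 - int (length \<beta>)) * (?s (deg ?T) * (?s (deg ?D) * (d_mat \<delta> ?a \<gamma> * coef \<mu> (\<gamma> # ?T @ ?D) \<beta>))))) =
        (\<lambda>\<gamma>. ?s (2 - int (length \<beta>)) * (?s (deg ?D) * (d_mat \<delta> ?a \<gamma> * coef \<mu> (?T @ \<gamma> # ?D) \<beta>)))"
    proof
      fix \<gamma>
      show "?s (dg ?a * deg ?T) * (?s (2 - int (length \<beta>)) * (?s (deg ?T) * (?s (deg ?D) * (d_mat \<delta> ?a \<gamma> * coef \<mu> (\<gamma> # ?T @ ?D) \<beta>)))) =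
          ?s (2 - int (length \<beta>)) * (?s (deg ?D) * (d_mat \<delta> ?a \<gamma> * coef \<mu> (?T @ \<gamma> # ?D) \<beta>))"
      proof (cases "d_mat \<delta> ?a \<gamma> = 0")
        case False
        then have d: "dg \<gamma> = dg ?a + 1" by (rule d_mat_degree[OF \<delta>])
        have "coef \<mu> (\<gamma> # ?T @ ?D) \<beta> = ?s (dg \<gamma> * deg ?T) * coef \<mu> (?T @ \<gamma> # ?D) \<beta>"
          using alternating_move[OF alternating_coef_in, of "[]" \<gamma> ?T ?D \<beta>] by (simp add: prod_graded_swap deg_def)
        then show ?thesis unfolding d by (simp add: parity_sign_add distrib_left distrib_right mult_ac)
      qed simp
    qed
    also have "Sum_any \<dots> = ?s (2 - int (length \<beta>)) * (?s (deg ?D) * Sum_any (\<lambda>\<gamma>. d_mat \<delta> ?a \<gamma> * coef \<mu> (?T @ \<gamma> # ?D) \<beta>))"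
      by (simp add: Sum_any_cmult)
    finally show "(\<Prod>b\<leftarrow>?T. graded_swap dg ?a b) * composite \<mu> [?a] (?T @ ?D) [] \<beta> = \<dots>" .
  qed simp
  finally show ?thesis by (simp add: sum_distrib_left)
qed

text \<open>For \<open>m + n \<ge> 3\<close> at most one vertex of a tree is of type (1,1), so the
  relation splits into the admissible trees and the two families just computed, and these families
  add up to minus the differential of \<open>\<mu> m n\<close>. The relation thus measures the
  failure of a corolla to respect the differentials.\<close>

theorem corolla_differential_relation:
  assumes w: "\<alpha> \<in> words n" "\<beta> \<in> words m" and mn: "m \<ge> 1" "n \<ge> 1" "m + n \<ge> 3"
  shows "mat (sem \<mu> (corolla_differential m n)) \<alpha> \<beta> = relation \<mu> \<alpha> \<beta> + mat (end_diff \<delta> (2 - int m) (\<mu> m n)) \<alpha> \<beta>"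
proof -
  have len: "length \<alpha> = n" "length \<beta> = m" using w by (auto simp: words_def)
  have ne: "\<alpha> \<noteq> []" "\<beta> \<noteq> []" using mn len by auto
  have split: "composite \<mu> x y z w =
      (if admissible x y z w then composite \<mu> x y z w else 0) +
      ((if length w = 1 \<and> length y = 0 then composite \<mu> x y z w else 0) +
      (if length z = 0 \<and> length x = 1 then composite \<mu> x y z w else 0))"
    if "length x + length y = n" "length z + length w = m" for x y z w
    using that mn by (auto simp: admissible_def)
  have cong: "unshuffle_sum \<chi> G v = unshuffle_sum \<chi> H v"
    if "\<And>x y. length x + length y = length v \<Longrightarrow> G x y = H x y" for \<chi> :: "'i \<Rightarrow> 'i \<Rightarrow> 'k" and G H v
    using that
  proof (induction v arbitrary: G H)
    case (Cons a v)
    have "unshuffle_sum \<chi> (\<lambda>x y. G (a # x) y) v = unshuffle_sum \<chi> (\<lambda>x y. H (a # x) y) v"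
      by (rule Cons.IH) (use Cons.prems in auto)
    moreover have "unshuffle_sum \<chi> (\<lambda>x y. (\<Prod>b\<leftarrow>x. \<chi> b a) * G x (a # y)) v = unshuffle_sum \<chi> (\<lambda>x y. (\<Prod>b\<leftarrow>x. \<chi> b a) * H x (a # y)) v"
      by (rule Cons.IH) (use Cons.prems in auto)
    ultimately show ?case by simp
  qed simp
  have "relation \<mu> \<alpha> \<beta> = unshuffle_sum (graded_swap dg) (\<lambda>x y. unshuffle_sum (skew_swap dg) (\<lambda>z w.
      (if admissible x y z w then composite \<mu> x y z w else 0) +
      ((if length w = 1 \<and> length y = 0 then composite \<mu> x y z w else 0) +
      (if length z = 0 \<and> length x = 1 then composite \<mu> x y z w else 0))) \<beta>) \<alpha>"
    unfolding relation_def by (intro cong split) (simp_all add: len)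
  also have "\<dots> = mat (sem \<mu> (corolla_differential m n)) \<alpha> \<beta> - mat (end_diff \<delta> (2 - int m) (\<mu> m n)) \<alpha> \<beta>"
    using mat_corolla_differential[of \<beta> \<alpha>] upper_differential[OF ne] lower_differential[OF ne]
      mat_end_diff[OF \<delta> mu_End[OF \<mu> mn(1,2)] w] ne
    by (simp add: unshuffle_sum_add len coef_def min_def)
  finally show ?thesis by simp
qed

end

end

end

section \<open>Arities and degrees of the differential\<close>

lemma foldr_DAdd_typed:
  assumes "\<And>t. t \<in> set ts \<Longrightarrow> dwf t \<and> outs t = m \<and> ins t = n \<and> ddeg t = d" "m \<ge> 1" "n \<ge> 1"
  defines "F \<equiv> foldr DAdd ts (DZero m n d)"
  shows "dwf F" "outs F = m" "ins F = n" "ddeg F = d"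
proof -
  have "dwf F \<and> outs F = m \<and> ins F = n \<and> ddeg F = d"
    unfolding F_def using assms(1-3) by (induction ts) auto
  then show "dwf F" "outs F = m" "ins F = n" "ddeg F = d" by simp_all
qed

text \<open>Leaving out the (1,1) vertices is what makes both corollas of each tree well-formed.
  Their degrees \<open>1 - length I1\<close> and \<open>2 - length I2\<close> add up to
  \<open>3 - m\<close>.\<close>

lemma corolla_differential_typed:
  assumes "m \<ge> 1" "n \<ge> 1"
  defines "F \<equiv> corolla_differential m n :: 'k::field dterm"
  shows "dwf F" "outs F = m" "ins F = n" "ddeg F = 3 - int m"
proof -
  have tree: "dwf t \<and> outs t = m \<and> ins t = n \<and> ddeg t = 3 - int m"
    if "(I1, I2) \<in> set (splittings m)" "(J1, J2) \<in> set (splittings n)" "I2 \<noteq> []" "J1 \<noteq> []"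
      "(Suc (length I1), length J1) \<noteq> (1, 1) \<and> (length I2, Suc (length J2)) \<noteq> (1, 1)"
      "t = DScale c (two_vertex_tree I1 I2 J1 J2)" for I1 I2 J1 J2 c and t :: "'k dterm"
  proof -
    have "length I1 + length I2 = m" "length J1 + length J2 = n"
      using splittings_properties(3)[OF that(1)] splittings_properties(3)[OF that(2)] by simp_all
    moreover have *: "length I2 \<ge> 1" "length J1 \<ge> 1" using that(3,4) by (simp_all add: Suc_le_eq)
    moreover have "length I1 + length J1 \<ge> 2" "length I2 + length J2 \<ge> 2"
      using that(5) * unfolding prod.inject by presburger+
    ultimately show ?thesis
      using list_perm_splitting_permutes[OF that(1)] list_perm_splitting_permutes[OF that(2)] that(6)
      by (auto simp: two_vertex_tree_def)
  qed
  let ?ts = "[DScale (of_int (sign (list_perm (I1 @ I2))) * (- 1) ^ (length I1 * length I2)) (two_vertex_tree I1 I2 J1 J2).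
      (I1, I2) \<leftarrow> splittings m, (J1, J2) \<leftarrow> splittings n,
      I2 \<noteq> [] \<and> J1 \<noteq> [] \<and>
      (Suc (length I1), length J1) \<noteq> (1, 1) \<and> (length I2, Suc (length J2)) \<noteq> (1, 1)] :: 'k dterm list"
  have ts: "dwf t \<and> outs t = m \<and> ins t = n \<and> ddeg t = 3 - int m" if t: "t \<in> set ?ts" for t
  proof -
    obtain p q where p: "p \<in> set (splittings m)" and q: "q \<in> set (splittings n)"
      and t: "t \<in> set (case p of (I1, I2) \<Rightarrow> case q of (J1, J2) \<Rightarrow>
        if I2 \<noteq> [] \<and> J1 \<noteq> [] \<and> (Suc (length I1), length J1) \<noteq> (1, 1) \<and> (length I2, Suc (length J2)) \<noteq> (1, 1)
        then [DScale (of_int (sign (list_perm (I1 @ I2))) * (- 1) ^ (length I1 * length I2)) (two_vertex_tree I1 I2 J1 J2)]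
        else [])"
      using t by (force simp: case_prod_unfold)
    obtain I1 I2 J1 J2 where pq: "p = (I1, I2)" "q = (J1, J2)" by (cases p, cases q)
    show ?thesis
      by (rule tree[OF p[unfolded pq] q[unfolded pq]]) (use t in \<open>auto simp: pq simp del: One_nat_def split: if_splits\<close>)
  qed
  show "dwf F" "outs F = m" "ins F = n" "ddeg F = 3 - int m"
    unfolding F_def corolla_differential_def using foldr_DAdd_typed[of ?ts m n "3 - int m", OF ts assms(1,2)] by simp_all
qed

lemma ddiff_typed:
  assumes "dwf t"
  shows "dwf (ddiff t)" "outs (ddiff t) = outs t" "ins (ddiff t) = ins t" "ddeg (ddiff t) = ddeg t + 1"
proof -
  have "dwf (ddiff t) \<and> outs (ddiff t) = outs t \<and> ins (ddiff t) = ins t \<and> ddeg (ddiff t) = ddeg t + 1"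
    using assms by (induction t) (auto simp: corolla_differential_typed)
  then show "dwf (ddiff t)" "outs (ddiff t) = outs t" "ins (ddiff t) = ins t" "ddeg (ddiff t) = ddeg t + 1" by simp_all
qed

section \<open>Dioperad morphisms and the quadratic relations\<close>

context based_graded_space begin

lemma end_diff_add: "end_diff \<delta> d (f + g) = end_diff \<delta> d f + end_diff \<delta> d g"
  by (intro ext) (simp add: end_diff_def sum.distrib algebra_simps)

lemma end_diff_scale: "end_diff \<delta> d (\<lambda>xs \<xi>s. c * f xs \<xi>s) = (\<lambda>xs \<xi>s. c * end_diff \<delta> d f xs \<xi>s)"
  by (intro ext) (simp add: end_diff_def sum_distrib_left algebra_simps)

lemma end_diff_0: "end_diff \<delta> d 0 = 0"
  by (intro ext) (simp add: end_diff_def)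

lemma end_diff_unit:
  assumes "dg_vector_space \<delta>"
  shows "end_diff \<delta> 0 end_unit = 0"
proof (intro ext)
  fix xs \<xi>s
  note fc = functional_comp[OF lin_dg[OF assms]]
  show "end_diff \<delta> 0 end_unit xs \<xi>s = 0 xs \<xi>s"
  proof (cases "length xs = 1 \<and> length \<xi>s = 1 \<and> set \<xi>s \<subseteq> functionals")
    case True
    then obtain x \<xi> where "xs = [x]" "\<xi>s = [\<xi>]" "\<xi> \<in> functionals" by (auto simp: length_Suc_conv)
    then show ?thesis using fc[of \<xi>] by (simp add: end_diff_def end_unit_def pure_tensor_Cons pure_tensor_Nil parity_sign_def)
  next
    case False
    then show ?thesis by (auto simp: end_diff_def end_unit_def pure_tensor_def intro!: sum.neutral)
  qed
qed

context
  fixes \<mu> :: "nat \<Rightarrow> nat \<Rightarrow> ('v, 'k) operation"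
  assumes \<mu>: "\<And>m n. m \<ge> 1 \<Longrightarrow> n \<ge> 1 \<Longrightarrow> \<mu> m n \<in> sym_to_ext m n"
begin

lemma sem_ddiff:
  assumes \<delta>: "dg_vector_space \<delta>"
    and corolla: "\<And>m n. m \<ge> 1 \<Longrightarrow> n \<ge> 1 \<Longrightarrow> m + n \<ge> 3 \<Longrightarrow> sem \<mu> (corolla_differential m n) = end_diff \<delta> (2 - int m) (\<mu> m n)"
    and "dwf t"
  shows "sem \<mu> (ddiff t) = end_diff \<delta> (ddeg t) (sem \<mu> t)"
  using assms(3)
proof (induction t)
  case (DCor m n)
  then show ?case using corolla by simp
next
  case DUnit
  show ?case using end_diff_unit[OF \<delta>] by simp
next
  case (DZero m n d)
  show ?case by (simp only: ddiff.simps sem.simps end_diff_0)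
next
  case (DAdd t s)
  then show ?case by (simp only: ddiff.simps sem.simps ddeg.simps end_diff_add) simp
next
  case (DScale c t)
  then show ?case by (simp add: end_diff_scale)
next
  case (DComp t s)
  then have t: "dwf t" and s: "dwf s" by simp_all
  obtain m1 n2 where *: "outs s = Suc m1" "ins t = Suc n2" "sem \<mu> s \<in> End (Suc m1) (ins s) (ddeg s)"
    "sem \<mu> t \<in> End (outs t) (Suc n2) (ddeg t)" by (rule sem_comp_End[OF \<mu> t s])
  show ?case using DComp.IH(1)[OF t] DComp.IH(2)[OF s] end_diff_comp[OF \<delta> *(3,4)]
    by (simp only: ddiff.simps sem.simps ddeg.simps ddiff_typed[OF t] ddiff_typed[OF s]) (simp add: *)
next
  case (DOut \<sigma> t)
  then show ?case using end_diff_out[OF \<delta> sem_End[OF \<mu>, of t], of \<sigma>] by simp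
next
  case (DIn \<sigma> t)
  then show ?case using end_diff_in[OF \<delta> sem_End[OF \<mu>, of t], of \<sigma>] by simp
qed

text \<open>For single letters the only tree has both vertices equal to \<open>\<mu> 1 1\<close>.
  The assumption on \<delta> concerns its coordinates alone, so the identity serves to derive that
  \<delta> squares to 0 as well as to exploit it.\<close>

lemma relation_11:
  assumes \<delta>: "\<And>v b. b \<in> A \<Longrightarrow> dual b (\<delta> v) = \<mu> 1 1 [v] [dual b]" and ab: "a \<in> A" "b \<in> A"
  shows "relation \<mu> [a] [b] = parity_sign 1 * dual b (\<delta> (\<delta> (e a)))"
proof -
  have c: "coef \<mu> [x] [y] = dual y (\<delta> (e x))" if "x \<in> A" "y \<in> A" for x y
    using that \<delta>[of y "e x"] by (simp add: coef_def mat_def)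
  have sup: "coef \<mu> [x] [y] = 0" if "x \<notin> A \<or> y \<notin> A" for x y using that by (auto simp: coef_def mat_def)
  have "dual b (\<delta> (\<delta> (e a))) = \<mu> 1 1 (map e [] @ \<delta> (e a) # map e []) (map dual [b])"
    using \<delta>[OF ab(2), of "\<delta> (e a)"] by simp
  also have "\<dots> = (\<Sum>\<gamma>\<in>supp (\<delta> (e a)). dual \<gamma> (\<delta> (e a)) * mat (\<mu> 1 1) ([] @ \<gamma> # []) [b])"
    by (rule input_slot) (use ab End_multilinear[OF mu_End[OF \<mu>]] in auto)
  also have "\<dots> = (\<Sum>\<gamma>\<in>supp (\<delta> (e a)). coef \<mu> [a] [\<gamma>] * coef \<mu> [\<gamma>] [b])"
    by (rule sum.cong) (auto simp: coef_def[of _ "[_]" "[b]"] c ab supp_def)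
  also have "\<dots> = Sum_any (\<lambda>\<gamma>. coef \<mu> [a] [\<gamma>] * coef \<mu> [\<gamma>] [b])"
  proof (rule Sum_any.expand_superset[symmetric])
    show "{\<gamma>. coef \<mu> [a] [\<gamma>] * coef \<mu> [\<gamma>] [b] \<noteq> 0} \<subseteq> supp (\<delta> (e a))"
    proof
      fix \<gamma> assume "\<gamma> \<in> {\<gamma>. coef \<mu> [a] [\<gamma>] * coef \<mu> [\<gamma>] [b] \<noteq> 0}"
      then have *: "coef \<mu> [a] [\<gamma>] \<noteq> 0" by auto
      then have "\<gamma> \<in> A" using sup by blast
      then show "\<gamma> \<in> supp (\<delta> (e a))" using * c[OF ab(1)] by (simp add: supp_def)
    qed
  qed simp
  finally show ?thesis by (simp add: relation_def composite_def coef_def[of _ "[]"] coef_def[of _ _ "[]"])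
qed

lemma relation_imp_structure:
  assumes R: "\<And>\<alpha> \<beta>. relation \<mu> \<alpha> \<beta> = 0"
  shows "Lie1Bi_infinity_structure \<mu>"
proof -
  let ?M = "mat (\<mu> 1 1)"
  have E: "\<mu> 1 1 \<in> End 1 1 1" using mu_End[OF \<mu>, of 1 1] by simp
  \<comment> \<open>The linear map with matrix \<open>?M\<close>, defined through the expansion of
    \<open>v\<close>. The inner sum is finite because the rows of \<open>\<mu> 1 1\<close>
    are.\<close>
  define \<delta> where "\<delta> v = (\<Sum>a\<in>supp v. scale (dual a v) (\<Sum>b | ?M [a] [b] \<noteq> 0. scale (?M [a] [b]) (e b)))" for v
  have fin: "finite {b. ?M [a] [b] \<noteq> 0}" for a
    using finite_mat_slot[OF E, of "[a]" "[]" "[]"] by simp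
  have inA: "b \<in> A" if "?M [a] [b] \<noteq> 0" for a b using mat_nonzero[OF E that] by simp
  have d: "dual b (\<delta> v) = \<mu> 1 1 [v] [dual b]" if b: "b \<in> A" for v b
  proof -
    have "dual b (\<Sum>c | ?M [a] [c] \<noteq> 0. scale (?M [a] [c]) (e c)) = ?M [a] [b]" for a
    proof -
      have "dual b (\<Sum>c | ?M [a] [c] \<noteq> 0. scale (?M [a] [c]) (e c)) = (\<Sum>c | ?M [a] [c] \<noteq> 0. if b = c then ?M [a] [c] else 0)"
        unfolding dual_sum by (rule sum.cong) (auto simp: dual_scale dual_e b inA)
      then show ?thesis using fin[of a] by simp
    qed
    then have "dual b (\<delta> v) = (\<Sum>\<gamma>\<in>supp v. dual \<gamma> v * ?M ([] @ \<gamma> # []) [b])"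
      by (simp add: \<delta>_def dual_sum dual_scale)
    also have "\<dots> = \<mu> 1 1 (map e [] @ v # map e []) (map dual [b])"
      by (rule input_slot[symmetric]) (use b End_multilinear[OF E] in auto)
    finally show ?thesis by simp
  qed
  have lin: "\<delta> (u + scale c w) = \<delta> u + scale c (\<delta> w)" for u c w
  proof (rule vector_eqI)
    fix b assume "b \<in> A"
    then show "dual b (\<delta> (u + scale c w)) = dual b (\<delta> u + scale c (\<delta> w))"
      using multilinearD[OF End_multilinear[OF E], of 0 "[0]" u c w "[dual b]"] by (simp add: d dual_add dual_scale)
  qed
  have add: "\<delta> (u + w) = \<delta> u + \<delta> w" for u w using lin[of u 1 w] by simp
  have zero: "\<delta> 0 = 0" using add[of 0 0] by simp
  have scl: "\<delta> (scale c w) = scale c (\<delta> w)" for c w using lin[of 0 c w] by (simp add: zero)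
  have sm: "\<delta> (sum f S) = (\<Sum>x\<in>S. \<delta> (f x))" for f and S :: "'i set"
    by (induction S rule: infinite_finite_induct) (simp_all add: zero add)
  have sq_e: "\<delta> (\<delta> (e a)) = 0" if "a \<in> A" for a
    by (rule vector_eqI) (use relation_11[of \<delta>, OF d that] R in \<open>simp add: parity_sign_def\<close>)
  have sq: "\<delta> (\<delta> v) = 0" for v
  proof -
    have "\<delta> (\<delta> (\<Sum>a\<in>supp v. scale (dual a v) (e a))) = (\<Sum>a\<in>supp v. scale (dual a v) (\<delta> (\<delta> (e a))))"
      by (simp add: sm scl)
    also have "\<dots> = 0" by (rule sum.neutral) (auto simp: sq_e supp_def)
    finally show ?thesis using expand[of v] by simp
  qed
  have degree: "\<delta> v \<in> V (i + 1)" if v: "v \<in> V i" for v i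
    unfolding \<delta>_def
  proof (intro subspace_sum subspace_scale subspace_V)
    fix a b assume "a \<in> supp v" "b \<in> {b. ?M [a] [b] \<noteq> 0}"
    then have "dg b = i + 1" "b \<in> A" using mat_nonzero(3)[OF E, of "[a]" "[b]"] V_degree[OF v] inA by auto
    then show "e b \<in> V (i + 1)" using e_in_V by metis
  qed
  have \<delta>: "dg_vector_space \<delta>"
    unfolding dg_vector_space_def using degree sq
    by (auto simp: add scl Vector_Spaces.linear_iff vector_space_axioms)
  have \<mu>11: "\<mu> 1 1 = (\<lambda>xs. if length xs = 1 then pure_tensor (map \<delta> xs) else 0)"
  proof
    fix xs :: "'v list"
    show "\<mu> 1 1 xs = (if length xs = 1 then pure_tensor (map \<delta> xs) else 0)"
    proof (cases "length xs = 1")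
      case True
      then obtain v where v: "xs = [v]" by (auto simp: length_Suc_conv)
      \<comment> \<open>An equality of tensors and not only of coordinates: both sides are tensors
        of length 1, so agreement on the dual basis suffices.\<close>
      have "\<mu> 1 1 [v] = end_unit [\<delta> v]"
      proof (rule tensors_eqI[OF End_tensors[OF E] End_tensors[OF End_end_unit]])
        fix \<beta> assume "\<beta> \<in> words 1"
        then obtain b where "\<beta> = [b]" "b \<in> A" by (auto simp: words_def length_Suc_conv)
        then show "\<mu> 1 1 [v] (map dual \<beta>) = end_unit [\<delta> v] (map dual \<beta>)"
          using d[of b v] by (simp add: end_unit_def pure_tensor_Cons pure_tensor_Nil)
      qed
      then show ?thesis using v by (simp add: end_unit_def)
    next
      case False
      then show ?thesis using End_zero[OF E] by simp
    qed
  qed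
  have corolla: "sem \<mu> (corolla_differential m n) = end_diff \<delta> (2 - int m) (\<mu> m n)"
    if "m \<ge> 1" "n \<ge> 1" "m + n \<ge> 3" for m n
  proof (rule End_eqI)
    show "sem \<mu> (corolla_differential m n) \<in> End m n (3 - int m)"
      using sem_End[OF \<mu> corolla_differential_typed(1)[OF that(1,2)]] corolla_differential_typed[OF that(1,2), where 'k = 'k]
      by simp
    show "end_diff \<delta> (2 - int m) (\<mu> m n) \<in> End m n (3 - int m)"
      using End_end_diff[OF \<delta> mu_End[OF \<mu> that(1,2)]] by simp
    show "mat (sem \<mu> (corolla_differential m n)) \<alpha> \<beta> = mat (end_diff \<delta> (2 - int m) (\<mu> m n)) \<alpha> \<beta>"
      if "\<alpha> \<in> words n" "\<beta> \<in> words m" for \<alpha> \<beta>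
      using corolla_differential_relation[OF \<mu> \<delta> \<mu>11 that \<open>m \<ge> 1\<close> \<open>n \<ge> 1\<close> \<open>m + n \<ge> 3\<close>] by (simp add: R)
  qed
  have "dioperad_morphism \<delta> (sem \<mu>)"
    unfolding dioperad_morphism_def
    by (intro conjI allI impI) (auto simp: deq_sound[OF \<mu>] sem_End[OF \<mu>] sem_ddiff[OF \<delta> corolla])
  then show ?thesis
    unfolding Lie1Bi_infinity_structure_def using \<delta> \<mu>11 by (intro exI[of _ \<delta>] exI[of _ "sem \<mu>"]) simp
qed

lemma structure_imp_relation:
  assumes "Lie1Bi_infinity_structure \<mu>"
  shows "relation \<mu> \<alpha> \<beta> = 0"
proof -
  obtain \<delta> \<phi> where \<delta>: "dg_vector_space \<delta>"
    and \<mu>11: "\<mu> 1 1 = (\<lambda>xs. if length xs = 1 then pure_tensor (map \<delta> xs) else 0)"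
    and \<phi>: "dioperad_morphism \<delta> \<phi>" and cor: "\<And>m n. m \<ge> 1 \<Longrightarrow> n \<ge> 1 \<Longrightarrow> m + n \<ge> 3 \<Longrightarrow> \<phi> (DCor m n) = \<mu> m n"
    using assms unfolding Lie1Bi_infinity_structure_def by blast
  have "\<phi> t = sem \<mu> t" if "dwf t" for t
    using that
  proof (induction t)
    case (DZero m n d)
    let ?z = "DZero m n d :: 'k dterm"
    \<comment> \<open>The value of a morphism on zero terms is not prescribed; it is forced by the
      congruence of \<open>z - z\<close> with \<open>z\<close>.\<close>
    have "DAdd ?z (DScale (- 1) ?z) \<approx>\<^sub>D DZero (outs ?z) (ins ?z) (ddeg ?z)" by (rule deq.add_minus) (rule DZero)
    then have "\<phi> ?z = \<phi> (DAdd ?z (DScale (- 1) ?z))" using \<phi> unfolding dioperad_morphism_def by simp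
    also have "\<dots> = \<phi> ?z + \<phi> (DScale (- 1) ?z)"
    proof -
      have "dwf (DAdd ?z (DScale (- 1) ?z))" using DZero by simp
      then show ?thesis using \<phi> unfolding dioperad_morphism_def by blast
    qed
    also have "\<phi> (DScale (- 1) ?z) = (\<lambda>xs \<xi>s. - 1 * \<phi> ?z xs \<xi>s)"
      using \<phi> DZero unfolding dioperad_morphism_def by blast
    finally show ?case by (auto simp: fun_eq_iff)
  next
    case (DAdd t s)
    have "\<phi> (DAdd t s) = \<phi> t + \<phi> s" using \<phi> DAdd.prems unfolding dioperad_morphism_def by blast
    then show ?case using DAdd by simp
  next
    case (DComp t s)
    have "\<phi> (DComp t s) = end_comp (outs s - 1) (ins s) (ddeg t) (ddeg s) (\<phi> t) (\<phi> s)"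
      using \<phi> DComp.prems unfolding dioperad_morphism_def by simp
    then show ?case using DComp by simp
  next
    case (DScale c t)
    have "\<phi> (DScale c t) = (\<lambda>xs \<xi>s. c * \<phi> t xs \<xi>s)" using \<phi> DScale.prems unfolding dioperad_morphism_def by simp
    then show ?case using DScale by simp
  next
    case (DOut \<sigma> t)
    have "\<phi> (DOut \<sigma> t) = end_out \<sigma> (\<phi> t)" using \<phi> DOut.prems unfolding dioperad_morphism_def by blast
    then show ?case using DOut by simp
  next
    case (DIn \<sigma> t)
    have "\<phi> (DIn \<sigma> t) = end_in \<sigma> (\<phi> t)" using \<phi> DIn.prems unfolding dioperad_morphism_def by blast
    then show ?case using DIn by simp
  next
    case DUnit
    then show ?case using \<phi> unfolding dioperad_morphism_def by simp
  next
    case (DCor m n)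
    then show ?case using cor by simp
  qed
  note eq = this
  show ?thesis
  proof (cases "set \<alpha> \<subseteq> A \<and> set \<beta> \<subseteq> A \<and> \<alpha> \<noteq> [] \<and> \<beta> \<noteq> []")
    case True
    let ?m = "length \<beta>" and ?n = "length \<alpha>"
    have w: "\<alpha> \<in> words ?n" "\<beta> \<in> words ?m" and mn: "?m \<ge> 1" "?n \<ge> 1" using True by (auto simp: words_def Suc_le_eq)
    show ?thesis
    proof (cases "?m + ?n \<ge> 3")
      case True
      let ?c = "DCor ?m ?n :: 'k dterm"
      have "dwf ?c" using True mn by simp
      then have "\<phi> (ddiff ?c) = end_diff \<delta> (ddeg ?c) (\<phi> ?c)"
        using \<phi> unfolding dioperad_morphism_def by blast
      then have "sem \<mu> (corolla_differential ?m ?n) = end_diff \<delta> (2 - int ?m) (\<mu> ?m ?n)"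
        using eq[OF corolla_differential_typed(1)[OF mn]] cor[OF mn True] by simp
      then show ?thesis using corolla_differential_relation[OF \<mu> \<delta> \<mu>11 w mn True] by simp
    next
      case False
      then have "?m = 1" "?n = 1" using mn by auto
      then obtain a b where ab: "\<alpha> = [a]" "\<beta> = [b]" by (auto simp: length_Suc_conv)
      have "dual b (\<delta> v) = \<mu> 1 1 [v] [dual b]" for b v
        unfolding \<mu>11 by (simp add: pure_tensor_Cons pure_tensor_Nil)
      moreover have "\<delta> (\<delta> (e a)) = 0" using \<delta> by (simp add: dg_vector_space_def)
      ultimately show ?thesis using relation_11[of \<delta> a b] True ab by simp
    qed
  next
    case False
    then show ?thesis by (rule relation_support)
  qed
qed

theorem structure_iff_relation: "Lie1Bi_infinity_structure \<mu> \<longleftrightarrow> (\<forall>\<alpha> \<beta>. relation \<mu> \<alpha> \<beta> = 0)"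
  using relation_imp_structure structure_imp_relation by blast

end

end

section \<open>Identities for unshuffle sums\<close>

definition cross_sign :: "('x \<Rightarrow> 'x \<Rightarrow> 'k::comm_ring_1) \<Rightarrow> 'x list \<Rightarrow> 'x list \<Rightarrow> 'k" where
  "cross_sign \<chi> x y = (\<Prod>c\<leftarrow>y. \<Prod>b\<leftarrow>x. \<chi> b c)"

lemma cross_sign_Nil [simp]: "cross_sign \<chi> [] y = 1" "cross_sign \<chi> x [] = 1"
  by (simp_all add: cross_sign_def prod_list_map_eq_1)

lemma cross_sign_Cons:
  "cross_sign \<chi> (b # x) y = (\<Prod>c\<leftarrow>y. \<chi> b c) * cross_sign \<chi> x y"
  "cross_sign \<chi> x (c # y) = (\<Prod>b\<leftarrow>x. \<chi> b c) * cross_sign \<chi> x y"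
proof -
  show "cross_sign \<chi> (b # x) y = (\<Prod>c\<leftarrow>y. \<chi> b c) * cross_sign \<chi> x y"
    by (induction y) (simp_all add: cross_sign_def mult_ac)
qed (simp add: cross_sign_def)

lemma cross_sign_append:
  "cross_sign \<chi> (x @ x') y = cross_sign \<chi> x y * cross_sign \<chi> x' y"
  "cross_sign \<chi> x (y @ y') = cross_sign \<chi> x y * cross_sign \<chi> x y'"
proof -
  show "cross_sign \<chi> (x @ x') y = cross_sign \<chi> x y * cross_sign \<chi> x' y"
    by (induction x) (simp_all add: cross_sign_Cons mult_ac)
qed (simp add: cross_sign_def)

lemma cross_sign_rev: "cross_sign \<chi> x (rev y) = cross_sign \<chi> x y"
  by (induction y) (simp_all add: cross_sign_append cross_sign_Cons mult_ac)

text \<open>The multiset of letters is what every unshuffle retains. Lengths and total degrees of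
  the two parts follow from it, as the sign comparison with fixed words \<alpha> and \<beta>
  requires.\<close>

lemma unshuffle_sum_cong:
  "(\<And>x y. mset x + mset y = mset w \<Longrightarrow> G x y = H x y) \<Longrightarrow> unshuffle_sum \<chi> G w = unshuffle_sum \<chi> H w"
proof (induction w arbitrary: G H)
  case (Cons a w)
  have "unshuffle_sum \<chi> (\<lambda>x y. G (a # x) y) w = unshuffle_sum \<chi> (\<lambda>x y. H (a # x) y) w"
    by (rule Cons.IH) (rule Cons.prems, simp)
  moreover have "unshuffle_sum \<chi> (\<lambda>x y. (\<Prod>b\<leftarrow>x. \<chi> b a) * G x (a # y)) w =
      unshuffle_sum \<chi> (\<lambda>x y. (\<Prod>b\<leftarrow>x. \<chi> b a) * H x (a # y)) w"
    by (rule Cons.IH) (rule arg_cong, rule Cons.prems, simp)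
  ultimately show ?case by simp
qed simp

text \<open>An unshuffle sum is a finite combination of values of \<open>G\<close>, so a sum over an
  internal index can be pulled inside once its support is finite for each pair of words. Finiteness
  of the resulting support is proved along, because \<open>Sum_any\<close> distributes over addition
  only for finite supports.\<close>

lemma unshuffle_sum_Sum_any:
  fixes \<chi> :: "'x \<Rightarrow> 'x \<Rightarrow> 'k::field"
  assumes "\<And>x y. finite {\<gamma>. G \<gamma> x y \<noteq> 0}"
  shows "finite {\<gamma>. unshuffle_sum \<chi> (G \<gamma>) w \<noteq> 0}"
    and "Sum_any (\<lambda>\<gamma>. unshuffle_sum \<chi> (G \<gamma>) w) = unshuffle_sum \<chi> (\<lambda>x y. Sum_any (\<lambda>\<gamma>. G \<gamma> x y)) w"
proof -
  have "finite {\<gamma>. unshuffle_sum \<chi> (G \<gamma>) w \<noteq> 0} \<and>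
    Sum_any (\<lambda>\<gamma>. unshuffle_sum \<chi> (G \<gamma>) w) = unshuffle_sum \<chi> (\<lambda>x y. Sum_any (\<lambda>\<gamma>. G \<gamma> x y)) w"
    using assms
  proof (induction w arbitrary: G)
    case (Cons a w)
    let ?H = "\<lambda>\<gamma> x y. G \<gamma> (a # x) y" and ?K = "\<lambda>\<gamma> x y. (\<Prod>b\<leftarrow>x. \<chi> b a) * G \<gamma> x (a # y)"
    have fK: "finite {\<gamma>. ?K \<gamma> x y \<noteq> 0}" for x y
      by (rule finite_subset[OF _ Cons.prems[of x "a # y"]]) auto
    note H = Cons.IH[of ?H, OF Cons.prems] and K = Cons.IH[of ?K, OF fK]
    have "finite {\<gamma>. unshuffle_sum \<chi> (G \<gamma>) (a # w) \<noteq> 0}"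
      by (rule finite_subset[OF _ finite_UnI[OF conjunct1[OF H] conjunct1[OF K]]]) auto
    moreover have "Sum_any (\<lambda>\<gamma>. unshuffle_sum \<chi> (G \<gamma>) (a # w)) =
        Sum_any (\<lambda>\<gamma>. unshuffle_sum \<chi> (?H \<gamma>) w) + Sum_any (\<lambda>\<gamma>. unshuffle_sum \<chi> (?K \<gamma>) w)"
      unfolding unshuffle_sum.simps by (rule Sum_any.distrib[OF conjunct1[OF H] conjunct1[OF K]])
    ultimately show ?case using H K by (simp add: Sum_any_cmult)
  qed simp
  then show "finite {\<gamma>. unshuffle_sum \<chi> (G \<gamma>) w \<noteq> 0}"
    and "Sum_any (\<lambda>\<gamma>. unshuffle_sum \<chi> (G \<gamma>) w) = unshuffle_sum \<chi> (\<lambda>x y. Sum_any (\<lambda>\<gamma>. G \<gamma> x y)) w" by auto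
qed

text \<open>The two words are unshuffled separately, and the part of \<open>v\<close> going left has
  to cross the part of \<open>u\<close> going right. For coordinates followed by fields this
  separates inputs from outputs.\<close>

lemma unshuffle_sum_append:
  "unshuffle_sum \<chi> G (u @ v) =
    unshuffle_sum \<chi> (\<lambda>x y. unshuffle_sum \<chi> (\<lambda>x' y'. cross_sign \<chi> x' y * G (x @ x') (y @ y')) v) u"
proof (induction u arbitrary: G)
  case (Cons a u)
  show ?case
    by (simp add: Cons.IH unshuffle_sum_cmult[symmetric] cross_sign_Cons mult_ac)
qed simp

lemma unshuffle_sum_map:
  "unshuffle_sum \<chi> G (map f w) = unshuffle_sum (\<lambda>a b. \<chi> (f a) (f b)) (\<lambda>x y. G (map f x) (map f y)) w"
  by (induction w arbitrary: G) (simp_all add: o_def)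

context
  fixes \<chi> :: "'x \<Rightarrow> 'x \<Rightarrow> 'k::comm_ring_1"
  assumes \<chi>: "\<And>a b. \<chi> a b * \<chi> b a = 1" "\<And>a b. \<chi> a b = \<chi> b a"
begin

lemma prod_list_square:
  "(\<Prod>c\<leftarrow>y. \<chi> c a) * (\<Prod>c\<leftarrow>y. \<chi> c a) = 1" "(\<Prod>c\<leftarrow>y. \<chi> c a) * ((\<Prod>c\<leftarrow>y. \<chi> c a) * z) = z"
proof -
  show *: "(\<Prod>c\<leftarrow>y. \<chi> c a) * (\<Prod>c\<leftarrow>y. \<chi> c a) = 1"
  proof (induction y)
    case (Cons b y)
    have "\<chi> b a * \<chi> b a = 1" using \<chi>(1)[of b a] \<chi>(2)[of a b] by simp
    then have "\<chi> b a * \<chi> b a * ((\<Prod>c\<leftarrow>y. \<chi> c a) * (\<Prod>c\<leftarrow>y. \<chi> c a)) = 1" by (simp add: Cons.IH)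
    then show ?case by (simp add: mult_ac)
  qed simp
  show "(\<Prod>c\<leftarrow>y. \<chi> c a) * ((\<Prod>c\<leftarrow>y. \<chi> c a) * z) = z" by (simp add: mult.assoc[symmetric] *)
qed

text \<open>Graded cocommutativity of the unshuffle coproduct.\<close>

lemma unshuffle_sum_swap: "unshuffle_sum \<chi> G w = unshuffle_sum \<chi> (\<lambda>x y. cross_sign \<chi> x y * G y x) w"
proof (induction w arbitrary: G)
  case (Cons a w)
  have 1: "(\<Prod>c\<leftarrow>y. \<chi> a c) = (\<Prod>c\<leftarrow>y. \<chi> c a)" for y by (simp only: \<chi>(2)[of a])
  have "unshuffle_sum \<chi> G (a # w) =
      unshuffle_sum \<chi> (\<lambda>x y. cross_sign \<chi> x y * G (a # y) x) w +
      unshuffle_sum \<chi> (\<lambda>x y. cross_sign \<chi> x y * ((\<Prod>b\<leftarrow>y. \<chi> b a) * G y (a # x))) w"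
    by (simp only: unshuffle_sum.simps Cons.IH[of "\<lambda>x. G (a # x)"] Cons.IH[of "\<lambda>x y. (\<Prod>b\<leftarrow>x. \<chi> b a) * G x (a # y)"])
  then show ?case by (simp add: cross_sign_Cons 1 prod_list_square mult_ac add_ac)
qed simp

text \<open>Under reversal each pair of letters lying in different parts is exchanged once, which
  gives the crossing sign. The rule is needed because fields are multiplied in the reverse order of
  the outputs.\<close>

lemma unshuffle_sum_rev:
  "unshuffle_sum \<chi> G (rev w) = unshuffle_sum \<chi> (\<lambda>x y. cross_sign \<chi> x y * G (rev x) (rev y)) w"
proof (induction w arbitrary: G)
  case (Cons a w)
  have 1: "(\<Prod>c\<leftarrow>y. \<chi> a c) = (\<Prod>c\<leftarrow>y. \<chi> c a)" for y by (simp only: \<chi>(2)[of a])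
  have 2: "cross_sign \<chi> [a] (rev y) = (\<Prod>c\<leftarrow>y. \<chi> c a)" for y
    by (simp add: cross_sign_rev cross_sign_Cons 1)
  have "unshuffle_sum \<chi> G (rev (a # w)) = unshuffle_sum \<chi> (\<lambda>x y. cross_sign \<chi> [a] y * G (x @ [a]) y + G x (y @ [a])) (rev w)"
    by (simp add: unshuffle_sum_append)
  also have "\<dots> = unshuffle_sum \<chi> (\<lambda>x y. cross_sign \<chi> x y *
      ((\<Prod>c\<leftarrow>y. \<chi> c a) * G (rev x @ [a]) (rev y) + G (rev x) (rev y @ [a]))) w"
    by (simp only: Cons.IH 2)
  finally show ?case
    by (simp add: cross_sign_Cons 1 prod_list_square mult.assoc mult.left_commute distrib_left unshuffle_sum_add)
qed simp

end

text \<open>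
  This turns the signs of the degree-shifted letters (the symbols \<open>\<psi>\<close>) into those of skew-symmetric
  indices.
\<close>

lemma unshuffle_sum_twist:
  assumes "\<And>a b. \<chi>' a b = \<chi> a b * \<kappa> a b" "\<And>a b. \<kappa> a b * \<kappa> a b = 1" "\<And>a b. \<kappa> a b = \<kappa> b a"
    and "alternating \<kappa> \<theta>" "\<And>w. \<theta> w * \<theta> w = 1"
  shows "unshuffle_sum \<chi>' G w = \<theta> w * unshuffle_sum \<chi> (\<lambda>x y. \<theta> (x @ y) * G x y) w"
  using assms(4,5)
proof (induction w arbitrary: \<theta> G)
  case Nil
  then show ?case by (simp add: mult.assoc[symmetric])
next
  case (Cons a w)
  let ?\<theta> = "\<lambda>w. \<theta> (a # w)"
  have IH: "unshuffle_sum \<chi>' G w = ?\<theta> w * unshuffle_sum \<chi> (\<lambda>x y. ?\<theta> (x @ y) * G x y) w" for G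
    by (rule Cons.IH[OF alternating_Cons[OF Cons.prems(1)] Cons.prems(2)])
  have "?\<theta> (x @ y) * ((\<Prod>b\<leftarrow>x. \<chi>' b a) * c) = (\<Prod>b\<leftarrow>x. \<chi> b a) * (\<theta> (x @ a # y) * c)" for x y c
  proof -
    have "?\<theta> (x @ y) = (\<Prod>b\<leftarrow>x. \<kappa> b a) * \<theta> (x @ a # y)"
      using alternating_move[OF Cons.prems(1), of "[]" a x y] by (simp add: assms(3)[of a])
    moreover have "(\<Prod>b\<leftarrow>x. \<chi>' b a) = (\<Prod>b\<leftarrow>x. \<chi> b a) * (\<Prod>b\<leftarrow>x. \<kappa> b a)"
      by (induction x) (simp_all add: assms(1) mult_ac)
    moreover have "(\<Prod>b\<leftarrow>x. \<kappa> b a) * ((\<Prod>b\<leftarrow>x. \<kappa> b a) * z) = z" for z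
      using assms(2,3) by (intro prod_list_square(2)) auto
    ultimately show ?thesis by (simp add: mult_ac)
  qed
  then show ?case by (simp add: IH distrib_left)
qed


section \<open>Taylor coefficients of formal series\<close>

primrec factorials :: "'x list \<Rightarrow> 'k::field_char_0" where
  "factorials [] = 1"
| "factorials (a # w) = of_nat (Suc (count_list w a)) * factorials w"

lemma factorials_nonzero [simp]: "factorials w \<noteq> (0 :: 'k::field_char_0)"
  by (induction w) (simp_all del: of_nat_Suc)

lemma factorials_eq: "factorials w = (\<Prod>x\<in>set w. fact (count_list w x) :: 'k::field_char_0)"
proof (induction w)
  case (Cons a w)
  have "(\<Prod>x\<in>set (a # w). fact (count_list (a # w) x) :: 'k) =
      fact (Suc (count_list w a)) * (\<Prod>x\<in>set w - {a}. fact (count_list (a # w) x))"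
    by (simp add: prod.insert_remove)
  also have "(\<Prod>x\<in>set w - {a}. fact (count_list (a # w) x) :: 'k) = (\<Prod>x\<in>set w - {a}. fact (count_list w x))"
    by (rule prod.cong) auto
  also have "fact (Suc (count_list w a)) * \<dots> = of_nat (Suc (count_list w a)) * (fact (count_list w a) * \<dots>)"
    by (simp only: fact_Suc mult.assoc)
  also have "fact (count_list w a) * (\<Prod>x\<in>set w - {a}. fact (count_list w x) :: 'k) = (\<Prod>x\<in>set w. fact (count_list w x))"
    by (cases "a \<in> set w") (simp_all add: prod.remove[of "set w" a] count_list_0_iff)
  finally show ?case using Cons by simp
qed simp

lemma factorials_mset: "mset x = mset y \<Longrightarrow> factorials x = factorials y"
  by (simp add: factorials_eq count_mset[symmetric] set_mset_mset[symmetric] del: set_mset_mset)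

text \<open>Two equal odd letters are brought together; their swap changes the sign but not the
  word, so twice the value is 0.\<close>

lemma alternating_repeated:
  fixes \<Phi> :: "'x list \<Rightarrow> 'k::field_char_0"
  assumes \<Phi>: "alternating (graded_swap d) \<Phi>" and a: "odd (d a)" "count_list w a > 1"
  shows "\<Phi> w = 0"
proof -
  have "a \<in> set w" using a(2) by (metis count_list_0_iff not_less_zero)
  then obtain x r where w: "w = x @ a # r" "a \<notin> set x" by (meson split_list_first)
  then have "a \<in> set r" using a(2) by (auto simp: count_list_0_iff intro: ccontr)
  then obtain y z where r: "r = y @ a # z" by (meson split_list)
  have "\<Phi> ((x @ y) @ a # a # z) = graded_swap d a a * \<Phi> ((x @ y) @ a # a # z)"
    by (rule alternatingD[OF \<Phi>])
  then have "\<Phi> (x @ y @ a # a # z) = 0" using a(1) by (simp add: graded_swap_def parity_sign_def)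
  then show ?thesis using alternating_move[OF \<Phi>, of x a y "a # z"] by (simp add: w r)
qed

lemma alternating_not_normal:
  "alternating (graded_swap d) \<Phi> \<Longrightarrow> sorted u \<Longrightarrow> \<not> normal_word d u \<Longrightarrow> \<Phi> u = (0 :: 'k::field_char_0)"
  using alternating_repeated[of d \<Phi> _ u] by (auto simp: normal_word_def not_le)

lemma alternating_word_series:
  fixes d :: "'x::linorder \<Rightarrow> int"
  shows "alternating (graded_swap d) (\<lambda>w. word_series d w u :: 'k::field_char_0)"
  unfolding alternating_def
proof (intro allI)
  fix x y :: "'x list" and a b
  have s: "sort (x @ a # b # y) = sort (x @ b # a # y)" by (rule properties_for_sort) simp_all
  show "word_series d (x @ a # b # y) u = graded_swap d a b * (word_series d (x @ b # a # y) u :: 'k)"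
  proof (cases "a = b")
    case False
    have "inversion_sign (graded_swap d) (x @ a # b # y) = graded_swap d a b * (inversion_sign (graded_swap d) (x @ b # a # y) :: 'k)"
      by (rule inversion_sign_swap[OF False graded_swap_involutive])
    then show ?thesis by (auto simp: word_series_def s sorting_sign_eq)
  next
    case True
    have "\<not> normal_word d (sort (x @ a # a # y))" if "odd (d a)"
    proof -
      have "count_list (sort (x @ a # a # y)) a > 1" by (simp add: count_mset[symmetric])
      then show ?thesis using that by (auto simp: normal_word_def not_le)
    qed
    then show ?thesis using True by (auto simp: word_series_def graded_swap_def parity_sign_def)
  qed
qed

text \<open>Rearranging \<open>w\<close> into the sorted word \<open>u\<close> costs the sorting
  sign, which is the coefficient of the monomial. If \<open>u\<close> is not normal, the monomial is
  0 and \<open>\<Phi>\<close> vanishes on both words.\<close>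

lemma word_series_mult:
  fixes \<Phi> :: "'x::linorder list \<Rightarrow> 'k::field_char_0"
  assumes "alternating (graded_swap d) \<Phi>" "sorted u" "mset w = mset u"
  shows "word_series d w u * \<Phi> u = \<Phi> w"
proof -
  have "sort w = u" using assms(2,3) by (metis properties_for_sort)
  then show ?thesis
    using alternating_sort[OF assms(1), of w] alternating_not_normal[OF assms(1,2)]
    by (auto simp: word_series_def sorting_sign_eq)
qed

lemma word_series_0:
  "mset w \<noteq> mset u \<Longrightarrow> word_series d w u = 0" "\<not> sorted u \<Longrightarrow> word_series d w u = 0"
  by (auto simp: word_series_def normal_word_def)

text \<open>\<open>f w\<close> plays the role of the iterated derivative of \<open>F\<close> at 0
  along the word \<open>w\<close>. Sorted words that are not normal get no separate clause, as an
  alternating \<open>f\<close> vanishes on them.\<close>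

definition taylor :: "('x::linorder \<Rightarrow> int) \<Rightarrow> ('x, 'k::field_char_0) series \<Rightarrow> ('x list \<Rightarrow> 'k) \<Rightarrow> bool" where
  "taylor d F f \<longleftrightarrow> alternating (graded_swap d) f \<and> (\<forall>u. F u = (if sorted u then f u / factorials u else 0))"

lemma taylor_eq_0_iff:
  assumes "taylor d F f"
  shows "F = (\<lambda>u. 0) \<longleftrightarrow> (\<forall>w. f w = 0)"
proof
  assume F: "F = (\<lambda>u. 0)"
  show "\<forall>w. f w = 0"
  proof
    fix w
    have "F (sort w) = f (sort w) / factorials (sort w)" using assms by (simp add: taylor_def)
    then have "f (sort w) = 0" using F by simp
    then show "f w = 0" using alternating_sort[of "graded_swap d" f w] assms by (simp add: taylor_def)
  qed
next
  assume "\<forall>w. f w = 0"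
  then show "F = (\<lambda>u. 0)" using assms by (auto simp: taylor_def)
qed

text \<open>The common core of left and right derivatives; \<open>sg\<close> is the sign of moving
  the deleted letter to the end at which it is removed. For sorted \<open>u\<close> only the word
  \<open>sort (x # u)\<close> contributes, once for each of its \<open>Suc (count_list u x)\<close>
  letters \<open>x\<close>, and this number cancels the additional factor in the factorials.\<close>

lemma deletion_series:
  fixes F :: "('x::linorder, 'k::field_char_0) series"
  assumes F: "taylor d F f" and h: "alternating (graded_swap d) h"
    and del: "\<And>w i. i < length w \<Longrightarrow> w ! i = x \<Longrightarrow> sg w i * f w = h (take i w @ drop (Suc i) w)"
  shows "taylor d (\<lambda>u. Sum_any (\<lambda>w. F w * (\<Sum>i | i < length w \<and> w ! i = x. sg w i * word_series d (take i w @ drop (Suc i) w) u))) h"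
  unfolding taylor_def
proof (intro conjI allI h)
  fix u
  let ?d = "\<lambda>w i. take i w @ drop (Suc i) w"
  let ?T = "\<lambda>w. F w * (\<Sum>i | i < length w \<and> w ! i = x. sg w i * word_series d (?d w i) u)"
  let ?w = "sort (x # u)"
  have Fw: "F w = (if sorted w then f w / factorials w else 0)" for w using F by (simp add: taylor_def)
  have mset_d: "mset w = add_mset x (mset (?d w i))" if "i < length w" "w ! i = x" for w i
  proof -
    have "mset w = mset (take i w @ w ! i # drop (Suc i) w)" using id_take_nth_drop[OF that(1)] by simp
    then show ?thesis using that(2) by simp
  qed
  have 0: "?T w = 0" if "w \<noteq> ?w" for w
  proof (cases "sorted w")
    case True
    have "mset w \<noteq> add_mset x (mset u)"
      using that True by (metis mset.simps(2) properties_for_sort)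
    then have "mset (?d w i) \<noteq> mset u" if "i < length w" "w ! i = x" for i using mset_d[OF that] by auto
    then have "(\<Sum>i | i < length w \<and> w ! i = x. sg w i * word_series d (?d w i) u) = 0"
      by (intro sum.neutral) (auto simp: word_series_0)
    then show ?thesis by simp
  qed (simp add: Fw)
  have "Sum_any ?T = sum ?T {?w}"
    by (rule Sum_any.expand_superset) (use 0 in auto)
  then have eq: "Sum_any ?T = ?T ?w" by simp
  show "Sum_any ?T = (if sorted u then h u / factorials u else 0)"
  proof (cases "sorted u")
    case False
    then show ?thesis unfolding eq by (simp add: word_series_0)
  next
    case True
    have summand: "F ?w * (sg ?w i * word_series d (?d ?w i) u) = h u / factorials ?w"
      if i: "i < length ?w" "?w ! i = x" for i
    proof -
      have "mset (?d ?w i) = mset u" using mset_d[OF i] by simp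
      moreover have "sorted (?d ?w i)"
      proof -
        have "sorted (take i ?w @ ?w ! i # drop (Suc i) ?w)" using id_take_nth_drop[OF i(1)] by (metis sorted_sort)
        then show ?thesis by (auto simp: sorted_append)
      qed
      ultimately have d: "?d ?w i = u" using True by (metis properties_for_sort)
      have "F ?w * (sg ?w i * word_series d (?d ?w i) u) = word_series d u u * (sg ?w i * f ?w) / factorials ?w"
      proof -
        have "F ?w = f ?w / factorials ?w" using Fw[of ?w] by (simp only: sorted_sort if_True)
        then show ?thesis unfolding d by simp
      qed
      also have "sg ?w i * f ?w = h u" using del[OF i] d by simp
      also have "word_series d u u * h u = h u" by (rule word_series_mult[OF h True]) simp
      finally show ?thesis .
    qed
    have "card {i. i < length ?w \<and> ?w ! i = x} = Suc (count_list u x)"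
    proof -
      have "card {i. i < length ?w \<and> ?w ! i = x} = count_list ?w x"
        by (simp add: count_list_eq_length_filter length_filter_conv_card eq_commute)
      also have "\<dots> = count_list (x # u) x" by (simp only: count_mset[symmetric] mset_sort)
      finally show ?thesis by simp
    qed
    moreover have "factorials ?w = of_nat (Suc (count_list u x)) * (factorials u :: 'k)"
      using factorials_mset[of ?w "x # u"] by simp
    moreover have "?T ?w = (\<Sum>i | i < length ?w \<and> ?w ! i = x. h u / factorials ?w)"
      unfolding sum_distrib_left by (rule sum.cong) (use summand in auto)
    ultimately show ?thesis unfolding eq using True by (simp del: of_nat_Suc)
  qed
qed

lemma taylor_left_deriv:
  assumes "taylor d F f"
  shows "taylor d (left_deriv d x F) (\<lambda>w. f (x # w))"
proof -
  have f: "alternating (graded_swap d) f" using assms by (simp add: taylor_def)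
  show ?thesis
    unfolding left_deriv_def[abs_def]
  proof (rule deletion_series[OF assms alternating_Cons[OF f]])
    fix w i assume i: "i < length w" "w ! i = x"
    then have w: "w = take i w @ x # drop (Suc i) w" using id_take_nth_drop by metis
    show "parity_sign (d x * sum_list (map d (take i w))) * f w = f (x # take i w @ drop (Suc i) w)"
      using alternating_move[OF f, of "[]" x "take i w" "drop (Suc i) w"] w by (simp add: prod_graded_swap)
  qed
qed

lemma taylor_right_deriv:
  assumes "taylor d F f"
  shows "taylor d (right_deriv d x F) (\<lambda>w. f (w @ [x]))"
proof -
  have f: "alternating (graded_swap d) f" using assms by (simp add: taylor_def)
  show ?thesis
    unfolding right_deriv_def[abs_def]
  proof (rule deletion_series[OF assms alternating_append_right[OF f]])
    fix w i assume i: "i < length w" "w ! i = x"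
    then have w: "w = take i w @ x # drop (Suc i) w" using id_take_nth_drop by metis
    have "f w = parity_sign (d x * sum_list (map d (drop (Suc i) w))) * f (take i w @ drop (Suc i) w @ [x])"
      using alternating_move[OF f, of "take i w" x "drop (Suc i) w" "[]"] w by (simp add: prod_graded_swap)
    then show "parity_sign (d x * sum_list (map d (drop (Suc i) w))) * f w = f ((take i w @ drop (Suc i) w) @ [x])"
      by simp
  qed
qed

section \<open>Products of series\<close>

definition sorted_pairs :: "'x::linorder list \<Rightarrow> ('x list \<times> 'x list) set" where
  "sorted_pairs u = {(v, w). sorted v \<and> sorted w \<and> mset v + mset w = mset u}"

lemma sorted_pairs_Nil: "sorted_pairs ([] :: 'x::linorder list) = {([], [])}"
proof (rule set_eqI)
  fix p :: "'x list \<times> 'x list"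
  obtain v w where p: "p = (v, w)" by (cases p)
  have "mset v + mset w = mset [] \<longleftrightarrow> v = [] \<and> w = []" by (simp only: mset.simps union_eq_empty mset_zero_iff)
  then show "p \<in> sorted_pairs [] \<longleftrightarrow> p \<in> {([], [])}"
    unfolding p sorted_pairs_def mem_Collect_eq prod.case singleton_iff prod.inject by (metis sorted_wrt.simps(1))
qed

lemma finite_sorted_pairs: "finite (sorted_pairs u)"
proof (rule finite_subset)
  let ?L = "{v. set v \<subseteq> set u \<and> length v \<le> length u}"
  have "v \<in> ?L \<and> w \<in> ?L" if "mset v + mset w = mset u" for v w
  proof -
    have "size (mset v + mset w) = size (mset u)" "set_mset (mset v + mset w) = set_mset (mset u)" by (simp_all only: that)
    then show ?thesis by auto
  qed
  then show "sorted_pairs u \<subseteq> ?L \<times> ?L" by (auto simp: sorted_pairs_def)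
  show "finite (?L \<times> ?L)" by (simp add: finite_lists_length_le)
qed

text \<open>A given pair of sorted words arises from as many unshuffles as a product of binomial
  coefficients, which is the quotient of the factorials. Normality makes repeated letters even, so
  all these unshuffles carry the same sign.\<close>

lemma unshuffle_sum_sorted_pairs:
  fixes H :: "'x::linorder list \<Rightarrow> 'x list \<Rightarrow> 'k::field_char_0"
  assumes "normal_word d u"
  defines "\<chi> \<equiv> graded_swap d"
  shows "unshuffle_sum \<chi> H u = factorials u *
    (\<Sum>(v, w)\<in>sorted_pairs u. inversion_sign \<chi> (v @ w) / (factorials v * factorials w) * H v w)"
  using assms(1)
proof (induction u arbitrary: H)
  case Nil
  show ?case unfolding sorted_pairs_Nil by simp
next
  case (Cons a u)
  let ?c = "\<lambda>v w. inversion_sign \<chi> (v @ w) / (factorials v * factorials w) :: 'k"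
  have u: "normal_word d u"
    unfolding normal_word_def
  proof (intro conjI allI impI)
    show "sorted u" using Cons.prems by (simp add: normal_word_def)
    fix x assume "odd (d x)"
    then have "count_list (a # u) x \<le> 1" using Cons.prems unfolding normal_word_def by blast
    then show "count_list u x \<le> 1" by (simp split: if_splits)
  qed
  have le: "a \<le> b" if "b \<in> set u" for b using Cons.prems that by (auto simp: normal_word_def)
  have even: "\<chi> a a = 1" if "a \<in> set u"
  proof -
    have "even (d a)"
    proof (rule ccontr)
      assume "odd (d a)"
      then have "count_list (a # u) a \<le> 1" using Cons.prems unfolding normal_word_def by blast
      then show False using that by (simp add: count_list_0_iff)
    qed
    then show ?thesis by (simp add: \<chi>_def graded_swap_def parity_sign_def)
  qed
  have ge: "a < b \<or> a = b \<and> \<chi> a a = 1" if "b \<in> set u" for b using le[OF that] even that by (cases "a = b") auto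
  have sets: "set v \<union> set w = set u" if "mset v + mset w = mset u" for v w :: "'x list" and u
    using arg_cong[OF that, of set_mset] by simp
  have cnt: "count_list v a + count_list w a = Suc (count_list u a)" if "(v, w) \<in> sorted_pairs (a # u)" for v w
  proof -
    have "mset v + mset w = mset (a # u)" using that by (simp add: sorted_pairs_def)
    from arg_cong[OF this, of "\<lambda>m. count m a"] show ?thesis by (simp add: count_mset)
  qed
  have hd: "\<exists>v'. v = a # v' \<and> sorted v'" if "sorted v" "a \<in> set v" "set v \<subseteq> insert a (set u)" for v
  proof (cases v)
    case (Cons b v')
    then have "b \<le> a" "a \<le> b" using that le by auto
    then show ?thesis using Cons that(1) by auto
  qed (use that in simp)
  \<comment> \<open>Weighted by the multiplicity of the least letter \<open>a\<close> in
    \<open>v\<close>, only pairs with \<open>a\<close> at the front of \<open>v\<close> remain, and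
    removing it cancels the weight against a factor of \<open>factorials v\<close>. The sum
    \<open>right\<close> does the same for \<open>w\<close>, where \<open>a\<close> in addition
    crosses \<open>v\<close>.\<close>
  have left: "(\<Sum>(v, w)\<in>sorted_pairs (a # u). of_nat (count_list v a) * (?c v w * H v w)) =
      (\<Sum>(v, w)\<in>sorted_pairs u. ?c v w * H (a # v) w)"
  proof (subst sum.mono_neutral_right[where S = "{(v, w) \<in> sorted_pairs (a # u). a \<in> set v}", OF finite_sorted_pairs],
      goal_cases)
    case 3
    show ?case
    proof (rule sum.reindex_bij_witness[where i = "\<lambda>(v, w). (a # v, w)" and j = "\<lambda>(v, w). (tl v, w)"], goal_cases)
    case (1 p)
    then obtain v w where p: "p = (v, w)" "sorted v" "sorted w" "mset v + mset w = mset (a # u)" "a \<in> set v"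
      by (auto simp: sorted_pairs_def)
    then obtain v' where "v = a # v'" using hd[of v] sets[of v w "a # u"] by auto
    then show ?case using p by simp
  next
    case (2 p)
    then obtain v w where p: "p = (v, w)" "sorted v" "sorted w" "mset v + mset w = mset (a # u)" "a \<in> set v"
      by (auto simp: sorted_pairs_def)
    then obtain v' where "v = a # v'" "sorted v'" using hd[of v] sets[of v w "a # u"] by auto
    then show ?case using p by (simp add: sorted_pairs_def)
  next
    case (4 p)
    then obtain v w where p: "p = (v, w)" "sorted v" "sorted w" "mset v + mset w = mset u"
      by (auto simp: sorted_pairs_def)
    then show ?case using le sets[of v w u] by (auto simp: sorted_pairs_def)
  next
    case (5 p)
    then obtain v w where p: "p = (v, w)" "sorted v" "sorted w" "mset v + mset w = mset (a # u)" "a \<in> set v"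
      by (auto simp: sorted_pairs_def)
    then obtain v' where v: "v = a # v'" "sorted v'" using hd[of v] sets[of v w "a # u"] by auto
    then have "set v' \<union> set w = set u" using p(4) sets[of v' w u] by simp
    then have "inversion_sign \<chi> ([] @ a # (v' @ w)) = inversion_sign \<chi> ([] @ (v' @ w))"
      using inversion_sign_insert_min[of "[]" "v' @ w" a \<chi>] ge by simp
    then show ?case using p(1) v(1) by (simp del: of_nat_Suc)
    qed (auto simp: sorted_pairs_def)
  qed (auto simp: count_list_0_iff)
  have right: "(\<Sum>(v, w)\<in>sorted_pairs (a # u). of_nat (count_list w a) * (?c v w * H v w)) =
      (\<Sum>(v, w)\<in>sorted_pairs u. ?c v w * ((\<Prod>b\<leftarrow>v. \<chi> b a) * H v (a # w)))"
  proof (subst sum.mono_neutral_right[where S = "{(v, w) \<in> sorted_pairs (a # u). a \<in> set w}", OF finite_sorted_pairs],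
      goal_cases)
    case 3
    show ?case
    proof (rule sum.reindex_bij_witness[where i = "\<lambda>(v, w). (v, a # w)" and j = "\<lambda>(v, w). (v, tl w)"], goal_cases)
    case (1 p)
    then obtain v w where p: "p = (v, w)" "sorted v" "sorted w" "mset v + mset w = mset (a # u)" "a \<in> set w"
      by (auto simp: sorted_pairs_def)
    then obtain v' where "w = a # v'" using hd[of w] sets[of v w "a # u"] by auto
    then show ?case using p by simp
  next
    case (2 p)
    then obtain v w where p: "p = (v, w)" "sorted v" "sorted w" "mset v + mset w = mset (a # u)" "a \<in> set w"
      by (auto simp: sorted_pairs_def)
    then obtain v' where "w = a # v'" "sorted v'" using hd[of w] sets[of v w "a # u"] by auto
    then show ?case using p by (simp add: sorted_pairs_def)
  next
    case (4 p)
    then obtain v w where p: "p = (v, w)" "sorted v" "sorted w" "mset v + mset w = mset u"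
      by (auto simp: sorted_pairs_def)
    then show ?case using le sets[of v w u] by (auto simp: sorted_pairs_def)
  next
    case (5 p)
    then obtain v w where p: "p = (v, w)" "sorted v" "sorted w" "mset v + mset w = mset (a # u)" "a \<in> set w"
      by (auto simp: sorted_pairs_def)
    then obtain w' where w: "w = a # w'" "sorted w'" using hd[of w] sets[of v w "a # u"] by auto
    then have "set v \<union> set w' = set u" using p(4) sets[of v w' u] by simp
    then have "inversion_sign \<chi> (v @ a # w') = (\<Prod>b\<leftarrow>v. \<chi> b a) * inversion_sign \<chi> (v @ w')"
      using inversion_sign_insert_min[of v w' a \<chi>] ge by blast
    then show ?case using p(1) w(1) by (simp del: of_nat_Suc)
    qed (auto simp: sorted_pairs_def)
  qed (auto simp: count_list_0_iff)
  have "factorials (a # u) * (\<Sum>(v, w)\<in>sorted_pairs (a # u). ?c v w * H v w) =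
      factorials u * (\<Sum>(v, w)\<in>sorted_pairs (a # u). of_nat (Suc (count_list u a)) * (?c v w * H v w))"
    by (simp add: sum_distrib_left case_prod_unfold mult_ac del: of_nat_Suc)
  \<comment> \<open>A Pascal rule: the multiplicity of \<open>a\<close> in the whole word is
    distributed over the two parts.\<close>
  also have "(\<Sum>(v, w)\<in>sorted_pairs (a # u). of_nat (Suc (count_list u a)) * (?c v w * H v w)) =
      (\<Sum>(v, w)\<in>sorted_pairs (a # u). of_nat (count_list v a) * (?c v w * H v w) + of_nat (count_list w a) * (?c v w * H v w))"
  proof (rule sum.cong)
    fix p assume "p \<in> sorted_pairs (a # u)"
    moreover obtain v w where "p = (v, w)" by (cases p)
    ultimately show "(case p of (v, w) \<Rightarrow> of_nat (Suc (count_list u a)) * (?c v w * H v w)) =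
        (case p of (v, w) \<Rightarrow> of_nat (count_list v a) * (?c v w * H v w) + of_nat (count_list w a) * (?c v w * H v w))"
      using cnt[of v w] by (simp only: prod.case of_nat_add[symmetric] distrib_right[symmetric])
  qed simp
  also have "\<dots> = (\<Sum>(v, w)\<in>sorted_pairs u. ?c v w * H (a # v) w) + (\<Sum>(v, w)\<in>sorted_pairs u. ?c v w * ((\<Prod>b\<leftarrow>v. \<chi> b a) * H v (a # w)))"
    unfolding left[symmetric] right[symmetric] by (simp add: sum.distrib case_prod_unfold)
  finally show ?case
    using Cons.IH[OF u, of "\<lambda>x y. H (a # x) y"] Cons.IH[OF u, of "\<lambda>x y. (\<Prod>b\<leftarrow>x. \<chi> b a) * H x (a # y)"]
    by (simp only: unshuffle_sum.simps distrib_left)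
qed

lemma alternating_mult:
  assumes "alternating \<chi> \<Phi>"
  shows "alternating \<chi> (\<lambda>w. \<Phi> w * c)" "alternating \<chi> (\<lambda>w. c * \<Phi> w)"
proof -
  have "\<Phi> (x @ a # b # y) * c = \<chi> a b * (\<Phi> (x @ b # a # y) * c)" for x a b y
    by (simp add: alternatingD[OF assms, of x a b y] mult.assoc)
  then show "alternating \<chi> (\<lambda>w. \<Phi> w * c)" "alternating \<chi> (\<lambda>w. c * \<Phi> w)"
    unfolding alternating_def mult.commute[of c] by blast+
qed

text \<open>The Leibniz formula for iterated derivatives of a product.\<close>

lemma taylor_mult:
  fixes F G :: "('x::linorder, 'k::field_char_0) series"
  assumes F: "taylor d F f" and G: "taylor d G g"
  shows "taylor d (series_mult d F G) (unshuffle_sum (graded_swap d) (\<lambda>x y. f x * g y))"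
  unfolding taylor_def
proof (intro conjI allI)
  have f: "alternating (graded_swap d) f" and g: "alternating (graded_swap d) g"
    and Fu: "F u = (if sorted u then f u / factorials u else 0)" and Gu: "G u = (if sorted u then g u / factorials u else 0)" for u
    using F G by (simp_all add: taylor_def)
  show alt: "alternating (graded_swap d) (unshuffle_sum (graded_swap d) (\<lambda>x y. f x * g y))"
    by (rule alternating_unshuffle_sum[OF graded_swap_involutive graded_swap_commute])
      (rule alternating_mult(1)[OF f] alternating_mult(2)[OF g])+
  fix u
  let ?T = "\<lambda>(v, w). F v * G w * word_series d (v @ w) u"
  have "{p. ?T p \<noteq> 0} \<subseteq> sorted_pairs u"
  proof
    fix p assume "p \<in> {p. ?T p \<noteq> 0}"
    then obtain v w where p: "p = (v, w)" "F v \<noteq> 0" "G w \<noteq> 0" "word_series d (v @ w) u \<noteq> (0 :: 'k)" by (cases p) auto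
    then have "mset (v @ w) = mset u" using word_series_0(1) by blast
    then show "p \<in> sorted_pairs u"
      using p by (auto simp: sorted_pairs_def Fu Gu split: if_splits)
  qed
  then have eq: "series_mult d F G u = sum ?T (sorted_pairs u)"
    unfolding series_mult_def by (rule Sum_any.expand_superset[OF finite_sorted_pairs])
  show "series_mult d F G u = (if sorted u then unshuffle_sum (graded_swap d) (\<lambda>x y. f x * g y) u / factorials u else 0)"
  proof (cases "normal_word d u")
    case True
    have "sum ?T (sorted_pairs u) = (\<Sum>(v, w)\<in>sorted_pairs u. inversion_sign (graded_swap d) (v @ w) / (factorials v * factorials w) * (f v * g w))"
    proof (rule sum.cong)
      fix p assume "p \<in> sorted_pairs u"
      then obtain v w where p: "p = (v, w)" "sorted v" "sorted w" "mset (v @ w) = mset u" by (auto simp: sorted_pairs_def)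
      then have "sort (v @ w) = u" using True by (metis properties_for_sort normal_word_def)
      then show "?T p = (case p of (v, w) \<Rightarrow> inversion_sign (graded_swap d) (v @ w) / (factorials v * factorials w) * (f v * g w))"
        using p True by (simp add: Fu Gu word_series_def sorting_sign_eq mult_ac)
    qed simp
    then show ?thesis
      using eq unshuffle_sum_sorted_pairs[OF True, of "\<lambda>x y. f x * g y"] True by (simp add: normal_word_def)
  next
    case False
    then have "sum ?T (sorted_pairs u) = 0" by (intro sum.neutral) (auto simp: word_series_def)
    then show ?thesis using eq alternating_not_normal[OF alt _ False] by simp
  qed
qed

section \<open>The polyvector field in Taylor coefficients\<close>

primrec pair_exponent :: "('x \<Rightarrow> int) \<Rightarrow> 'x list \<Rightarrow> int" where
  "pair_exponent d [] = 0"
| "pair_exponent d (a # w) = d a * (\<Sum>b\<leftarrow>w. d b) + pair_exponent d w"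

text \<open>Each letter is weighted by its place, counted from 0. Unlike
  \<open>pair_exponent\<close> this depends on the order of the letters, and it is the part of
  \<epsilon> that changes the symmetry type of the outputs.\<close>

primrec position_exponent :: "('x \<Rightarrow> int) \<Rightarrow> 'x list \<Rightarrow> int" where
  "position_exponent d [] = 0"
| "position_exponent d (a # w) = (\<Sum>b\<leftarrow>w. d b) + position_exponent d w"

lemma pair_exponent_append:
  "pair_exponent d (x @ y) = pair_exponent d x + pair_exponent d y + (\<Sum>a\<leftarrow>x. d a) * (\<Sum>b\<leftarrow>y. d b)"
  by (induction x) (simp_all add: algebra_simps)

lemma position_exponent_append:
  "position_exponent d (x @ y) = position_exponent d x + position_exponent d y + int (length x) * (\<Sum>b\<leftarrow>y. d b)"
  by (induction x) (simp_all add: algebra_simps)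

text \<open>The second elementary symmetric polynomial in terms of power sums; invariance under
  permutations becomes evident.\<close>

lemma pair_exponent_square: "2 * pair_exponent d w = (\<Sum>a\<leftarrow>w. d a) ^ 2 - (\<Sum>a\<leftarrow>w. d a ^ 2)"
  by (induction w) (simp_all add: algebra_simps power2_eq_square)

lemma pair_exponent_mset: "mset x = mset y \<Longrightarrow> pair_exponent d x = pair_exponent d y"
  using pair_exponent_square[of d x] pair_exponent_square[of d y]
    sum_list_map_mset_cong[of x y d] sum_list_map_mset_cong[of x y "\<lambda>a. d a ^ 2"] by simp

lemma sum_nth_sum_list: "(\<Sum>i<length w. f (w ! i)) = (\<Sum>a\<leftarrow>w. f a :: 'b::comm_monoid_add)"
  by (induction w) (simp_all add: sum.lessThan_Suc_shift del: sum.lessThan_Suc)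

text \<open>This separates the permutation-invariant parts of \<epsilon> from the position sum.
  Diagonal terms \<open>d a * d a\<close> have the parity of \<open>d a\<close>, which turns the
  factor \<open>2 - m\<close> into \<open>1 + m\<close> modulo 2.\<close>

lemma parity_sign_gamma_exponent:
  "parity_sign (gamma_exponent d \<alpha> \<beta>) = parity_sign ((1 + int (length \<beta>)) * (\<Sum>a\<leftarrow>\<alpha>. d a) +
    pair_exponent d \<alpha> + pair_exponent d \<beta> + position_exponent d \<beta>)"
proof (rule parity_sign_cong)
  have 1: "even (\<Sum>k<length w. d (w ! k) * (c + (\<Sum>i\<le>k. d (w ! i)))) \<longleftrightarrow> even ((c + 1) * (\<Sum>a\<leftarrow>w. d a) + pair_exponent d w)" for c w
  proof (induction w arbitrary: c)
    case (Cons a w)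
    have "(\<Sum>k<length (a # w). d ((a # w) ! k) * (c + (\<Sum>i\<le>k. d ((a # w) ! i)))) =
        d a * (c + d a) + (\<Sum>k<length w. d (w ! k) * ((c + d a) + (\<Sum>i\<le>k. d (w ! i))))"
      by (simp add: sum.lessThan_Suc_shift sum.atMost_Suc_shift add_ac del: sum.lessThan_Suc sum.atMost_Suc)
    then show ?case using Cons.IH[of "c + d a"] by (simp add: algebra_simps) argo
  qed simp
  have 2: "(\<Sum>k<length w. (d (w ! k) + 1) * (\<Sum>i\<in>{k<..<length w}. d (w ! i))) = pair_exponent d w + position_exponent d w" for w
  proof (induction w)
    case (Cons a w)
    have s: "(\<Sum>i\<in>{Suc k<..<Suc (length w)}. d ((a # w) ! i)) = (\<Sum>i\<in>{k<..<length w}. d (w ! i))" for k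
      unfolding atLeastSucLessThan_greaterThanLessThan[symmetric] sum.shift_bounds_Suc_ivl by simp
    have s0: "(\<Sum>i\<in>{0<..<Suc (length w)}. d ((a # w) ! i)) = (\<Sum>b\<leftarrow>w. d b)"
      unfolding atLeastSucLessThan_greaterThanLessThan[symmetric] sum.shift_bounds_Suc_ivl
      by (simp add: sum_nth_sum_list[of d, symmetric] atLeast0LessThan)
    have "(\<Sum>k<length (a # w). (d ((a # w) ! k) + 1) * (\<Sum>i\<in>{k<..<length (a # w)}. d ((a # w) ! i))) =
        (d a + 1) * (\<Sum>b\<leftarrow>w. d b) + (\<Sum>k<length w. (d (w ! k) + 1) * (\<Sum>i\<in>{k<..<length w}. d (w ! i)))"
      by (simp only: length_Cons sum.lessThan_Suc_shift nth_Cons_0 nth_Cons_Suc s s0)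
    then show ?case unfolding Cons.IH by (simp add: algebra_simps)
  qed simp
  have "even (gamma_exponent d \<alpha> \<beta>) \<longleftrightarrow>
      even ((\<Sum>k<length \<alpha>. d (\<alpha> ! k) * ((2 - int (length \<beta>)) + (\<Sum>i\<le>k. d (\<alpha> ! i)))) + (pair_exponent d \<beta> + position_exponent d \<beta>))"
    unfolding gamma_exponent_def 2 ..
  also have "\<dots> \<longleftrightarrow> even ((3 - int (length \<beta>)) * (\<Sum>a\<leftarrow>\<alpha>. d a) + pair_exponent d \<alpha> + (pair_exponent d \<beta> + position_exponent d \<beta>))"
    using 1[of \<alpha> "2 - int (length \<beta>)"] by simp
  finally show "even (gamma_exponent d \<alpha> \<beta>) \<longleftrightarrow> even ((1 + int (length \<beta>)) * (\<Sum>a\<leftarrow>\<alpha>. d a) +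
      pair_exponent d \<alpha> + pair_exponent d \<beta> + position_exponent d \<beta>)"
    by simp argo
qed

section \<open>Words in coordinates and fields\<close>

primrec coords :: "'i pvar list \<Rightarrow> 'i list" where
  "coords [] = []"
| "coords (v # w) = (case v of Coord a \<Rightarrow> a # coords w | Field a \<Rightarrow> coords w)"

primrec fields :: "'i pvar list \<Rightarrow> 'i list" where
  "fields [] = []"
| "fields (v # w) = (case v of Coord a \<Rightarrow> fields w | Field a \<Rightarrow> a # fields w)"

lemma coords_fields [simp]:
  "coords (map Coord \<alpha> @ map Field b) = \<alpha>" "fields (map Coord \<alpha> @ map Field b) = b"
proof -
  have "coords (map Field b) = []" "fields (map Field b) = b" by (induction b) simp_all
  then show "coords (map Coord \<alpha> @ map Field b) = \<alpha>" "fields (map Coord \<alpha> @ map Field b) = b"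
    by (induction \<alpha>) simp_all
qed

lemma Coord_less [simp]: "Coord a < Coord b \<longleftrightarrow> a < b" "Coord a < Field b" "Field a < Field b \<longleftrightarrow> a < (b :: 'i::linorder)"
  by (auto simp: less_pvar_def)

text \<open>Coordinates precede fields in the order on variables, so a sorted word amounts to an
  input word and an output word.\<close>

lemma sorted_pvars: "sorted w \<Longrightarrow> map Coord (coords w) @ map Field (fields w) = (w :: 'i::linorder pvar list)"
proof (induction w)
  case (Cons v w)
  show ?case
  proof (cases v)
    case (Field a)
    have "\<forall>x\<in>set w. \<exists>b. x = Field b"
    proof
      fix x assume "x \<in> set w"
      then have "v \<le> x" using Cons.prems by simp
      then show "\<exists>b. x = Field b" by (cases x) (simp_all add: Field)
    qed
    then have "coords w = []" by (induction w) auto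
    then show ?thesis using Cons Field by simp
  qed (use Cons in simp)
qed simp

lemma sort_pvars: "sort (map Coord \<alpha> @ map Field b) = map Coord (sort \<alpha>) @ map Field (sort (b :: 'i::linorder list))"
proof (rule properties_for_sort)
  have "sorted (map Coord (sort \<alpha>))" "sorted (map Field (sort b))" by (simp_all add: sorted_map)
  then show "sorted (map Coord (sort \<alpha>) @ map Field (sort b))" by (auto simp: sorted_append)
qed simp

lemma count_list_pvars:
  "count_list (map Coord \<alpha> @ map Field b) (Coord a) = count_list \<alpha> a"
  "count_list (map Coord \<alpha> @ map Field b) (Field a) = count_list b a"
proof -
  have "count_list (map Field b) (Coord a) = 0" "count_list (map Field b) (Field a) = count_list b a"
    by (induction b) simp_all
  then show "count_list (map Coord \<alpha> @ map Field b) (Coord a) = count_list \<alpha> a"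
    "count_list (map Coord \<alpha> @ map Field b) (Field a) = count_list b a"
    by (induction \<alpha>) simp_all
qed

lemma mset_pvars:
  assumes "mset (map Coord \<alpha> @ map Field b) = mset (map Coord \<alpha>' @ map Field b')"
  shows "mset \<alpha> = mset \<alpha>'" "mset b = mset b'"
proof -
  have *: "count_list (map Coord \<alpha> @ map Field b) v = count_list (map Coord \<alpha>' @ map Field b') v" for v
    unfolding count_mset[symmetric] assms ..
  show "mset \<alpha> = mset \<alpha>'" by (rule multiset_eqI) (use * count_list_pvars(1) in \<open>metis count_mset\<close>)
  show "mset b = mset b'" by (rule multiset_eqI) (use * count_list_pvars(2) in \<open>metis count_mset\<close>)
qed

lemma factorials_pvars:
  "factorials (map Coord \<alpha> @ map Field b) = factorials \<alpha> * (factorials b :: 'k::field_char_0)"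
proof -
  have "factorials (map Field b) = (factorials b :: 'k)"
  proof (induction b)
    case (Cons a b)
    then show ?case using count_list_pvars(2)[of "[]" b a] by simp
  qed simp
  then show ?thesis
  proof (induction \<alpha>)
    case (Cons a \<alpha>)
    then show ?case using count_list_pvars(1)[of \<alpha> b a] by (simp add: mult.assoc del: of_nat_Suc)
  qed simp
qed

text \<open>The multinomial count. It accounts for the factor 1/(m! n!) when the index words with
  the same letters are collected.\<close>

lemma card_arrangements:
  "of_nat (card {v. mset v = mset w}) * factorials w = (fact (length w) :: 'k::field_char_0)"
proof -
  have "card {v. mset v = mset w} * (\<Prod>x\<in>set w. fact (count_list w x)) = (fact (length w) :: nat)"
    using card_permutations_of_multiset_aux[of "mset w"] by (simp add: permutations_of_multiset_def count_mset)
  from arg_cong[OF this, of "of_nat :: nat \<Rightarrow> 'k"] show ?thesis by (simp add: factorials_eq)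
qed

lemma finite_arrangements: "finite {v. mset v = mset w}"
  using finite_permutations_of_multiset[of "mset w"] by (simp add: permutations_of_multiset_def)

lemma alternating_rev:
  assumes "alternating \<chi> \<Phi>" "\<And>a b. \<chi> a b = \<chi> b a"
  shows "alternating \<chi> (\<lambda>w. \<Phi> (rev w))"
  unfolding alternating_def
proof (intro allI)
  fix x a b y
  show "\<Phi> (rev (x @ a # b # y)) = \<chi> a b * \<Phi> (rev (x @ b # a # y))"
    using alternatingD[OF assms(1), of "rev y" b a "rev x"] assms(2)[of a b] by simp
qed

lemma sorting_sign_square: "sorting_sign d w * sorting_sign d w = 1"
  unfolding sorting_sign_def prod.distrib[symmetric] by (rule prod.neutral) auto

lemma cross_sign_graded:
  "cross_sign (graded_swap d) x y = parity_sign ((\<Sum>a\<leftarrow>x. d a) * (\<Sum>b\<leftarrow>y. d b))"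
  unfolding cross_sign_def using prod_prod_graded_swap[of d x y]
  by (simp add: graded_swap_commute[of d _ "_ :: _"] prod_prod_graded_swap mult.commute)

context based_graded_space begin

definition signed_coef :: "(nat \<Rightarrow> nat \<Rightarrow> ('v, 'k) operation) \<Rightarrow> 'i list \<Rightarrow> 'i list \<Rightarrow> 'k" where
  "signed_coef \<mu> \<alpha> \<beta> = parity_sign (gamma_exponent dg \<alpha> \<beta>) * coef \<mu> \<alpha> \<beta>"

text \<open>Prescribed on sorted words and extended by the sorting sign, so that alternation is
  inherited from monomials. The reversal reflects that outputs \<beta> correspond to fields in the
  order \<open>rev \<beta>\<close>.\<close>

definition gamma_taylor :: "(nat \<Rightarrow> nat \<Rightarrow> ('v, 'k) operation) \<Rightarrow> 'i pvar list \<Rightarrow> 'k" where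
  "gamma_taylor \<mu> w = word_series (pvar_degree dg) w (sort w) * signed_coef \<mu> (coords (sort w)) (rev (fields (sort w)))"

abbreviation pd :: "'i pvar \<Rightarrow> int" where "pd \<equiv> pvar_degree dg"
abbreviation fd :: "'i \<Rightarrow> int" where "fd a \<equiv> dg a + 1"

lemma pd_swaps [simp]:
  "graded_swap pd (Coord a) (Coord b) = graded_swap dg a b" "graded_swap pd (Field a) (Field b) = graded_swap fd a b"
  by (simp_all add: graded_swap_def)

lemma alternating_gamma_taylor: "alternating (graded_swap pd) (gamma_taylor \<mu>)"
  unfolding alternating_def
proof (intro allI)
  fix x y :: "'i pvar list" and a b
  have s: "sort (x @ a # b # y) = sort (x @ b # a # y)" by (rule properties_for_sort) simp_all
  show "gamma_taylor \<mu> (x @ a # b # y) = graded_swap pd a b * gamma_taylor \<mu> (x @ b # a # y)"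
  proof -
    have "word_series pd (x @ a # b # y) u = graded_swap pd a b * (word_series pd (x @ b # a # y) u :: 'k)" for u
      by (rule alternatingD[OF alternating_word_series])
    then show ?thesis by (simp only: gamma_taylor_def s mult.assoc)
  qed
qed

context
  fixes \<mu> :: "nat \<Rightarrow> nat \<Rightarrow> ('v, 'k) operation"
  assumes \<mu>: "\<And>m n. m \<ge> 1 \<Longrightarrow> n \<ge> 1 \<Longrightarrow> \<mu> m n \<in> sym_to_ext m n"
begin

lemma alternating_signed_coef_in: "alternating (graded_swap dg) (\<lambda>\<alpha>. signed_coef \<mu> \<alpha> \<beta>)"
  unfolding alternating_def
proof (intro allI)
  fix x y a b
  show "signed_coef \<mu> (x @ a # b # y) \<beta> = graded_swap dg a b * signed_coef \<mu> (x @ b # a # y) \<beta>"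
    using alternatingD[OF alternating_coef_in[OF \<mu>], of x a b y \<beta>]
      pair_exponent_mset[of "x @ a # b # y" "x @ b # a # y" dg]
    by (simp add: signed_coef_def parity_sign_gamma_exponent add_ac mult_ac)
qed

text \<open>A swap of neighbours changes the position sum by \<open>dg b - dg a\<close>, and 1 +
  |a||b| + |a| + |b| = (|a| + 1)(|b| + 1). Thus skew symmetry in degree |e| becomes symmetry in
  degree |e| + 1.\<close>

lemma alternating_signed_coef_out: "alternating (graded_swap fd) (signed_coef \<mu> \<alpha>)"
  unfolding alternating_def
proof (intro allI)
  fix x y a b
  have "parity_sign (position_exponent dg (x @ a # b # y)) * skew_swap dg a b =
      graded_swap fd a b * (parity_sign (position_exponent dg (x @ b # a # y)) :: 'k)"
  proof -
    have p: "position_exponent dg (x @ a # b # y) = position_exponent dg (x @ b # a # y) + (dg b - dg a)"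
      by (simp add: position_exponent_append)
    show ?thesis
      unfolding skew_swap_eq graded_swap_def parity_sign_add[symmetric] p by (rule parity_sign_cong) (simp, argo)
  qed
  then show "signed_coef \<mu> \<alpha> (x @ a # b # y) = graded_swap fd a b * signed_coef \<mu> \<alpha> (x @ b # a # y)"
    using alternatingD[OF alternating_coef_out[OF \<mu>], of \<alpha> x a b y]
      pair_exponent_mset[of "x @ a # b # y" "x @ b # a # y" dg]
    by (simp add: signed_coef_def parity_sign_gamma_exponent parity_sign_add mult_ac)
qed

text \<open>The prescribed formula extends from sorted words to all words of coordinates followed by
  fields, because \<open>signed_coef\<close> has the symmetries of the variables. If an odd variable
  is repeated, both sides vanish.\<close>

lemma gamma_taylor_word: "gamma_taylor \<mu> (map Coord \<alpha> @ map Field b) = signed_coef \<mu> \<alpha> (rev b)"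
proof -
  let ?u = "map Coord (sort \<alpha>) @ map Field (sort b)"
  have out: "alternating (graded_swap fd) (\<lambda>b. signed_coef \<mu> \<alpha> (rev b))" for \<alpha>
    by (rule alternating_rev[OF alternating_signed_coef_out graded_swap_commute])
  have sorted: "sorted ?u" using sort_pvars[of \<alpha> b] by (metis sorted_sort)
  show ?thesis
  proof (cases "normal_word pd ?u")
    case True
    have "inversion_sign (graded_swap pd) (map Coord \<alpha> @ map Field b) =
        inversion_sign (graded_swap pd) (map Coord \<alpha>) * (inversion_sign (graded_swap pd) (map Field b) :: 'k)"
      by (rule inversion_sign_append) auto
    also have "\<dots> = inversion_sign (graded_swap dg) \<alpha> * inversion_sign (graded_swap fd) b"
      by (simp add: inversion_sign_map_strict_mono)
    finally show ?thesis
      using True alternating_sort[OF alternating_signed_coef_in, of \<alpha> "rev b"] alternating_sort[OF out, of "sort \<alpha>" b]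
      by (simp add: gamma_taylor_def sort_pvars word_series_def sorting_sign_eq mult_ac)
  next
    case False
    then obtain v where v: "odd (pd v)" "count_list ?u v > 1" using sorted by (auto simp: normal_word_def not_le)
    have cs: "count_list (sort w) a = count_list w a" for w :: "'i list" and a by (simp only: count_mset[symmetric] mset_sort)
    have "signed_coef \<mu> \<alpha> (rev b) = 0"
    proof (cases v)
      case (Coord a)
      then show ?thesis using v alternating_repeated[OF alternating_signed_coef_in, of a \<alpha>]
        by (simp only: count_list_pvars cs) simp
    next
      case (Field a)
      then show ?thesis using v alternating_repeated[OF out, of a b]
        by (simp only: count_list_pvars cs) simp
    qed
    then show ?thesis using False by (simp add: gamma_taylor_def sort_pvars word_series_def)
  qed
qed

lemma coef_degree:
  assumes "coef \<mu> \<alpha> \<beta> \<noteq> 0"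
  shows "deg \<beta> = deg \<alpha> + 2 - int (length \<beta>)"
proof -
  have ne: "length \<beta> \<ge> 1" "length \<alpha> \<ge> 1" using assms by (auto simp: coef_def Suc_le_eq split: if_splits)
  then show ?thesis using assms mat_nonzero(3)[OF mu_End[OF \<mu> ne], of \<alpha> \<beta>] by (auto simp: coef_def split: if_splits)
qed

text \<open>The operations have degree 2 - m, the coordinates degree -|e| and the symbols of the
  fields degree |e| + 1, so every monomial of \<Gamma> has total degree 2.\<close>

lemma gamma_taylor_degree:
  assumes "gamma_taylor \<mu> w \<noteq> 0"
  shows "even (\<Sum>v\<leftarrow>w. pd v)"
proof -
  let ?\<alpha> = "coords (sort w)" and ?b = "fields (sort w)"
  have "coef \<mu> ?\<alpha> (rev ?b) \<noteq> 0" using assms by (auto simp: gamma_taylor_def signed_coef_def)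
  from coef_degree[OF this] have d: "deg ?b = deg ?\<alpha> + 2 - int (length ?b)" by (simp add: deg_def rev_map[symmetric] sum_list_rev)
  have "(\<Sum>v\<leftarrow>w. pd v) = (\<Sum>v\<leftarrow>sort w. pd v)" by (rule sum_list_map_mset_cong) simp
  also have "\<dots> = (\<Sum>v\<leftarrow>map Coord ?\<alpha> @ map Field ?b. pd v)" by (subst sorted_pvars) simp_all
  also have "\<dots> = - deg ?\<alpha> + (deg ?b + int (length ?b))"
  proof -
    have "(\<Sum>a\<leftarrow>x. - dg a) = - deg x" "(\<Sum>a\<leftarrow>x. fd a) = deg x + int (length x)" for x
      by (induction x) simp_all
    then show ?thesis by (simp add: o_def)
  qed
  finally show ?thesis using d by simp
qed

text \<open>All index words with the same letters contribute equally, as the sign of the monomial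
  compensates that of the coefficient. Their number divided by m! n! is the reciprocal of the
  factorials of the monomial.\<close>

theorem taylor_Gamma: "taylor pd (Gamma A e dg \<mu>) (gamma_taylor \<mu>)"
  unfolding taylor_def
proof (intro conjI allI alternating_gamma_taylor)
  fix u
  let ?wd = "\<lambda>\<alpha> \<beta>. map Coord \<alpha> @ map Field (rev \<beta>)"
  let ?t = "\<lambda>\<alpha> \<beta>. 1 / (fact (length \<beta>) * fact (length \<alpha>)) * signed_coef \<mu> \<alpha> \<beta> * word_series pd (?wd \<alpha> \<beta>) u"
  let ?m = "length (fields u)"
  have part: "Gamma_part A e dg \<mu> m u = Sum_any (\<lambda>(\<alpha>, \<beta>). if length \<beta> = m then ?t \<alpha> \<beta> else 0)" if "m \<ge> 1" for m
  proof -
    have "(if set \<alpha> \<subseteq> A \<and> set \<beta> \<subseteq> A \<and> \<alpha> \<noteq> [] \<and> length \<beta> = m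
        then 1 / (fact m * fact (length \<alpha>)) * parity_sign (gamma_exponent dg \<alpha> \<beta>) * coefficient A e \<mu> \<alpha> \<beta> * polyvector_monomial dg \<alpha> \<beta> u
        else 0) = (if length \<beta> = m then ?t \<alpha> \<beta> else 0)" for \<alpha> \<beta>
      using that by (auto simp: signed_coef_def coef_def mat_def coefficient_def polyvector_monomial_def)
    then show ?thesis unfolding Gamma_part_def by simp
  qed
  show "Gamma A e dg \<mu> u = (if sorted u then gamma_taylor \<mu> u / factorials u else 0)"
  proof (cases "sorted u")
    case False
    then have "Gamma_part A e dg \<mu> m u = 0" if "m \<ge> 1" for m
      unfolding part[OF that] by (simp add: word_series_0 case_prod_unfold cong: if_cong)
    then show ?thesis using False by (simp add: Gamma_def cong: if_cong)
  next
    case True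
    let ?P = "{\<alpha>. mset \<alpha> = mset (coords u)} \<times> {\<beta>. mset \<beta> = mset (fields u)}"
    have fin: "finite ?P" by (simp add: finite_arrangements)
    have u: "u = map Coord (coords u) @ map Field (fields u)" using sorted_pvars[OF True] by simp
    have P: "(\<alpha>, \<beta>) \<in> ?P" if "?t \<alpha> \<beta> \<noteq> 0" for \<alpha> \<beta>
    proof -
      have "mset (?wd \<alpha> \<beta>) = mset u" using that word_series_0(1) by (metis mult_zero_right)
      then have "mset (map Coord \<alpha> @ map Field (rev \<beta>)) = mset (map Coord (coords u) @ map Field (fields u))"
        by (rule HOL.trans[OF _ arg_cong[OF u, of mset]])
      from mset_pvars[OF this] show ?thesis by simp
    qed
    have len: "length \<beta> = ?m" "length \<alpha> = length (coords u)" if "(\<alpha>, \<beta>) \<in> ?P" for \<alpha> \<beta>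
      using that by (auto dest: mset_eq_length)
    have part': "Gamma_part A e dg \<mu> m u = (if m = ?m then \<Sum>(\<alpha>, \<beta>)\<in>?P. ?t \<alpha> \<beta> else 0)" if "m \<ge> 1" for m
    proof -
      have "Gamma_part A e dg \<mu> m u = (\<Sum>(\<alpha>, \<beta>)\<in>?P. if length \<beta> = m then ?t \<alpha> \<beta> else 0)"
        unfolding part[OF that]
      proof (rule Sum_any.expand_superset[OF fin], rule subsetI)
        fix p assume "p \<in> {p. (case p of (\<alpha>, \<beta>) \<Rightarrow> if length \<beta> = m then ?t \<alpha> \<beta> else 0) \<noteq> 0}"
        moreover obtain \<alpha> \<beta> where p: "p = (\<alpha>, \<beta>)" by (cases p)
        ultimately have "(if length \<beta> = m then ?t \<alpha> \<beta> else 0) \<noteq> 0" by (simp only: p mem_Collect_eq prod.case simp_thms)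
        then have "?t \<alpha> \<beta> \<noteq> 0" by (cases "length \<beta> = m") (simp_all only: if_True if_False simp_thms)
        then show "p \<in> ?P" unfolding p by (rule P)
      qed
      also have "\<dots> = (\<Sum>(\<alpha>, \<beta>)\<in>?P. if m = ?m then ?t \<alpha> \<beta> else 0)"
      proof (rule sum.cong[OF HOL.refl])
        fix p assume p: "p \<in> ?P"
        obtain \<alpha> \<beta> where pq: "p = (\<alpha>, \<beta>)" by (cases p)
        have "length \<beta> = ?m" by (rule len(1)[OF p[unfolded pq]])
        then have "(length \<beta> = m) = (m = ?m)" by auto
        then show "(case p of (\<alpha>, \<beta>) \<Rightarrow> if length \<beta> = m then ?t \<alpha> \<beta> else 0) = (case p of (\<alpha>, \<beta>) \<Rightarrow> if m = ?m then ?t \<alpha> \<beta> else 0)"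
          unfolding pq prod.case by (simp only:)
      qed
      finally show ?thesis by (simp add: case_prod_unfold)
    qed
    have t: "?t \<alpha> \<beta> = gamma_taylor \<mu> u / (fact ?m * fact (length (coords u)))" if p: "(\<alpha>, \<beta>) \<in> ?P" for \<alpha> \<beta>
    proof -
      have "mset (?wd \<alpha> \<beta>) = mset (map Coord (coords u) @ map Field (fields u))" using p by simp
      then have m: "mset (?wd \<alpha> \<beta>) = mset u" by (rule HOL.trans[OF _ arg_cong[OF u[symmetric], of mset]])
      have k: "word_series pd (?wd \<alpha> \<beta>) u * gamma_taylor \<mu> u = signed_coef \<mu> \<alpha> \<beta>"
        using word_series_mult[OF alternating_gamma_taylor True m] by (simp add: gamma_taylor_word)
      \<comment> \<open>On a normal word the sorting sign occurs twice and squares to 1; otherwise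
        both sides are 0.\<close>
      have "signed_coef \<mu> \<alpha> \<beta> * word_series pd (?wd \<alpha> \<beta>) u = gamma_taylor \<mu> u"
      proof (cases "normal_word pd u")
        case True
        have "sort (?wd \<alpha> \<beta>) = u" using \<open>sorted u\<close> m by (metis properties_for_sort)
        then have "word_series pd (?wd \<alpha> \<beta>) u * word_series pd (?wd \<alpha> \<beta>) u = (1 :: 'k)"
          using True by (simp add: word_series_def sorting_sign_square)
        moreover have "word_series pd (?wd \<alpha> \<beta>) u * gamma_taylor \<mu> u * word_series pd (?wd \<alpha> \<beta>) u =
            word_series pd (?wd \<alpha> \<beta>) u * word_series pd (?wd \<alpha> \<beta>) u * gamma_taylor \<mu> u" by (simp only: mult_ac)
        ultimately show ?thesis unfolding k by simp
      next
        case False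
        then show ?thesis using alternating_not_normal[OF alternating_gamma_taylor True False] by (simp add: word_series_def)
      qed
      then have "1 / (fact ?m * fact (length (coords u))) * (signed_coef \<mu> \<alpha> \<beta> * word_series pd (?wd \<alpha> \<beta>) u) =
          gamma_taylor \<mu> u / (fact ?m * fact (length (coords u)))" by simp
      then show ?thesis unfolding len[OF p] by (simp only: mult.assoc)
    qed
    have "(\<Sum>(\<alpha>, \<beta>)\<in>?P. ?t \<alpha> \<beta>) = (\<Sum>(\<alpha>, \<beta>)\<in>?P. gamma_taylor \<mu> u / (fact ?m * fact (length (coords u))))"
    proof (rule sum.cong[OF HOL.refl])
      fix p assume p: "p \<in> ?P"
      obtain \<alpha> \<beta> where pq: "p = (\<alpha>, \<beta>)" by (cases p)
      show "(case p of (\<alpha>, \<beta>) \<Rightarrow> ?t \<alpha> \<beta>) = (case p of (\<alpha>, \<beta>) \<Rightarrow> gamma_taylor \<mu> u / (fact ?m * fact (length (coords u))))"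
        unfolding pq prod.case by (rule t[OF p[unfolded pq]])
    qed
    also have "\<dots> = of_nat (card ?P) * gamma_taylor \<mu> u / (fact ?m * fact (length (coords u)))"
      by (simp add: case_prod_unfold)
    also have "of_nat (card ?P) * (factorials (coords u) * factorials (fields u)) = (fact ?m * fact (length (coords u)) :: 'k)"
      unfolding card_arrangements[of "coords u", symmetric] card_arrangements[of "fields u", symmetric]
      by (simp add: card_cartesian_product mult_ac)
    then have "of_nat (card ?P) * gamma_taylor \<mu> u / (fact ?m * fact (length (coords u))) =
        gamma_taylor \<mu> u / (factorials (coords u) * factorials (fields u))"
      by (simp add: field_simps)
    also have "factorials (coords u) * factorials (fields u) = (factorials u :: 'k)"
      by (rule HOL.trans[OF factorials_pvars[symmetric] arg_cong[OF u[symmetric], of factorials]])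
    finally have S: "(\<Sum>(\<alpha>, \<beta>)\<in>?P. ?t \<alpha> \<beta>) = gamma_taylor \<mu> u / factorials u" .
    \<comment> \<open>The sum defining \<open>Gamma\<close> starts at \<open>m = 1\<close>. For
      monomials without fields the formula agrees with it because \<open>coef\<close> is 0 on empty
      words.\<close>
    have zero: "(\<Sum>(\<alpha>, \<beta>)\<in>?P. ?t \<alpha> \<beta>) = 0" if "?m = 0"
      by (rule sum.neutral) (use that in \<open>auto simp: signed_coef_def coef_def\<close>)
    have "(if m \<ge> 1 then Gamma_part A e dg \<mu> m u else 0) = (if m = ?m then \<Sum>(\<alpha>, \<beta>)\<in>?P. ?t \<alpha> \<beta> else 0)" for m
    proof (cases "m \<ge> 1")
      case True
      then show ?thesis unfolding part'[OF True] by (simp only: if_True)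
    next
      case False
      have "(if m = ?m then \<Sum>(\<alpha>, \<beta>)\<in>?P. ?t \<alpha> \<beta> else 0) = 0"
      proof (cases "m = ?m")
        case True
        then have "?m = 0" using False by linarith
        from zero[OF this] show ?thesis by (simp only: if_cancel)
      qed (simp only: if_False)
      then show ?thesis using False by (simp only: if_False)
    qed
    then have "Gamma A e dg \<mu> u = Sum_any (\<lambda>m. if m = ?m then \<Sum>(\<alpha>, \<beta>)\<in>?P. ?t \<alpha> \<beta> else 0)"
      unfolding Gamma_def by (simp only:)
    also have "\<dots> = (\<Sum>m\<in>{?m}. if m = ?m then \<Sum>(\<alpha>, \<beta>)\<in>?P. ?t \<alpha> \<beta> else 0)"
      by (rule Sum_any.expand_superset) auto
    finally show ?thesis using S True by simp
  qed
qed

end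

end

section \<open>The Schouten bracket\<close>

context based_graded_space begin

context
  fixes \<mu> :: "nat \<Rightarrow> nat \<Rightarrow> ('v, 'k) operation"
  assumes \<mu>: "\<And>m n. m \<ge> 1 \<Longrightarrow> n \<ge> 1 \<Longrightarrow> \<mu> m n \<in> sym_to_ext m n"
begin

text \<open>The Taylor coefficients of the product of the right derivative of \<Gamma> in the field
  and its left derivative in the coordinate with index \<gamma>: one of the two terms of the
  bracket.\<close>

definition contraction :: "'i \<Rightarrow> 'i pvar list \<Rightarrow> 'k" where
  "contraction \<gamma> = unshuffle_sum (graded_swap pd)
    (\<lambda>x y. gamma_taylor \<mu> (x @ [Field \<gamma>]) * gamma_taylor \<mu> (Coord \<gamma> # y))"

lemma alternating_contraction: "alternating (graded_swap pd) (contraction \<gamma>)"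
  unfolding contraction_def
  by (rule alternating_unshuffle_sum[OF graded_swap_involutive graded_swap_commute])
    (rule alternating_mult(1)[OF alternating_append_right[OF alternating_gamma_taylor]]
      alternating_mult(2)[OF alternating_Cons[OF alternating_gamma_taylor]])+

text \<open>The two halves of the Schouten bracket agree because \<open>\<Gamma>\<close> has even total degree.\<close>

lemma other_contraction:
  "unshuffle_sum (graded_swap pd) (\<lambda>x y. gamma_taylor \<mu> (x @ [Coord \<gamma>]) * gamma_taylor \<mu> (Field \<gamma> # y)) w =
    - contraction \<gamma> w"
proof -
  let ?g = "gamma_taylor \<mu>" and ?s = "parity_sign :: int \<Rightarrow> 'k"
  let ?P = "\<lambda>w. \<Sum>v\<leftarrow>w. pd v"
  have move: "?g (w @ [v]) = ?s (pd v * ?P w) * ?g (v # w)" for v w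
    using alternating_move[OF alternating_gamma_taylor, of \<mu> "[]" v w "[]"] by (simp add: prod_graded_swap)
  have "cross_sign (graded_swap pd) x y * (?g (y @ [Coord \<gamma>]) * ?g (Field \<gamma> # x)) =
      - 1 * (?g (x @ [Field \<gamma>]) * ?g (Coord \<gamma> # y))" for x y
  proof (cases "?g (Coord \<gamma> # y) = 0 \<or> ?g (Field \<gamma> # x) = 0")
    case True
    then show ?thesis using move[of y "Coord \<gamma>"] move[of x "Field \<gamma>"] by auto
  next
    case False
    then have "even (?P (Coord \<gamma> # y))" "even (?P (Field \<gamma> # x))"
      using gamma_taylor_degree[OF \<mu>] by blast+
    then have "even (?P y) \<longleftrightarrow> even (dg \<gamma>)" "even (?P x) \<longleftrightarrow> odd (dg \<gamma>)" by simp_all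
    \<comment> \<open>By evenness \<open>x\<close> has the parity of \<open>fd \<gamma>\<close> and
      \<open>y\<close> that of \<open>dg \<gamma>\<close>. One of them is even, so exchanging the
      two blocks costs nothing, while the signs of moving the letters with index \<gamma> are
      opposite.\<close>
    then have "?s (?P x * ?P y) * ?s (- dg \<gamma> * ?P y) = - ?s (fd \<gamma> * ?P x)"
      by (cases "even (dg \<gamma>)") (simp_all add: parity_sign_def)
    then show ?thesis
      unfolding cross_sign_graded move by (simp add: mult.assoc[symmetric])
  qed
  then have "unshuffle_sum (graded_swap pd) (\<lambda>x y. ?g (x @ [Coord \<gamma>]) * ?g (Field \<gamma> # y)) w =
      unshuffle_sum (graded_swap pd) (\<lambda>x y. - 1 * (?g (x @ [Field \<gamma>]) * ?g (Coord \<gamma> # y))) w"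
    by (subst unshuffle_sum_swap[OF graded_swap_involutive graded_swap_commute]) simp
  also have "\<dots> = - 1 * contraction \<gamma> w"
    unfolding contraction_def by (rule unshuffle_sum_cmult)
  finally show ?thesis by simp
qed

text \<open>For each \<gamma> the second term of the bracket is minus the first, so their difference
  is twice the contraction; the constant factor is then taken out of the sum over \<gamma>.\<close>

lemma taylor_schouten:
  "taylor pd (schouten dg (Gamma A e dg \<mu>) (Gamma A e dg \<mu>)) (\<lambda>w. 2 * Sum_any (\<lambda>\<gamma>. contraction \<gamma> w))"
  unfolding taylor_def
proof (intro conjI allI)
  have "2 * Sum_any (\<lambda>\<gamma>. contraction \<gamma> (x @ a # b # y)) = graded_swap pd a b * (2 * Sum_any (\<lambda>\<gamma>. contraction \<gamma> (x @ b # a # y)))"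
    for x a b y
    unfolding alternatingD[OF alternating_contraction, of _ x a b y] Sum_any_cmult[symmetric] by (rule mult.left_commute)
  then show "alternating (graded_swap pd) (\<lambda>w. 2 * Sum_any (\<lambda>\<gamma>. contraction \<gamma> w))"
    unfolding alternating_def by blast
  fix u
  let ?G = "Gamma A e dg \<mu>"
  note T = taylor_Gamma[OF \<mu>]
  have 1: "series_mult pd (right_deriv pd (Field \<gamma>) ?G) (left_deriv pd (Coord \<gamma>) ?G) u =
      (if sorted u then contraction \<gamma> u / factorials u else 0)" for \<gamma>
    using taylor_mult[OF taylor_right_deriv[OF T] taylor_left_deriv[OF T], of "Field \<gamma>" "Coord \<gamma>"]
    by (simp add: taylor_def contraction_def)
  have 2: "series_mult pd (right_deriv pd (Coord \<gamma>) ?G) (left_deriv pd (Field \<gamma>) ?G) u =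
      (if sorted u then - contraction \<gamma> u / factorials u else 0)" for \<gamma>
    using taylor_mult[OF taylor_right_deriv[OF T] taylor_left_deriv[OF T], of "Coord \<gamma>" "Field \<gamma>"]
    by (simp add: taylor_def other_contraction)
  have "(if sorted u then contraction \<gamma> u / factorials u else 0) - (if sorted u then - contraction \<gamma> u / factorials u else 0) =
      (if sorted u then 2 / factorials u else 0) * contraction \<gamma> u" for \<gamma>
    by simp
  then have "schouten dg ?G ?G u = (if sorted u then 2 / factorials u else 0) * Sum_any (\<lambda>\<gamma>. contraction \<gamma> u)"
    unfolding schouten_def Let_def 1 2 Sum_any_cmult by presburger
  then show "schouten dg ?G ?G u = (if sorted u then 2 * Sum_any (\<lambda>\<gamma>. contraction \<gamma> u) / factorials u else 0)"
    by simp
qed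

text \<open>Here the exponent \<epsilon> of \<Gamma> is matched with the signs of the corolla
  differential. The two position signs on the left come from replacing the shifted Koszul signs of
  the fields by skew ones, and the crossing sign from reversing their order.\<close>

lemma contraction_term:
  assumes x: "mset x + mset y = mset \<alpha>" and z: "mset z + mset w = mset \<beta>"
  shows "parity_sign (position_exponent dg \<beta>) * (parity_sign (position_exponent dg (z @ w)) *
      (cross_sign (graded_swap fd) z w * (parity_sign ((deg z + int (length z)) * deg y) *
        (signed_coef \<mu> x (\<gamma> # z) * signed_coef \<mu> (\<gamma> # y) w)))) =
    - parity_sign (gamma_exponent dg \<alpha> \<beta>) * (parity_sign (int (length z * length w)) *
      (parity_sign ((1 - int (length z)) * (2 - int (length w) + deg y)) * (coef \<mu> x (z @ [\<gamma>]) * coef \<mu> (\<gamma> # y) w)))"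
proof -
  let ?s = "parity_sign :: int \<Rightarrow> 'k"
  let ?E = "pair_exponent dg" and ?T = "position_exponent dg"
  let ?X = "deg x" and ?Y = "deg y" and ?Z = "deg z" and ?W = "deg w" and ?c = "dg \<gamma>"
  let ?m = "int (length z)" and ?n = "int (length w)"
  have sl: "sum_list (map dg v) = deg v" for v by (simp add: deg_def)
  have sf: "sum_list (map fd v) = deg v + int (length v)" for v by (induction v) (simp_all add: deg_def)
  have coef: "coef \<mu> x (\<gamma> # z) = ?s (?m + ?c * ?Z) * coef \<mu> x (z @ [\<gamma>])"
    using alternating_move[OF alternating_coef_out[OF \<mu>], of x "[]" \<gamma> z "[]"] by (simp add: prod_skew_swap sl)
  show ?thesis
  proof (cases "coef \<mu> x (z @ [\<gamma>]) = 0")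
    case True
    then show ?thesis by (simp add: signed_coef_def coef)
  next
    case False
    \<comment> \<open>The degree equation of the lower vertex eliminates the degree of the internal
      index.\<close>
    have c: "?c = ?X + 1 - ?m - ?Z" using coef_degree[OF \<mu> False] by simp
    have \<alpha>: "?E \<alpha> = ?E x + ?E y + ?X * ?Y" "deg \<alpha> = ?X + ?Y"
      using pair_exponent_mset[of \<alpha> "x @ y" dg] sum_list_map_mset_cong[of \<alpha> "x @ y" dg] x
      by (simp_all add: pair_exponent_append sl)
    have \<beta>: "?E \<beta> = ?E z + ?E w + ?Z * ?W" "int (length \<beta>) = ?m + ?n"
      using pair_exponent_mset[of \<beta> "z @ w" dg] mset_eq_length[of \<beta> "z @ w"] z
      by (simp_all add: pair_exponent_append sl)
    \<comment> \<open>The pair exponents of the four words and the position exponent of \<beta>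
      occur on both sides. They are split off together with even contributions, leaving a polynomial
      identity modulo 2 between \<open>?L'\<close> and \<open>?R'\<close>.\<close>
    let ?e = "?E x + ?E y + ?E z + ?E w + ?T \<beta>"
    let ?L = "?T \<beta> + (?T z + ?T w + ?m * ?W) + (?Z + ?m) * (?W + ?n) + (?Z + ?m) * ?Y +
      ((1 + (?m + 1)) * ?X + ?E x + (?c * ?Z + ?E z) + (?Z + ?T z)) + (?m + ?c * ?Z) +
      ((1 + ?n) * (?c + ?Y) + (?c * ?Y + ?E y) + ?E w + ?T w)"
    let ?R = "1 + ((1 + (?m + ?n)) * (?X + ?Y) + (?E x + ?E y + ?X * ?Y) + (?E z + ?E w + ?Z * ?W) + ?T \<beta>) +
      ?m * ?n + (1 - ?m) * (2 - ?n + ?Y)"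
    let ?L' = "?m * ?W + (?Z + ?m) * (?W + ?n) + (?Z + ?m) * ?Y + ?m * ?X + ?Z + ?m + (1 + ?n) * (?c + ?Y) + ?c * ?Y"
    let ?R' = "1 + (1 + (?m + ?n)) * (?X + ?Y) + ?X * ?Y + ?Z * ?W + ?m * ?n + (1 - ?m) * (?Y - ?n)"
    have L: "?L = ?L' + ?e + 2 * (?T z + ?T w + ?X + ?c * ?Z)" by (simp add: algebra_simps)
    have R: "?R = ?R' + ?e + 2 * (1 - ?m)" by (simp add: algebra_simps)
    have LR: "even ?L' = even ?R'" unfolding c by (simp, argo)
    have "even (a + h + 2 * i) = even (b + h + 2 * j)" if "even a = even b" for a b h i j :: int
      using that by simp
    then have "even ?L = even ?R" unfolding L R using LR by blast
    then have sign: "?s ?L = ?s ?R" by (rule parity_sign_cong)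
    have "?s (?T \<beta>) * (?s (?T (z @ w)) * (cross_sign (graded_swap fd) z w * (?s ((?Z + ?m) * ?Y) *
        (signed_coef \<mu> x (\<gamma> # z) * signed_coef \<mu> (\<gamma> # y) w)))) = ?s ?L * (coef \<mu> x (z @ [\<gamma>]) * coef \<mu> (\<gamma> # y) w)"
      unfolding signed_coef_def coef parity_sign_gamma_exponent cross_sign_graded position_exponent_append sf parity_sign_add
      by (simp add: sl mult_ac parity_sign_add add_ac)
    moreover have "- ?s (gamma_exponent dg \<alpha> \<beta>) * (?s (int (length z * length w)) *
        (?s ((1 - ?m) * (2 - ?n + ?Y)) * (coef \<mu> x (z @ [\<gamma>]) * coef \<mu> (\<gamma> # y) w))) = ?s ?R * (coef \<mu> x (z @ [\<gamma>]) * coef \<mu> (\<gamma> # y) w)"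
    proof -
      have "- ?s (gamma_exponent dg \<alpha> \<beta>) = ?s (1 + ((1 + (?m + ?n)) * (?X + ?Y) + (?E x + ?E y + ?X * ?Y) + (?E z + ?E w + ?Z * ?W) + ?T \<beta>))"
        unfolding parity_sign_gamma_exponent sl \<alpha> \<beta> by (simp add: parity_sign_def)
      then show ?thesis by (simp only: parity_sign_add of_nat_mult mult.assoc)
    qed
    ultimately show ?thesis using sign by simp
  qed
qed

text \<open>The unshuffles of coordinates and fields are separated, the fields are put into the
  order of the outputs, and their shifted signs are traded for skew ones. The two sums then agree
  term by term up to a sign that depends on \<alpha> and \<beta> only.\<close>

theorem contraction_relation:
  "Sum_any (\<lambda>\<gamma>. contraction \<gamma> (map Coord \<alpha> @ map Field (rev \<beta>))) = - parity_sign (gamma_exponent dg \<alpha> \<beta>) * relation \<mu> \<alpha> \<beta>"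
proof -
  let ?s = "parity_sign :: int \<Rightarrow> 'k" and ?K = "signed_coef \<mu>"
  let ?\<epsilon> = "- ?s (gamma_exponent dg \<alpha> \<beta>)"
  let ?U = "unshuffle_sum (graded_swap dg) :: _ \<Rightarrow> _ \<Rightarrow> 'k" and ?S = "unshuffle_sum (skew_swap dg) :: _ \<Rightarrow> _ \<Rightarrow> 'k"
  let ?t = "\<lambda>\<gamma> x y z w. ?\<epsilon> * (?s (int (length z * length w)) *
    (?s ((1 - int (length z)) * (2 - int (length w) + deg y)) * (coef \<mu> x (z @ [\<gamma>]) * coef \<mu> (\<gamma> # y) w)))"
  have sf: "sum_list (map fd v) = deg v + int (length v)" for v by (induction v) (simp_all add: deg_def)
  have swaps: "(\<lambda>a b. graded_swap pd (Coord a) (Coord b)) = (graded_swap dg :: _ \<Rightarrow> _ \<Rightarrow> 'k)"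
    "(\<lambda>a b. graded_swap pd (Field a) (Field b)) = (graded_swap fd :: _ \<Rightarrow> _ \<Rightarrow> 'k)"
    by (simp_all add: fun_eq_iff)
  have word: "gamma_taylor \<mu> ((map Coord x @ map Field x') @ [Field \<gamma>]) * gamma_taylor \<mu> (Coord \<gamma> # map Coord y @ map Field y') =
      ?K x (\<gamma> # rev x') * ?K (\<gamma> # y) (rev y')" for \<gamma> x x' y y'
    using gamma_taylor_word[OF \<mu>, of x "x' @ [\<gamma>]"] gamma_taylor_word[OF \<mu>, of "\<gamma> # y" y'] by simp
  \<comment> \<open>Fields going to the left factor are crossed by coordinates going to the right
    one; the degrees \<open>- dg a\<close> and \<open>dg a\<close> have the same parity.\<close>
  have cross: "cross_sign (graded_swap pd) (map Field x') (map Coord y) = ?s ((deg x' + int (length x')) * deg y)" for x' y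
  proof -
    have "(\<Sum>a\<leftarrow>y. - dg a) = - deg y" by (induction y) simp_all
    moreover have "?s (- k) = ?s k" for k by (simp add: parity_sign_def)
    ultimately show ?thesis by (simp add: cross_sign_graded o_def sf)
  qed
  have rev: "deg (rev v) = deg v" for v by (simp add: deg_def rev_map[symmetric] sum_list_rev)
  have contr: "contraction \<gamma> (map Coord \<alpha> @ map Field (rev \<beta>)) = ?U (\<lambda>x y. ?S (?t \<gamma> x y) \<beta>) \<alpha>" for \<gamma>
  proof -
    have "contraction \<gamma> (map Coord \<alpha> @ map Field (rev \<beta>)) =
        ?U (\<lambda>x y. unshuffle_sum (graded_swap fd) (\<lambda>x' y'. ?s ((deg x' + int (length x')) * deg y) *
          (?K x (\<gamma> # rev x') * ?K (\<gamma> # y) (rev y'))) (rev \<beta>)) \<alpha>"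
      unfolding contraction_def unshuffle_sum_append unshuffle_sum_map swaps word cross ..
    also have "\<dots> = ?U (\<lambda>x y. unshuffle_sum (graded_swap fd) (\<lambda>z w. cross_sign (graded_swap fd) z w *
        (?s ((deg z + int (length z)) * deg y) * (?K x (\<gamma> # z) * ?K (\<gamma> # y) w))) \<beta>) \<alpha>"
      unfolding unshuffle_sum_rev[OF graded_swap_involutive graded_swap_commute] by (simp only: rev length_rev rev_rev_ident)
    also have "\<dots> = ?U (\<lambda>x y. ?s (position_exponent dg \<beta>) * ?S (\<lambda>z w. ?s (position_exponent dg (z @ w)) * (cross_sign (graded_swap fd) z w *
        (?s ((deg z + int (length z)) * deg y) * (?K x (\<gamma> # z) * ?K (\<gamma> # y) w)))) \<beta>) \<alpha>"
    proof -
      \<comment> \<open>The weight (-1)^(|a| + |b|) is the quotient of the two symmetry types, and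
        the position sign is alternating for it.\<close>
      have "alternating (\<lambda>a b. ?s (dg a + dg b)) (\<lambda>w. ?s (position_exponent dg w))"
        unfolding alternating_def
      proof (intro allI)
        fix x a b y
        have p: "position_exponent dg (x @ a # b # y) = position_exponent dg (x @ b # a # y) + (dg b - dg a)"
          by (simp add: position_exponent_append)
        show "?s (position_exponent dg (x @ a # b # y)) = ?s (dg a + dg b) * ?s (position_exponent dg (x @ b # a # y))"
          unfolding p parity_sign_add[symmetric] by (rule parity_sign_cong) (simp, argo)
      qed
      moreover have "graded_swap fd a b = skew_swap dg a b * ?s (dg a + dg b)" for a b
        unfolding skew_swap_eq graded_swap_def parity_sign_add[symmetric] by (rule parity_sign_cong) (simp, argo)
      ultimately have "unshuffle_sum (graded_swap fd) G \<beta> = ?s (position_exponent dg \<beta>) * ?S (\<lambda>z w. ?s (position_exponent dg (z @ w)) * G z w) \<beta>" for G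
        by (intro unshuffle_sum_twist) (simp_all add: add.commute)
      then show ?thesis by simp
    qed
    also have "\<dots> = ?U (\<lambda>x y. ?S (?t \<gamma> x y) \<beta>) \<alpha>"
      unfolding unshuffle_sum_cmult[symmetric]
      by (intro unshuffle_sum_cong contraction_term)
    finally show ?thesis .
  qed
  have fin: "finite {\<gamma>. ?t \<gamma> x y z w \<noteq> 0}" for x y z w
    by (rule finite_subset[OF _ finite_coef[OF \<mu>, of x z "[]"]]) auto
  have "Sum_any (\<lambda>\<gamma>. contraction \<gamma> (map Coord \<alpha> @ map Field (rev \<beta>))) = Sum_any (\<lambda>\<gamma>. ?U (\<lambda>x y. ?S (?t \<gamma> x y) \<beta>) \<alpha>)"
    by (simp only: contr)
  also have "\<dots> = ?U (\<lambda>x y. Sum_any (\<lambda>\<gamma>. ?S (?t \<gamma> x y) \<beta>)) \<alpha>"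
    by (rule unshuffle_sum_Sum_any(2)) (rule unshuffle_sum_Sum_any(1)[OF fin])
  also have "\<dots> = ?U (\<lambda>x y. ?S (\<lambda>z w. Sum_any (\<lambda>\<gamma>. ?t \<gamma> x y z w)) \<beta>) \<alpha>"
    by (simp only: unshuffle_sum_Sum_any(2)[OF fin])
  also have "\<dots> = ?U (\<lambda>x y. ?S (\<lambda>z w. ?\<epsilon> * composite \<mu> x y z w) \<beta>) \<alpha>"
    by (simp only: composite_def Sum_any_cmult[symmetric])
  also have "\<dots> = ?\<epsilon> * relation \<mu> \<alpha> \<beta>"
    by (simp only: unshuffle_sum_cmult relation_def)
  finally show ?thesis .
qed

text \<open>An alternating functional vanishes as soon as it does so on sorted words, and these
  consist of coordinates followed by fields. On such words the Taylor coefficient of the bracket is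
  the relation times an invertible factor, a sign times 2.\<close>

theorem schouten_eq_0_iff:
  "schouten dg (Gamma A e dg \<mu>) (Gamma A e dg \<mu>) = (\<lambda>u. 0) \<longleftrightarrow> (\<forall>\<alpha> \<beta>. relation \<mu> \<alpha> \<beta> = 0)"
  unfolding taylor_eq_0_iff[OF taylor_schouten]
proof
  let ?h = "\<lambda>w. 2 * Sum_any (\<lambda>\<gamma>. contraction \<gamma> w)"
  show "\<forall>\<alpha> \<beta>. relation \<mu> \<alpha> \<beta> = 0" if "\<forall>w. ?h w = 0"
  proof (intro allI)
    fix \<alpha> \<beta>
    show "relation \<mu> \<alpha> \<beta> = 0"
      using that[rule_format, of "map Coord \<alpha> @ map Field (rev \<beta>)"] by (simp add: contraction_relation)
  qed
  show "\<forall>w. ?h w = 0" if R: "\<forall>\<alpha> \<beta>. relation \<mu> \<alpha> \<beta> = 0"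
  proof
    fix w
    have "alternating (graded_swap pd) ?h" using taylor_schouten by (simp add: taylor_def)
    then have "?h w = inversion_sign (graded_swap pd) w * ?h (sort w)" by (rule alternating_sort)
    also have "?h (sort w) = 0"
    proof -
      have "sort w = map Coord (coords (sort w)) @ map Field (rev (rev (fields (sort w))))"
        using sorted_pvars[of "sort w"] by simp
      then show ?thesis
        using contraction_relation[of "coords (sort w)" "rev (fields (sort w))"] R by (metis mult_zero_right)
    qed
    finally show "?h w = 0" by simp
  qed
qed

end

end

theorem proposition1p5p1:
  fixes scale :: "'k::field_char_0 \<Rightarrow> 'v::ab_group_add \<Rightarrow> 'v"
    and V :: "int \<Rightarrow> 'v set"
    and A :: "'i::linorder set"
    and e :: "'i \<Rightarrow> 'v"
    and dg :: "'i \<Rightarrow> int"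
    and \<mu> :: "nat \<Rightarrow> nat \<Rightarrow> ('v, 'k) operation"
  assumes "graded_vector_space scale V"
    and "graded_vector_space.homogeneous_basis scale V A e dg"
    and "\<And>m n. m \<ge> 1 \<Longrightarrow> n \<ge> 1 \<Longrightarrow> \<mu> m n \<in> graded_vector_space.sym_to_ext scale V m n"
  shows "graded_vector_space.Lie1Bi_infinity_structure scale V \<mu> \<longleftrightarrow>
    (let \<Gamma> = graded_vector_space.Gamma scale A e dg \<mu> in schouten dg \<Gamma> \<Gamma> = (\<lambda>u. 0))"
proof -
  interpret graded_vector_space scale V by (rule assms(1))
  interpret based_graded_space scale V A e dg by unfold_locales (rule assms(2))
  have "Lie1Bi_infinity_structure \<mu> \<longleftrightarrow> (\<forall>\<alpha> \<beta>. relation \<mu> \<alpha> \<beta> = 0)"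
    by (rule structure_iff_relation) (rule assms(3))
  moreover have "schouten dg (Gamma A e dg \<mu>) (Gamma A e dg \<mu>) = (\<lambda>u. 0) \<longleftrightarrow> (\<forall>\<alpha> \<beta>. relation \<mu> \<alpha> \<beta> = 0)"
    by (rule schouten_eq_0_iff) (rule assms(3))
  ultimately show ?thesis unfolding Let_def by blast
qed

end
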